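(* Let $P$ be a probability distribution on $\mathbb N$ with $P(1)<1$, let $n_o\sim P$, and assume $\mathbb E[e^{\theta n_o}]<\infty$ for some $\theta>0$. Suppose $\beta_0>1$. For the Erlang Weighted Tree with potential degree distribution $P$, let $D_l$ be the number of descendants (children) of a uniformly randomly selected vertex in generation $l$, given that the number $Z_l$ of vertices in generation $l$ is positive. Then for any $d\in\mathbb Z_+$, $$\lim_{l\to\infty}\mathbb P(D_l=d\mid Z_l>0)=\frac{\displaystyle\sum_{k=1}^\infty\int_0^\infty\nu(k-1,z)\,\mathrm{Bi}\left(d;k-1,\int_0^z\frac1z\sum_{k'=1}^\infty P(k')\bar F_{k'}(y)\,dy\right)dz}{\displaystyle\sum_{k=1}^\infty\int_0^\infty\nu(k-1,z)\,dz}.$$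
   Context: $\mathbb N=\{1,2,\dots\}$, $\mathbb Z_+=\{0,1,\dots\}$, $\mathbb R_+=[0,\infty)$. $\mathrm{Erlang}(k)$ has density $e^{-x}x^{k-1}/(k-1)!$; $\bar F_k$ is its complementary cumulative distribution function. $\mathrm{Bi}(d;m,\eta)=\binom md\eta^d(1-\eta)^{m-d}$. **Erlang Weighted Tree (EWT).** Let $\mathbb N^f=\bigcup_{i\ge0}\mathbb N^i$, $\mathbb N^0=\{o\}$, $\widehat P(k)=P(k+1)$. Independently over $\boldsymbol i\in\mathbb N^f$: $n_o\sim P$, $n_{\boldsymbol i}\sim\widehat P$ for $\boldsymbol i\ne o$; given $n_{\boldsymbol i}$, $v_{\boldsymbol i}\sim\mathrm{Erlang}(n_{\boldsymbol i}+1)$; given $(n_{\boldsymbol i},v_{\boldsymbol i})$, the costs $\zeta_{(\boldsymbol i,1)},\dots,\zeta_{(\boldsymbol i,n_{\boldsymbol i})}$ are i.i.d. uniform on $[0,v_{\boldsymbol i}]$. The backbone tree is the component of $o$ in the graph with edges $\{\boldsymbol i,(\boldsymbol i,j)\}$, $1\le j\le n_{\boldsymbol i}$. The EWT is the component of the root $o$ after keeping $\{\boldsymbol i,(\boldsymbol i,j)\}$ iff $\zeta_{(\boldsymbol i,j)}<v_{(\boldsymbol i,j)}$. Generation $l$ is the set of vertices at distance $l$ from $o$. **Spectral quantities.** $g_2(x)=e^{-x}\sum_{k=2}^\infty P(k)\frac{x^{k-2}}{(k-2)!}$; $G_0\equiv1$, $G_i(x)=\int_{y=x}^\infty\int_{z=y}^\infty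 g_2(z)G_{i-1}(z)\,dz\,dy$ for $i\ge1$; $L(\beta,x)=\sum_{i\ge0}G_i(x)(-1/\beta)^i$. $\beta_0$ is the largest $\beta>0$ with $L(\beta,0)=0$; $f_0(x)=L(\beta_0,x)\big/\big(\int_0^\infty g_2(y)L(\beta_0,y)^2dy\big)^{1/2}$; $\nu(k-1,z)=P(k)\frac{e^{-z}z^{k-1}}{(k-1)!}f_0(z)$. *)

theory Defs
  imports "HOL-Probability.Probability"
begin

section \<open>The Erlang Weighted Tree\<close>

text \<open>The Erlang(k) law, for k at least 1 (the library density is indexed by k - 1).\<close>

definition erlang_law :: "nat \<Rightarrow> real measure" where
  "erlang_law k = density lborel (\<lambda>x. ennreal (erlang_density (k - 1) 1 x))"

definition erlang_ccdf :: "nat \<Rightarrow> real \<Rightarrow> real" where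
  "erlang_ccdf k y = measure (erlang_law k) {y<..}"

text \<open>The uniform law on [0,v]. The value for v = 0 is the point mass at 0; the value for v < 0
  is irrelevant, since an Erlang variable is almost surely positive.\<close>

definition uniform_upto :: "real \<Rightarrow> real measure" where
  "uniform_upto v = (if v > 0 then uniform_measure lborel {0..v} else return borel 0)"

type_synonym mark = "nat \<times> real \<times> (nat \<Rightarrow> real)"

definition mark_space :: "mark measure" where
  "mark_space = count_space UNIV \<Otimes>\<^sub>M (borel \<Otimes>\<^sub>M (\<Pi>\<^sub>M j\<in>UNIV. borel))"

text \<open>The joint law of the mark of a vertex i, that is, of n_i, v_i and the costs of the edges
  from i to (i,j). Costs are drawn for every index j, but only those with j in {1..n_i} belong to
  edges of the backbone tree, so the others have no influence.\<close>

definition mark_law :: "nat pmf \<Rightarrow> mark measure" where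
  "mark_law Q =
     measure_pmf Q \<bind> (\<lambda>n.
     erlang_law (n + 1) \<bind> (\<lambda>v.
     (\<Pi>\<^sub>M j\<in>UNIV. uniform_upto v) \<bind> (\<lambda>\<zeta>.
     return mark_space (n, v, \<zeta>))))"

text \<open>For P concentrated on positive numbers this is the law k \<mapsto> P(k+1).\<close>

definition shifted :: "nat pmf \<Rightarrow> nat pmf" where
  "shifted P = map_pmf (\<lambda>k. k - 1) P"

text \<open>A vertex is a list of natural numbers; the root is the empty list and the vertex (i,j)
  is i @ [j]. Lists with an entry 0 also carry marks, but no edge of the backbone leads to them.\<close>

type_synonym vertex = "nat list"

type_synonym marks = "vertex \<Rightarrow> mark"

definition ewt :: "nat pmf \<Rightarrow> marks measure" where
  "ewt P = (\<Pi>\<^sub>M i\<in>UNIV. mark_law (if i = [] then P else shifted P))"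

definition pot_deg :: "marks \<Rightarrow> vertex \<Rightarrow> nat" where
  "pot_deg \<omega> i = fst (\<omega> i)"

definition threshold :: "marks \<Rightarrow> vertex \<Rightarrow> real" where
  "threshold \<omega> i = fst (snd (\<omega> i))"

text \<open>The cost of the edge between i and (i,j).\<close>

definition cost :: "marks \<Rightarrow> vertex \<Rightarrow> nat \<Rightarrow> real" where
  "cost \<omega> i j = snd (snd (\<omega> i)) j"

text \<open>Edge sets are given as sets of pairs (parent, child) and are read as undirected graphs.\<close>

definition component :: "('a \<times> 'a) set \<Rightarrow> 'a \<Rightarrow> 'a set" where
  "component E r = {x. (r, x) \<in> (E \<union> E\<inverse>)\<^sup>*}"

definition graph_dist :: "('a \<times> 'a) set \<Rightarrow> 'a \<Rightarrow> 'a \<Rightarrow> nat" where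
  "graph_dist E x y = (LEAST n. (x, y) \<in> (E \<union> E\<inverse>) ^^ n)"

definition potential_edges :: "marks \<Rightarrow> (vertex \<times> vertex) set" where
  "potential_edges \<omega> = {(i, i @ [j]) | i j. 1 \<le> j \<and> j \<le> pot_deg \<omega> i}"

definition backbone :: "marks \<Rightarrow> vertex set" where
  "backbone \<omega> = component (potential_edges \<omega>) []"

definition kept_edges :: "marks \<Rightarrow> (vertex \<times> vertex) set" where
  "kept_edges \<omega> = {(i, i @ [j]) | i j. i \<in> backbone \<omega> \<and> (i, i @ [j]) \<in> potential_edges \<omega> \<and>
     cost \<omega> i j < threshold \<omega> (i @ [j])}"

definition generation :: "nat \<Rightarrow> marks \<Rightarrow> vertex set" where
  "generation l \<omega> =
     {x \<in> component (kept_edges \<omega>) []. graph_dist (kept_edges \<omega>) [] x = l}"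

definition children :: "marks \<Rightarrow> vertex \<Rightarrow> vertex set" where
  "children \<omega> x = {y. (x, y) \<in> kept_edges \<omega>}"

text \<open>The joint law of the marks and of a vertex that, given the marks, is uniformly distributed
  on generation l. If that generation is empty, the root serves as a dummy value; this case is
  excluded by conditioning on Z l > 0.\<close>

definition ewt_selected :: "nat pmf \<Rightarrow> nat \<Rightarrow> (marks \<times> vertex) measure" where
  "ewt_selected P l =
     ewt P \<bind> (\<lambda>\<omega>.
     measure_pmf (if generation l \<omega> = {} then return_pmf [] else pmf_of_set (generation l \<omega>))
       \<bind> (\<lambda>u.
     return (ewt P \<Otimes>\<^sub>M count_space UNIV) (\<omega>, u)))"

definition Z :: "nat \<Rightarrow> marks \<times> vertex \<Rightarrow> nat" where
  "Z l = (\<lambda>(\<omega>, u). card (generation l \<omega>))"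

text \<open>The number of children of the selected vertex; under ewt_selected P l this is D_l.\<close>

definition D :: "marks \<times> vertex \<Rightarrow> nat" where
  "D = (\<lambda>(\<omega>, u). card (children \<omega> u))"

section \<open>Spectral quantities\<close>

text \<open>The summation index k of the series below stands for k - 2 in the usual formula.\<close>

definition g2 :: "nat pmf \<Rightarrow> real \<Rightarrow> real" where
  "g2 P x = exp (- x) * (\<Sum>k. pmf P (k + 2) * x ^ k / fact k)"

primrec G :: "nat pmf \<Rightarrow> nat \<Rightarrow> real \<Rightarrow> real" where
  "G P 0 = (\<lambda>x. 1)"
| "G P (Suc i) = (\<lambda>x. LBINT y:{x..}. (LBINT z:{y..}. g2 P z * G P i z))"

definition L :: "nat pmf \<Rightarrow> real \<Rightarrow> real \<Rightarrow> real" where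
  "L P \<beta> x = (\<Sum>i. G P i x * (- 1 / \<beta>) ^ i)"

definition beta0 :: "nat pmf \<Rightarrow> real" where
  "beta0 P = (GREATEST \<beta>. \<beta> > 0 \<and> L P \<beta> 0 = 0)"

definition f0 :: "nat pmf \<Rightarrow> real \<Rightarrow> real" where
  "f0 P x = L P (beta0 P) x / sqrt (LBINT y:{0..}. g2 P y * (L P (beta0 P) y)\<^sup>2)"

text \<open>Here m stands for k - 1.\<close>

definition nu :: "nat pmf \<Rightarrow> nat \<Rightarrow> real \<Rightarrow> real" where
  "nu P m z = pmf P (m + 1) * (exp (- z) * z ^ m / fact m) * f0 P z"

definition Bi :: "nat \<Rightarrow> nat \<Rightarrow> real \<Rightarrow> real" where
  "Bi d m \<eta> = real (m choose d) * \<eta> ^ d * (1 - \<eta>) ^ (m - d)"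

end

theory Submission
  imports Defs
begin

text \<open>
  Give a vertex the type \<open>(m, z)\<close>, where m is its number of potential children and z its threshold.
  A child of type \<open>(m', z')\<close> of a vertex with threshold z is kept with probability \<open>min z z' / z\<close>, so
  the tree is a branching process with infinitely many types whose mean operator has the kernel
  \<open>(m / z) * min z z'\<close> with respect to the law \<open>\<mu>\<close> of the type of a child. Since twofold integration
  from infinity has kernel \<open>max 0 (z - x)\<close>, the vanishing of \<open>U = L \<beta>0\<close> at 0 turns the series into
  \<open>\<beta>0 * U x = (\<integral>z. min x z * g2 z * U z)\<close>. Thus \<open>\<beta>0\<close> is the growth rate, U is positive on the positive
  axis, \<open>h (m, z) = m * U z / z\<close> is a right eigenfunction and \<open>U(z) \<mu>(dm dz)\<close> is the left eigenmeasure.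

  U is comparable to \<open>min z 1\<close> and \<open>min z z'\<close> dominates \<open>min z 1 * min z' 1\<close>, so a multiple of the
  eigenprojection can be subtracted from the kernel: on functions orthogonal to U the mean operator
  contracts by a factor strictly below \<open>\<beta>0\<close>. A second moment computation then shows that the sum over
  generation l of a function of the vertex with conditional mean orthogonal to U is \<open>o(\<beta>0 ^ l)\<close> in mean
  square. Applied to the indicator of having d children, minus its eigenmeasure average r, and to the
  constant 1, minus a multiple of h, this shows that the proportion of vertices with d children tends
  to r wherever the martingale W, the normalised sum of h over generation l, stays away from 0.

  It remains to see that on survival W is not small. Comparing the Laplace transforms of W with and
  without extinction one generation later, a concavity argument moves the comparison from a single
  vertex to the whole of generation k, and the convergence of the Laplace transforms as their parameter
  grows yields that W is small only on an event whose difference from extinction has small probability.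
  The average r is the asserted ratio because, given its type, the children of a vertex are kept
  independently.
\<close>

section \<open>The law of a mark\<close>

text \<open>With types ranging over an unbounded set, neither compactness nor finite-type Perron
  theory is invoked. Every uniform estimate rests on one fact: f x and the integrals of
  \<open>min x z\<close> against fixed weights are comparable to \<open>min x 1\<close>. Second
  moments are therefore controlled within the functions bounded by a multiple of
  \<open>(1 + m)\<^sup>2\<close>: the square of h is of this size, and integrating it against the
  weight 1 + z takes a third moment of P, which the exponential moment supplies.

  For survival, the classical route would show that the generating functional has a unique
  nontrivial fixed point, over all types at once. It is replaced by a quantitative comparison in
  which the order of choices matters: \<theta> is taken beyond the point where the limiting Laplace
  transform still drops noticeably, then a generation k after which W moves by little compared with
  1 / \<theta>, then \<kappa> of order \<beta>^k, large enough to see each single vertex of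
  generation k. The drop between \<theta> and \<theta> + \<kappa> stays small however large \<kappa>
  is.\<close>

lemma sets_erlang_law [measurable_cong, simp]: "sets (erlang_law k) = sets borel"
  by (simp add: erlang_law_def)

lemma prob_space_erlang_law: "prob_space (erlang_law k)"
  unfolding erlang_law_def by (rule prob_space_erlang_density) simp

lemma sets_uniform_upto [measurable_cong, simp]: "sets (uniform_upto v) = sets borel"
  by (simp add: uniform_upto_def)

lemma prob_space_uniform_upto: "prob_space (uniform_upto v)"
  unfolding uniform_upto_def
  by (auto intro!: prob_space_uniform_measure prob_space_return simp: emeasure_lborel_Icc_eq)

lemma nn_integral_uniform_upto_1:
  assumes [measurable]: "f \<in> borel_measurable borel"
  shows "(\<integral>\<^sup>+y. f y \<partial>uniform_upto 1) = (\<integral>\<^sup>+y. f y * indicator {0..1} y \<partial>lborel)"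
  by (simp add: uniform_upto_def nn_integral_uniform_measure divide_ennreal_def)

text \<open>Scaling by \<open>max 0 v\<close> covers v <= 0 too, where both sides are the point mass
  at 0. Writing a cost as threshold times relative cost separates the randomness of the costs from
  that of the threshold.\<close>

lemma uniform_upto_eq_distr:
  "uniform_upto v = distr (uniform_upto 1) borel (\<lambda>y. max 0 v * y)"
proof (cases "v > 0")
  case False
  interpret prob_space "uniform_upto 1" by (rule prob_space_uniform_upto)
  show ?thesis
  proof (rule measure_eqI)
    fix A assume "A \<in> sets (uniform_upto v)"
    then show "emeasure (uniform_upto v) A = emeasure (distr (uniform_upto 1) borel (\<lambda>y. max 0 v * y)) A"
      using False emeasure_space_1 by (auto simp: uniform_upto_def emeasure_distr max_def vimage_def split: split_indicator)
  qed simp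
next
  case True
  show ?thesis
  proof (rule measure_eqI)
    fix A assume "A \<in> sets (uniform_upto v)"
    then have A[measurable]: "A \<in> sets borel" by simp
    have "emeasure (uniform_upto v) A = (\<integral>\<^sup>+y. indicator ({0..v} \<inter> A) y \<partial>lborel) / ennreal v"
      using True by (simp add: uniform_upto_def)
    also have "(\<integral>\<^sup>+y. indicator ({0..v} \<inter> A) y \<partial>lborel)
       = ennreal v * (\<integral>\<^sup>+y. indicator ({0..v} \<inter> A) (v * y) \<partial>lborel)"
      using True by (subst nn_integral_real_affine[where c = v and t = 0]) auto
    also have "(\<integral>\<^sup>+y. indicator ({0..v} \<inter> A) (v * y) \<partial>lborel)
       = (\<integral>\<^sup>+y. indicator A (v * y) * indicator {0..1} y \<partial>lborel)"
      using True by (intro nn_integral_cong) (auto split: split_indicator simp: field_simps zero_le_mult_iff)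
    also have "\<dots> = (\<integral>\<^sup>+y. indicator A (v * y) \<partial>uniform_upto 1)"
      by (subst nn_integral_uniform_upto_1) auto
    also have "\<dots> = emeasure (distr (uniform_upto 1) borel (\<lambda>y. max 0 v * y)) A"
      using True by (subst nn_integral_indicator[symmetric], simp, subst nn_integral_distr) auto
    finally show "emeasure (uniform_upto v) A = emeasure (distr (uniform_upto 1) borel (\<lambda>y. max 0 v * y)) A"
      using True by (simp add: ennreal_mult_divide_eq mult.commute[of "ennreal v"])
  qed simp
qed

lemma PiM_distr_UNIV:
  assumes M: "prob_space M" and f[measurable]: "f \<in> measurable M N"
  shows "(\<Pi>\<^sub>M j\<in>UNIV. distr M N f) = distr (\<Pi>\<^sub>M j\<in>UNIV. M) (\<Pi>\<^sub>M j\<in>UNIV. N) (\<lambda>\<omega> j. f (\<omega> j))"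
proof -
  interpret M: prob_space M by fact
  interpret D: prob_space "distr M N f" by (rule M.prob_space_distr) simp
  interpret product_prob_space "\<lambda>_. distr M N f" UNIV ..
  interpret PM: product_prob_space "\<lambda>_. M" UNIV ..
  have f': "(\<lambda>\<omega> j. f (\<omega> j)) \<in> measurable (\<Pi>\<^sub>M j\<in>UNIV. M) (\<Pi>\<^sub>M j\<in>UNIV. N)"
    by (rule measurable_PiM_single') (auto simp: space_PiM intro: measurable_space[OF f])
  show ?thesis
  proof (rule PiM_eq[symmetric])
    show "sets (distr (\<Pi>\<^sub>M j\<in>UNIV. M) (\<Pi>\<^sub>M j\<in>UNIV. N) (\<lambda>\<omega> j. f (\<omega> j))) = sets (\<Pi>\<^sub>M j\<in>UNIV. distr M N f)"
      by (simp cong: sets_PiM_cong)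
  next
    fix J and F :: "'c \<Rightarrow> _" assume J: "finite J" "J \<subseteq> UNIV" and F: "\<And>j. j \<in> J \<Longrightarrow> F j \<in> sets (distr M N f)"
    have eq: "prod_emb UNIV (\<lambda>_. distr M N f) J (\<Pi>\<^sub>E j\<in>J. F j) = prod_emb UNIV (\<lambda>_. N) J (\<Pi>\<^sub>E j\<in>J. F j)"
      by (simp add: prod_emb_def space_PiM)
    have "emeasure (distr (\<Pi>\<^sub>M j\<in>UNIV. M) (\<Pi>\<^sub>M j\<in>UNIV. N) (\<lambda>\<omega> j. f (\<omega> j)))
       (prod_emb UNIV (\<lambda>_. distr M N f) J (\<Pi>\<^sub>E j\<in>J. F j))
       = emeasure (\<Pi>\<^sub>M j\<in>UNIV. M) ((\<lambda>\<omega> j. f (\<omega> j)) -` prod_emb UNIV (\<lambda>_. N) J (\<Pi>\<^sub>E j\<in>J. F j) \<inter> space (\<Pi>\<^sub>M j\<in>UNIV. M))"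
      unfolding eq using J F f' by (intro emeasure_distr) (auto intro!: sets_PiM_I)
    also have "(\<lambda>\<omega> j. f (\<omega> j)) -` prod_emb UNIV (\<lambda>_. N) J (\<Pi>\<^sub>E j\<in>J. F j) \<inter> space (\<Pi>\<^sub>M j\<in>UNIV. M)
       = prod_emb UNIV (\<lambda>_. M) J (\<Pi>\<^sub>E j\<in>J. f -` F j \<inter> space M)"
      by (auto simp: prod_emb_def space_PiM PiE_iff Pi_iff intro: measurable_space[OF f])
    also have "emeasure (\<Pi>\<^sub>M j\<in>UNIV. M) \<dots> = (\<Prod>j\<in>J. emeasure M (f -` F j \<inter> space M))"
      using J F by (intro PM.emeasure_PiM_emb) auto
    also have "\<dots> = (\<Prod>j\<in>J. emeasure (distr M N f) (F j))"
      using F by (intro prod.cong refl emeasure_distr[symmetric]) auto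
    finally show "emeasure (distr (\<Pi>\<^sub>M j\<in>UNIV. M) (\<Pi>\<^sub>M j\<in>UNIV. N) (\<lambda>\<omega> j. f (\<omega> j)))
       (prod_emb UNIV (\<lambda>_. distr M N f) J (\<Pi>\<^sub>E j\<in>J. F j)) = (\<Prod>j\<in>J. emeasure (distr M N f) (F j))" .
  qed
qed

definition unit_costs :: "(nat \<Rightarrow> real) measure" where
  "unit_costs = (\<Pi>\<^sub>M j\<in>UNIV. uniform_upto 1)"

lemma sets_unit_costs [measurable_cong, simp]: "sets unit_costs = sets (\<Pi>\<^sub>M j\<in>UNIV. borel)"
  by (auto simp: unit_costs_def intro!: sets_PiM_cong)

lemma prob_space_unit_costs: "prob_space unit_costs"
  unfolding unit_costs_def by (intro prob_space_PiM prob_space_uniform_upto)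

lemma costs_eq_distr:
  "(\<Pi>\<^sub>M j\<in>UNIV. uniform_upto v)
     = distr unit_costs (\<Pi>\<^sub>M j\<in>UNIV. borel) (\<lambda>\<zeta> (j::nat). max 0 v * \<zeta> j)"
  unfolding unit_costs_def
  by (subst uniform_upto_eq_distr) (rule PiM_distr_UNIV, rule prob_space_uniform_upto, simp)

text \<open>The joint law of (n, v) with n distributed as R and v as Erlang(n + 1) given n; the
  library indexes the Erlang density by shape minus one, hence by n. Given as a density, it turns
  integrals into series of Lebesgue integrals.\<close>

definition type_law :: "nat pmf \<Rightarrow> (nat \<times> real) measure" where
  "type_law R = density (count_space UNIV \<Otimes>\<^sub>M lborel) (\<lambda>(n, v). ennreal (pmf R n * erlang_density n 1 v))"

lemma sets_type_law [measurable_cong, simp]: "sets (type_law R) = sets (count_space UNIV \<Otimes>\<^sub>M borel)"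
  by (auto simp: type_law_def intro!: sets_pair_measure_cong)

lemma space_type_law [simp]: "space (type_law R) = UNIV"
  by (simp add: type_law_def space_pair_measure)

lemma space_erlang_law [simp]: "space (erlang_law k) = UNIV"
  by (simp add: erlang_law_def)

lemma space_unit_costs [simp]: "space unit_costs = UNIV"
  using sets_eq_imp_space_eq[OF sets_unit_costs] by (simp add: space_PiM)

lemma space_uniform_upto [simp]: "space (uniform_upto v) = UNIV"
  using sets_eq_imp_space_eq[OF sets_uniform_upto] by simp

lemma measurable_type_law_density [measurable]:
  "(\<lambda>(n, v). ennreal (pmf R n * erlang_density n 1 v)) \<in> borel_measurable (count_space UNIV \<Otimes>\<^sub>M borel)"
  by (rule measurable_pair_measure_countable1) auto

lemma nn_integral_type_law_lborel:
  assumes [measurable]: "F \<in> borel_measurable (count_space UNIV \<Otimes>\<^sub>M borel)"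
  shows "(\<integral>\<^sup>+t. F t \<partial>type_law R) = (\<Sum>n. ennreal (pmf R n) * (\<integral>\<^sup>+v. ennreal (erlang_density n 1 v) * F (n, v) \<partial>lborel))"
proof -
  interpret sigma_finite_measure "count_space UNIV :: nat measure"
    by (rule sigma_finite_measure_count_space_countable) auto
  have "(\<integral>\<^sup>+t. F t \<partial>type_law R) = (\<integral>\<^sup>+t. (case t of (n, v) \<Rightarrow> ennreal (pmf R n * erlang_density n 1 v)) * F t \<partial>(count_space UNIV \<Otimes>\<^sub>M lborel))"
    unfolding type_law_def by (rule nn_integral_density) measurable
  also have "\<dots> = (\<integral>\<^sup>+n. \<integral>\<^sup>+v. ennreal (pmf R n * erlang_density n 1 v) * F (n, v) \<partial>lborel \<partial>count_space UNIV)"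
    by (subst lborel.nn_integral_fst[symmetric]) auto
  also have "\<dots> = (\<Sum>n. ennreal (pmf R n) * (\<integral>\<^sup>+v. ennreal (erlang_density n 1 v) * F (n, v) \<partial>lborel))"
    by (subst nn_integral_count_space_nat) (auto simp: ennreal_mult nn_integral_cmult mult.assoc intro!: suminf_cong)
  finally show ?thesis .
qed

lemma nn_integral_type_law:
  assumes [measurable]: "F \<in> borel_measurable (count_space UNIV \<Otimes>\<^sub>M borel)"
  shows "(\<integral>\<^sup>+t. F t \<partial>type_law R) = (\<integral>\<^sup>+n. \<integral>\<^sup>+v. F (n, v) \<partial>erlang_law (n + 1) \<partial>measure_pmf R)"
proof -
  have *: "(\<integral>\<^sup>+v. F (n, v) \<partial>erlang_law (n + 1)) = (\<integral>\<^sup>+v. ennreal (erlang_density n 1 v) * F (n, v) \<partial>lborel)" for n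
    unfolding erlang_law_def by (subst nn_integral_density) auto
  show ?thesis
    by (simp only: nn_integral_type_law_lborel[OF assms] * nn_integral_measure_pmf nn_integral_count_space_nat)
qed

lemma prob_space_type_law: "prob_space (type_law R)"
proof
  interpret prob_space "erlang_law k" for k by (rule prob_space_erlang_law)
  have "emeasure (type_law R) (space (type_law R)) = (\<integral>\<^sup>+t. 1 \<partial>type_law R)"
    by simp
  also have "\<dots> = 1"
    by (subst nn_integral_type_law) (auto simp: emeasure_space_1[simplified] measure_pmf.emeasure_space_1[simplified])
  finally show "emeasure (type_law R) (space (type_law R)) = 1" .
qed

lemma sets_mark_space: "sets mark_space = sets (count_space UNIV \<Otimes>\<^sub>M (borel \<Otimes>\<^sub>M (\<Pi>\<^sub>M j\<in>UNIV. borel)))"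
  by (simp add: mark_space_def)

lemma space_mark_space [simp]: "space mark_space = UNIV"
  by (simp add: mark_space_def space_pair_measure space_PiM)

definition mk_mark :: "(nat \<times> real) \<times> (nat \<Rightarrow> real) \<Rightarrow> mark" where
  "mk_mark = (\<lambda>((n, v), \<zeta>). (n, v, \<lambda>j. max 0 v * \<zeta> j))"

lemma measurable_PiM_borel_iff:
  "(\<lambda>x j. g j x) \<in> measurable M (\<Pi>\<^sub>M j\<in>UNIV. (borel :: real measure)) \<longleftrightarrow> (\<forall>j. (\<lambda>x. g j x) \<in> borel_measurable M)"
proof safe
  fix j assume "(\<lambda>x j. g j x) \<in> measurable M (\<Pi>\<^sub>M j\<in>UNIV. (borel :: real measure))"
  from measurable_compose[OF this measurable_component_singleton[of j]]
  show "(\<lambda>x. g j x) \<in> borel_measurable M" by simp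
qed (auto intro!: measurable_PiM_single' simp: space_PiM)

lemma measurable_mk_mark [measurable]:
  "mk_mark \<in> measurable ((count_space UNIV \<Otimes>\<^sub>M borel) \<Otimes>\<^sub>M (\<Pi>\<^sub>M j\<in>UNIV. borel)) mark_space"
  unfolding mk_mark_def mark_space_def case_prod_beta
  by (intro measurable_Pair) (auto simp: measurable_PiM_borel_iff)

text \<open>The costs depend on the threshold through scaling alone, and
  \<open>costs_eq_distr\<close> moves this dependence into \<open>mk_mark\<close>. The mark is
  thereby a function of two independent pieces, the type and the relative costs.\<close>

lemma mark_law_eq_distr: "mark_law R = distr (type_law R \<Otimes>\<^sub>M unit_costs) mark_space mk_mark"
proof -
  interpret U: prob_space unit_costs by (rule prob_space_unit_costs)
  interpret E: prob_space "erlang_law k" for k by (rule prob_space_erlang_law)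
  interpret T: prob_space "type_law R" by (rule prob_space_type_law)
  define K where "K n v = distr unit_costs mark_space (\<lambda>\<zeta>. mk_mark ((n, v), \<zeta>))" for n v
  have costs: "(\<Pi>\<^sub>M j\<in>UNIV. uniform_upto v) \<bind> (\<lambda>\<zeta>. return mark_space (n, v, \<zeta>)) = K n v" for n v
  proof -
    have m: "(\<lambda>\<zeta>. (n, v, \<zeta>)) \<in> measurable (\<Pi>\<^sub>M j\<in>UNIV. borel) mark_space"
      unfolding mark_space_def by (intro measurable_Pair) auto
    have m2: "(\<lambda>\<zeta> (j::nat). max 0 v * \<zeta> j) \<in> measurable unit_costs (\<Pi>\<^sub>M j\<in>UNIV. borel)"
      by (auto simp: measurable_PiM_borel_iff)
    have "(\<Pi>\<^sub>M j\<in>UNIV. uniform_upto v) \<bind> (\<lambda>\<zeta>. return mark_space (n, v, \<zeta>))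
       = distr (\<Pi>\<^sub>M j\<in>UNIV. uniform_upto v) mark_space (\<lambda>\<zeta>. (n, v, \<zeta>))"
      by (rule bind_return_distr')
         (auto simp: space_PiM m cong: measurable_cong_sets sets_PiM_cong)
    also have "\<dots> = K n v"
      unfolding costs_eq_distr K_def by (subst distr_distr[OF m m2]) (auto simp: comp_def mk_mark_def)
    finally show ?thesis .
  qed
  have K_prob: "prob_space (K n v)" for n v
    unfolding K_def by (rule U.prob_space_distr) measurable
  have K_meas[measurable]: "K n \<in> measurable (erlang_law (n+1)) (subprob_algebra mark_space)" for n
  proof -
    have "(\<lambda>v. distr unit_costs mark_space ((\<lambda>v \<zeta>. mk_mark ((n, v), \<zeta>)) v)) \<in> measurable borel (subprob_algebra mark_space)"
    proof (rule measurable_distr2[where M="\<Pi>\<^sub>M j\<in>UNIV. borel"])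
      show "case_prod (\<lambda>v \<zeta>. mk_mark ((n, v), \<zeta>)) \<in> measurable (borel \<Otimes>\<^sub>M (\<Pi>\<^sub>M j\<in>UNIV. borel)) mark_space"
        by measurable
      show "(\<lambda>v. unit_costs) \<in> measurable borel (subprob_algebra (\<Pi>\<^sub>M j\<in>UNIV. borel))"
        by (rule measurable_const) (simp add: space_subprob_algebra prob_space_imp_subprob_space prob_space_unit_costs)
    qed
    then show ?thesis
      by (simp add: K_def[abs_def] cong: measurable_cong_sets)
  qed
  define K2 where "K2 n = erlang_law (n + 1) \<bind> K n" for n
  have K2_sets: "sets (K2 n) = sets mark_space" for n
    unfolding K2_def by (rule sets_bind) (auto simp: K_def)
  have K2_sub: "subprob_space (K2 n)" for n
    unfolding K2_def by (rule subprob_space_bind[OF _ K_meas]) (rule prob_space_imp_subprob_space, rule prob_space_erlang_law)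
  have K2_meas[measurable]: "K2 \<in> measurable (measure_pmf R) (subprob_algebra mark_space)"
    by (auto simp: space_subprob_algebra K2_sets K2_sub)
  have law: "mark_law R = measure_pmf R \<bind> K2"
    unfolding mark_law_def costs K2_def ..
  show ?thesis
  proof (rule measure_eqI)
    show "sets (mark_law R) = sets (distr (type_law R \<Otimes>\<^sub>M unit_costs) mark_space mk_mark)"
      unfolding law by (simp, rule sets_bind) (auto simp: K2_sets)
  next
    fix A assume "A \<in> sets (mark_law R)"
    moreover have "sets (mark_law R) = sets mark_space"
      unfolding law by (rule sets_bind) (auto simp: K2_sets)
    ultimately have A[measurable]: "A \<in> sets mark_space" by simp
    have "emeasure (mark_law R) A = (\<integral>\<^sup>+n. emeasure (K2 n) A \<partial>measure_pmf R)"
      unfolding law by (rule emeasure_bind[OF _ K2_meas]) auto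
    also have "\<dots> = (\<integral>\<^sup>+n. \<integral>\<^sup>+v. emeasure (K n v) A \<partial>erlang_law (n+1) \<partial>measure_pmf R)"
      unfolding K2_def by (intro nn_integral_cong emeasure_bind[OF _ K_meas]) auto
    also have "\<dots> = (\<integral>\<^sup>+n. \<integral>\<^sup>+v. (\<integral>\<^sup>+\<zeta>. indicator A (mk_mark ((n, v), \<zeta>)) \<partial>unit_costs) \<partial>erlang_law (n+1) \<partial>measure_pmf R)"
    proof (intro nn_integral_cong)
      fix n v
      have "emeasure (K n v) A = (\<integral>\<^sup>+m. indicator A m \<partial>K n v)"
        by (rule nn_integral_indicator[symmetric]) (simp add: K_def A)
      also have "\<dots> = (\<integral>\<^sup>+\<zeta>. indicator A (mk_mark ((n, v), \<zeta>)) \<partial>unit_costs)"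
        unfolding K_def by (rule nn_integral_distr) measurable
      finally show "emeasure (K n v) A = (\<integral>\<^sup>+\<zeta>. indicator A (mk_mark ((n, v), \<zeta>)) \<partial>unit_costs)" .
    qed
    also have "\<dots> = (\<integral>\<^sup>+t. (\<integral>\<^sup>+\<zeta>. indicator A (mk_mark (t, \<zeta>)) \<partial>unit_costs) \<partial>type_law R)"
      by (subst nn_integral_type_law) measurable
    also have "\<dots> = (\<integral>\<^sup>+p. indicator A (mk_mark p) \<partial>(type_law R \<Otimes>\<^sub>M unit_costs))"
      by (subst U.nn_integral_fst[symmetric]) auto
    also have "\<dots> = emeasure (distr (type_law R \<Otimes>\<^sub>M unit_costs) mark_space mk_mark) A"
      by (subst nn_integral_indicator[symmetric], simp add: A, subst nn_integral_distr) measurable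
    finally show "emeasure (mark_law R) A = emeasure (distr (type_law R \<Otimes>\<^sub>M unit_costs) mark_space mk_mark) A" .
  qed
qed

lemma sets_mark_law [measurable_cong, simp]: "sets (mark_law R) = sets mark_space"
  by (simp add: mark_law_eq_distr)

lemma space_mark_law [simp]: "space (mark_law R) = UNIV"
  by (simp add: mark_law_eq_distr)

lemma prob_space_mark_law: "prob_space (mark_law R)"
proof -
  interpret U: prob_space unit_costs by (rule prob_space_unit_costs)
  interpret T: prob_space "type_law R" by (rule prob_space_type_law)
  interpret TU: pair_prob_space "type_law R" unit_costs ..
  show ?thesis unfolding mark_law_eq_distr by (rule TU.prob_space_distr) measurable
qed

section \<open>Infinite products of probability spaces\<close>

lemma measurable_PiM_coord: "j \<in> J \<Longrightarrow> (\<lambda>\<omega>. \<omega> j) \<in> measurable (\<Pi>\<^sub>M i\<in>J. M) M"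
  by (rule measurable_component_singleton)

text \<open>A list is either empty or a head with a tail, so a product over all lists is the root
  coordinate times, for each head, a product over the tails. On a cylinder over a finite J,
  \<open>J1\<close> collects the heads that occur and \<open>J2 j\<close> the tails below the head
  j.\<close>

lemma PiM_list_decomp:
  fixes A K S :: "'b measure"
  assumes A: "prob_space A" and K: "prob_space K" and sA: "sets A = sets S" and sK: "sets K = sets S"
  shows "distr (A \<Otimes>\<^sub>M (\<Pi>\<^sub>M j\<in>UNIV :: 'a set. \<Pi>\<^sub>M i\<in>UNIV :: 'a list set. K)) (\<Pi>\<^sub>M i\<in>UNIV. S)
      (\<lambda>(a, s) i. case i of [] \<Rightarrow> a | j # i' \<Rightarrow> s j i')
    = (\<Pi>\<^sub>M i\<in>UNIV. if i = [] then A else K)" (is "distr ?AS ?S ?f = _")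
proof -
  let ?M = "\<lambda>i :: 'a list. if i = [] then A else K"
  let ?PK = "\<Pi>\<^sub>M i\<in>UNIV :: 'a list set. K"
  interpret A: prob_space A by fact
  interpret K: prob_space K by fact
  interpret M: prob_space "?M i" for i by (cases "i = []") (auto intro: A K)
  interpret product_prob_space ?M UNIV ..
  interpret KK: product_prob_space "\<lambda>_ :: 'a list. K" UNIV ..
  interpret KS: product_prob_space "\<lambda>_ :: 'a. ?PK" UNIV ..
  have spA: "space A = space S" and spK: "space K = space S"
    using sA sK by (auto dest: sets_eq_imp_space_eq)
  have meas: "?f \<in> measurable ?AS ?S"
  proof (rule measurable_PiM_single')
    fix i :: "'a list"
    show "(\<lambda>x. ?f x i) \<in> measurable ?AS S"
    proof (cases i)
      case Nil
      then show ?thesis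
        using measurable_fst[of A "\<Pi>\<^sub>M j\<in>UNIV :: 'a set. ?PK"] by (simp add: case_prod_beta' sA cong: measurable_cong_sets)
    next
      case (Cons j i')
      have "(\<lambda>x. snd x j i') \<in> measurable ?AS K"
        using measurable_compose[OF measurable_compose[OF measurable_snd measurable_PiM_coord[OF UNIV_I]]
              measurable_PiM_coord[OF UNIV_I]] .
      then show ?thesis using Cons by (simp add: case_prod_beta' sK cong: measurable_cong_sets)
    qed
  next
    show "?f \<in> space ?AS \<rightarrow> UNIV \<rightarrow>\<^sub>E space S"
      by (auto simp: space_pair_measure space_PiM PiE_iff spA spK split: list.split)
  qed
  show ?thesis
  proof (rule PiM_eq)
    show "sets (distr ?AS ?S ?f) = sets (Pi\<^sub>M UNIV ?M)"
      by (simp, rule sets_PiM_cong) (auto simp: sA sK)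
  next
    fix J and F :: "'a list \<Rightarrow> _"
    assume J: "finite J" and F: "\<And>j. j \<in> J \<Longrightarrow> F j \<in> sets (?M j)"
    define J1 where "J1 = hd ` (J - {[]})"
    define J2 where "J2 j = {i. j # i \<in> J}" for j
    have fin1: "finite J1" using J by (simp add: J1_def)
    have fin2: "finite (J2 j)" for j
    proof -
      have "J2 j \<subseteq> tl ` J" by (force simp: J2_def image_iff)
      then show ?thesis using J finite_subset by blast
    qed
    define A0 where "A0 = (if [] \<in> J then F [] else space A)"
    define B0 where "B0 j = prod_emb UNIV (\<lambda>_. K) (J2 j) (\<Pi>\<^sub>E i\<in>J2 j. F (j # i))" for j
    have A0: "A0 \<in> sets A" using F[of "[]"] by (auto simp: A0_def)
    have FK: "F (j # i) \<in> sets K" if "j # i \<in> J" for j i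
      using F[OF that] by simp
    have B0: "B0 j \<in> sets ?PK" for j
      unfolding B0_def using fin2 FK by (intro sets_PiM_I) (auto simp: J2_def)
    have F_sub: "\<And>i x. i \<in> J \<Longrightarrow> x \<in> F i \<Longrightarrow> x \<in> space S"
      using F sets.sets_into_space spA spK by (fastforce split: if_splits)
    have F': "\<And>i. i \<in> J \<Longrightarrow> F i \<in> sets S"
      using F sA sK by (fastforce split: if_splits)
    have emb: "prod_emb UNIV ?M J (Pi\<^sub>E J F) = prod_emb UNIV (\<lambda>_. S) J (Pi\<^sub>E J F)"
      by (auto simp: prod_emb_def space_PiM PiE_iff spA spK split: if_splits)
    have vimage: "?f -` prod_emb UNIV (\<lambda>_. S) J (Pi\<^sub>E J F) \<inter> space ?AS
      = A0 \<times> prod_emb UNIV (\<lambda>_. ?PK) J1 (\<Pi>\<^sub>E j\<in>J1. B0 j)" (is "?L = ?R")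
    proof (intro set_eqI)
      fix x :: "'b \<times> ('a \<Rightarrow> 'a list \<Rightarrow> 'b)"
      obtain a s where x: "x = (a, s)" by (cases x)
      have L: "x \<in> ?L \<longleftrightarrow> a \<in> space S \<and> (\<forall>j i. s j i \<in> space S) \<and> (\<forall>i\<in>J. ?f x i \<in> F i)"
        using F_sub by (auto simp: x prod_emb_def space_pair_measure space_PiM PiE_iff spA spK split: list.splits)
      have all: "(\<forall>i\<in>J. ?f x i \<in> F i) \<longleftrightarrow> ([] \<in> J \<longrightarrow> a \<in> F []) \<and> (\<forall>j i. j # i \<in> J \<longrightarrow> s j i \<in> F (j # i))"
        unfolding x by (auto split: list.splits)
      have J1': "j # i \<in> J \<Longrightarrow> j \<in> J1" for j i
        unfolding J1_def by force
      have R: "x \<in> ?R \<longleftrightarrow> a \<in> A0 \<and> (\<forall>j i. s j i \<in> space S) \<and> (\<forall>j i. j # i \<in> J \<longrightarrow> s j i \<in> F (j # i))"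
        using J1' by (auto simp: x prod_emb_def space_PiM PiE_iff spK B0_def J2_def)
      show "x \<in> ?L \<longleftrightarrow> x \<in> ?R"
        unfolding L R all unfolding A0_def using F_sub[of "[]"] by (auto simp: spA)
    qed
    have "emeasure (distr ?AS ?S ?f) (prod_emb UNIV ?M J (Pi\<^sub>E J F))
      = emeasure ?AS (A0 \<times> prod_emb UNIV (\<lambda>_. ?PK) J1 (\<Pi>\<^sub>E j\<in>J1. B0 j))"
      unfolding emb vimage[symmetric] using J F' by (intro emeasure_distr meas sets_PiM_I) auto
    also have "\<dots> = emeasure A A0 * emeasure (\<Pi>\<^sub>M j\<in>UNIV. ?PK) (prod_emb UNIV (\<lambda>_. ?PK) J1 (\<Pi>\<^sub>E j\<in>J1. B0 j))"
      using A0 B0 fin1 by (intro KS.P.emeasure_pair_measure_Times sets_PiM_I) auto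
    also have "emeasure (\<Pi>\<^sub>M j\<in>UNIV. ?PK) (prod_emb UNIV (\<lambda>_. ?PK) J1 (\<Pi>\<^sub>E j\<in>J1. B0 j))
      = (\<Prod>j\<in>J1. emeasure ?PK (B0 j))"
      using fin1 B0 by (intro KS.emeasure_PiM_emb) auto
    also have "\<dots> = (\<Prod>j\<in>J1. \<Prod>i\<in>J2 j. emeasure K (F (j # i)))"
      unfolding B0_def using fin2 FK by (intro prod.cong refl KK.emeasure_PiM_emb) (auto simp: J2_def)
    also have "\<dots> = (\<Prod>(j, i)\<in>Sigma J1 J2. emeasure K (F (j # i)))"
      using fin1 fin2 by (intro prod.Sigma) auto
    also have "\<dots> = (\<Prod>i\<in>J - {[]}. emeasure K (F i))"
      by (rule prod.reindex_bij_witness[of _ "\<lambda>i. (hd i, tl i)" "\<lambda>(j, i). j # i"])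
         (auto simp: J1_def J2_def neq_Nil_conv image_iff)
    also have "\<dots> = (\<Prod>i\<in>J - {[]}. emeasure (?M i) (F i))"
      by (intro prod.cong) auto
    also have "emeasure A A0 * \<dots> = (\<Prod>i\<in>J. emeasure (?M i) (F i))"
    proof (cases "[] \<in> J")
      case True
      then show ?thesis using prod.remove[OF J True, of "\<lambda>i. emeasure (?M i) (F i)"] by (simp add: A0_def)
    next
      case False
      then show ?thesis by (simp add: A0_def A.emeasure_space_1)
    qed
    finally show "emeasure (distr ?AS ?S ?f) (prod_emb UNIV ?M J (Pi\<^sub>E J F)) = (\<Prod>i\<in>J. emeasure (?M i) (F i))" .
  qed
qed

text \<open>A product over finitely many coordinates only sees the restriction to J, where the
  theorem for finite products applies.\<close>

lemma (in prob_space) integrable_PiM_prod: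
  fixes g :: "'i \<Rightarrow> 'a \<Rightarrow> real"
  assumes J: "finite J" and g: "\<And>j. j \<in> J \<Longrightarrow> integrable M (g j)"
  shows "integrable (\<Pi>\<^sub>M i\<in>UNIV. M) (\<lambda>\<omega>. \<Prod>j\<in>J. g j (\<omega> j))" (is ?A)
    and "(\<integral>\<omega>. (\<Prod>j\<in>J. g j (\<omega> j)) \<partial>(\<Pi>\<^sub>M i\<in>UNIV. M)) = (\<Prod>j\<in>J. integral\<^sup>L M (g j))" (is ?B)
proof -
  interpret product_prob_space "\<lambda>_ :: 'i. M" UNIV ..
  have d: "(\<Pi>\<^sub>M i\<in>J. M) = distr (\<Pi>\<^sub>M i\<in>UNIV. M) (\<Pi>\<^sub>M i\<in>J. M) (\<lambda>x. restrict x J)"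
    using J by (intro distr_PiM_restrict_finite[symmetric]) auto
  have r: "(\<lambda>x. restrict x J) \<in> measurable (\<Pi>\<^sub>M i\<in>UNIV. M) (\<Pi>\<^sub>M i\<in>J. M)"
    by (rule measurable_restrict_subset) simp
  have m: "(\<lambda>\<omega>. \<Prod>j\<in>J. g j (\<omega> j)) \<in> borel_measurable (\<Pi>\<^sub>M i\<in>J. M)"
    proof (intro borel_measurable_prod)
    fix j assume "j \<in> J"
    from measurable_compose[OF measurable_PiM_coord[OF this] borel_measurable_integrable[OF g[OF this]]]
    show "(\<lambda>\<omega>. g j (\<omega> j)) \<in> borel_measurable (\<Pi>\<^sub>M i\<in>J. M)" .
  qed
  have eq: "(\<Prod>j\<in>J. g j (restrict \<omega> J j)) = (\<Prod>j\<in>J. g j (\<omega> j))" for \<omega>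
    by (intro prod.cong) auto
  have "integrable (\<Pi>\<^sub>M i\<in>J. M) (\<lambda>\<omega>. \<Prod>j\<in>J. g j (\<omega> j))"
    using J g by (rule product_integrable_prod)
  then show ?A
    by (subst (asm) d, subst (asm) integrable_distr_eq[OF r m]) (simp only: eq)
  have "(\<integral>\<omega>. (\<Prod>j\<in>J. g j (\<omega> j)) \<partial>(\<Pi>\<^sub>M i\<in>J. M)) = (\<Prod>j\<in>J. integral\<^sup>L M (g j))"
    using J g by (rule product_integral_prod)
  then show ?B
    by (subst (asm) d, subst (asm) integral_distr[OF r m]) (simp only: eq)
qed

lemma nn_integral_PiM_prod:
  fixes g :: "'i \<Rightarrow> 'a \<Rightarrow> ennreal"
  assumes M: "prob_space M" and J: "finite J" and g: "\<And>j. j \<in> J \<Longrightarrow> g j \<in> borel_measurable M"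
  shows "(\<integral>\<^sup>+\<omega>. (\<Prod>j\<in>J. g j (\<omega> j)) \<partial>(\<Pi>\<^sub>M i\<in>UNIV. M)) = (\<Prod>j\<in>J. integral\<^sup>N M (g j))"
proof -
  interpret prob_space M by fact
  interpret product_prob_space "\<lambda>_ :: 'i. M" UNIV ..
  have d: "(\<Pi>\<^sub>M i\<in>J. M) = distr (\<Pi>\<^sub>M i\<in>UNIV. M) (\<Pi>\<^sub>M i\<in>J. M) (\<lambda>x. restrict x J)"
    using J by (intro distr_PiM_restrict_finite[symmetric]) auto
  have r: "(\<lambda>x. restrict x J) \<in> measurable (\<Pi>\<^sub>M i\<in>UNIV. M) (\<Pi>\<^sub>M i\<in>J. M)"
    by (rule measurable_restrict_subset) simp
  have m: "(\<lambda>\<omega>. \<Prod>j\<in>J. g j (\<omega> j)) \<in> borel_measurable (\<Pi>\<^sub>M i\<in>J. M)"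
    proof (intro borel_measurable_prod_ennreal)
    fix j assume "j \<in> J"
    from measurable_compose[OF measurable_PiM_coord[OF this] g[OF this]]
    show "(\<lambda>\<omega>. g j (\<omega> j)) \<in> borel_measurable (\<Pi>\<^sub>M i\<in>J. M)" .
  qed
  have eq: "(\<Prod>j\<in>J. g j (restrict \<omega> J j)) = (\<Prod>j\<in>J. g j (\<omega> j))" for \<omega>
    by (intro prod.cong) auto
  have "(\<integral>\<^sup>+\<omega>. (\<Prod>j\<in>J. g j (\<omega> j)) \<partial>(\<Pi>\<^sub>M i\<in>J. M)) = (\<Prod>j\<in>J. integral\<^sup>N M (g j))"
    using J g by (rule product_nn_integral_prod)
  then show ?thesis
    by (subst (asm) d, subst (asm) nn_integral_distr[OF r]) (use m in \<open>simp_all only: eq measurable_distr_eq1\<close>)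
qed

lemma measurable_zip_PiM:
  "(\<lambda>(a, b) j. (a j, b j)) \<in> measurable ((\<Pi>\<^sub>M j\<in>UNIV. A) \<Otimes>\<^sub>M (\<Pi>\<^sub>M j\<in>UNIV. B)) (\<Pi>\<^sub>M j\<in>UNIV. A \<Otimes>\<^sub>M B)"
  by (rule measurable_PiM_single')
     (auto simp: space_pair_measure space_PiM PiE_iff case_prod_beta')

text \<open>Applied to the relative cost of the j-th edge and the j-th subtree: both families are
  independent products, so the pairs are i.i.d. over j.\<close>

lemma distr_zip_PiM:
  assumes A: "prob_space A" and B: "prob_space B"
  shows "distr ((\<Pi>\<^sub>M j\<in>UNIV :: 'i set. A) \<Otimes>\<^sub>M (\<Pi>\<^sub>M j\<in>UNIV. B)) (\<Pi>\<^sub>M j\<in>UNIV. A \<Otimes>\<^sub>M B) (\<lambda>(a, b) j. (a j, b j))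
    = (\<Pi>\<^sub>M j\<in>UNIV. A \<Otimes>\<^sub>M B)" (is "distr ?AB ?Z ?f = _")
proof -
  interpret A: prob_space A by fact
  interpret B: prob_space B by fact
  interpret AB: pair_prob_space A B ..
  interpret product_prob_space "\<lambda>_ :: 'i. A \<Otimes>\<^sub>M B" UNIV ..
  interpret PA: product_prob_space "\<lambda>_ :: 'i. A" UNIV ..
  interpret PB: product_prob_space "\<lambda>_ :: 'i. B" UNIV ..
  show ?thesis
  proof (rule PiM_eq)
    fix J and F :: "'i \<Rightarrow> _"
    assume J: "finite J" and F[measurable]: "\<And>j. j \<in> J \<Longrightarrow> F j \<in> sets (A \<Otimes>\<^sub>M B)"
    have ind: "(indicator (prod_emb UNIV (\<lambda>_. A \<Otimes>\<^sub>M B) J (Pi\<^sub>E J F)) (?f x) :: ennreal)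
       = (\<Prod>j\<in>J. indicator (F j) (fst x j, snd x j))" if "x \<in> space ?AB" for x
    proof -
      have "?f x \<in> prod_emb UNIV (\<lambda>_. A \<Otimes>\<^sub>M B) J (Pi\<^sub>E J F) \<longleftrightarrow> (\<forall>j\<in>J. (fst x j, snd x j) \<in> F j)"
        using that by (auto simp: prod_emb_def space_pair_measure space_PiM PiE_iff case_prod_beta')
      then show ?thesis
        using J by (auto simp: indicator_def prod_eq_1_iff[OF J] intro!: prod_zero[OF J, symmetric])
    qed
    have S: "prod_emb UNIV (\<lambda>_. A \<Otimes>\<^sub>M B) J (Pi\<^sub>E J F) \<in> sets ?Z"
      using J F by (intro sets_PiM_I) auto
    have "emeasure (distr ?AB ?Z ?f) (prod_emb UNIV (\<lambda>_. A \<Otimes>\<^sub>M B) J (Pi\<^sub>E J F))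
      = (\<integral>\<^sup>+x. indicator (prod_emb UNIV (\<lambda>_. A \<Otimes>\<^sub>M B) J (Pi\<^sub>E J F)) (?f x) \<partial>?AB)"
      using S measurable_zip_PiM[of A B] by (subst nn_integral_indicator[symmetric], simp, subst nn_integral_distr) auto
    also have "\<dots> = (\<integral>\<^sup>+x. (\<Prod>j\<in>J. indicator (F j) (fst x j, snd x j)) \<partial>?AB)"
      by (intro nn_integral_cong ind)
    also have "\<dots> = (\<integral>\<^sup>+a. \<integral>\<^sup>+b. (\<Prod>j\<in>J. indicator (F j) (a j, b j)) \<partial>(\<Pi>\<^sub>M j\<in>UNIV. B) \<partial>(\<Pi>\<^sub>M j\<in>UNIV. A))"
    proof (subst PB.nn_integral_fst[symmetric])
      show "(\<lambda>x. \<Prod>j\<in>J. indicator (F j) (fst x j, snd x j) :: ennreal) \<in> borel_measurable ?AB"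
      proof (intro borel_measurable_prod_ennreal)
        fix j assume j: "j \<in> J"
        have "(\<lambda>x. (fst x j, snd x j)) \<in> measurable ?AB (A \<Otimes>\<^sub>M B)"
          using measurable_compose[OF measurable_fst measurable_PiM_coord[OF UNIV_I]]
            measurable_compose[OF measurable_snd measurable_PiM_coord[OF UNIV_I]]
          by (rule measurable_Pair)
        from measurable_compose[OF this borel_measurable_indicator[OF F[OF j]]]
        show "(\<lambda>x. indicator (F j) (fst x j, snd x j) :: ennreal) \<in> borel_measurable ?AB" .
      qed
    qed simp
    also have "\<dots> = (\<integral>\<^sup>+a. (\<Prod>j\<in>J. \<integral>\<^sup>+b. indicator (F j) (a j, b) \<partial>B) \<partial>(\<Pi>\<^sub>M j\<in>UNIV. A))"
    proof (intro nn_integral_cong nn_integral_PiM_prod B J)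
      fix a j assume "a \<in> space (\<Pi>\<^sub>M j\<in>UNIV :: 'i set. A)" and j: "j \<in> J"
      then have "a j \<in> space A" by (auto simp: space_PiM PiE_iff)
      from measurable_compose[OF measurable_Pair1'[OF this] borel_measurable_indicator[OF F[OF j]]]
      show "(\<lambda>b. indicator (F j) (a j, b) :: ennreal) \<in> borel_measurable B" .
    qed
    also have "\<dots> = (\<Prod>j\<in>J. \<integral>\<^sup>+a. \<integral>\<^sup>+b. indicator (F j) (a, b) \<partial>B \<partial>A)"
      by (intro nn_integral_PiM_prod A J) measurable
    also have "\<dots> = (\<Prod>j\<in>J. emeasure (A \<Otimes>\<^sub>M B) (F j))"
      by (intro prod.cong refl) (auto simp: B.nn_integral_fst)
    finally show "emeasure (distr ?AB ?Z ?f) (prod_emb UNIV (\<lambda>_. A \<Otimes>\<^sub>M B) J (Pi\<^sub>E J F))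
      = (\<Prod>j\<in>J. emeasure (A \<Otimes>\<^sub>M B) (F j))" .
  qed simp
qed

section \<open>The tree as a root with independent subtrees\<close>

abbreviation marks_space :: "marks measure" where
  "marks_space \<equiv> \<Pi>\<^sub>M i\<in>UNIV. mark_space"

definition subtree :: "nat \<Rightarrow> marks \<Rightarrow> marks" where
  "subtree j \<omega> = (\<lambda>i. \<omega> (j # i))"

definition tree_law :: "nat pmf \<Rightarrow> nat pmf \<Rightarrow> marks measure" where
  "tree_law R Q = (\<Pi>\<^sub>M i\<in>UNIV. mark_law (if i = [] then R else Q))"

lemma ewt_eq_tree_law: "ewt P = tree_law P (shifted P)"
  by (simp add: ewt_def tree_law_def)

lemma sets_tree_law [measurable_cong, simp]: "sets (tree_law R Q) = sets marks_space"
  unfolding tree_law_def by (rule sets_PiM_cong) auto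

lemma space_marks_space [simp]: "space marks_space = UNIV"
  by (simp add: space_PiM)

lemma space_tree_law [simp]: "space (tree_law R Q) = UNIV"
  using sets_eq_imp_space_eq[OF sets_tree_law] by simp

lemma prob_space_tree_law: "prob_space (tree_law R Q)"
  unfolding tree_law_def by (intro prob_space_PiM prob_space_mark_law)

text \<open>The randomness left in a tree once the type (potential degree, threshold) of its root is
  fixed: the relative costs of the edges at the root and the subtrees hanging off it.\<close>

definition env :: "nat pmf \<Rightarrow> ((nat \<Rightarrow> real) \<times> (nat \<Rightarrow> marks)) measure" where
  "env Q = unit_costs \<Otimes>\<^sub>M (\<Pi>\<^sub>M j\<in>UNIV. tree_law Q Q)"

definition graft :: "nat \<times> real \<Rightarrow> (nat \<Rightarrow> real) \<times> (nat \<Rightarrow> marks) \<Rightarrow> marks" where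
  "graft t = (\<lambda>(\<zeta>, s) i. case i of [] \<Rightarrow> mk_mark (t, \<zeta>) | j # i' \<Rightarrow> s j i')"

lemma subtree_graft [simp]: "subtree j (graft t b) = snd b j"
  by (simp add: subtree_def graft_def case_prod_beta)

lemma pot_deg_graft [simp]: "pot_deg (graft t b) [] = fst t"
  by (simp add: pot_deg_def graft_def case_prod_beta mk_mark_def)

lemma threshold_graft_Nil [simp]: "threshold (graft t b) [] = snd t"
  by (simp add: threshold_def graft_def case_prod_beta mk_mark_def)

lemma threshold_graft_Cons [simp]: "threshold (graft t b) (j # i) = threshold (snd b j) i"
  by (simp add: threshold_def graft_def case_prod_beta)

lemma cost_graft [simp]: "cost (graft t b) [] j = max 0 (snd t) * fst b j"
  by (simp add: cost_def graft_def case_prod_beta mk_mark_def)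

lemma sets_env [measurable_cong, simp]:
  "sets (env Q) = sets ((\<Pi>\<^sub>M j\<in>UNIV. borel) \<Otimes>\<^sub>M (\<Pi>\<^sub>M j\<in>UNIV. marks_space))"
  unfolding env_def by (intro sets_pair_measure_cong sets_unit_costs sets_PiM_cong) auto

lemma prob_space_env: "prob_space (env Q)"
proof -
  interpret U: prob_space unit_costs by (rule prob_space_unit_costs)
  interpret S: prob_space "\<Pi>\<^sub>M j\<in>UNIV :: nat set. tree_law Q Q"
    by (intro prob_space_PiM prob_space_tree_law)
  interpret pair_prob_space unit_costs "\<Pi>\<^sub>M j\<in>UNIV :: nat set. tree_law Q Q" ..
  show ?thesis unfolding env_def by (rule P.prob_space_axioms)
qed

lemma space_env [simp]: "space (env Q) = UNIV"
  using sets_eq_imp_space_eq[OF sets_env] by (simp add: space_pair_measure space_PiM)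

lemma measurable_graft [measurable]:
  "(\<lambda>(t, b). graft t b) \<in> measurable ((count_space UNIV \<Otimes>\<^sub>M borel) \<Otimes>\<^sub>M
      ((\<Pi>\<^sub>M j\<in>UNIV. borel) \<Otimes>\<^sub>M (\<Pi>\<^sub>M j\<in>UNIV. marks_space))) marks_space"
proof (rule measurable_PiM_single')
  fix i :: "nat list"
  show "(\<lambda>x. (case x of (t, b) \<Rightarrow> graft t b) i) \<in> measurable ((count_space UNIV \<Otimes>\<^sub>M borel) \<Otimes>\<^sub>M
      ((\<Pi>\<^sub>M j\<in>UNIV. borel) \<Otimes>\<^sub>M (\<Pi>\<^sub>M j\<in>UNIV. marks_space))) mark_space" (is "_ \<in> measurable ?M _")
  proof (cases i)
    case Nil
    have "(\<lambda>x. mk_mark (fst x, fst (snd x))) \<in> measurable ?M mark_space"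
      by measurable
    then show ?thesis by (simp add: Nil graft_def case_prod_beta')
  next
    case (Cons j i')
    have "(\<lambda>x. snd (snd x)) \<in> measurable ?M (\<Pi>\<^sub>M j\<in>UNIV. marks_space)" by measurable
    from measurable_compose[OF measurable_compose[OF this measurable_PiM_coord[OF UNIV_I]]
              measurable_PiM_coord[OF UNIV_I]]
    have "(\<lambda>x. snd (snd x) j i') \<in> measurable ?M mark_space" .
    then show ?thesis by (simp add: Cons graft_def case_prod_beta')
  qed
qed auto

lemma measurable_graft2 [measurable]:
  "graft t \<in> measurable ((\<Pi>\<^sub>M j\<in>UNIV. borel) \<Otimes>\<^sub>M (\<Pi>\<^sub>M j\<in>UNIV. marks_space)) marks_space"
  using measurable_compose[OF measurable_Pair1' measurable_graft, of t] by (simp add: space_pair_measure)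

text \<open>Disintegration at the root: its mark splits off by \<open>PiM_list_decomp\<close> and
  then splits into type and relative costs. The law \<open>env Q\<close> of all that remains is the
  same for every type, so conditioning on the type is an instance of Fubini's theorem.\<close>

lemma nn_integral_tree_law:
  assumes F[measurable]: "F \<in> borel_measurable marks_space"
  shows "(\<integral>\<^sup>+\<omega>. F \<omega> \<partial>tree_law R Q) = (\<integral>\<^sup>+t. \<integral>\<^sup>+b. F (graft t b) \<partial>env Q \<partial>type_law R)"
proof -
  let ?S = "\<Pi>\<^sub>M j\<in>UNIV :: nat set. tree_law Q Q"
  interpret U: prob_space unit_costs by (rule prob_space_unit_costs)
  interpret T: prob_space "type_law R" by (rule prob_space_type_law)
  interpret E: prob_space "env Q" by (rule prob_space_env)
  interpret S: prob_space ?S by (intro prob_space_PiM prob_space_tree_law)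
  let ?f = "\<lambda>(a, s) i. case i of [] \<Rightarrow> a | j # i' \<Rightarrow> s j i'"
  have ss: "sets ?S = sets (\<Pi>\<^sub>M j\<in>UNIV. marks_space)"
    by (intro sets_PiM_cong) auto
  have "distr (mark_law R \<Otimes>\<^sub>M ?S) marks_space ?f = (\<Pi>\<^sub>M i\<in>UNIV. if i = [] then mark_law R else mark_law Q)"
    unfolding tree_law_def if_cancel
    by (rule PiM_list_decomp) (auto intro: prob_space_mark_law)
  also have "\<dots> = tree_law R Q"
    unfolding tree_law_def by (intro PiM_cong) auto
  finally have d: "tree_law R Q = distr (mark_law R \<Otimes>\<^sub>M ?S) marks_space ?f" ..
  have f: "?f \<in> measurable (mark_space \<Otimes>\<^sub>M (\<Pi>\<^sub>M j\<in>UNIV. marks_space)) marks_space"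
  proof (rule measurable_PiM_single')
    fix i :: "nat list"
    show "(\<lambda>x. ?f x i) \<in> measurable (mark_space \<Otimes>\<^sub>M (\<Pi>\<^sub>M j\<in>UNIV. marks_space)) mark_space"
      using measurable_compose[OF measurable_compose[OF measurable_snd measurable_PiM_coord[OF UNIV_I]]
              measurable_PiM_coord[OF UNIV_I]]
      by (cases i) (auto simp: case_prod_beta')
  qed auto
  have [measurable_cong]: "sets (mark_law R \<Otimes>\<^sub>M ?S) = sets (mark_space \<Otimes>\<^sub>M (\<Pi>\<^sub>M j\<in>UNIV. marks_space))"
    by (intro sets_pair_measure_cong ss) auto
  note ss[measurable_cong]
  have fF: "(\<lambda>x. F (?f x)) \<in> borel_measurable (mark_space \<Otimes>\<^sub>M (\<Pi>\<^sub>M j\<in>UNIV. marks_space))"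
    using measurable_compose[OF f F] .
  have "(\<integral>\<^sup>+\<omega>. F \<omega> \<partial>tree_law R Q) = (\<integral>\<^sup>+x. F (?f x) \<partial>(mark_law R \<Otimes>\<^sub>M ?S))"
    unfolding d using f F by (subst nn_integral_distr) (auto cong: measurable_cong_sets)
  also have "\<dots> = (\<integral>\<^sup>+a. \<integral>\<^sup>+s. F (?f (a, s)) \<partial>?S \<partial>mark_law R)"
    using fF by (subst S.nn_integral_fst[symmetric]) (auto cong: measurable_cong_sets)
  also have "\<dots> = (\<integral>\<^sup>+p. \<integral>\<^sup>+s. F (?f (mk_mark p, s)) \<partial>?S \<partial>(type_law R \<Otimes>\<^sub>M unit_costs))"
    unfolding mark_law_eq_distr
  proof (subst nn_integral_distr)
    have "(\<lambda>x. F (?f x)) \<in> borel_measurable (mark_space \<Otimes>\<^sub>M ?S)"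
      using fF by simp
    from S.borel_measurable_nn_integral_fst[OF this]
    show "(\<lambda>a. \<integral>\<^sup>+s. F (?f (a, s)) \<partial>?S) \<in> borel_measurable
       (distr (type_law R \<Otimes>\<^sub>M unit_costs) mark_space mk_mark)" by simp
  qed simp_all
  also have "\<dots> = (\<integral>\<^sup>+t. \<integral>\<^sup>+\<zeta>. \<integral>\<^sup>+s. F (?f (mk_mark (t, \<zeta>), s)) \<partial>?S \<partial>unit_costs \<partial>type_law R)"
  proof (subst U.nn_integral_fst[symmetric])
    have "(\<lambda>x. F (?f (mk_mark (fst x), snd x))) \<in> borel_measurable ((type_law R \<Otimes>\<^sub>M unit_costs) \<Otimes>\<^sub>M ?S)"
      using measurable_compose[OF _ fF] by measurable
    from S.borel_measurable_nn_integral_fst[OF this]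
    show "(\<lambda>p. \<integral>\<^sup>+s. F (?f (mk_mark p, s)) \<partial>?S) \<in> borel_measurable (type_law R \<Otimes>\<^sub>M unit_costs)"
      by simp
  qed simp
  also have "\<dots> = (\<integral>\<^sup>+t. \<integral>\<^sup>+b. F (graft t b) \<partial>env Q \<partial>type_law R)"
  proof (intro nn_integral_cong)
    fix t
    have "(\<lambda>b. F (graft t b)) \<in> borel_measurable (unit_costs \<Otimes>\<^sub>M ?S)"
      by measurable
    from S.nn_integral_fst[OF this]
    show "(\<integral>\<^sup>+\<zeta>. \<integral>\<^sup>+s. F (?f (mk_mark (t, \<zeta>), s)) \<partial>?S \<partial>unit_costs) = (\<integral>\<^sup>+b. F (graft t b) \<partial>env Q)"
      by (simp add: env_def graft_def)
  qed
  finally show ?thesis .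
qed

lemma tree_law_eq_distr:
  "tree_law R Q = distr (type_law R \<Otimes>\<^sub>M env Q) marks_space (\<lambda>(t, b). graft t b)"
proof (rule measure_eqI)
  interpret E: prob_space "env Q" by (rule prob_space_env)
  fix A assume "A \<in> sets (tree_law R Q)"
  then have A[measurable]: "A \<in> sets marks_space" by simp
  have "emeasure (tree_law R Q) A = (\<integral>\<^sup>+\<omega>. indicator A \<omega> \<partial>tree_law R Q)" by simp
  also have "\<dots> = (\<integral>\<^sup>+t. \<integral>\<^sup>+b. indicator A (graft t b) \<partial>env Q \<partial>type_law R)"
    by (rule nn_integral_tree_law) simp
  also have "\<dots> = (\<integral>\<^sup>+x. indicator A (case x of (t, b) \<Rightarrow> graft t b) \<partial>(type_law R \<Otimes>\<^sub>M env Q))"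
    by (subst E.nn_integral_fst[symmetric]) auto
  also have "\<dots> = emeasure (distr (type_law R \<Otimes>\<^sub>M env Q) marks_space (\<lambda>(t, b). graft t b)) A"
    by (subst nn_integral_indicator[symmetric], simp, subst nn_integral_distr) auto
  finally show "emeasure (tree_law R Q) A = emeasure (distr (type_law R \<Otimes>\<^sub>M env Q) marks_space (\<lambda>(t, b). graft t b)) A" .
qed simp

lemma distr_env_zip:
  "distr (env Q) (\<Pi>\<^sub>M j\<in>UNIV. uniform_upto 1 \<Otimes>\<^sub>M tree_law Q Q) (\<lambda>(a, b) j. (a j, b j))
     = (\<Pi>\<^sub>M j\<in>UNIV. uniform_upto 1 \<Otimes>\<^sub>M tree_law Q Q)"
  unfolding env_def unit_costs_def
  by (intro distr_zip_PiM prob_space_uniform_upto prob_space_tree_law)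

section \<open>Sums and products over a generation\<close>

lemma sets_Collect_UNIV: "Measurable.pred M p \<Longrightarrow> space M = UNIV \<Longrightarrow> {x. p x} \<in> sets M"
  by (simp add: pred_def)

definition kept :: "marks \<Rightarrow> nat set" where
  "kept \<omega> = {j \<in> {1..pot_deg \<omega> []}. cost \<omega> [] j < threshold \<omega> [j]}"

lemma finite_kept [simp]: "finite (kept \<omega>)"
  by (simp add: kept_def)

text \<open>The sum of \<xi> over the subtrees hanging off the vertices of generation l. Recursion
  at the root, rather than a sum over a vertex set, exposes the step at which the branching property
  acts; \<open>gen_sum_generation\<close> identifies the two.\<close>

primrec gen_sum :: "nat \<Rightarrow> (marks \<Rightarrow> real) \<Rightarrow> marks \<Rightarrow> real" where
  "gen_sum 0 \<xi> \<omega> = \<xi> \<omega>"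
| "gen_sum (Suc l) \<xi> \<omega> = (\<Sum>j\<in>kept \<omega>. gen_sum l \<xi> (subtree j \<omega>))"

text \<open>The multiplicative companion: factors exp (- \<xi>) yield Laplace transforms of
  generation sums, and the constant factor 0 yields the indicator of extinction.\<close>

primrec gen_prod :: "nat \<Rightarrow> (marks \<Rightarrow> real) \<Rightarrow> marks \<Rightarrow> real" where
  "gen_prod 0 \<xi> \<omega> = \<xi> \<omega>"
| "gen_prod (Suc l) \<xi> \<omega> = (\<Prod>j\<in>kept \<omega>. gen_prod l \<xi> (subtree j \<omega>))"

lemma measurable_subtree [measurable]: "subtree j \<in> measurable marks_space marks_space"
  unfolding subtree_def
  by (rule measurable_PiM_single') (auto intro: measurable_PiM_coord)

lemma measurable_pot_deg [measurable]: "(\<lambda>\<omega>. pot_deg \<omega> i) \<in> measurable marks_space (count_space UNIV)"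
proof -
  have "(\<lambda>\<omega>. \<omega> i) \<in> measurable marks_space (count_space UNIV \<Otimes>\<^sub>M (borel \<Otimes>\<^sub>M (\<Pi>\<^sub>M j\<in>UNIV. borel)))"
    using measurable_PiM_coord[of i UNIV mark_space] by (simp add: mark_space_def)
  then show ?thesis unfolding pot_deg_def by measurable
qed

lemma measurable_threshold [measurable]: "(\<lambda>\<omega>. threshold \<omega> i) \<in> borel_measurable marks_space"
proof -
  have "(\<lambda>\<omega>. \<omega> i) \<in> measurable marks_space (count_space UNIV \<Otimes>\<^sub>M (borel \<Otimes>\<^sub>M (\<Pi>\<^sub>M j\<in>UNIV. borel)))"
    using measurable_PiM_coord[of i UNIV mark_space] by (simp add: mark_space_def)
  then show ?thesis unfolding threshold_def by measurable
qed

lemma measurable_cost [measurable]: "(\<lambda>\<omega>. cost \<omega> i j) \<in> borel_measurable marks_space"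
proof -
  have "(\<lambda>\<omega>. \<omega> i) \<in> measurable marks_space (count_space UNIV \<Otimes>\<^sub>M (borel \<Otimes>\<^sub>M (\<Pi>\<^sub>M j\<in>UNIV. borel)))"
    using measurable_PiM_coord[of i UNIV mark_space] by (simp add: mark_space_def)
  then have "(\<lambda>\<omega>. snd (snd (\<omega> i))) \<in> measurable marks_space (\<Pi>\<^sub>M j\<in>UNIV. borel)"
    by measurable
  from measurable_compose[OF this measurable_PiM_coord[OF UNIV_I]]
  show ?thesis unfolding cost_def .
qed

lemma measurable_kept_pred [measurable]: "Measurable.pred marks_space (\<lambda>\<omega>. j \<in> kept \<omega>)"
  unfolding kept_def by measurable

text \<open>Over a range determined by the integer \<open>pot_deg\<close> alone, measurability
  reduces to countably many fixed ranges.\<close>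

lemma sum_kept_eq: "(\<Sum>j\<in>kept \<omega>. f j) = (\<Sum>j\<in>{1..pot_deg \<omega> []}. if j \<in> kept \<omega> then f j else (0 :: real))"
  by (intro sum.mono_neutral_cong_left) (auto simp: kept_def)

lemma prod_kept_eq: "(\<Prod>j\<in>kept \<omega>. f j) = (\<Prod>j\<in>{1..pot_deg \<omega> []}. if j \<in> kept \<omega> then f j else (1 :: real))"
  by (intro prod.mono_neutral_cong_left) (auto simp: kept_def)

lemma measurable_gen_sum [measurable]:
  assumes [measurable]: "\<xi> \<in> borel_measurable marks_space"
  shows "gen_sum l \<xi> \<in> borel_measurable marks_space"
proof (induction l)
  case 0
  then show ?case by (simp add: assms[unfolded] cong: measurable_cong)
next
  case (Suc l)
  note Suc[measurable]
  have "(\<lambda>\<omega>. (\<lambda>n \<omega>. \<Sum>j\<in>{1..n}. if j \<in> kept \<omega> then gen_sum l \<xi> (subtree j \<omega>) else 0) (pot_deg \<omega> []) \<omega>)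
      \<in> borel_measurable marks_space"
    by (rule measurable_compose_countable) measurable
  then show ?case by (simp add: sum_kept_eq[abs_def] cong: measurable_cong)
qed

lemma measurable_gen_prod [measurable]:
  assumes [measurable]: "\<xi> \<in> borel_measurable marks_space"
  shows "gen_prod l \<xi> \<in> borel_measurable marks_space"
proof (induction l)
  case 0
  then show ?case by (simp add: assms[unfolded] cong: measurable_cong)
next
  case (Suc l)
  note Suc[measurable]
  have "(\<lambda>\<omega>. (\<lambda>n \<omega>. \<Prod>j\<in>{1..n}. if j \<in> kept \<omega> then gen_prod l \<xi> (subtree j \<omega>) else 1) (pot_deg \<omega> []) \<omega>)
      \<in> borel_measurable marks_space"
    by (rule measurable_compose_countable) measurable
  then show ?case by (simp add: prod_kept_eq[abs_def] cong: measurable_cong)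
qed

lemma gen_sum_add: "gen_sum l (gen_sum k \<xi>) \<omega> = gen_sum (l + k) \<xi> \<omega>"
  by (induction l arbitrary: \<omega>) auto

lemma gen_sum_Suc1: "gen_sum (Suc l) \<xi> = gen_sum 1 (gen_sum l \<xi>)"
  by (rule ext) simp

lemma gen_sum_cmult: "gen_sum l (\<lambda>\<omega>. c * \<xi> \<omega>) \<omega> = c * gen_sum l \<xi> \<omega>"
  by (induction l arbitrary: \<omega>) (auto simp: sum_distrib_left)

lemma gen_sum_diff: "gen_sum l (\<lambda>\<omega>. \<xi> \<omega> - \<psi> \<omega>) \<omega> = gen_sum l \<xi> \<omega> - gen_sum l \<psi> \<omega>"
  by (induction l arbitrary: \<omega>) (auto simp: sum_subtractf)

lemma gen_sum_mono: "(\<And>\<omega>. \<xi> \<omega> \<le> \<psi> \<omega>) \<Longrightarrow> gen_sum l \<xi> \<omega> \<le> gen_sum l \<psi> \<omega>"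
  by (induction l arbitrary: \<omega>) (auto intro: sum_mono)

lemma gen_sum_nonneg: "(\<And>\<omega>. 0 \<le> \<xi> \<omega>) \<Longrightarrow> 0 \<le> gen_sum l \<xi> \<omega>"
  by (induction l arbitrary: \<omega>) (auto intro: sum_nonneg)

lemma gen_prod_exp: "gen_prod l (\<lambda>\<omega>. exp (- \<xi> \<omega>)) \<omega> = exp (- gen_sum l \<xi> \<omega>)"
  by (induction l arbitrary: \<omega>) (auto simp: exp_sum sum_negf[symmetric])

lemma gen_prod_bounds:
  assumes "\<And>\<omega>. 0 \<le> \<xi> \<omega>" "\<And>\<omega>. \<xi> \<omega> \<le> 1"
  shows "0 \<le> gen_prod l \<xi> \<omega>" "gen_prod l \<xi> \<omega> \<le> 1"
  using assms by (induction l arbitrary: \<omega>) (auto intro!: prod_nonneg prod_le_1)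

lemma gen_prod_mult: "gen_prod l (\<lambda>\<omega>. \<xi> \<omega> * \<psi> \<omega>) \<omega> = gen_prod l \<xi> \<omega> * gen_prod l \<psi> \<omega>"
  by (induction l arbitrary: \<omega>) (auto simp: prod.distrib)

lemma gen_prod_add: "gen_prod l (gen_prod k \<xi>) \<omega> = gen_prod (l + k) \<xi> \<omega>"
  by (induction l arbitrary: \<omega>) auto

text \<open>The probability that a potential child is connected to a parent with threshold x, averaged
  with weight \<open>\<phi>\<close> over the type of the child.\<close>

definition kappa :: "nat pmf \<Rightarrow> real \<Rightarrow> (nat \<times> real \<Rightarrow> real) \<Rightarrow> real" where
  "kappa Q x \<phi> = (\<integral>t. min x (snd t) / x * \<phi> t \<partial>type_law Q)"

text \<open>The conditional expectation of \<xi> given that the root has type t, in a version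
  defined for every t.\<close>

definition cexp :: "nat pmf \<Rightarrow> (marks \<Rightarrow> real) \<Rightarrow> nat \<times> real \<Rightarrow> real" where
  "cexp Q \<xi> t = (\<integral>b. \<xi> (graft t b) \<partial>env Q)"

text \<open>Lets the later pointwise bounds be required at positive thresholds only.\<close>

lemma AE_type_law_pos: "AE t in type_law R. 0 < snd t"
proof -
  have m[measurable]: "{t :: nat \<times> real. \<not> 0 < snd t} \<in> sets (count_space UNIV \<Otimes>\<^sub>M borel)"
    by (rule sets_Collect_UNIV) (auto simp: space_pair_measure)
  have *: "(\<integral>\<^sup>+v. ennreal (erlang_density n 1 v) * indicator {t. \<not> 0 < snd t} (n, v) \<partial>lborel) = 0" for n
  proof -
    have "AE v in lborel. ennreal (erlang_density n 1 v) * indicator {t. \<not> 0 < snd t} (n, v) = 0"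
      using AE_lborel_singleton[of "0::real"]
      by eventually_elim (simp add: erlang_density_def indicator_def)
    then have "(\<integral>\<^sup>+v. ennreal (erlang_density n 1 v) * indicator {t. \<not> 0 < snd t} (n, v) \<partial>lborel)
        = (\<integral>\<^sup>+v. 0 \<partial>(lborel :: real measure))"
      by (rule nn_integral_cong_AE)
    then show ?thesis by simp
  qed
  have "emeasure (type_law R) {t. \<not> 0 < snd t} = (\<integral>\<^sup>+t. indicator {t. \<not> 0 < snd t} t \<partial>type_law R)"
    by simp
  also have "\<dots> = 0"
    by (subst nn_integral_type_law_lborel) (simp_all add: *)
  finally show ?thesis
    by (subst AE_iff_measurable[OF _ refl]) auto
qed

lemma integral_uniform_upto_link:
  assumes x: "0 < x" and z: "0 < z"
  shows "(\<integral>y. of_bool (x * y < z) \<partial>uniform_upto 1) = min x z / x"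
proof -
  have "(\<lambda>y. of_bool (x * y < z) :: real) = indicator {y. x * y < z}"
    by (auto simp: indicator_def)
  then have "(\<integral>y. of_bool (x * y < z) \<partial>uniform_upto 1) = measure (uniform_upto 1) {y. x * y < z}"
    by simp
  also have "{y. x * y < z} = {..<z / x}"
    using x by (auto simp: field_simps)
  also have "measure (uniform_upto 1) {..<z / x} = measure lborel ({0..1} \<inter> {..<z / x})"
    by (simp add: uniform_upto_def measure_uniform_measure)
  also have "\<dots> = min x z / x"
  proof (cases "z \<le> x")
    case True
    then have "z / x \<le> 1" using x by simp
    then have "{0..1} \<inter> {..<z / x} = {0..<z / x}"
      by auto
    then show ?thesis using True x z by simp
  next
    case False
    then have "{0..1} \<inter> {..<z / x} = {0..1}"
      using x by (auto simp: field_simps intro: order_le_less_trans)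
    then show ?thesis using False x z by simp
  qed
  finally show ?thesis .
qed

text \<open>In the expanded square each off-diagonal pair contributes the squared mean by
  independence, and each diagonal term the second moment.\<close>

lemma (in prob_space)
  fixes Y :: "'a \<Rightarrow> real"
  assumes J: "finite (J :: 'i set)" and Y: "integrable M Y" and Y2: "integrable M (\<lambda>x. (Y x)\<^sup>2)"
  shows iid_sum: "integrable (\<Pi>\<^sub>M i\<in>UNIV. M) (\<lambda>\<omega>. \<Sum>j\<in>J. Y (\<omega> j))" (is ?A)
      "integrable (\<Pi>\<^sub>M i\<in>UNIV. M) (\<lambda>\<omega>. (\<Sum>j\<in>J. Y (\<omega> j))\<^sup>2)" (is ?B)
      "(\<integral>\<omega>. (\<Sum>j\<in>J. Y (\<omega> j)) \<partial>(\<Pi>\<^sub>M i\<in>UNIV. M)) = real (card J) * integral\<^sup>L M Y" (is ?C)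
      "(\<integral>\<omega>. (\<Sum>j\<in>J. Y (\<omega> j))\<^sup>2 \<partial>(\<Pi>\<^sub>M i\<in>UNIV. M))
         = real (card J) * (\<integral>x. (Y x)\<^sup>2 \<partial>M) + real (card J) * (real (card J) - 1) * (integral\<^sup>L M Y)\<^sup>2" (is ?D)
proof -
  let ?P = "\<Pi>\<^sub>M i\<in>UNIV :: 'i set. M"
  have one: "integrable ?P (\<lambda>\<omega>. Y (\<omega> j))" "(\<integral>\<omega>. Y (\<omega> j) \<partial>?P) = integral\<^sup>L M Y" for j
    using integrable_PiM_prod[of "{j}" "\<lambda>_. Y"] Y by auto
  have sq: "integrable ?P (\<lambda>\<omega>. (Y (\<omega> j))\<^sup>2)" "(\<integral>\<omega>. (Y (\<omega> j))\<^sup>2 \<partial>?P) = (\<integral>x. (Y x)\<^sup>2 \<partial>M)" for j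
    using integrable_PiM_prod[of "{j}" "\<lambda>_ x. (Y x)\<^sup>2"] Y2 by auto
  have two: "integrable ?P (\<lambda>\<omega>. Y (\<omega> i) * Y (\<omega> j))" "(\<integral>\<omega>. Y (\<omega> i) * Y (\<omega> j) \<partial>?P) = (integral\<^sup>L M Y)\<^sup>2"
    if "i \<noteq> j" for i j
    using integrable_PiM_prod[of "{i, j}" "\<lambda>_. Y"] Y that by (auto simp: power2_eq_square)
  have int2: "integrable ?P (\<lambda>\<omega>. Y (\<omega> i) * Y (\<omega> j))" for i j
    using two(1)[of i j] sq(1)[of i] by (cases "i = j") (auto simp: power2_eq_square)
  have val2: "(\<integral>\<omega>. Y (\<omega> i) * Y (\<omega> j) \<partial>?P) = (integral\<^sup>L M Y)\<^sup>2 + (if i = j then (\<integral>x. (Y x)\<^sup>2 \<partial>M) - (integral\<^sup>L M Y)\<^sup>2 else 0)" for i j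
    using two(2)[of i j] sq(2)[of i] by (cases "i = j") (auto simp: power2_eq_square)
  have expand: "(\<Sum>j\<in>J. Y (\<omega> j))\<^sup>2 = (\<Sum>i\<in>J. \<Sum>j\<in>J. Y (\<omega> i) * Y (\<omega> j))" for \<omega> :: "'i \<Rightarrow> 'a"
    by (simp add: power2_eq_square sum_product)
  show ?A ?B ?C
    unfolding expand using one int2 by (auto simp: integral_sum)
  have "(\<integral>\<omega>. (\<Sum>j\<in>J. Y (\<omega> j))\<^sup>2 \<partial>?P) = (\<Sum>i\<in>J. \<Sum>j\<in>J. (integral\<^sup>L M Y)\<^sup>2 + (if i = j then (\<integral>x. (Y x)\<^sup>2 \<partial>M) - (integral\<^sup>L M Y)\<^sup>2 else 0))"
    unfolding expand using int2 by (simp add: integral_sum val2)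
  also have "\<dots> = real (card J) * (real (card J) * (integral\<^sup>L M Y)\<^sup>2 + ((\<integral>x. (Y x)\<^sup>2 \<partial>M) - (integral\<^sup>L M Y)\<^sup>2))"
    using J by (simp add: sum.distrib algebra_simps)
  finally show ?D by (simp add: algebra_simps)
qed

locale branching =
  fixes Q :: "nat pmf"
begin

abbreviation "\<mu> \<equiv> type_law Q"
abbreviation "\<E> \<equiv> env Q"
abbreviation "\<T> \<equiv> tree_law Q Q"
abbreviation "child_law \<equiv> uniform_upto 1 \<Otimes>\<^sub>M tree_law Q Q"

sublocale mu: prob_space \<mu> by (rule prob_space_type_law)
sublocale en: prob_space \<E> by (rule prob_space_env)
sublocale tr: prob_space \<T> by (rule prob_space_tree_law)
sublocale un: prob_space "uniform_upto 1" by (rule prob_space_uniform_upto)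
sublocale ch: pair_prob_space "uniform_upto 1" \<T> ..

definition link :: "real \<Rightarrow> real \<times> marks \<Rightarrow> bool" where
  "link x c \<longleftrightarrow> x * fst c < threshold (snd c) []"

lemma measurable_link [measurable]: "Measurable.pred (borel \<Otimes>\<^sub>M marks_space) (link x)"
  unfolding link_def by measurable

lemma kept_graft:
  assumes "0 < x"
  shows "kept (graft (m, x) b) = {j \<in> {1..m}. link x (fst b j, snd b j)}"
  using assms by (auto simp: kept_def link_def max_def)

lemma
  assumes \<xi>: "integrable (tree_law R Q) \<xi>"
  shows integral_tree_law: "(\<integral>\<omega>. \<xi> \<omega> \<partial>tree_law R Q) = (\<integral>t. cexp Q \<xi> t \<partial>type_law R)"
    and integrable_cexp: "integrable (type_law R) (cexp Q \<xi>)"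
proof -
  interpret R: prob_space "type_law R" by (rule prob_space_type_law)
  interpret RE: pair_prob_space "type_law R" \<E> ..
  have m: "(\<lambda>(t, b). graft t b) \<in> measurable (type_law R \<Otimes>\<^sub>M \<E>) marks_space" by measurable
  have \<xi>m[measurable]: "\<xi> \<in> borel_measurable marks_space"
    using borel_measurable_integrable[OF \<xi>] by simp
  have 1: "integrable (type_law R \<Otimes>\<^sub>M \<E>) (\<lambda>(t, b). \<xi> (graft t b))"
    using \<xi> unfolding tree_law_eq_distr
    by (subst (asm) integrable_distr_eq[OF m \<xi>m]) (simp add: case_prod_beta')
  show "integrable (type_law R) (cexp Q \<xi>)"
    using RE.integrable_fst'[OF 1] by (simp add: cexp_def[abs_def])
  have "(\<integral>\<omega>. \<xi> \<omega> \<partial>tree_law R Q) = (\<integral>p. \<xi> (case p of (t, b) \<Rightarrow> graft t b) \<partial>(type_law R \<Otimes>\<^sub>M \<E>))"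
    unfolding tree_law_eq_distr by (rule integral_distr[OF m \<xi>m])
  also have "\<dots> = (\<integral>t. cexp Q \<xi> t \<partial>type_law R)"
    using RE.integral_fst'[OF 1] by (simp add: cexp_def case_prod_beta')
  finally show "(\<integral>\<omega>. \<xi> \<omega> \<partial>tree_law R Q) = (\<integral>t. cexp Q \<xi> t \<partial>type_law R)" .
qed

lemma AE_threshold_pos: "AE \<omega> in \<T>. 0 < threshold \<omega> []"
proof -
  have [measurable]: "{\<omega>. \<not> 0 < threshold \<omega> []} \<in> sets marks_space"
    by (rule sets_Collect_UNIV) auto
  have "emeasure \<T> {\<omega>. \<not> 0 < threshold \<omega> []} = (\<integral>\<^sup>+\<omega>. indicator {\<omega>. \<not> 0 < threshold \<omega> []} \<omega> \<partial>\<T>)"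
    by simp
  also have "\<dots> = (\<integral>\<^sup>+t. \<integral>\<^sup>+b. indicator {t. \<not> 0 < snd t} t \<partial>\<E> \<partial>\<mu>)"
    by (subst nn_integral_tree_law) (auto simp: indicator_def)
  also have "\<dots> = (\<integral>\<^sup>+t. 0 \<partial>\<mu>)"
  proof (intro nn_integral_cong_AE)
    show "AE t in \<mu>. (\<integral>\<^sup>+b. indicator {t. \<not> 0 < snd t} t \<partial>\<E>) = 0"
      using AE_type_law_pos[of Q] by eventually_elim (simp add: indicator_def)
  qed
  finally show ?thesis
    by (subst AE_iff_measurable[OF _ refl]) auto
qed

text \<open>Integrating out the relative cost leaves the probability \<open>min x z / x\<close> that
  the edge is kept, a function of the child's threshold z alone; conditioning on the type of the
  child then gives \<open>kappa\<close>.\<close>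

lemma
  assumes x: "0 < x" and \<xi>: "integrable \<T> \<xi>"
  shows integrable_child: "integrable child_law (\<lambda>c. of_bool (link x c) * \<xi> (snd c))"
    and integral_child: "(\<integral>c. of_bool (link x c) * \<xi> (snd c) \<partial>child_law) = kappa Q x (cexp Q \<xi>)"
proof -
  have \<xi>m[measurable]: "\<xi> \<in> borel_measurable marks_space"
    using borel_measurable_integrable[OF \<xi>] by simp
  have snd: "integrable child_law (\<lambda>c. \<xi> (snd c))"
  proof (rule ch.integrable_product_swap_iff[THEN iffD1])
    have "integrable (distr (\<T> \<Otimes>\<^sub>M uniform_upto 1) \<T> fst) \<xi>"
      using \<xi> by (simp only: un.distr_pair_fst)
    then show "integrable (\<T> \<Otimes>\<^sub>M uniform_upto 1) (\<lambda>(x, y). \<xi> (snd (y, x)))"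
      by (subst (asm) integrable_distr_eq) (auto simp: case_prod_beta')
  qed
  show 1: "integrable child_law (\<lambda>c. of_bool (link x c) * \<xi> (snd c))"
    by (rule Bochner_Integration.integrable_bound[OF snd]) (auto simp: of_bool_def)
  let ?\<xi>' = "\<lambda>\<omega>. min x (threshold \<omega> []) / x * \<xi> \<omega>"
  have AE: "AE \<omega> in \<T>. (\<integral>y. of_bool (link x (y, \<omega>)) * \<xi> \<omega> \<partial>uniform_upto 1) = ?\<xi>' \<omega>"
    using AE_threshold_pos
    by eventually_elim (auto simp: link_def integral_uniform_upto_link[OF x])
  have \<xi>': "integrable \<T> ?\<xi>'"
  proof (rule Bochner_Integration.integrable_bound[OF \<xi>])
    show "AE \<omega> in \<T>. norm (?\<xi>' \<omega>) \<le> norm (\<xi> \<omega>)"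
      using AE_threshold_pos
    proof eventually_elim
      case (elim \<omega>)
      then have le: "\<bar>min x (threshold \<omega> []) / x\<bar> \<le> 1"
        using x by (auto simp: abs_le_iff field_simps)
      show ?case
        using mult_right_mono[OF le, of "\<bar>\<xi> \<omega>\<bar>"] by (simp only: real_norm_def abs_mult) simp
    qed
  qed simp
  have "(\<integral>c. of_bool (link x c) * \<xi> (snd c) \<partial>child_law)
      = (\<integral>\<omega>. \<integral>y. of_bool (link x (y, \<omega>)) * \<xi> \<omega> \<partial>uniform_upto 1 \<partial>\<T>)"
    using ch.integral_snd[of "\<lambda>y \<omega>. of_bool (link x (y, \<omega>)) * \<xi> \<omega>"] 1
    by (simp add: case_prod_beta')
  also have "\<dots> = (\<integral>\<omega>. ?\<xi>' \<omega> \<partial>\<T>)"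
    using AE by (intro integral_cong_AE) auto
  also have "\<dots> = (\<integral>t. cexp Q ?\<xi>' t \<partial>\<mu>)"
    by (rule integral_tree_law[OF \<xi>'])
  also have "\<dots> = kappa Q x (cexp Q \<xi>)"
    unfolding kappa_def cexp_def by simp
  finally show "(\<integral>c. of_bool (link x c) * \<xi> (snd c) \<partial>child_law) = kappa Q x (cexp Q \<xi>)" .
qed

lemma measurable_zip_env [measurable]:
  "(\<lambda>b j. (fst b j, snd b j)) \<in> measurable \<E> (\<Pi>\<^sub>M j\<in>UNIV. child_law)"
proof -
  have "(\<lambda>(a, b) j. (a j, b j)) \<in> measurable ((\<Pi>\<^sub>M j\<in>UNIV. borel) \<Otimes>\<^sub>M (\<Pi>\<^sub>M j\<in>UNIV. marks_space))
     (\<Pi>\<^sub>M j\<in>UNIV :: nat set. borel \<Otimes>\<^sub>M marks_space)"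
    by (rule measurable_zip_PiM)
  moreover have "sets (\<Pi>\<^sub>M j\<in>UNIV :: nat set. child_law) = sets (\<Pi>\<^sub>M j\<in>UNIV. borel \<Otimes>\<^sub>M marks_space)"
    by (intro sets_PiM_cong sets_pair_measure_cong) auto
  ultimately show ?thesis by (simp add: case_prod_beta' cong: measurable_cong_sets)
qed

lemma
  fixes F :: "(nat \<Rightarrow> real \<times> marks) \<Rightarrow> real"
  assumes F: "integrable (\<Pi>\<^sub>M j\<in>UNIV. child_law) F"
  shows integrable_env_zip: "integrable \<E> (\<lambda>b. F (\<lambda>j. (fst b j, snd b j)))"
    and integral_env_zip: "(\<integral>b. F (\<lambda>j. (fst b j, snd b j)) \<partial>\<E>) = integral\<^sup>L (\<Pi>\<^sub>M j\<in>UNIV. child_law) F"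
proof -
  have d: "distr \<E> (\<Pi>\<^sub>M j\<in>UNIV. child_law) (\<lambda>b j. (fst b j, snd b j)) = (\<Pi>\<^sub>M j\<in>UNIV. child_law)"
    using distr_env_zip[of Q] by (simp add: case_prod_beta')
  note Fm = borel_measurable_integrable[OF F]
  show "integrable \<E> (\<lambda>b. F (\<lambda>j. (fst b j, snd b j)))"
    using integrable_distr_eq[OF measurable_zip_env Fm] F unfolding d by simp
  show "(\<integral>b. F (\<lambda>j. (fst b j, snd b j)) \<partial>\<E>) = integral\<^sup>L (\<Pi>\<^sub>M j\<in>UNIV. child_law) F"
    using integral_distr[OF measurable_zip_env Fm] unfolding d by simp
qed

lemma gen_sum_1_graft:
  assumes "0 < x"
  shows "gen_sum 1 \<xi> (graft (m, x) b)
    = (\<Sum>j\<in>{1..m}. of_bool (link x (fst b j, snd b j)) * \<xi> (snd (fst b j, snd b j)))"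
  unfolding One_nat_def gen_sum.simps kept_graft[OF assms] subtree_graft
  by (intro sum.mono_neutral_cong_left) auto

lemma gen_prod_1_graft:
  assumes "0 < x"
  shows "gen_prod 1 \<xi> (graft (m, x) b)
    = (\<Prod>j\<in>{1..m}. 1 - of_bool (link x (fst b j, snd b j)) * (1 - \<xi> (snd (fst b j, snd b j))))"
  unfolding One_nat_def gen_prod.simps kept_graft[OF assms] subtree_graft
  by (intro prod.mono_neutral_cong_left) auto

lemma integrable_tree_bounded:
  assumes [measurable]: "\<gamma> \<in> borel_measurable marks_space" and "\<And>\<omega>. \<bar>\<gamma> \<omega>\<bar> \<le> (c :: real)"
  shows "integrable (tree_law R Q) \<gamma>"
proof -
  interpret R: prob_space "tree_law R Q" by (rule prob_space_tree_law)
  show ?thesis using assms by (intro R.integrable_const_bound[where B=c]) auto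
qed

lemma integrable_env_bounded:
  assumes [measurable]: "\<gamma> \<in> borel_measurable marks_space" and "\<And>\<omega>. \<bar>\<gamma> \<omega>\<bar> \<le> (c :: real)"
  shows "integrable \<E> (\<lambda>b. \<gamma> (graft t b))"
  using assms by (intro en.integrable_const_bound[where B=c]) auto

text \<open>Each of the m potential children contributes the factor 1 if its edge is dropped and
  \<gamma> of its subtree otherwise. These factors are i.i.d., so the expectation is an m-th
  power.\<close>

lemma cexp_gen_prod_1:
  assumes x: "0 < x" and [measurable]: "\<gamma> \<in> borel_measurable marks_space"
    and \<gamma>: "\<And>\<omega>. 0 \<le> \<gamma> \<omega>" "\<And>\<omega>. \<gamma> \<omega> \<le> 1"
  shows "cexp Q (gen_prod 1 \<gamma>) (m, x) = (1 - kappa Q x (\<lambda>t. 1 - cexp Q \<gamma> t)) ^ m"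
proof -
  let ?Y = "\<lambda>c. 1 - of_bool (link x c) * (1 - \<gamma> (snd c))"
  have \<gamma>1: "integrable \<T> (\<lambda>\<omega>. 1 - \<gamma> \<omega>)"
    by (rule integrable_tree_bounded[where c=1]) (use \<gamma> in auto)
  note ic = integrable_child[OF x \<gamma>1] integral_child[OF x \<gamma>1]
  have Y: "integrable child_law ?Y"
    using ic(1) by (intro Bochner_Integration.integrable_diff) auto
  have "cexp Q (\<lambda>\<omega>. 1 - \<gamma> \<omega>) = (\<lambda>t. 1 - cexp Q \<gamma> t)"
  proof
    fix t show "cexp Q (\<lambda>\<omega>. 1 - \<gamma> \<omega>) t = 1 - cexp Q \<gamma> t"
    unfolding cexp_def using integrable_env_bounded[of \<gamma> 1] \<gamma>
    by (subst Bochner_Integration.integral_diff) (auto simp: en.prob_space[simplified])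
  qed
  then have YI: "integral\<^sup>L child_law ?Y = 1 - kappa Q x (\<lambda>t. 1 - cexp Q \<gamma> t)"
    using ic by (subst Bochner_Integration.integral_diff) (auto simp: ch.P.prob_space)
  have "cexp Q (gen_prod 1 \<gamma>) (m, x) = (\<integral>b. (\<Prod>j\<in>{1..m}. ?Y (fst b j, snd b j)) \<partial>\<E>)"
    unfolding cexp_def gen_prod_1_graft[OF x] ..
  also have "\<dots> = (\<integral>c. (\<Prod>j\<in>{1..m}. ?Y (c j)) \<partial>(\<Pi>\<^sub>M j\<in>UNIV. child_law))"
    using integral_env_zip[OF ch.P.integrable_PiM_prod(1)[of "{1..m}" "\<lambda>_. ?Y"]] Y by simp
  also have "\<dots> = (\<Prod>j\<in>{1..m}. integral\<^sup>L child_law ?Y)"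
    by (rule ch.P.integrable_PiM_prod(2)) (use Y in auto)
  finally show ?thesis using YI by simp
qed

text \<open>Given its type, the root sums over m i.i.d. potential children, of which the dropped
  ones count 0. The square of an indicator is the indicator itself, so second moments are again
  expressed by \<open>kappa\<close>.\<close>

lemma
  assumes x: "0 < x" and [measurable]: "\<xi> \<in> borel_measurable marks_space"
    and \<xi>2: "integrable \<T> (\<lambda>\<omega>. (\<xi> \<omega>)\<^sup>2)"
  shows cexp_gen_sum_1: "cexp Q (gen_sum 1 \<xi>) (m, x) = real m * kappa Q x (cexp Q \<xi>)"
    and integrable_gen_sum_1: "integrable \<E> (\<lambda>b. gen_sum 1 \<xi> (graft (m, x) b))"
    and integrable_gen_sum_1_sq: "integrable \<E> (\<lambda>b. (gen_sum 1 \<xi> (graft (m, x) b))\<^sup>2)"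
    and cexp_gen_sum_1_sq: "cexp Q (\<lambda>\<omega>. (gen_sum 1 \<xi> \<omega>)\<^sup>2) (m, x)
      = real m * kappa Q x (cexp Q (\<lambda>\<omega>. (\<xi> \<omega>)\<^sup>2)) + real m * (real m - 1) * (kappa Q x (cexp Q \<xi>))\<^sup>2"
proof -
  have \<xi>1: "integrable \<T> \<xi>"
    by (rule tr.square_integrable_imp_integrable[OF _ \<xi>2]) simp
  define Y where "Y = (\<lambda>c. of_bool (link x c) * \<xi> (snd c))"
  have Y: "integrable child_law Y" and YI: "integral\<^sup>L child_law Y = kappa Q x (cexp Q \<xi>)"
    unfolding Y_def by (rule integrable_child[OF x \<xi>1], rule integral_child[OF x \<xi>1])
  have Y2: "(\<lambda>c. (Y c)\<^sup>2) = (\<lambda>c. of_bool (link x c) * (\<xi> (snd c))\<^sup>2)"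
    by (auto simp: Y_def of_bool_def power_mult_distrib)
  have Y2i: "integrable child_law (\<lambda>c. (Y c)\<^sup>2)" and Y2I: "(\<integral>c. (Y c)\<^sup>2 \<partial>child_law) = kappa Q x (cexp Q (\<lambda>\<omega>. (\<xi> \<omega>)\<^sup>2))"
    unfolding Y2 by (rule integrable_child[OF x \<xi>2], rule integral_child[OF x \<xi>2])
  have fin: "finite {1..m}" by simp
  note iid = ch.P.iid_sum[OF fin Y Y2i]
  have eq: "gen_sum 1 \<xi> (graft (m, x) b) = (\<Sum>j\<in>{1..m}. Y (fst b j, snd b j))" for b
    unfolding Y_def by (rule gen_sum_1_graft[OF x])
  note i1 = integrable_env_zip[OF iid(1)] integral_env_zip[OF iid(1), unfolded iid(3)]
  note i2 = integrable_env_zip[OF iid(2)] integral_env_zip[OF iid(2), unfolded iid(4)]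
  show "integrable \<E> (\<lambda>b. gen_sum 1 \<xi> (graft (m, x) b))"
    unfolding eq by (rule i1(1))
  show "integrable \<E> (\<lambda>b. (gen_sum 1 \<xi> (graft (m, x) b))\<^sup>2)"
    unfolding eq by (rule i2(1))
  have "cexp Q (gen_sum 1 \<xi>) (m, x) = real (card {1..m}) * integral\<^sup>L child_law Y"
    unfolding cexp_def eq by (rule i1(2))
  then show "cexp Q (gen_sum 1 \<xi>) (m, x) = real m * kappa Q x (cexp Q \<xi>)"
    unfolding YI by simp
  have "cexp Q (\<lambda>\<omega>. (gen_sum 1 \<xi> \<omega>)\<^sup>2) (m, x)
    = real (card {1..m}) * (\<integral>c. (Y c)\<^sup>2 \<partial>child_law) + real (card {1..m}) * (real (card {1..m}) - 1) * (integral\<^sup>L child_law Y)\<^sup>2"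
    unfolding cexp_def eq by (rule i2(2))
  then show "cexp Q (\<lambda>\<omega>. (gen_sum 1 \<xi> \<omega>)\<^sup>2) (m, x)
      = real m * kappa Q x (cexp Q (\<lambda>\<omega>. (\<xi> \<omega>)\<^sup>2)) + real m * (real m - 1) * (kappa Q x (cexp Q \<xi>))\<^sup>2"
    unfolding YI Y2I by simp
qed

end

section \<open>First and second moments\<close>

lemma measurable_cexp [measurable]:
  assumes [measurable]: "\<xi> \<in> borel_measurable marks_space"
  shows "cexp Q \<xi> \<in> borel_measurable (count_space UNIV \<Otimes>\<^sub>M borel)"
proof -
  interpret en: prob_space "env Q" by (rule prob_space_env)
  show ?thesis unfolding cexp_def[abs_def] by measurable
qed

text \<open>The analytic input of the branching argument, kept apart from its construction.
  \<open>f\<close> is the function called U in the overview and \<open>eigen\<close> is its integral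
  equation, written with the type law of a child. The two-sided comparison with
  \<open>min x 1\<close> takes the place of compactness of the mean operator.\<close>

locale spectral_branching = branching +
  fixes f :: "real \<Rightarrow> real" and \<beta> c1 c2 :: real
  assumes f_meas [measurable]: "f \<in> borel_measurable borel"
    and beta_gt_1: "1 < \<beta>"
    and c1_pos: "0 < c1"
    and f_ge: "\<And>x. 0 < x \<Longrightarrow> c1 * min x 1 \<le> f x"
    and f_le: "\<And>x. 0 < x \<Longrightarrow> f x \<le> c2 * min x 1"
    and eigen: "\<And>x. 0 < x \<Longrightarrow> (\<integral>t. min x (snd t) * (real (fst t) * f (snd t) / snd t) \<partial>\<mu>) = \<beta> * f x"
    and moment: "integrable \<mu> (\<lambda>t. (1 + real (fst t))\<^sup>2 * (1 + \<bar>snd t\<bar>))"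
begin

definition h :: "nat \<times> real \<Rightarrow> real" where
  "h t = real (fst t) * f (snd t) / snd t"

definition mean_op :: "(nat \<times> real \<Rightarrow> real) \<Rightarrow> nat \<times> real \<Rightarrow> real" where
  "mean_op \<phi> t = real (fst t) * kappa Q (snd t) \<phi>"

text \<open>Arises from \<open>min x z <= min x 1 * (1 + z)\<close>: a function bounded by C times
  \<open>(1 + m)\<^sup>2\<close>, integrated against \<open>min x z\<close>, gives at most
  \<open>C * K0 * min x 1\<close>.\<close>

definition K0 :: real where
  "K0 = (\<integral>t. (1 + real (fst t))\<^sup>2 * (1 + \<bar>snd t\<bar>) \<partial>\<mu>)"

lemma h_meas [measurable]: "h \<in> borel_measurable (count_space UNIV \<Otimes>\<^sub>M borel)"
  unfolding h_def[abs_def] by measurable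

lemma f_pos: "0 < x \<Longrightarrow> 0 < f x"
  using f_ge[of x] c1_pos by (smt (verit) min_less_iff_conj mult_pos_pos)

lemma c2_pos: "0 < c2"
  using f_pos[of 1] f_le[of 1] by simp

lemma h_nonneg: "0 < snd t \<Longrightarrow> 0 \<le> h t"
  using f_pos[of "snd t"] by (simp add: h_def)

lemma h_le: "0 < snd t \<Longrightarrow> h t \<le> c2 * real (fst t)"
proof -
  assume x: "0 < snd t"
  have "f (snd t) \<le> c2 * snd t"
    using f_le[OF x] c2_pos by (smt (verit) mult_left_mono)
  then have "f (snd t) / snd t \<le> c2" using x by (simp add: field_simps)
  then have "f (snd t) / snd t * real (fst t) \<le> c2 * real (fst t)"
    by (rule mult_right_mono) simp
  then show ?thesis by (simp add: h_def mult.commute)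
qed

lemma K0_ge_1: "1 \<le> K0"
proof -
  have "(\<integral>t. 1 \<partial>\<mu>) \<le> K0"
    unfolding K0_def using moment
  proof (rule integral_mono[rotated])
    fix t :: "nat \<times> real"
    have "1 * 1 \<le> (1 + real (fst t))\<^sup>2 * (1 + \<bar>snd t\<bar>)"
      by (intro mult_mono) (auto simp: power2_eq_square algebra_simps)
    then show "1 \<le> (1 + real (fst t))\<^sup>2 * (1 + \<bar>snd t\<bar>)" by simp
  qed simp
  then show ?thesis by (simp add: mu.prob_space[simplified])
qed

text \<open>The growth allowed is that of the square of h. Values at nonpositive thresholds are
  unrestricted because they carry no mass.\<close>

definition quad :: "real \<Rightarrow> (nat \<times> real \<Rightarrow> real) \<Rightarrow> bool" where
  "quad C \<phi> \<longleftrightarrow> \<phi> \<in> borel_measurable (count_space UNIV \<Otimes>\<^sub>M borel) \<and> 0 \<le> C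
     \<and> (\<forall>t. 0 < snd t \<longrightarrow> \<bar>\<phi> t\<bar> \<le> C * (1 + real (fst t))\<^sup>2)"

lemma quad_integrable:
  assumes q: "quad C \<phi>"
  shows "integrable \<mu> \<phi>" and "integrable \<mu> (\<lambda>t. min x (snd t) * \<phi> t)"
    and "0 < x \<Longrightarrow> \<bar>\<integral>t. min x (snd t) * \<phi> t \<partial>\<mu>\<bar> \<le> C * K0 * min x 1"
    and "(\<integral>t. \<bar>\<phi> t\<bar> \<partial>\<mu>) \<le> C * K0"
proof -
  have m[measurable]: "\<phi> \<in> borel_measurable (count_space UNIV \<Otimes>\<^sub>M borel)" and C: "0 \<le> C"
    and b: "\<And>t. 0 < snd t \<Longrightarrow> \<bar>\<phi> t\<bar> \<le> C * (1 + real (fst t))\<^sup>2"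
    using q by (auto simp: quad_def)
  let ?g = "\<lambda>t. C * ((1 + real (fst t))\<^sup>2 * (1 + \<bar>snd t\<bar>))"
  have gi: "integrable \<mu> ?g" using moment by simp
  have b2: "\<bar>y * \<phi> t\<bar> \<le> k * ?g t" if "0 < snd t" "0 \<le> k" "\<bar>y\<bar> \<le> k * (1 + \<bar>snd t\<bar>)" for t k y
  proof -
    have "\<bar>y * \<phi> t\<bar> \<le> k * (1 + \<bar>snd t\<bar>) * (C * (1 + real (fst t))\<^sup>2)"
      unfolding abs_mult using that b[OF that(1)] C by (intro mult_mono) auto
    then show ?thesis by (simp add: mult_ac)
  qed
  show i1: "integrable \<mu> \<phi>"
  proof (rule Bochner_Integration.integrable_bound[OF gi])
    show "AE t in \<mu>. norm (\<phi> t) \<le> norm (?g t)"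
      using AE_type_law_pos[of Q]
    proof eventually_elim
      case (elim t)
      then show ?case using b2[of t 1 1] C by auto
    qed
  qed simp
  show i2: "integrable \<mu> (\<lambda>t. min x (snd t) * \<phi> t)" for x
  proof (rule Bochner_Integration.integrable_bound[of _ "\<lambda>t. (\<bar>x\<bar> + 1) * ?g t"])
    show "AE t in \<mu>. norm (min x (snd t) * \<phi> t) \<le> norm ((\<bar>x\<bar> + 1) * ?g t)"
      using AE_type_law_pos[of Q]
    proof eventually_elim
      case (elim t)
      have "\<bar>min x (snd t)\<bar> \<le> (\<bar>x\<bar> + 1) * (1 + \<bar>snd t\<bar>)"
      proof -
        have "\<bar>min x (snd t)\<bar> \<le> \<bar>x\<bar> + \<bar>snd t\<bar>" by (auto simp: min_def)
        moreover have "0 \<le> \<bar>x\<bar> * \<bar>snd t\<bar>" by simp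
        ultimately show ?thesis unfolding ring_distribs by linarith
      qed
      with elim show ?case using b2[of t "\<bar>x\<bar> + 1" "min x (snd t)"] C by auto
    qed
  qed (use gi in simp_all)
  show "\<bar>\<integral>t. min x (snd t) * \<phi> t \<partial>\<mu>\<bar> \<le> C * K0 * min x 1" if x: "0 < x"
  proof -
    have "\<bar>\<integral>t. min x (snd t) * \<phi> t \<partial>\<mu>\<bar> \<le> (\<integral>t. \<bar>min x (snd t) * \<phi> t\<bar> \<partial>\<mu>)"
      by (rule integral_abs_bound)
    also have "\<dots> \<le> (\<integral>t. min x 1 * ?g t \<partial>\<mu>)"
    proof (rule integral_mono_AE)
      show "AE t in \<mu>. \<bar>min x (snd t) * \<phi> t\<bar> \<le> min x 1 * ?g t"
        using AE_type_law_pos[of Q]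
      proof eventually_elim
        case (elim t)
        have "min x (snd t) \<le> min x 1 * (1 + snd t)"
        proof (cases "x \<le> 1")
          case True
          have "0 \<le> x * snd t" using elim x by simp
          then have "x \<le> x * (1 + snd t)" by (simp only: ring_distribs)
          then show ?thesis using True by auto
        qed (use elim in auto)
        with elim x show ?case by (intro b2) auto
      qed
    qed (use i2 gi in auto)
    also have "\<dots> = C * K0 * min x 1"
      by (simp add: K0_def)
    finally show ?thesis .
  qed
  have "(\<integral>t. \<bar>\<phi> t\<bar> \<partial>\<mu>) \<le> (\<integral>t. ?g t \<partial>\<mu>)"
  proof (rule integral_mono_AE)
    show "AE t in \<mu>. \<bar>\<phi> t\<bar> \<le> ?g t"
      using AE_type_law_pos[of Q]
    proof eventually_elim
      case (elim t)
      then show ?case using b2[of t 1 1] by auto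
    qed
  qed (use i1 gi in auto)
  then show "(\<integral>t. \<bar>\<phi> t\<bar> \<partial>\<mu>) \<le> C * K0" by (simp add: K0_def)
qed

lemma kappa_eq: "kappa Q x \<phi> = (\<integral>t. min x (snd t) * \<phi> t \<partial>\<mu>) / x"
  unfolding kappa_def by (simp flip: integral_divide_zero)

text \<open>The integral is at most \<open>C * K0 * min x 1\<close>, and
  \<open>min x 1 <= f x / c1\<close> turns this into a bound by h. A single application of the mean
  operator thus brings every admissible function below a multiple of the eigenfunction.\<close>

lemma mean_op_quad:
  assumes "quad C \<phi>" "0 < snd t"
  shows "\<bar>mean_op \<phi> t\<bar> \<le> C * K0 / c1 * h t"
proof -
  let ?x = "snd t"
  have C: "0 \<le> C" using assms by (simp add: quad_def)
  have "\<bar>\<integral>s. min ?x (snd s) * \<phi> s \<partial>\<mu>\<bar> \<le> C * K0 * min ?x 1"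
    by (rule quad_integrable(3)[OF assms])
  also have "\<dots> = C * K0 / c1 * (c1 * min ?x 1)" using c1_pos by simp
  also have "\<dots> \<le> C * K0 / c1 * f ?x"
    using f_ge[OF assms(2)] C K0_ge_1 c1_pos by (intro mult_left_mono) auto
  finally have "real (fst t) / ?x * \<bar>\<integral>s. min ?x (snd s) * \<phi> s \<partial>\<mu>\<bar> \<le> real (fst t) / ?x * (C * K0 / c1 * f ?x)"
    using assms(2) by (intro mult_left_mono) auto
  then show ?thesis
    using assms(2) by (simp add: mean_op_def kappa_eq h_def abs_mult mult_ac)
qed

lemma quad_h: "quad c2 h"
  unfolding quad_def
proof (intro conjI allI impI)
  fix t :: "nat \<times> real" assume t: "0 < snd t"
  have "real (fst t) \<le> (1 + real (fst t))\<^sup>2" by (simp add: power2_eq_square algebra_simps)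
  then have "c2 * real (fst t) \<le> c2 * (1 + real (fst t))\<^sup>2"
    using c2_pos by (intro mult_left_mono) auto
  then show "\<bar>h t\<bar> \<le> c2 * (1 + real (fst t))\<^sup>2"
    using h_le[OF t] h_nonneg[OF t] by linarith
qed (use c2_pos in auto)

lemma quad_h2: "quad (c2\<^sup>2) (\<lambda>t. (h t)\<^sup>2)"
  unfolding quad_def
proof (intro conjI allI impI)
  fix t :: "nat \<times> real" assume t: "0 < snd t"
  have "(h t)\<^sup>2 \<le> (c2 * (1 + real (fst t)))\<^sup>2"
    using h_le[OF t] h_nonneg[OF t] c2_pos by (intro power_mono) (auto simp: algebra_simps)
  then show "\<bar>(h t)\<^sup>2\<bar> \<le> c2\<^sup>2 * (1 + real (fst t))\<^sup>2" by (simp add: power_mult_distrib)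
qed auto

lemma mean_op_h: "0 < snd t \<Longrightarrow> mean_op h t = \<beta> * h t"
  using eigen[of "snd t"] by (simp add: mean_op_def kappa_eq h_def)

lemma quad_mono_fun:
  assumes "quad C \<phi>" "\<psi> \<in> borel_measurable (count_space UNIV \<Otimes>\<^sub>M borel)" "\<And>t. 0 < snd t \<Longrightarrow> \<bar>\<psi> t\<bar> \<le> \<bar>\<phi> t\<bar>"
  shows "quad C \<psi>"
  using assms unfolding quad_def by (meson order_trans)

lemma quad_add: "quad C \<phi> \<Longrightarrow> quad C' \<psi> \<Longrightarrow> quad (C + C') (\<lambda>t. \<phi> t + \<psi> t)"
  unfolding quad_def by (auto simp: algebra_simps intro!: order_trans[OF abs_triangle_ineq] add_mono)

lemma quad_cmult: "quad C \<phi> \<Longrightarrow> quad (\<bar>c\<bar> * C) (\<lambda>t. c * \<phi> t)"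
  unfolding quad_def by (auto simp: abs_mult mult.assoc intro!: mult_left_mono)

lemma quad_const: "quad \<bar>c\<bar> (\<lambda>t. c)"
  unfolding quad_def
proof (intro conjI allI impI)
  fix t :: "nat \<times> real"
  have "\<bar>c\<bar> * 1 \<le> \<bar>c\<bar> * (1 + real (fst t))\<^sup>2"
    by (intro mult_left_mono) (auto simp: power2_eq_square algebra_simps)
  then show "\<bar>c\<bar> \<le> \<bar>c\<bar> * (1 + real (fst t))\<^sup>2" by simp
qed auto

lemma mean_op_mono:
  assumes \<phi>: "quad C \<phi>" and \<psi>: "quad C' \<psi>" and le: "\<And>s. 0 < snd s \<Longrightarrow> \<phi> s \<le> \<psi> s" and t: "0 < snd t"
  shows "mean_op \<phi> t \<le> mean_op \<psi> t"
proof -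
  have "(\<integral>s. min (snd t) (snd s) * \<phi> s \<partial>\<mu>) \<le> (\<integral>s. min (snd t) (snd s) * \<psi> s \<partial>\<mu>)"
  proof (rule integral_mono_AE)
    show "AE s in \<mu>. min (snd t) (snd s) * \<phi> s \<le> min (snd t) (snd s) * \<psi> s"
      using AE_type_law_pos[of Q] by eventually_elim (use t le in \<open>auto intro!: mult_left_mono\<close>)
  qed (use quad_integrable(2)[OF \<phi>] quad_integrable(2)[OF \<psi>] in auto)
  then show ?thesis
    using t by (simp add: mean_op_def kappa_eq divide_right_mono mult_left_mono)
qed

lemma mean_op_add:
  assumes \<phi>: "quad C \<phi>" and \<psi>: "quad C' \<psi>"
  shows "mean_op (\<lambda>s. \<phi> s + \<psi> s) t = mean_op \<phi> t + mean_op \<psi> t"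
  using quad_integrable(2)[OF \<phi>] quad_integrable(2)[OF \<psi>]
  by (simp add: mean_op_def kappa_eq ring_distribs add_divide_distrib)

lemma mean_op_cmult: "mean_op (\<lambda>s. c * \<phi> s) t = c * mean_op \<phi> t"
proof -
  have "(\<lambda>s. min (snd t) (snd s) * (c * \<phi> s)) = (\<lambda>s. c * (min (snd t) (snd s) * \<phi> s))"
    by (auto simp: mult_ac)
  then show ?thesis by (simp add: mean_op_def kappa_eq)
qed

text \<open>Integrability is demanded at each type with positive threshold because the Bochner
  integral of a non-integrable function is 0, which would make the bound on \<open>cexp\<close>
  void.\<close>

definition sq_bounded :: "(marks \<Rightarrow> real) \<Rightarrow> bool" where
  "sq_bounded \<xi> \<longleftrightarrow> \<xi> \<in> borel_measurable marks_space \<and>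
     (\<forall>t. 0 < snd t \<longrightarrow> integrable \<E> (\<lambda>b. (\<xi> (graft t b))\<^sup>2)) \<and>
     (\<exists>C. quad C (cexp Q (\<lambda>\<omega>. (\<xi> \<omega>)\<^sup>2)))"

lemma sq_bounded_measurable: "sq_bounded \<xi> \<Longrightarrow> \<xi> \<in> borel_measurable marks_space"
  by (simp add: sq_bounded_def)

lemma sq_bounded_integrable_graft:
  assumes \<xi>: "sq_bounded \<xi>" and t: "0 < snd t"
  shows "integrable \<E> (\<lambda>b. (\<xi> (graft t b))\<^sup>2)" "integrable \<E> (\<lambda>b. \<xi> (graft t b))"
proof -
  show 1: "integrable \<E> (\<lambda>b. (\<xi> (graft t b))\<^sup>2)" using assms unfolding sq_bounded_def by blast
  have [measurable]: "\<xi> \<in> borel_measurable marks_space" using \<xi> by (rule sq_bounded_measurable)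
  show "integrable \<E> (\<lambda>b. \<xi> (graft t b))"
    by (rule en.square_integrable_imp_integrable[OF _ 1]) simp
qed

lemma sq_bounded_integrable:
  assumes "sq_bounded \<xi>"
  shows "integrable \<T> (\<lambda>\<omega>. (\<xi> \<omega>)\<^sup>2)"
proof -
  have [measurable]: "\<xi> \<in> borel_measurable marks_space" using assms by (rule sq_bounded_measurable)
  obtain C where C: "quad C (cexp Q (\<lambda>\<omega>. (\<xi> \<omega>)\<^sup>2))" using assms by (auto simp: sq_bounded_def)
  have "(\<integral>\<^sup>+\<omega>. ennreal (norm ((\<xi> \<omega>)\<^sup>2)) \<partial>\<T>) = (\<integral>\<^sup>+t. \<integral>\<^sup>+b. ennreal ((\<xi> (graft t b))\<^sup>2) \<partial>\<E> \<partial>\<mu>)"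
    by (subst nn_integral_tree_law) auto
  also have "\<dots> = (\<integral>\<^sup>+t. ennreal (cexp Q (\<lambda>\<omega>. (\<xi> \<omega>)\<^sup>2) t) \<partial>\<mu>)"
  proof (rule nn_integral_cong_AE)
    show "AE t in \<mu>. (\<integral>\<^sup>+b. ennreal ((\<xi> (graft t b))\<^sup>2) \<partial>\<E>) = ennreal (cexp Q (\<lambda>\<omega>. (\<xi> \<omega>)\<^sup>2) t)"
      using AE_type_law_pos[of Q]
    proof eventually_elim
      case (elim t)
      then show ?case
        unfolding cexp_def using sq_bounded_integrable_graft(1)[OF assms]
        by (intro nn_integral_eq_integral) auto
    qed
  qed
  also have "\<dots> \<le> (\<integral>\<^sup>+t. ennreal (norm (cexp Q (\<lambda>\<omega>. (\<xi> \<omega>)\<^sup>2) t)) \<partial>\<mu>)"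
    by (intro nn_integral_mono ennreal_leI) auto
  also have "\<dots> < \<infinity>"
    using quad_integrable(1)[OF C] by (simp add: integrable_iff_bounded)
  finally show ?thesis by (intro integrableI_bounded) auto
qed

lemma cexp_square_le:
  assumes "sq_bounded \<xi>" "0 < snd t"
  shows "(cexp Q \<xi> t)\<^sup>2 \<le> cexp Q (\<lambda>\<omega>. (\<xi> \<omega>)\<^sup>2) t"
proof -
  note i = sq_bounded_integrable_graft[OF assms]
  have "0 \<le> (\<integral>b. (\<xi> (graft t b) - cexp Q \<xi> t)\<^sup>2 \<partial>\<E>)" by simp
  also have "\<dots> = (\<integral>b. (\<xi> (graft t b))\<^sup>2 \<partial>\<E>) - (\<integral>b. \<xi> (graft t b) \<partial>\<E>)\<^sup>2"
    unfolding cexp_def using i by (intro en.variance_eq)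
  finally show ?thesis by (simp add: cexp_def)
qed

text \<open>From \<open>|y| <= 1 + y\<^sup>2\<close> and Jensen's inequality in the form of
  \<open>cexp_square_le\<close>.\<close>

lemma quad_cexp:
  assumes "sq_bounded \<xi>"
  obtains C where "quad C (cexp Q \<xi>)"
proof -
  have [measurable]: "\<xi> \<in> borel_measurable marks_space" using assms by (rule sq_bounded_measurable)
  obtain C where C: "quad C (cexp Q (\<lambda>\<omega>. (\<xi> \<omega>)\<^sup>2))" using assms by (auto simp: sq_bounded_def)
  have "quad (\<bar>1\<bar> + C) (cexp Q \<xi>)"
  proof (rule quad_mono_fun[OF quad_add[OF quad_const[of 1] C]])
    fix t :: "nat \<times> real" assume t: "0 < snd t"
    have "\<bar>x\<bar> \<le> 1 + x\<^sup>2" for x :: real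
      using zero_le_power2[of "\<bar>x\<bar> - 1"] by (simp add: power2_diff)
    then show "\<bar>cexp Q \<xi> t\<bar> \<le> \<bar>1 + cexp Q (\<lambda>\<omega>. (\<xi> \<omega>)\<^sup>2) t\<bar>"
      using cexp_square_le[OF assms t] by (smt (verit))
  qed simp
  then show ?thesis using that by blast
qed

text \<open>The squared mean carries the factor m (m - 1), which is at most m^2; the other term is
  the branching noise, driven by the second moments at the children.\<close>

lemma
  assumes \<xi>: "sq_bounded \<xi>" and t: "0 < snd t"
  shows cexp_gen_sum_Suc0: "cexp Q (gen_sum 1 \<xi>) t = mean_op (cexp Q \<xi>) t"
    and cexp_gen_sum_Suc0_sq: "cexp Q (\<lambda>\<omega>. (gen_sum 1 \<xi> \<omega>)\<^sup>2) t
        \<le> mean_op (cexp Q (\<lambda>\<omega>. (\<xi> \<omega>)\<^sup>2)) t + (mean_op (cexp Q \<xi>) t)\<^sup>2"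
proof -
  note m = sq_bounded_measurable[OF \<xi>]
  note i = sq_bounded_integrable[OF \<xi>]
  obtain k x where tt: "t = (k, x)" by (cases t)
  have x: "0 < x" using t by (simp add: tt)
  show "cexp Q (gen_sum 1 \<xi>) t = mean_op (cexp Q \<xi>) t"
    unfolding tt cexp_gen_sum_1[OF x m i] by (simp add: mean_op_def)
  have "real k * (real k - 1) * (kappa Q x (cexp Q \<xi>))\<^sup>2 \<le> real k * real k * (kappa Q x (cexp Q \<xi>))\<^sup>2"
    by (intro mult_right_mono) (auto simp: algebra_simps)
  then show "cexp Q (\<lambda>\<omega>. (gen_sum 1 \<xi> \<omega>)\<^sup>2) t
        \<le> mean_op (cexp Q (\<lambda>\<omega>. (\<xi> \<omega>)\<^sup>2)) t + (mean_op (cexp Q \<xi>) t)\<^sup>2"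
    unfolding tt cexp_gen_sum_1_sq[OF x m i] by (simp add: mean_op_def power_mult_distrib power2_eq_square mult_ac)
qed

text \<open>\<open>mean_op_quad\<close> bounds the noise by a multiple of h and the squared mean by
  a multiple of the square of h; both are of quadratic growth.\<close>

lemma sq_bounded_gen_sum_1:
  assumes \<xi>: "sq_bounded \<xi>"
  shows "sq_bounded (gen_sum 1 \<xi>)"
proof -
  note m[measurable] = sq_bounded_measurable[OF \<xi>]
  note i = sq_bounded_integrable[OF \<xi>]
  obtain C where C: "quad C (cexp Q (\<lambda>\<omega>. (\<xi> \<omega>)\<^sup>2))" using \<xi> by (auto simp: sq_bounded_def)
  obtain C' where C': "quad C' (cexp Q \<xi>)" by (rule quad_cexp[OF \<xi>])
  let ?c = "C * K0 / c1" and ?c' = "C' * K0 / c1"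
  have nn: "0 \<le> ?c" "0 \<le> ?c'"
    using C C' K0_ge_1 c1_pos by (auto simp: quad_def)
  have "quad (\<bar>?c\<bar> * c2 + \<bar>?c'\<^sup>2\<bar> * c2\<^sup>2) (cexp Q (\<lambda>\<omega>. (gen_sum 1 \<xi> \<omega>)\<^sup>2))"
  proof (rule quad_mono_fun[OF quad_add[OF quad_cmult[OF quad_h] quad_cmult[OF quad_h2]]])
    fix t :: "nat \<times> real" assume t: "0 < snd t"
    have "0 \<le> cexp Q (\<lambda>\<omega>. (gen_sum 1 \<xi> \<omega>)\<^sup>2) t" by (simp add: cexp_def)
    moreover have "mean_op (cexp Q (\<lambda>\<omega>. (\<xi> \<omega>)\<^sup>2)) t \<le> ?c * h t"
      using mean_op_quad[OF C t] abs_le_D1 by blast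
    moreover have "(mean_op (cexp Q \<xi>) t)\<^sup>2 \<le> ?c'\<^sup>2 * (h t)\<^sup>2"
      unfolding power_mult_distrib[symmetric]
      by (subst power2_abs[symmetric]) (rule power_mono[OF mean_op_quad[OF C' t]], simp)
    ultimately show "\<bar>cexp Q (\<lambda>\<omega>. (gen_sum 1 \<xi> \<omega>)\<^sup>2) t\<bar> \<le> \<bar>?c * h t + ?c'\<^sup>2 * (h t)\<^sup>2\<bar>"
      using cexp_gen_sum_Suc0_sq[OF \<xi> t] by linarith
  qed measurable
  moreover have "integrable \<E> (\<lambda>b. (gen_sum 1 \<xi> (graft t b))\<^sup>2)" if "0 < snd t" for t
    using integrable_gen_sum_1_sq[OF that m i, of "fst t"] by simp
  ultimately show ?thesis
    unfolding sq_bounded_def by auto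
qed

lemma sq_bounded_gen_sum: "sq_bounded \<xi> \<Longrightarrow> sq_bounded (gen_sum l \<xi>)"
proof (induction l)
  case (Suc l)
  then show ?case unfolding gen_sum_Suc1 by (intro sq_bounded_gen_sum_1)
qed (simp add: gen_sum.simps(1)[abs_def])

end

section \<open>Spectral gap and growth of generation sums\<close>

context spectral_branching
begin

text \<open>The rank-one kernel f x f z / c2^2, applied to h, gives gap * f x: this is what the
  eigenvalue loses when that kernel is subtracted.\<close>

definition gap :: real where
  "gap = (\<integral>t. f (snd t) * h t \<partial>\<mu>) / c2\<^sup>2"

lemma quad_f_mult: "quad C \<phi> \<Longrightarrow> quad (c2 * C) (\<lambda>t. f (snd t) * \<phi> t)"
  unfolding quad_def
proof (intro conjI allI impI)
  fix t :: "nat \<times> real"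
  assume q: "\<phi> \<in> borel_measurable (count_space UNIV \<Otimes>\<^sub>M borel) \<and> 0 \<le> C
     \<and> (\<forall>t. 0 < snd t \<longrightarrow> \<bar>\<phi> t\<bar> \<le> C * (1 + real (fst t))\<^sup>2)" and t: "0 < snd t"
  have b: "\<bar>\<phi> t\<bar> \<le> C * (1 + real (fst t))\<^sup>2" using q t by blast
  have "c2 * min (snd t) 1 \<le> c2" using c2_pos by (intro mult_left_le) auto
  then have "\<bar>f (snd t)\<bar> \<le> c2"
    using f_le[OF t] f_pos[OF t] by linarith
  then have "\<bar>f (snd t)\<bar> * \<bar>\<phi> t\<bar> \<le> c2 * (C * (1 + real (fst t))\<^sup>2)"
    using b c2_pos by (intro mult_mono) auto
  then show "\<bar>f (snd t) * \<phi> t\<bar> \<le> c2 * C * (1 + real (fst t))\<^sup>2"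
    by (simp add: abs_mult mult.assoc)
qed (use c2_pos in auto)

text \<open>If the integral vanished, h would vanish almost everywhere, against \<open>eigen\<close>
  at x = 1, whose right-hand side is positive.\<close>

lemma gap_pos: "0 < gap"
proof -
  have i: "integrable \<mu> (\<lambda>t. f (snd t) * h t)"
    by (rule quad_integrable(1)[OF quad_f_mult[OF quad_h]])
  have nn: "AE t in \<mu>. 0 \<le> f (snd t) * h t"
    using AE_type_law_pos[of Q]
    by eventually_elim (intro mult_nonneg_nonneg less_imp_le[OF f_pos] h_nonneg)
  have "(\<integral>t. f (snd t) * h t \<partial>\<mu>) \<noteq> 0"
  proof
    assume "(\<integral>t. f (snd t) * h t \<partial>\<mu>) = 0"
    then have "AE t in \<mu>. f (snd t) * h t = 0"
      using integral_nonneg_eq_0_iff_AE[OF i nn] by simp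
    then have "AE t in \<mu>. min 1 (snd t) * h t = 0"
      using AE_type_law_pos[of Q]
    proof eventually_elim
      case (elim t)
      then show ?case using f_pos[of "snd t"] by auto
    qed
    then have "(\<integral>t. min 1 (snd t) * h t \<partial>\<mu>) = (\<integral>t. 0 \<partial>\<mu>)"
      by (intro integral_cong_AE) auto
    then have "\<beta> * f 1 = 0"
      using eigen[of 1] by (simp add: h_def)
    then show False using f_pos[of 1] beta_gt_1 by simp
  qed
  moreover have "0 \<le> (\<integral>t. f (snd t) * h t \<partial>\<mu>)"
    by (rule integral_nonneg_AE[OF nn])
  ultimately show ?thesis using c2_pos by (simp add: gap_def)
qed

sublocale mm: pair_prob_space \<mu> \<mu> ..

text \<open>The kernel of the mean operator is m / x times the symmetric function
  \<open>min x z\<close>, and f x * m / x is h. Exchanging the integrals lets \<open>min\<close> act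
  on h, where \<open>eigen\<close> applies; so f is the density of a left eigenmeasure.\<close>

lemma integral_f_mean_op:
  assumes \<phi>: "quad C \<phi>"
  shows "(\<integral>t. f (snd t) * mean_op \<phi> t \<partial>\<mu>) = \<beta> * (\<integral>t. f (snd t) * \<phi> t \<partial>\<mu>)"
proof -
  have [measurable]: "\<phi> \<in> borel_measurable (count_space UNIV \<Otimes>\<^sub>M borel)" and C: "0 \<le> C"
    using \<phi> by (auto simp: quad_def)
  have \<phi>': "quad C (\<lambda>t. \<bar>\<phi> t\<bar>)"
    by (rule quad_mono_fun[OF \<phi>]) auto
  let ?F = "\<lambda>t s. h t * (min (snd t) (snd s) * \<phi> s)"
  have F: "integrable (\<mu> \<Otimes>\<^sub>M \<mu>) (case_prod ?F)"
  proof (rule mm.Fubini_integrable)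
    show "AE t in \<mu>. integrable \<mu> (\<lambda>s. case (t, s) of (t, s) \<Rightarrow> ?F t s)"
      using quad_integrable(2)[OF \<phi>] by simp
    show "integrable \<mu> (\<lambda>t. \<integral>s. norm (case (t, s) of (t, s) \<Rightarrow> ?F t s) \<partial>\<mu>)"
    proof (rule Bochner_Integration.integrable_bound)
      show "integrable \<mu> (\<lambda>t. C * K0 * h t)"
        using quad_integrable(1)[OF quad_h] by simp
      show "AE t in \<mu>. norm (\<integral>s. norm (case (t, s) of (t, s) \<Rightarrow> ?F t s) \<partial>\<mu>) \<le> norm (C * K0 * h t)"
        using AE_type_law_pos[of Q]
      proof eventually_elim
        case (elim t)
        have "(\<integral>s. norm (case (t, s) of (t, s) \<Rightarrow> ?F t s) \<partial>\<mu>) = (\<integral>s. h t * (min (snd t) (snd s) * \<bar>\<phi> s\<bar>) \<partial>\<mu>)"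
        proof (rule integral_cong_AE)
          show "AE s in \<mu>. norm (case (t, s) of (t, s) \<Rightarrow> ?F t s) = h t * (min (snd t) (snd s) * \<bar>\<phi> s\<bar>)"
            using AE_type_law_pos[of Q]
            by eventually_elim (use h_nonneg[OF elim] elim in \<open>auto simp: abs_mult\<close>)
        qed simp_all
        also have "\<dots> = h t * (\<integral>s. min (snd t) (snd s) * \<bar>\<phi> s\<bar> \<partial>\<mu>)" by simp
        also have "\<bar>\<dots>\<bar> \<le> h t * (C * K0 * min (snd t) 1)"
          unfolding abs_mult using quad_integrable(3)[OF \<phi>' elim] h_nonneg[OF elim]
          by (intro mult_mono) auto
        also have "\<dots> \<le> h t * (C * K0)"
          using h_nonneg[OF elim] C K0_ge_1 by (intro mult_left_mono mult_left_le) auto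
        finally show ?case using h_nonneg[OF elim] C K0_ge_1 by (simp add: mult_ac)
      qed
    qed simp
  qed simp
  have "(\<integral>t. f (snd t) * mean_op \<phi> t \<partial>\<mu>) = (\<integral>t. \<integral>s. ?F t s \<partial>\<mu> \<partial>\<mu>)"
    by (simp only: integral_mult_right_zero) (simp add: mean_op_def kappa_eq h_def mult_ac)
  also have "\<dots> = (\<integral>s. \<integral>t. ?F t s \<partial>\<mu> \<partial>\<mu>)"
    by (rule mm.Fubini_integral[OF F, symmetric])
  also have "\<dots> = (\<integral>s. \<beta> * (f (snd s) * \<phi> s) \<partial>\<mu>)"
  proof (rule integral_cong_AE)
    show "AE s in \<mu>. (\<integral>t. ?F t s \<partial>\<mu>) = \<beta> * (f (snd s) * \<phi> s)"
      using AE_type_law_pos[of Q]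
    proof eventually_elim
      case (elim s)
      have "(\<integral>t. ?F t s \<partial>\<mu>) = (\<integral>t. (min (snd s) (snd t) * h t) * \<phi> s \<partial>\<mu>)"
        by (intro Bochner_Integration.integral_cong refl) (simp add: min.commute mult_ac)
      also have "\<dots> = (\<beta> * f (snd s)) * \<phi> s"
        using eigen[OF elim, folded h_def] by (simp only: integral_mult_left_zero)
      finally show ?case by simp
    qed
  qed simp_all
  finally show ?thesis by simp
qed

text \<open>Since \<open>\<phi>\<close> is orthogonal to f, the kernel min x z may be replaced by the nonnegative kernel
  min x z - f x f z / c2^2, whose mass is smaller by the factor 1 - gap / \<beta>.\<close>

lemma mean_op_contraction:
  assumes \<phi>: "quad C \<phi>" and orth: "(\<integral>t. f (snd t) * \<phi> t \<partial>\<mu>) = 0"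
    and bd: "\<And>s. 0 < snd s \<Longrightarrow> \<bar>\<phi> s\<bar> \<le> R * h s" and t: "0 < snd t"
  shows "\<bar>mean_op \<phi> t\<bar> \<le> R * (\<beta> - gap) * h t"
proof -
  let ?x = "snd t"
  let ?k = "\<lambda>s. min ?x (snd s) - f ?x * f (snd s) / c2\<^sup>2"
  have k: "0 \<le> ?k s" if s: "0 < snd s" for s :: "nat \<times> real"
  proof -
    have "f ?x * f (snd s) \<le> (c2 * min ?x 1) * (c2 * min (snd s) 1)"
      using f_le[OF t] f_le[OF s] f_pos[OF t] f_pos[OF s] c2_pos t by (intro mult_mono) auto
    also have "\<dots> = c2\<^sup>2 * (min ?x 1 * min (snd s) 1)" by (simp add: power2_eq_square)
    also have "min ?x 1 * min (snd s) 1 \<le> min ?x (snd s)"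
      using t s by (auto simp: min_def mult_le_one mult_left_le mult_left_le_one_le)
    finally show ?thesis using c2_pos by (simp add: field_simps)
  qed
  have i1: "integrable \<mu> (\<lambda>s. min ?x (snd s) * \<phi> s)" by (rule quad_integrable(2)[OF \<phi>])
  have i2: "integrable \<mu> (\<lambda>s. f (snd s) * \<phi> s)" by (rule quad_integrable(1)[OF quad_f_mult[OF \<phi>]])
  have j1: "integrable \<mu> (\<lambda>s. min ?x (snd s) * h s)" by (rule quad_integrable(2)[OF quad_h])
  have j2: "integrable \<mu> (\<lambda>s. f (snd s) * h s)" by (rule quad_integrable(1)[OF quad_f_mult[OF quad_h]])
  have split\<phi>: "?k s * \<phi> s = min ?x (snd s) * \<phi> s - f ?x / c2\<^sup>2 * (f (snd s) * \<phi> s)" for s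
    by (simp add: algebra_simps)
  have splith: "?k s * h s = min ?x (snd s) * h s - f ?x / c2\<^sup>2 * (f (snd s) * h s)" for s
    by (simp add: algebra_simps)
  have ik: "integrable \<mu> (\<lambda>s. ?k s * \<phi> s)" unfolding split\<phi> using i1 i2 by simp
  have jk: "integrable \<mu> (\<lambda>s. ?k s * h s)" unfolding splith using j1 j2 by simp
  have "(\<integral>s. min ?x (snd s) * \<phi> s \<partial>\<mu>) = (\<integral>s. ?k s * \<phi> s \<partial>\<mu>)"
    unfolding split\<phi> using i1 i2 orth by simp
  also have "\<bar>\<dots>\<bar> \<le> (\<integral>s. \<bar>?k s * \<phi> s\<bar> \<partial>\<mu>)" by (rule integral_abs_bound)
  also have "\<dots> \<le> (\<integral>s. R * (?k s * h s) \<partial>\<mu>)"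
  proof (rule integral_mono_AE)
    show "AE s in \<mu>. \<bar>?k s * \<phi> s\<bar> \<le> R * (?k s * h s)"
      using AE_type_law_pos[of Q]
    proof eventually_elim
      case (elim s)
      have "?k s * \<bar>\<phi> s\<bar> \<le> ?k s * (R * h s)"
        by (rule mult_left_mono[OF bd[OF elim] k[OF elim]])
      then show ?case using k[OF elim] by (simp add: abs_mult mult_ac)
    qed
  qed (use ik jk in simp_all)
  also have "\<dots> = R * (\<beta> - gap) * f ?x"
  proof -
    have "(\<integral>s. ?k s * h s \<partial>\<mu>) = (\<beta> - gap) * f ?x"
      unfolding splith using j1 j2 eigen[OF t, folded h_def]
      by (simp add: gap_def left_diff_distrib)
    then show ?thesis by simp
  qed
  finally have "real (fst t) / ?x * \<bar>\<integral>s. min ?x (snd s) * \<phi> s \<partial>\<mu>\<bar> \<le> real (fst t) / ?x * (R * (\<beta> - gap) * f ?x)"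
    using t by (intro mult_left_mono) auto
  then show ?thesis using t by (simp add: mean_op_def kappa_eq h_def abs_mult mult_ac)
qed

text \<open>The second argument of the maximum keeps the square of \<open>rate * \<beta>\<close> above \<open>\<beta>\<close>, so that in
  second moments the squared means dominate the branching noise.\<close>

definition rate :: real where
  "rate = max ((\<beta> - gap) / \<beta>) (sqrt ((\<beta> + 1) / (2 * \<beta>)))"

lemma rate: "0 < rate" "rate < 1" "\<beta> < (rate * \<beta>)\<^sup>2" "\<beta> - gap \<le> rate * \<beta>"
proof -
  show 0: "0 < rate" using beta_gt_1 by (simp add: rate_def less_max_iff_disj)
  have "(\<beta> + 1) / (2 * \<beta>) < 1" using beta_gt_1 by simp
  then show "rate < 1" using gap_pos beta_gt_1 by (auto simp: rate_def)
  have "(\<beta> - gap) / \<beta> \<le> rate" by (simp add: rate_def)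
  then show "\<beta> - gap \<le> rate * \<beta>" using beta_gt_1 by (simp add: field_simps)
  have "(\<beta> + 1) / (2 * \<beta>) = (sqrt ((\<beta> + 1) / (2 * \<beta>)))\<^sup>2" using beta_gt_1 by simp
  also have "\<dots> \<le> rate\<^sup>2" using beta_gt_1 by (intro power_mono) (auto simp: rate_def)
  finally have "(\<beta> + 1) / (2 * \<beta>) * \<beta>\<^sup>2 \<le> rate\<^sup>2 * \<beta>\<^sup>2" by (intro mult_right_mono) auto
  moreover have "\<beta> < (\<beta> + 1) / (2 * \<beta>) * \<beta>\<^sup>2"
    using beta_gt_1 by (simp add: field_simps power2_eq_square)
  ultimately show "\<beta> < (rate * \<beta>)\<^sup>2" by (simp add: power_mult_distrib)
qed

lemma cexp_gen_sum_Suc: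
  assumes "sq_bounded \<xi>" "0 < snd t"
  shows "cexp Q (gen_sum (Suc l) \<xi>) t = mean_op (cexp Q (gen_sum l \<xi>)) t"
  unfolding gen_sum_Suc1 by (rule cexp_gen_sum_Suc0[OF sq_bounded_gen_sum]) fact+

lemma cexp_gen_sum_Suc_sq:
  assumes "sq_bounded \<xi>" "0 < snd t"
  shows "cexp Q (\<lambda>\<omega>. (gen_sum (Suc l) \<xi> \<omega>)\<^sup>2) t
    \<le> mean_op (cexp Q (\<lambda>\<omega>. (gen_sum l \<xi> \<omega>)\<^sup>2)) t + (cexp Q (gen_sum (Suc l) \<xi>) t)\<^sup>2"
  unfolding cexp_gen_sum_Suc[OF assms] unfolding gen_sum_Suc1[of l]
  by (rule cexp_gen_sum_Suc0_sq[OF sq_bounded_gen_sum]) fact+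

text \<open>The mean operator multiplies the integral against the left eigenmeasure by \<beta>, so
  the value 0 persists.\<close>

lemma orthogonal_gen_sum:
  assumes \<xi>: "sq_bounded \<xi>" and orth: "(\<integral>t. f (snd t) * cexp Q \<xi> t \<partial>\<mu>) = 0"
  shows "(\<integral>t. f (snd t) * cexp Q (gen_sum l \<xi>) t \<partial>\<mu>) = 0"
proof (induction l)
  case 0
  then show ?case using orth by (simp add: gen_sum.simps(1)[abs_def])
next
  case (Suc l)
  note [measurable] = sq_bounded_measurable[OF \<xi>]
  obtain C where C: "quad C (cexp Q (gen_sum l \<xi>))"
    by (rule quad_cexp[OF sq_bounded_gen_sum[OF \<xi>]])
  have [measurable]: "mean_op (cexp Q (gen_sum l \<xi>)) \<in> borel_measurable (count_space UNIV \<Otimes>\<^sub>M borel)"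
    unfolding mean_op_def[abs_def] kappa_def by measurable
  have "(\<integral>t. f (snd t) * cexp Q (gen_sum (Suc l) \<xi>) t \<partial>\<mu>) = (\<integral>t. f (snd t) * mean_op (cexp Q (gen_sum l \<xi>)) t \<partial>\<mu>)"
  proof (rule integral_cong_AE)
    show "AE t in \<mu>. f (snd t) * cexp Q (gen_sum (Suc l) \<xi>) t = f (snd t) * mean_op (cexp Q (gen_sum l \<xi>)) t"
      using AE_type_law_pos[of Q] by eventually_elim (simp only: cexp_gen_sum_Suc[OF \<xi>])
  next
    have "gen_sum (Suc l) \<xi> \<in> borel_measurable marks_space" by measurable
    then show "(\<lambda>t. f (snd t) * cexp Q (gen_sum (Suc l) \<xi>) t) \<in> borel_measurable \<mu>" by measurable
  qed measurable
  also have "\<dots> = 0" using integral_f_mean_op[OF C] Suc by simp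
  finally show ?case .
qed

text \<open>The first generation is spent on bringing the conditional mean below a multiple of h
  through \<open>mean_op_quad\<close>: before that no such bound is available, since h vanishes at
  types without potential children. From then on each step contracts.\<close>

lemma mean_decay:
  assumes \<xi>: "sq_bounded \<xi>" and orth: "(\<integral>t. f (snd t) * cexp Q \<xi> t \<partial>\<mu>) = 0"
  obtains R where "0 \<le> R" "\<And>l t. 0 < snd t \<Longrightarrow> \<bar>cexp Q (gen_sum (Suc l) \<xi>) t\<bar> \<le> R * (rate * \<beta>) ^ Suc l * h t"
proof -
  obtain C where C: "quad C (cexp Q \<xi>)" by (rule quad_cexp[OF \<xi>])
  define R where "R = C * K0 / c1 / (rate * \<beta>)"
  have rb: "0 < rate * \<beta>" using rate(1) beta_gt_1 by simp
  have R: "0 \<le> R" using C K0_ge_1 c1_pos rb by (auto simp: R_def quad_def)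
  have "\<bar>cexp Q (gen_sum (Suc l) \<xi>) t\<bar> \<le> R * (rate * \<beta>) ^ Suc l * h t" if "0 < snd t" for l t
    using that
  proof (induction l arbitrary: t)
    case 0
    have "cexp Q (gen_sum (Suc 0) \<xi>) t = mean_op (cexp Q \<xi>) t"
      using cexp_gen_sum_Suc[OF \<xi> 0, of 0] by (simp add: gen_sum.simps(1)[abs_def])
    then show ?case using mean_op_quad[OF C 0] rate(1) beta_gt_1 by (simp add: R_def del: gen_sum.simps)
  next
    case (Suc l)
    obtain C' where C': "quad C' (cexp Q (gen_sum (Suc l) \<xi>))"
      by (rule quad_cexp[OF sq_bounded_gen_sum[OF \<xi>]])
    have "\<bar>cexp Q (gen_sum (Suc (Suc l)) \<xi>) t\<bar> \<le> R * (rate * \<beta>) ^ Suc l * (\<beta> - gap) * h t"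
      unfolding cexp_gen_sum_Suc[OF \<xi> Suc.prems]
      by (rule mean_op_contraction[OF C' orthogonal_gen_sum[OF \<xi> orth] Suc.IH Suc.prems])
    also have "\<dots> \<le> R * (rate * \<beta>) ^ Suc l * (rate * \<beta>) * h t"
      using R rb rate(4) h_nonneg[OF Suc.prems] by (intro mult_right_mono mult_left_mono) auto
    finally show ?case by (simp add: mult_ac del: gen_sum.simps)
  qed
  with R show ?thesis using that by blast
qed

section \<open>Second moments of generation sums\<close>

definition K1 :: real where "K1 = c2\<^sup>2 * K0 / c1"

lemma K1_nonneg: "0 \<le> K1"
  using K0_ge_1 c1_pos by (simp add: K1_def)

lemma mean_op_h2: "0 < snd t \<Longrightarrow> mean_op (\<lambda>s. (h s)\<^sup>2) t \<le> K1 * h t"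
  using mean_op_quad[OF quad_h2, of t] by (simp add: K1_def)

lemma mean_op_lin:
  assumes t: "0 < snd t" and b: "0 \<le> b"
  shows "mean_op (\<lambda>s. a * h s + b * (h s)\<^sup>2) t \<le> (a * \<beta> + b * K1) * h t"
proof -
  have "mean_op (\<lambda>s. a * h s + b * (h s)\<^sup>2) t = a * (\<beta> * h t) + b * mean_op (\<lambda>s. (h s)\<^sup>2) t"
    using mean_op_add[OF quad_cmult[OF quad_h] quad_cmult[OF quad_h2]] t
    by (simp add: mean_op_cmult mean_op_h)
  also have "\<dots> \<le> a * (\<beta> * h t) + b * (K1 * h t)"
    using mean_op_h2[OF t] b by (intro add_left_mono mult_left_mono)
  finally show ?thesis by (simp add: algebra_simps)
qed

lemma mean_op_le_lin:
  assumes \<phi>: "quad C \<phi>" and le: "\<And>s. 0 < snd s \<Longrightarrow> \<phi> s \<le> a * h s + b * (h s)\<^sup>2" and t: "0 < snd t" and b: "0 \<le> b"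
  shows "mean_op \<phi> t \<le> (a * \<beta> + b * K1) * h t"
  using mean_op_mono[OF \<phi> quad_add[OF quad_cmult[OF quad_h] quad_cmult[OF quad_h2]] le t] mean_op_lin[OF t b]
  by (rule order_trans)

text \<open>The ansatz is \<theta>^(2 l) times a combination of h and its square. The mean operator
  multiplies h by \<beta> < \<theta>^2 and sends the square of h below K1 * h, so the noise only has
  to be absorbed by the h-part, which has room to spare; the squared means account for the other
  part.\<close>

lemma second_moment_growth:
  assumes \<xi>: "sq_bounded \<xi>" and \<theta>: "0 < \<theta>" "\<beta> < \<theta>\<^sup>2" and R: "0 \<le> R"
    and a: "\<And>l t. 0 < snd t \<Longrightarrow> \<bar>cexp Q (gen_sum (Suc l) \<xi>) t\<bar> \<le> R * \<theta> ^ Suc l * h t"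
  obtains B where "0 \<le> B"
    "\<And>l t. 0 < snd t \<Longrightarrow> cexp Q (\<lambda>\<omega>. (gen_sum (Suc l) \<xi> \<omega>)\<^sup>2) t \<le> B * (\<theta>\<^sup>2) ^ Suc l * (h t + (h t)\<^sup>2)"
proof -
  have sq: "\<exists>C. quad C (cexp Q (\<lambda>\<omega>. (gen_sum l \<xi> \<omega>)\<^sup>2))" for l
    using sq_bounded_gen_sum[OF \<xi>, of l] by (simp add: sq_bounded_def)
  obtain C where C: "quad C (cexp Q (\<lambda>\<omega>. (\<xi> \<omega>)\<^sup>2))"
    using \<xi> by (auto simp: sq_bounded_def)
  \<comment> \<open>The first entry makes the bound hold in generation 1; the second gives B *
    \<beta> + R^2 * K1 <= B * \<theta>^2, which is the induction step.\<close>
  define B where "B = max (C * K0 / c1 / \<theta>\<^sup>2) (R\<^sup>2 * K1 / (\<theta>\<^sup>2 - \<beta>))"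
  have B: "C * K0 / c1 \<le> B * \<theta>\<^sup>2" "B * \<beta> + R\<^sup>2 * K1 \<le> B * \<theta>\<^sup>2" "0 \<le> B"
  proof -
    have "C * K0 / c1 / \<theta>\<^sup>2 \<le> B" by (simp add: B_def)
    then have "C * K0 / c1 / \<theta>\<^sup>2 * \<theta>\<^sup>2 \<le> B * \<theta>\<^sup>2" by (rule mult_right_mono) simp
    then show "C * K0 / c1 \<le> B * \<theta>\<^sup>2" using \<theta> by simp
    have "R\<^sup>2 * K1 / (\<theta>\<^sup>2 - \<beta>) \<le> B" by (simp add: B_def)
    then show "B * \<beta> + R\<^sup>2 * K1 \<le> B * \<theta>\<^sup>2" using \<theta> by (simp add: pos_divide_le_eq algebra_simps)
    have "0 \<le> C * K0 / c1 / \<theta>\<^sup>2" using C K0_ge_1 c1_pos by (simp add: quad_def)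
    then show "0 \<le> B" by (simp add: B_def le_max_iff_disj)
  qed
  have sqa: "(cexp Q (gen_sum (Suc l) \<xi>) t)\<^sup>2 \<le> R\<^sup>2 * (\<theta>\<^sup>2) ^ Suc l * (h t)\<^sup>2" if t: "0 < snd t" for l t
  proof -
    have "(cexp Q (gen_sum (Suc l) \<xi>) t)\<^sup>2 \<le> (R * \<theta> ^ Suc l * h t)\<^sup>2"
      by (subst power2_abs[symmetric]) (rule power_mono[OF a[OF t]], simp)
    also have "\<dots> = R\<^sup>2 * (\<theta>\<^sup>2) ^ Suc l * (h t)\<^sup>2"
      by (simp only: power_mult_distrib power_mult[symmetric] mult.commute[of 2])
    finally show ?thesis .
  qed
  have main: "cexp Q (\<lambda>\<omega>. (gen_sum (Suc l) \<xi> \<omega>)\<^sup>2) t \<le> B * (\<theta>\<^sup>2) ^ Suc l * h t + R\<^sup>2 * (\<theta>\<^sup>2) ^ Suc l * (h t)\<^sup>2"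
    if "0 < snd t" for l t
    using that
  proof (induction l arbitrary: t)
    case 0
    have "mean_op (cexp Q (\<lambda>\<omega>. (\<xi> \<omega>)\<^sup>2)) t \<le> C * K0 / c1 * h t"
      using mean_op_quad[OF C 0] abs_le_D1 by blast
    also have "\<dots> \<le> B * \<theta>\<^sup>2 * h t"
      using B(1) h_nonneg[OF 0] by (rule mult_right_mono)
    finally show ?case
      using cexp_gen_sum_Suc_sq[OF \<xi> 0, of 0] sqa[OF 0, of 0] by (simp only: gen_sum.simps(1)) simp
  next
    case (Suc l)
    obtain C' where C': "quad C' (cexp Q (\<lambda>\<omega>. (gen_sum (Suc l) \<xi> \<omega>)\<^sup>2))" using sq by blast
    have "mean_op (cexp Q (\<lambda>\<omega>. (gen_sum (Suc l) \<xi> \<omega>)\<^sup>2)) t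
       \<le> (B * (\<theta>\<^sup>2) ^ Suc l * \<beta> + R\<^sup>2 * (\<theta>\<^sup>2) ^ Suc l * K1) * h t"
      by (rule mean_op_le_lin[OF C' Suc.IH Suc.prems]) simp_all
    also have "\<dots> = (\<theta>\<^sup>2) ^ Suc l * ((B * \<beta> + R\<^sup>2 * K1) * h t)"
      by (simp add: algebra_simps)
    also have "\<dots> \<le> (\<theta>\<^sup>2) ^ Suc l * (B * \<theta>\<^sup>2 * h t)"
      using B(2) h_nonneg[OF Suc.prems] by (intro mult_left_mono mult_right_mono) auto
    finally show ?case
      using cexp_gen_sum_Suc_sq[OF \<xi> Suc.prems, of "Suc l"] sqa[OF Suc.prems, of "Suc l"]
      by (simp only: power_Suc mult_ac)
  qed
  have "cexp Q (\<lambda>\<omega>. (gen_sum (Suc l) \<xi> \<omega>)\<^sup>2) t \<le> (B + R\<^sup>2) * (\<theta>\<^sup>2) ^ Suc l * (h t + (h t)\<^sup>2)" if t: "0 < snd t" for l t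
  proof -
    have "0 \<le> B * (\<theta>\<^sup>2) ^ Suc l * (h t)\<^sup>2" "0 \<le> R\<^sup>2 * (\<theta>\<^sup>2) ^ Suc l * h t"
      using B(3) h_nonneg[OF t] by auto
    then show ?thesis using main[OF t, of l] by (simp only: ring_distribs)
  qed
  with B(3) show ?thesis using that[of "B + R\<^sup>2"] by auto
qed

text \<open>With conditional mean zero the contributions of different vertices are conditionally
  uncorrelated, so second moments follow the mean operator alone and grow like \<beta>^l instead of
  \<beta>^(2 l). The factor 1 + K1 absorbs the square of h in the first step.\<close>

lemma zero_mean_growth:
  assumes \<xi>: "sq_bounded \<xi>" and 0: "\<And>t. 0 < snd t \<Longrightarrow> cexp Q \<xi> t = 0"
    and b: "\<And>t. 0 < snd t \<Longrightarrow> cexp Q (\<lambda>\<omega>. (\<xi> \<omega>)\<^sup>2) t \<le> B * (h t + (h t)\<^sup>2)" "0 \<le> B"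
    and t: "0 < snd t"
  shows "cexp Q (\<lambda>\<omega>. (gen_sum (Suc l) \<xi> \<omega>)\<^sup>2) t \<le> B * (1 + K1) * \<beta> ^ Suc l * h t"
proof -
  have sq: "\<exists>C. quad C (cexp Q (\<lambda>\<omega>. (gen_sum l \<xi> \<omega>)\<^sup>2))" for l
    using sq_bounded_gen_sum[OF \<xi>, of l] by (simp add: sq_bounded_def)
  have zero: "cexp Q (gen_sum l \<xi>) t = 0" if "0 < snd t" for l t
    using that
  proof (induction l arbitrary: t)
    case 0
    then show ?case by (simp add: gen_sum.simps(1)[abs_def] assms(2))
  next
    case (Suc l)
    have "mean_op (cexp Q (gen_sum l \<xi>)) t = 0"
    proof -
      have "(\<integral>s. min (snd t) (snd s) * cexp Q (gen_sum l \<xi>) s \<partial>\<mu>) = (\<integral>s. 0 \<partial>\<mu>)"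
      proof (rule integral_cong_AE)
        have [measurable]: "\<xi> \<in> borel_measurable marks_space" by (rule sq_bounded_measurable[OF \<xi>])
        show "(\<lambda>s. min (snd t) (snd s) * cexp Q (gen_sum l \<xi>) s) \<in> borel_measurable \<mu>" by measurable
        show "AE s in \<mu>. min (snd t) (snd s) * cexp Q (gen_sum l \<xi>) s = 0"
          using AE_type_law_pos[of Q] by eventually_elim (simp add: Suc.IH)
      qed simp
      then show ?thesis by (simp add: mean_op_def kappa_eq)
    qed
    then show ?case by (simp only: cexp_gen_sum_Suc[OF \<xi> Suc.prems])
  qed
  show ?thesis using t
  proof (induction l arbitrary: t)
    case 0
    obtain C where C: "quad C (cexp Q (\<lambda>\<omega>. (\<xi> \<omega>)\<^sup>2))" using \<xi> by (auto simp: sq_bounded_def)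
    have "mean_op (cexp Q (\<lambda>\<omega>. (\<xi> \<omega>)\<^sup>2)) t \<le> (B * \<beta> + B * K1) * h t"
      by (rule mean_op_le_lin[OF C _ 0 b(2)]) (use b(1) in \<open>simp add: ring_distribs\<close>)
    also have "\<dots> \<le> B * (1 + K1) * \<beta> * h t"
    proof (rule mult_right_mono[OF _ h_nonneg[OF 0]])
      have "B * K1 * 1 \<le> B * K1 * \<beta>" using b(2) K1_nonneg beta_gt_1 by (intro mult_left_mono) auto
      then show "B * \<beta> + B * K1 \<le> B * (1 + K1) * \<beta>" by (simp add: algebra_simps)
    qed
    finally show ?case
      using cexp_gen_sum_Suc_sq[OF \<xi> 0, of 0] zero[OF 0, of "Suc 0"] by (simp only: gen_sum.simps(1)) simp
  next
    case (Suc l)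
    obtain C' where C': "quad C' (cexp Q (\<lambda>\<omega>. (gen_sum (Suc l) \<xi> \<omega>)\<^sup>2))" using sq by blast
    have "mean_op (cexp Q (\<lambda>\<omega>. (gen_sum (Suc l) \<xi> \<omega>)\<^sup>2)) t \<le> (B * (1 + K1) * \<beta> ^ Suc l * \<beta> + 0 * K1) * h t"
      by (rule mean_op_le_lin[OF C' _ Suc.prems]) (use Suc.IH in auto)
    then show ?case
      using cexp_gen_sum_Suc_sq[OF \<xi> Suc.prems, of "Suc l"] zero[OF Suc.prems, of "Suc (Suc l)"]
      by (simp only: power_Suc mult_ac power2_eq_square) (simp add: mult_ac)
  qed
qed

end

section \<open>The normalised generation sums\<close>

text \<open>The drop \<open>A ^ m - (A - y) ^ m\<close> is concave in y on [0, A] and vanishes at 0,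
  so its quotient by y is nonincreasing; this is read off the factorisation of a difference of
  powers.\<close>

lemma power_drop_concave:
  fixes A a b :: real
  assumes "0 \<le> b" "b \<le> a" "a \<le> A"
  shows "b * (A ^ m - (A - a) ^ m) \<le> a * (A ^ m - (A - b) ^ m)"
proof -
  have drop: "A ^ m - (A - y) ^ m = y * (\<Sum>i<m. (A - y) ^ (m - Suc i) * A ^ i)" for y
    using power_diff_sumr2[of A m "A - y"] by simp
  have "(\<Sum>i<m. (A - a) ^ (m - Suc i) * A ^ i) \<le> (\<Sum>i<m. (A - b) ^ (m - Suc i) * A ^ i)"
    using assms by (intro sum_mono mult_right_mono power_mono) auto
  then have "(a * b) * (\<Sum>i<m. (A - a) ^ (m - Suc i) * A ^ i) \<le> (a * b) * (\<Sum>i<m. (A - b) ^ (m - Suc i) * A ^ i)"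
    using assms by (intro mult_left_mono) auto
  then show ?thesis unfolding drop by (simp add: mult_ac)
qed

text \<open>For b < a the drop at a is at most a / b times the drop at b, by concavity; for a <= b
  monotonicity suffices, and this is where 1 <= C enters.\<close>

lemma power_drop_compare:
  fixes A a b C :: real
  assumes a: "0 \<le> a" "a \<le> A" and b: "0 \<le> b" "b \<le> A" and ab: "a \<le> C * b" and C: "1 \<le> C"
  shows "A ^ m - (A - a) ^ m \<le> C * (A ^ m - (A - b) ^ m)"
proof (cases "a \<le> b")
  case True
  have "A ^ m - (A - a) ^ m \<le> 1 * (A ^ m - (A - b) ^ m)"
    using True assms by (auto intro!: power_mono)
  also have "\<dots> \<le> C * (A ^ m - (A - b) ^ m)"
    using C b by (intro mult_right_mono) (auto intro!: power_mono)
  finally show ?thesis .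
next
  case False
  then have "0 < a" using b by linarith
  have nn: "0 \<le> A ^ m - (A - b) ^ m" using b by (auto intro!: power_mono)
  show ?thesis
  proof (cases "b = 0")
    case True
    then show ?thesis using ab \<open>0 < a\<close> by simp
  next
    case bz: False
    then have bp: "0 < b" using b by simp
    have "b * (A ^ m - (A - a) ^ m) \<le> a * (A ^ m - (A - b) ^ m)"
      using False b a by (intro power_drop_concave) auto
    also have "\<dots> \<le> (C * b) * (A ^ m - (A - b) ^ m)"
      using ab nn by (intro mult_right_mono)
    finally have "b * (A ^ m - (A - a) ^ m) \<le> b * (C * (A ^ m - (A - b) ^ m))" by (simp add: mult_ac)
    then show ?thesis using bp by simp
  qed
qed

definition fraction :: "(marks \<Rightarrow> real) \<Rightarrow> bool" where
  "fraction \<gamma> \<longleftrightarrow> \<gamma> \<in> borel_measurable marks_space \<and> (\<forall>\<omega>. 0 \<le> \<gamma> \<omega> \<and> \<gamma> \<omega> \<le> 1)"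

lemma fraction_gen_prod: "fraction \<gamma> \<Longrightarrow> fraction (gen_prod l \<gamma>)"
  unfolding fraction_def by (simp add: gen_prod_bounds measurable_gen_prod)

lemma fraction_mult: "fraction \<gamma> \<Longrightarrow> fraction \<delta> \<Longrightarrow> fraction (\<lambda>\<omega>. \<gamma> \<omega> * \<delta> \<omega>)"
  unfolding fraction_def by (auto intro: mult_le_one)

lemma fraction_exp:
  assumes "\<xi> \<in> borel_measurable marks_space" "\<And>\<omega>. 0 \<le> \<xi> \<omega>"
  shows "fraction (\<lambda>\<omega>. exp (- \<xi> \<omega>))"
  using assms unfolding fraction_def by auto

context spectral_branching
begin

lemma fraction_integrable: "fraction \<gamma> \<Longrightarrow> integrable \<E> (\<lambda>b. \<gamma> (graft t b))"
  unfolding fraction_def by (intro integrable_env_bounded[where c=1]) (auto simp: abs_of_nonneg)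

lemma cexp_fraction: "fraction \<gamma> \<Longrightarrow> 0 \<le> cexp Q \<gamma> t" "fraction \<gamma> \<Longrightarrow> cexp Q \<gamma> t \<le> 1"
proof -
  assume \<gamma>: "fraction \<gamma>"
  show "0 \<le> cexp Q \<gamma> t" using \<gamma> unfolding cexp_def fraction_def by (intro Bochner_Integration.integral_nonneg) auto
  have "cexp Q \<gamma> t \<le> (\<integral>b. 1 \<partial>\<E>)"
    unfolding cexp_def using fraction_integrable[OF \<gamma>] \<gamma>
    by (intro integral_mono) (auto simp: fraction_def)
  then show "cexp Q \<gamma> t \<le> 1" by (simp add: en.prob_space[simplified])
qed

lemma cexp_mono:
  assumes "fraction \<gamma>" "fraction \<delta>" "\<And>\<omega>. \<gamma> \<omega> \<le> \<delta> \<omega>"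
  shows "cexp Q \<gamma> t \<le> cexp Q \<delta> t"
  unfolding cexp_def using assms by (intro integral_mono fraction_integrable) auto

lemma cexp_gen_prod_Suc:
  assumes "0 < snd t" and \<gamma>: "fraction \<gamma>"
  shows "cexp Q (gen_prod (Suc l) \<gamma>) t = (1 - kappa Q (snd t) (\<lambda>s. 1 - cexp Q (gen_prod l \<gamma>) s)) ^ fst t"
proof -
  have "gen_prod (Suc l) \<gamma> = gen_prod 1 (gen_prod l \<gamma>)" by (rule ext) simp
  moreover have "fraction (gen_prod l \<gamma>)" by (rule fraction_gen_prod[OF \<gamma>])
  ultimately show ?thesis
    using cexp_gen_prod_1[of "snd t" "gen_prod l \<gamma>" "fst t"] assms
    by (simp only: fraction_def prod.collapse)
qed

lemma quad_1:
  assumes "\<psi> \<in> borel_measurable (count_space UNIV \<Otimes>\<^sub>M borel)" "\<And>s. 0 \<le> \<psi> s \<and> \<psi> s \<le> 1"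
  shows "quad 1 \<psi>"
proof -
  have "quad \<bar>1\<bar> \<psi>"
  proof (rule quad_mono_fun[OF quad_const[of 1] assms(1)])
    fix t show "\<bar>\<psi> t\<bar> \<le> \<bar>1\<bar>" using assms(2)[of t] by simp
  qed
  then show ?thesis by simp
qed

lemma kappa_le_1:
  assumes "\<psi> \<in> borel_measurable (count_space UNIV \<Otimes>\<^sub>M borel)" "\<And>s. 0 \<le> \<psi> s \<and> \<psi> s \<le> 1" "0 < x"
  shows "0 \<le> kappa Q x \<psi>" "kappa Q x \<psi> \<le> 1"
proof -
  have q: "quad 1 \<psi>" by (rule quad_1) fact+
  have nn: "AE s in \<mu>. 0 \<le> min x (snd s) * \<psi> s"
    using AE_type_law_pos[of Q] by eventually_elim (use assms in auto)
  show "0 \<le> kappa Q x \<psi>"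
    unfolding kappa_eq using assms(3) integral_nonneg_AE[OF nn] by simp
  have "(\<integral>s. min x (snd s) * \<psi> s \<partial>\<mu>) \<le> (\<integral>s. x \<partial>\<mu>)"
  proof (rule integral_mono_AE)
    show "AE s in \<mu>. min x (snd s) * \<psi> s \<le> x"
      using AE_type_law_pos[of Q]
    proof eventually_elim
      case (elim s)
      have "min x (snd s) * \<psi> s \<le> x * 1"
        using assms elim by (intro mult_mono) auto
      then show ?case by simp
    qed
  qed (use quad_integrable(2)[OF q] in auto)
  then show "kappa Q x \<psi> \<le> 1"
    unfolding kappa_eq using assms(3) by (simp add: mu.prob_space[simplified])
qed

lemma kappa_diff:
  assumes "quad C \<phi>" "quad C' \<psi>"
  shows "kappa Q x (\<lambda>s. \<phi> s - \<psi> s) = kappa Q x \<phi> - kappa Q x \<psi>"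
  using quad_integrable(2)[OF assms(1)] quad_integrable(2)[OF assms(2)]
  by (simp add: kappa_eq ring_distribs diff_divide_distrib)

lemma kappa_mono:
  assumes "quad C \<phi>" "quad C' \<psi>" "\<And>s. 0 < snd s \<Longrightarrow> \<phi> s \<le> \<psi> s" "0 < x"
  shows "kappa Q x \<phi> \<le> kappa Q x \<psi>"
proof -
  have "(\<integral>s. min x (snd s) * \<phi> s \<partial>\<mu>) \<le> (\<integral>s. min x (snd s) * \<psi> s \<partial>\<mu>)"
  proof (rule integral_mono_AE)
    show "AE s in \<mu>. min x (snd s) * \<phi> s \<le> min x (snd s) * \<psi> s"
      using AE_type_law_pos[of Q] by eventually_elim (use assms in \<open>auto intro!: mult_left_mono\<close>)
  qed (use quad_integrable(2)[OF assms(1)] quad_integrable(2)[OF assms(2)] in auto)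
  then show ?thesis using assms(4) by (simp add: kappa_eq divide_right_mono)
qed

lemma kappa_cmult: "kappa Q x (\<lambda>s. c * \<phi> s) = c * kappa Q x \<phi>"
proof -
  have "(\<lambda>s. min x (snd s) * (c * \<phi> s)) = (\<lambda>s. c * (min x (snd s) * \<phi> s))" by (auto simp: mult_ac)
  then show ?thesis by (simp add: kappa_eq)
qed

text \<open>By \<open>cexp_gen_prod_Suc\<close> each of the three expectations is a power whose base
  is affine in the expectations one generation lower. A comparison of the drops below \<gamma>
  passes to the bases by linearity and to the powers by \<open>power_drop_compare\<close>, so the
  same constant C serves all generations.\<close>

lemma gen_prod_compare:
  assumes g: "fraction \<gamma>" and d: "fraction \<delta>" and e: "fraction \<epsilon>" and C: "1 \<le> C"
    and le: "\<And>\<omega>. \<delta> \<omega> \<le> \<gamma> \<omega>" "\<And>\<omega>. \<epsilon> \<omega> \<le> \<gamma> \<omega>"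
    and base: "\<And>s. 0 < snd s \<Longrightarrow> cexp Q \<gamma> s - cexp Q \<delta> s \<le> C * (cexp Q \<gamma> s - cexp Q \<epsilon> s)"
    and t: "0 < snd t"
  shows "cexp Q (gen_prod l \<gamma>) t - cexp Q (gen_prod l \<delta>) t
    \<le> C * (cexp Q (gen_prod l \<gamma>) t - cexp Q (gen_prod l \<epsilon>) t)"
  using t
proof (induction l arbitrary: t)
  case 0
  then show ?case using base by (simp add: gen_prod.simps(1)[abs_def])
next
  case (Suc l)
  let ?x = "snd t"
  note [measurable] = g[unfolded fraction_def, THEN conjunct1] d[unfolded fraction_def, THEN conjunct1]
    e[unfolded fraction_def, THEN conjunct1]
  have fr: "fraction (gen_prod l \<gamma>)" "fraction (gen_prod l \<delta>)" "fraction (gen_prod l \<epsilon>)"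
    using g d e by (auto intro: fraction_gen_prod)
  have mono: "gen_prod l \<delta> \<omega> \<le> gen_prod l \<gamma> \<omega>" "gen_prod l \<epsilon> \<omega> \<le> gen_prod l \<gamma> \<omega>" for \<omega>
  proof -
    have "gen_prod l \<delta> \<omega> \<le> gen_prod l \<gamma> \<omega>" if "\<And>\<omega>. 0 \<le> \<delta> \<omega>" "\<And>\<omega>. \<delta> \<omega> \<le> 1" "\<And>\<omega>. \<delta> \<omega> \<le> \<gamma> \<omega>" for \<delta>
      using that(3) by (induction l arbitrary: \<omega>) (auto intro!: prod_mono gen_prod_bounds(1)[OF that(1,2)])
    then show "gen_prod l \<delta> \<omega> \<le> gen_prod l \<gamma> \<omega>" "gen_prod l \<epsilon> \<omega> \<le> gen_prod l \<gamma> \<omega>"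
      using d e le by (auto simp: fraction_def)
  qed
  define u v w where "u = cexp Q (gen_prod l \<gamma>)" and "v = cexp Q (gen_prod l \<delta>)" and "w = cexp Q (gen_prod l \<epsilon>)"
  have m[measurable]: "u \<in> borel_measurable (count_space UNIV \<Otimes>\<^sub>M borel)"
    "v \<in> borel_measurable (count_space UNIV \<Otimes>\<^sub>M borel)" "w \<in> borel_measurable (count_space UNIV \<Otimes>\<^sub>M borel)"
    unfolding u_def v_def w_def by measurable
  have bd: "0 \<le> u s" "u s \<le> 1" "0 \<le> v s" "v s \<le> 1" "0 \<le> w s" "w s \<le> 1" "v s \<le> u s" "w s \<le> u s" for s
    unfolding u_def v_def w_def using fr mono by (auto intro: cexp_fraction cexp_mono)
  have q: "quad 1 (\<lambda>s. 1 - u s)" "quad 1 (\<lambda>s. 1 - v s)" "quad 1 (\<lambda>s. 1 - w s)"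
    "quad 1 (\<lambda>s. u s - v s)" "quad 1 (\<lambda>s. u s - w s)"
    by (rule quad_1, measurable, use bd in \<open>simp add: diff_le_eq add_increasing2\<close>)+
  let ?k = "kappa Q ?x"
  \<comment> \<open>A is the base of the power for \<gamma>; a and b are the amounts by which the
    bases for \<delta> and \<epsilon> lie below it.\<close>
  define A a b where "A = 1 - ?k (\<lambda>s. 1 - u s)" and "a = ?k (\<lambda>s. u s - v s)" and "b = ?k (\<lambda>s. u s - w s)"
  have v': "1 - ?k (\<lambda>s. 1 - v s) = A - a"
    using kappa_diff[OF q(2,1), of ?x] by (simp add: A_def a_def)
  have w': "1 - ?k (\<lambda>s. 1 - w s) = A - b"
    using kappa_diff[OF q(3,1), of ?x] by (simp add: A_def b_def)
  have nn: "0 \<le> a" "0 \<le> b" "a \<le> A" "b \<le> A"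
  proof -
    show "0 \<le> a" "0 \<le> b"
      unfolding a_def b_def
      by (rule kappa_le_1(1)[OF _ _ Suc.prems], measurable, use bd in \<open>simp add: diff_le_eq add_increasing2\<close>)+
    have "?k (\<lambda>s. 1 - v s) \<le> 1" "?k (\<lambda>s. 1 - w s) \<le> 1"
      by (rule kappa_le_1(2)[OF _ _ Suc.prems], measurable, use bd in simp)+
    then show "a \<le> A" "b \<le> A" using v' w' by linarith+
  qed
  have "a \<le> ?k (\<lambda>s. C * (u s - w s))"
    unfolding a_def
    by (rule kappa_mono[OF q(4) quad_cmult[OF q(5)] _ Suc.prems]) (use Suc.IH in \<open>simp add: u_def v_def w_def\<close>)
  then have ab: "a \<le> C * b" by (simp add: kappa_cmult b_def)
  have "A ^ fst t - (A - a) ^ fst t \<le> C * (A ^ fst t - (A - b) ^ fst t)"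
    by (rule power_drop_compare[OF nn(1,3,2,4) ab C])
  then show ?case
    unfolding cexp_gen_prod_Suc[OF Suc.prems g] cexp_gen_prod_Suc[OF Suc.prems d] cexp_gen_prod_Suc[OF Suc.prems e]
    unfolding u_def[symmetric] v_def[symmetric] w_def[symmetric] v' w' A_def[symmetric] .
qed

text \<open>The eigenfunction at the root; its generation sums, normalised by \<open>\<beta> ^ l\<close>, form the
  martingale of the process. Off the almost sure event of positive thresholds it is cut at 0.\<close>

definition root_h :: "marks \<Rightarrow> real" where
  "root_h \<omega> = max 0 (h (pot_deg \<omega> [], threshold \<omega> []))"

definition W :: "nat \<Rightarrow> marks \<Rightarrow> real" where
  "W l \<omega> = gen_sum l root_h \<omega> / \<beta> ^ l"

lemma measurable_root_h [measurable]: "root_h \<in> borel_measurable marks_space"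
  unfolding root_h_def[abs_def] by measurable

lemma root_h_nonneg: "0 \<le> root_h \<omega>"
  by (simp add: root_h_def)

lemma measurable_W [measurable]: "W l \<in> borel_measurable marks_space"
  unfolding W_def[abs_def] by measurable

lemma W_nonneg: "0 \<le> W l \<omega>"
  using beta_gt_1 gen_sum_nonneg[of root_h, OF root_h_nonneg] by (simp add: W_def)

lemma root_h_graft: "0 < snd t \<Longrightarrow> root_h (graft t b) = h t"
  using h_nonneg by (simp add: root_h_def max_def)

lemma cexp_root_h: "0 < snd t \<Longrightarrow> cexp Q root_h t = h t"
  by (simp add: cexp_def root_h_graft en.prob_space[simplified])

lemma cexp_root_h_sq: "0 < snd t \<Longrightarrow> cexp Q (\<lambda>\<omega>. (root_h \<omega>)\<^sup>2) t = (h t)\<^sup>2"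
  by (simp add: cexp_def root_h_graft en.prob_space[simplified])

lemma sq_bounded_root_h: "sq_bounded root_h"
  unfolding sq_bounded_def
proof (intro conjI allI impI exI)
  show "quad (c2\<^sup>2) (cexp Q (\<lambda>\<omega>. (root_h \<omega>)\<^sup>2))"
    by (rule quad_mono_fun[OF quad_h2]) (auto simp: cexp_root_h_sq)
qed (simp_all add: root_h_graft)

text \<open>Iterates the eigenvalue equation \<open>mean_op_h\<close>; after division by \<beta>^l
  the conditional mean does not depend on l, as befits a martingale.\<close>

lemma cexp_gen_sum_root_h: "0 < snd t \<Longrightarrow> cexp Q (gen_sum l root_h) t = \<beta> ^ l * h t"
proof (induction l arbitrary: t)
  case 0
  then show ?case by (simp add: gen_sum.simps(1)[abs_def] cexp_root_h)
next
  case (Suc l)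
  obtain C where C: "quad C (cexp Q (gen_sum l root_h))"
    by (rule quad_cexp[OF sq_bounded_gen_sum[OF sq_bounded_root_h]])
  note D = quad_cmult[OF quad_h, of "\<beta> ^ l"]
  have "mean_op (cexp Q (gen_sum l root_h)) t = mean_op (\<lambda>s. \<beta> ^ l * h s) t"
    by (intro antisym mean_op_mono[OF C D] mean_op_mono[OF D C]) (simp_all add: Suc)
  then show ?case
    using cexp_gen_sum_Suc[OF sq_bounded_root_h Suc.prems, of l] mean_op_h[OF Suc.prems]
    by (simp add: mean_op_cmult del: gen_sum.simps)
qed

lemma sq_bounded_diff:
  assumes \<xi>: "sq_bounded \<xi>" and \<psi>: "sq_bounded \<psi>"
  shows "sq_bounded (\<lambda>\<omega>. \<xi> \<omega> - c * \<psi> \<omega>)"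
proof -
  note [measurable] = sq_bounded_measurable[OF \<xi>] sq_bounded_measurable[OF \<psi>]
  obtain C where C: "quad C (cexp Q (\<lambda>\<omega>. (\<xi> \<omega>)\<^sup>2))" using \<xi> by (auto simp: sq_bounded_def)
  obtain C' where C': "quad C' (cexp Q (\<lambda>\<omega>. (\<psi> \<omega>)\<^sup>2))" using \<psi> by (auto simp: sq_bounded_def)
  have b: "(x - c * y)\<^sup>2 \<le> 2 * x\<^sup>2 + (2 * c\<^sup>2) * y\<^sup>2" for x y :: real
  proof -
    have "0 \<le> (x + c * y)\<^sup>2" by simp
    then show ?thesis by (simp add: power2_eq_square algebra_simps)
  qed
  have i: "integrable \<E> (\<lambda>b. 2 * (\<xi> (graft t b))\<^sup>2 + (2 * c\<^sup>2) * (\<psi> (graft t b))\<^sup>2)" if "0 < snd t" for t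
    using sq_bounded_integrable_graft(1)[OF \<xi> that] sq_bounded_integrable_graft(1)[OF \<psi> that] by auto
  have i2: "integrable \<E> (\<lambda>b. (\<xi> (graft t b) - c * \<psi> (graft t b))\<^sup>2)" if "0 < snd t" for t
  proof (rule Bochner_Integration.integrable_bound[OF i[OF that]])
    show "AE x in \<E>. norm ((\<xi> (graft t x) - c * \<psi> (graft t x))\<^sup>2)
         \<le> norm (2 * (\<xi> (graft t x))\<^sup>2 + 2 * c\<^sup>2 * (\<psi> (graft t x))\<^sup>2)"
      using b by (intro AE_I2) simp
  qed measurable
  show ?thesis
    unfolding sq_bounded_def
  proof (intro conjI allI impI exI)
    show "quad (\<bar>2\<bar> * C + \<bar>2 * c\<^sup>2\<bar> * C') (cexp Q (\<lambda>\<omega>. (\<xi> \<omega> - c * \<psi> \<omega>)\<^sup>2))"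
    proof (rule quad_mono_fun[OF quad_add[OF quad_cmult[OF C] quad_cmult[OF C']]])
      fix t :: "nat \<times> real" assume t: "0 < snd t"
      have "cexp Q (\<lambda>\<omega>. (\<xi> \<omega> - c * \<psi> \<omega>)\<^sup>2) t \<le> (\<integral>b. 2 * (\<xi> (graft t b))\<^sup>2 + (2 * c\<^sup>2) * (\<psi> (graft t b))\<^sup>2 \<partial>\<E>)"
        unfolding cexp_def by (rule integral_mono[OF i2[OF t] i[OF t] b])
      also have "\<dots> = 2 * cexp Q (\<lambda>\<omega>. (\<xi> \<omega>)\<^sup>2) t + (2 * c\<^sup>2) * cexp Q (\<lambda>\<omega>. (\<psi> \<omega>)\<^sup>2) t"
        unfolding cexp_def
        using sq_bounded_integrable_graft(1)[OF \<xi> t] sq_bounded_integrable_graft(1)[OF \<psi> t] by simp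
      finally show "\<bar>cexp Q (\<lambda>\<omega>. (\<xi> \<omega> - c * \<psi> \<omega>)\<^sup>2) t\<bar>
        \<le> \<bar>2 * cexp Q (\<lambda>\<omega>. (\<xi> \<omega>)\<^sup>2) t + (2 * c\<^sup>2) * cexp Q (\<lambda>\<omega>. (\<psi> \<omega>)\<^sup>2) t\<bar>"
        by (simp add: cexp_def)
    qed measurable
  qed (use i2 in auto)
qed

lemma sq_bounded_bounded:
  assumes [measurable]: "\<xi> \<in> borel_measurable marks_space" and b: "\<And>\<omega>. \<bar>\<xi> \<omega>\<bar> \<le> c"
  shows "sq_bounded \<xi>"
proof -
  have b2: "\<bar>(\<xi> \<omega>)\<^sup>2\<bar> \<le> c\<^sup>2" for \<omega>
    using b[of \<omega>] by (simp add: abs_le_square_iff[symmetric] power2_le_iff_abs_le)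
  have i: "integrable \<E> (\<lambda>b. (\<xi> (graft t b))\<^sup>2)" for t
    by (rule integrable_env_bounded[where c="c\<^sup>2"]) (use b2 in auto)
  have "quad \<bar>c\<^sup>2\<bar> (cexp Q (\<lambda>\<omega>. (\<xi> \<omega>)\<^sup>2))"
  proof (rule quad_mono_fun[OF quad_const])
    fix t :: "nat \<times> real"
    have "cexp Q (\<lambda>\<omega>. (\<xi> \<omega>)\<^sup>2) t \<le> (\<integral>b. c\<^sup>2 \<partial>\<E>)"
      unfolding cexp_def by (rule integral_mono[OF i]) (use b2 in auto)
    then show "\<bar>cexp Q (\<lambda>\<omega>. (\<xi> \<omega>)\<^sup>2) t\<bar> \<le> \<bar>c\<^sup>2\<bar>"
      by (simp add: en.prob_space[simplified]) (simp add: cexp_def)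
  qed measurable
  then show ?thesis unfolding sq_bounded_def using i by auto
qed

end

section \<open>Laplace transforms and extinction\<close>

lemma (in prob_space) L1_le_L2:
  fixes X :: "'a \<Rightarrow> real"
  assumes [measurable]: "X \<in> borel_measurable M" and X2: "integrable M (\<lambda>x. (X x)\<^sup>2)"
  shows "expectation (\<lambda>x. \<bar>X x\<bar>) \<le> sqrt (expectation (\<lambda>x. (X x)\<^sup>2))"
proof (rule real_le_rsqrt)
  have X: "integrable M (\<lambda>x. \<bar>X x\<bar>)"
    using square_integrable_imp_integrable[OF _ X2] by auto
  have "0 \<le> expectation (\<lambda>x. (\<bar>X x\<bar> - expectation (\<lambda>x. \<bar>X x\<bar>))\<^sup>2)" by simp
  also have "\<dots> = expectation (\<lambda>x. (\<bar>X x\<bar>)\<^sup>2) - (expectation (\<lambda>x. \<bar>X x\<bar>))\<^sup>2"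
    using X X2 by (intro variance_eq) auto
  finally show "(expectation (\<lambda>x. \<bar>X x\<bar>))\<^sup>2 \<le> expectation (\<lambda>x. (X x)\<^sup>2)" by simp
qed

lemma exp_minus_le_quadratic:
  fixes x :: real
  assumes "0 \<le> x"
  shows "exp (- x) \<le> 1 - x + x\<^sup>2 / 2"
proof -
  let ?g = "\<lambda>x. 1 - x + x\<^sup>2 / 2 - exp (- x) :: real"
  have "?g 0 \<le> ?g x"
  proof (rule DERIV_nonneg_imp_nondecreasing[OF assms])
    fix y :: real assume "0 \<le> y"
    have "(?g has_real_derivative (y - 1 + exp (- y))) (at y)"
      by (auto intro!: derivative_eq_intros)
    moreover have "0 \<le> y - 1 + exp (- y)"
      using exp_ge_add_one_self[of "- y"] by simp
    ultimately show "\<exists>d. (?g has_real_derivative d) (at y) \<and> 0 \<le> d" by blast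
  qed
  then show ?thesis by simp
qed

lemma exp_minus_lipschitz:
  fixes x y :: real
  assumes "0 \<le> x" "0 \<le> y"
  shows "exp (- x) \<le> exp (- y) + \<bar>x - y\<bar>"
proof (cases "y \<le> x")
  case True
  then have "exp (- x) \<le> exp (- y)" by simp
  then show ?thesis by (smt (verit) abs_ge_zero)
next
  case False
  have e: "1 - exp (- (y - x)) \<le> y - x"
    using exp_ge_add_one_self[of "- (y - x)"] by linarith
  have "exp (- x) * (1 - exp (- (y - x))) \<le> 1 * (y - x)"
    by (rule mult_mono[OF _ e]) (use assms False in auto)
  moreover have "exp (- x) - exp (- y) = exp (- x) * (1 - exp (- (y - x)))"
    by (simp add: right_diff_distrib mult_exp_exp)
  ultimately show ?thesis using False by simp
qed

text \<open>A product of zeros is 0 unless it is empty, so this is the indicator that generation l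
  has no vertices.\<close>

abbreviation extinct :: "nat \<Rightarrow> marks \<Rightarrow> real" where
  "extinct l \<equiv> gen_prod l (\<lambda>_. 0)"

lemma fraction_zero: "fraction (\<lambda>_. 0)"
  by (simp add: fraction_def)

lemma extinct_cases: "extinct l \<omega> = 0 \<or> extinct l \<omega> = 1"
  by (induction l arbitrary: \<omega>) (simp_all, metis (mono_tags, lifting) prod.neutral prod_zero finite_kept)

lemma extinct_mono: "extinct l \<omega> \<le> extinct (Suc l) \<omega>"
proof (induction l arbitrary: \<omega>)
  case 0
  then show ?case using extinct_cases[of 1 \<omega>] by auto
next
  case (Suc l)
  have "(\<Prod>j\<in>kept \<omega>. extinct l (subtree j \<omega>)) \<le> (\<Prod>j\<in>kept \<omega>. extinct (Suc l) (subtree j \<omega>))"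
    using Suc fraction_gen_prod[OF fraction_zero, of l] by (intro prod_mono) (auto simp: fraction_def)
  then show ?case by simp
qed

lemma extinct_mono': "k \<le> l \<Longrightarrow> extinct k \<omega> \<le> extinct l \<omega>"
  by (induction rule: dec_induct) (auto intro: order_trans[OF _ extinct_mono] simp del: gen_prod.simps)

lemma gen_sum_extinct: "extinct l \<omega> = 1 \<Longrightarrow> gen_sum l \<xi> \<omega> = 0"
proof (induction l arbitrary: \<omega>)
  case (Suc l)
  have "extinct l (subtree j \<omega>) = 1" if "j \<in> kept \<omega>" for j
  proof (rule ccontr)
    assume "extinct l (subtree j \<omega>) \<noteq> 1"
    then have "extinct l (subtree j \<omega>) = 0" using extinct_cases by blast
    then have "(\<Prod>j\<in>kept \<omega>. extinct l (subtree j \<omega>)) = 0" using that by (intro prod_zero) auto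
    then show False using Suc.prems by (simp only: gen_prod.simps zero_neq_one)
  qed
  then show ?case using Suc.IH by (auto intro!: sum.neutral)
qed simp

context spectral_branching
begin

text \<open>W in generation k + j is \<beta>^(-k) times the sum, over the vertices of generation k,
  of W j in their subtrees.\<close>

lemma exp_W_eq_gen_prod:
  "gen_prod k (\<lambda>\<omega>. exp (- (\<theta> / \<beta> ^ k * W j \<omega>))) \<omega> = exp (- (\<theta> * W (k + j) \<omega>))"
proof -
  have "gen_sum k (\<lambda>\<omega>. \<theta> / \<beta> ^ k * W j \<omega>) \<omega> = \<theta> * W (k + j) \<omega>"
    by (simp add: W_def gen_sum_cmult[of k "\<theta> / \<beta> ^ k / \<beta> ^ j" "gen_sum j root_h", simplified] gen_sum_add power_add)
  then show ?thesis by (simp add: gen_prod_exp)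
qed

lemma W_0: "W 0 \<omega> = root_h \<omega>"
  by (simp add: W_def)

lemma fraction_exp_W: "0 \<le> \<theta> \<Longrightarrow> fraction (\<lambda>\<omega>. exp (- (\<theta> * W l \<omega>)))"
  by (rule fraction_exp) (auto intro: mult_nonneg_nonneg W_nonneg)

text \<open>\<open>second_moment_growth\<close> with \<theta> = \<beta>, which is admissible because
  \<beta> > 1; raising the constant to B + 1 accommodates generation 0.\<close>

lemma gen_sum_root_h_second_moment:
  obtains B where "0 \<le> B"
    "\<And>l t. 0 < snd t \<Longrightarrow> cexp Q (\<lambda>\<omega>. (gen_sum l root_h \<omega>)\<^sup>2) t \<le> B * (\<beta>\<^sup>2) ^ l * (h t + (h t)\<^sup>2)"
proof -
  have b2: "\<beta> < \<beta>\<^sup>2" using beta_gt_1 by (simp add: power2_eq_square)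
  obtain B where B: "0 \<le> B" "\<And>l t. 0 < snd t \<Longrightarrow>
     cexp Q (\<lambda>\<omega>. (gen_sum (Suc l) root_h \<omega>)\<^sup>2) t \<le> B * (\<beta>\<^sup>2) ^ Suc l * (h t + (h t)\<^sup>2)"
  proof (rule second_moment_growth[OF sq_bounded_root_h _ b2, of 1])
    show "0 < \<beta>" using beta_gt_1 by simp
    fix l and t :: "nat \<times> real" assume t: "0 < snd t"
    show "\<bar>cexp Q (gen_sum (Suc l) root_h) t\<bar> \<le> 1 * \<beta> ^ Suc l * h t"
      unfolding cexp_gen_sum_root_h[OF t] using h_nonneg[OF t] beta_gt_1 by simp
  qed (auto intro: that)
  have "cexp Q (\<lambda>\<omega>. (gen_sum l root_h \<omega>)\<^sup>2) t \<le> (B + 1) * (\<beta>\<^sup>2) ^ l * (h t + (h t)\<^sup>2)" if t: "0 < snd t" for l t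
  proof (cases l)
    case 0
    have "0 \<le> B * (h t + (h t)\<^sup>2)" using B(1) h_nonneg[OF t] by simp
    then show ?thesis using h_nonneg[OF t] by (simp add: 0 cexp_root_h_sq[OF t] ring_distribs)
  next
    case (Suc k)
    have "0 \<le> (\<beta>\<^sup>2) ^ l * (h t + (h t)\<^sup>2)" using h_nonneg[OF t] by simp
    then show ?thesis using B(2)[OF t, of k] unfolding Suc by (simp only: ring_distribs)
  qed
  with B(1) show ?thesis using that[of "B + 1"] by auto
qed

lemma cexp_W_sq_le:
  obtains B where "0 \<le> B" "\<And>l t. 0 < snd t \<Longrightarrow> cexp Q (\<lambda>\<omega>. (W l \<omega>)\<^sup>2) t \<le> B * (h t + (h t)\<^sup>2)"
proof -
  obtain B where B: "0 \<le> B"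
    "\<And>l t. 0 < snd t \<Longrightarrow> cexp Q (\<lambda>\<omega>. (gen_sum l root_h \<omega>)\<^sup>2) t \<le> B * (\<beta>\<^sup>2) ^ l * (h t + (h t)\<^sup>2)"
    by (rule gen_sum_root_h_second_moment) blast
  have "cexp Q (\<lambda>\<omega>. (W l \<omega>)\<^sup>2) t \<le> B * (h t + (h t)\<^sup>2)" if t: "0 < snd t" for l t
  proof -
    have pos: "0 < (\<beta>\<^sup>2) ^ l" using beta_gt_1 by simp
    have "cexp Q (\<lambda>\<omega>. (W l \<omega>)\<^sup>2) t = cexp Q (\<lambda>\<omega>. (gen_sum l root_h \<omega>)\<^sup>2) t / (\<beta>\<^sup>2) ^ l"
      by (simp add: cexp_def W_def power_divide power_mult[symmetric] mult.commute)
    also have "\<dots> \<le> (B * (\<beta>\<^sup>2) ^ l * (h t + (h t)\<^sup>2)) / (\<beta>\<^sup>2) ^ l"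
      using B(2)[OF t, of l] pos by (intro divide_right_mono) auto
    also have "\<dots> = B * (h t + (h t)\<^sup>2)" using beta_gt_1 by auto
    finally show ?thesis .
  qed
  with B(1) show ?thesis using that by blast
qed

lemma sq_bounded_W: "sq_bounded (W l)"
proof -
  have "sq_bounded (\<lambda>\<omega>. (\<lambda>_. 0) \<omega> - (- 1 / \<beta> ^ l) * gen_sum l root_h \<omega>)"
    by (rule sq_bounded_diff[OF sq_bounded_bounded[where c=0] sq_bounded_gen_sum[OF sq_bounded_root_h]]) auto
  then show ?thesis by (simp add: W_def[abs_def])
qed

lemma cexp_W: "0 < snd t \<Longrightarrow> cexp Q (W l) t = h t"
  using cexp_gen_sum_root_h[of t l] beta_gt_1 by (simp add: cexp_def W_def)

text \<open>From \<open>exp (- y) <= 1 - y + y\<^sup>2 / 2\<close>: the conditional mean of W l is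
  exactly h, and its second moment is bounded uniformly in l.\<close>

lemma one_minus_laplace_ge:
  assumes t: "0 < snd t" and \<theta>: "0 \<le> \<theta>"
    and B: "\<And>l t. 0 < snd t \<Longrightarrow> cexp Q (\<lambda>\<omega>. (W l \<omega>)\<^sup>2) t \<le> B * (h t + (h t)\<^sup>2)"
  shows "\<theta> * h t - \<theta>\<^sup>2 * (B * (h t + (h t)\<^sup>2)) / 2 \<le> 1 - cexp Q (\<lambda>\<omega>. exp (- (\<theta> * W l \<omega>))) t"
proof -
  note i = sq_bounded_integrable_graft[OF sq_bounded_W t, of l]
  have "cexp Q (\<lambda>\<omega>. exp (- (\<theta> * W l \<omega>))) t \<le> (\<integral>b. 1 - \<theta> * W l (graft t b) + \<theta>\<^sup>2 / 2 * (W l (graft t b))\<^sup>2 \<partial>\<E>)"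
    unfolding cexp_def
  proof (rule integral_mono)
    show "integrable \<E> (\<lambda>b. exp (- (\<theta> * W l (graft t b))))"
      by (rule fraction_integrable[OF fraction_exp_W[OF \<theta>]])
    fix b
    show "exp (- (\<theta> * W l (graft t b))) \<le> 1 - \<theta> * W l (graft t b) + \<theta>\<^sup>2 / 2 * (W l (graft t b))\<^sup>2"
      using exp_minus_le_quadratic[of "\<theta> * W l (graft t b)"] \<theta> W_nonneg by (simp add: power_mult_distrib)
  qed (use i in auto)
  also have "\<dots> = 1 - \<theta> * cexp Q (W l) t + \<theta>\<^sup>2 / 2 * cexp Q (\<lambda>\<omega>. (W l \<omega>)\<^sup>2) t"
    unfolding cexp_def using i by (simp add: en.prob_space[simplified])
  also have "\<dots> \<le> 1 - \<theta> * h t + \<theta>\<^sup>2 / 2 * (B * (h t + (h t)\<^sup>2))"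
    unfolding cexp_W[OF t] using B[OF t] by (intro add_left_mono mult_left_mono) auto
  finally show ?thesis by simp
qed

lemma quad_W2: "quad (c2 + c2\<^sup>2) (\<lambda>t. h t + (h t)\<^sup>2)"
  by (rule quad_add[OF quad_h quad_h2])

text \<open>Every potential child is connected with probability at most K0 * min x 1 / x and, given that,
  starts a surviving population with probability bounded below.\<close>

lemma extinct_le_laplace:
  obtains C \<kappa>1 where "1 \<le> C" "0 < \<kappa>1"
    "\<And>\<kappa> j t. \<kappa>1 \<le> \<kappa> \<Longrightarrow> 0 < snd t \<Longrightarrow>
       1 - cexp Q (extinct 1) t \<le> C * (1 - cexp Q (\<lambda>\<omega>. exp (- (\<kappa> * W (Suc j) \<omega>))) t)"
proof -
  obtain B where B: "0 \<le> B" "\<And>l t. 0 < snd t \<Longrightarrow> cexp Q (\<lambda>\<omega>. (W l \<omega>)\<^sup>2) t \<le> B * (h t + (h t)\<^sup>2)"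
    by (rule cexp_W_sq_le) blast
  define I1 where "I1 = (\<integral>s. min 1 (snd s) * h s \<partial>\<mu>)"
  define I2 where "I2 = (\<integral>s. min 1 (snd s) * (B * (h s + (h s)\<^sup>2) / 2) \<partial>\<mu>)"
  have qB: "quad (\<bar>B / 2\<bar> * (c2 + c2\<^sup>2)) (\<lambda>s. B * (h s + (h s)\<^sup>2) / 2)"
    using quad_cmult[OF quad_W2, of "B / 2"] by simp
  have I1: "0 < I1"
  proof -
    have "I1 = \<beta> * f 1" using eigen[of 1] by (simp add: I1_def h_def)
    then show ?thesis using f_pos[of 1] beta_gt_1 by simp
  qed
  have I2: "0 \<le> I2" unfolding I2_def
  proof (rule integral_nonneg_AE)
    show "AE s in \<mu>. 0 \<le> min 1 (snd s) * (B * (h s + (h s)\<^sup>2) / 2)"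
      using AE_type_law_pos[of Q] by eventually_elim (use B(1) h_nonneg in \<open>simp\<close>)
  qed
  \<comment> \<open>Small enough for \<kappa>0 * I1 - \<kappa>0^2 * I2 to be positive; adding 1
    rules out a zero denominator. That value, p0, bounds from below, uniformly in l, the weighted
    integral of one minus the Laplace transform at every \<kappa> >= \<kappa>0.\<close>
  define \<kappa>0 where "\<kappa>0 = I1 / (I2 + 1)"
  have \<kappa>0: "0 < \<kappa>0" using I1 I2 by (simp add: \<kappa>0_def)
  define p0 where "p0 = \<kappa>0 * (I1 - \<kappa>0 * I2)"
  have p0: "0 < p0"
  proof -
    have "\<kappa>0 * I2 < \<kappa>0 * (I2 + 1)" using \<kappa>0 by simp
    also have "\<dots> = I1" using I2 by (simp add: \<kappa>0_def)
    finally show ?thesis using \<kappa>0 by (simp add: p0_def)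
  qed
  define C where "C = max 1 (K0 / p0)"
  have mass: "p0 \<le> (\<integral>s. min 1 (snd s) * (1 - cexp Q (\<lambda>\<omega>. exp (- (\<kappa> * W l \<omega>))) s) \<partial>\<mu>)" if \<kappa>: "\<kappa>0 \<le> \<kappa>" for \<kappa> l
  proof -
    have fr: "fraction (\<lambda>\<omega>. exp (- (\<kappa> * W l \<omega>)))" using \<kappa> \<kappa>0 by (intro fraction_exp_W) auto
    have q: "quad 1 (\<lambda>s. 1 - cexp Q (\<lambda>\<omega>. exp (- (\<kappa> * W l \<omega>))) s)"
      by (rule quad_1, measurable, use cexp_fraction[OF fr] in simp)
    have "p0 = \<kappa>0 * I1 - \<kappa>0\<^sup>2 * I2"
      by (simp add: p0_def power2_eq_square right_diff_distrib)
    also have "\<dots> = (\<integral>s. \<kappa>0 * (min 1 (snd s) * h s) - \<kappa>0\<^sup>2 * (min 1 (snd s) * (B * (h s + (h s)\<^sup>2) / 2)) \<partial>\<mu>)"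
      unfolding I1_def I2_def using quad_integrable(2)[OF quad_h, of 1] quad_integrable(2)[OF qB, of 1]
      by (subst Bochner_Integration.integral_diff) (simp_all only: integrable_mult_right integral_mult_right_zero)
    also have "\<dots> \<le> (\<integral>s. min 1 (snd s) * (1 - cexp Q (\<lambda>\<omega>. exp (- (\<kappa> * W l \<omega>))) s) \<partial>\<mu>)"
    proof (rule integral_mono_AE)
      show "AE s in \<mu>. \<kappa>0 * (min 1 (snd s) * h s) - \<kappa>0\<^sup>2 * (min 1 (snd s) * (B * (h s + (h s)\<^sup>2) / 2))
         \<le> min 1 (snd s) * (1 - cexp Q (\<lambda>\<omega>. exp (- (\<kappa> * W l \<omega>))) s)"
        using AE_type_law_pos[of Q]
      proof eventually_elim
        case (elim s)
        have "cexp Q (\<lambda>\<omega>. exp (- (\<kappa> * W l \<omega>))) s \<le> cexp Q (\<lambda>\<omega>. exp (- (\<kappa>0 * W l \<omega>))) s"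
          using \<kappa> \<kappa>0 W_nonneg by (intro cexp_mono fr fraction_exp_W) (auto intro: mult_right_mono)
        then have "\<kappa>0 * h s - \<kappa>0\<^sup>2 * (B * (h s + (h s)\<^sup>2)) / 2 \<le> 1 - cexp Q (\<lambda>\<omega>. exp (- (\<kappa> * W l \<omega>))) s"
          using one_minus_laplace_ge[OF elim _ B(2), of \<kappa>0 l] \<kappa>0 by linarith
        then have "min 1 (snd s) * (\<kappa>0 * h s - \<kappa>0\<^sup>2 * (B * (h s + (h s)\<^sup>2)) / 2)
          \<le> min 1 (snd s) * (1 - cexp Q (\<lambda>\<omega>. exp (- (\<kappa> * W l \<omega>))) s)"
          using elim by (intro mult_left_mono) auto
        moreover have "min 1 (snd s) * (\<kappa>0 * h s - \<kappa>0\<^sup>2 * (B * (h s + (h s)\<^sup>2)) / 2)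
          = \<kappa>0 * (min 1 (snd s) * h s) - \<kappa>0\<^sup>2 * (min 1 (snd s) * (B * (h s + (h s)\<^sup>2) / 2))"
          by (simp add: right_diff_distrib mult_ac)
        ultimately show ?case by simp
      qed
    qed (intro Bochner_Integration.integrable_diff integrable_mult_right
          quad_integrable(2)[OF quad_h] quad_integrable(2)[OF qB] quad_integrable(2)[OF q])+
    finally show ?thesis .
  qed
  have "1 - cexp Q (extinct 1) t \<le> C * (1 - cexp Q (\<lambda>\<omega>. exp (- (\<kappa> * W (Suc j) \<omega>))) t)"
    if \<kappa>: "\<beta> * \<kappa>0 \<le> \<kappa>" and t: "0 < snd t" for \<kappa> j t
  proof -
    let ?x = "snd t"
    have \<kappa>': "\<kappa>0 \<le> \<kappa> / \<beta>" using \<kappa> beta_gt_1 by (simp add: field_simps)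
    define \<gamma> where "\<gamma> = (\<lambda>\<omega>. exp (- (\<kappa> / \<beta> * W j \<omega>)))"
    have fr: "fraction \<gamma>" unfolding \<gamma>_def using \<kappa>' \<kappa>0 by (intro fraction_exp_W) auto
    have [measurable]: "\<gamma> \<in> borel_measurable marks_space" using fr by (simp add: fraction_def)
    have q: "quad 1 (\<lambda>s. 1 - cexp Q \<gamma> s)"
      by (rule quad_1, measurable, use cexp_fraction[OF fr] in simp)
    have q1: "quad 1 (\<lambda>s. 1)" using quad_const[of 1] by simp
    define b where "b = kappa Q ?x (\<lambda>s. 1 - cexp Q \<gamma> s)"
    define a where "a = kappa Q ?x (\<lambda>s. 1)"
    have ab: "0 \<le> a" "a \<le> 1" "0 \<le> b" "b \<le> 1"
    proof -
      have m: "(\<lambda>s. 1 - cexp Q \<gamma> s) \<in> borel_measurable (count_space UNIV \<Otimes>\<^sub>M borel)" by measurable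
      have bd: "0 \<le> 1 - cexp Q \<gamma> s \<and> 1 - cexp Q \<gamma> s \<le> 1" for s
        using cexp_fraction[OF fr, of s] by simp
      show "0 \<le> a" "a \<le> 1" "0 \<le> b" "b \<le> 1"
        unfolding a_def b_def using kappa_le_1[OF m bd t] kappa_le_1[of "\<lambda>s. 1", OF _ _ t] by auto
    qed
    \<comment> \<open>Both quantities are of order \<open>min x 1 / x\<close>: a is at most K0 times
      this, while \<open>min x 1 * min 1 z <= min x z\<close> bounds b from below by p0 times
      it.\<close>
    have "a \<le> C * b"
    proof -
      have "(\<integral>s. min ?x (snd s) * 1 \<partial>\<mu>) \<le> 1 * K0 * min ?x 1"
        using quad_integrable(3)[OF q1 t] by (simp add: abs_le_iff)
      also have "\<dots> \<le> C * (min ?x 1 * p0)"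
      proof -
        have "K0 / p0 \<le> C" by (simp add: C_def)
        then have "K0 \<le> C * p0" using p0 by (simp add: pos_divide_le_eq)
        then have "K0 * min ?x 1 \<le> C * p0 * min ?x 1" using t by (intro mult_right_mono) auto
        then show ?thesis by (simp add: mult_ac)
      qed
      also have "\<dots> \<le> C * (min ?x 1 * (\<integral>s. min 1 (snd s) * (1 - cexp Q \<gamma> s) \<partial>\<mu>))"
        using mass[OF \<kappa>', of j] t by (intro mult_left_mono) (auto simp: \<gamma>_def C_def)
      also have "\<dots> = C * (\<integral>s. min ?x 1 * (min 1 (snd s) * (1 - cexp Q \<gamma> s)) \<partial>\<mu>)"
        by simp
      also have "\<dots> \<le> C * (\<integral>s. min ?x (snd s) * (1 - cexp Q \<gamma> s) \<partial>\<mu>)"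
      proof (intro mult_left_mono integral_mono_AE)
        show "AE s in \<mu>. min ?x 1 * (min 1 (snd s) * (1 - cexp Q \<gamma> s)) \<le> min ?x (snd s) * (1 - cexp Q \<gamma> s)"
          using AE_type_law_pos[of Q]
        proof eventually_elim
          case (elim s)
          have "min ?x 1 * min 1 (snd s) \<le> min ?x (snd s)"
            using t elim by (auto simp: min_def mult_le_one mult_left_le mult_left_le_one_le)
          then have "min ?x 1 * min 1 (snd s) * (1 - cexp Q \<gamma> s) \<le> min ?x (snd s) * (1 - cexp Q \<gamma> s)"
            using cexp_fraction(2)[OF fr] by (intro mult_right_mono) auto
          then show ?case by (simp add: mult.assoc)
        qed
      qed (use quad_integrable(2)[OF q] in \<open>auto simp: C_def\<close>)
      finally show ?thesis
        unfolding a_def b_def kappa_eq times_divide_eq_right using t by (intro divide_right_mono) auto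
    qed
    \<comment> \<open>The same exponent occurs on both sides, so C does not depend on the number of
      potential children.\<close>
    then have "1 ^ fst t - (1 - a) ^ fst t \<le> C * (1 ^ fst t - (1 - b) ^ fst t)"
      using ab by (intro power_drop_compare) (auto simp: C_def)
    moreover have "cexp Q (extinct 1) t = (1 - a) ^ fst t"
      using cexp_gen_prod_Suc[OF t fraction_zero, of 0] by (simp add: a_def cexp_def)
    moreover have "cexp Q (\<lambda>\<omega>. exp (- (\<kappa> * W (Suc j) \<omega>))) t = (1 - b) ^ fst t"
    proof -
      have "(\<lambda>\<omega>. exp (- (\<kappa> * W (Suc j) \<omega>))) = gen_prod (Suc 0) \<gamma>"
        using exp_W_eq_gen_prod[of "Suc 0" \<kappa> j] by (auto simp: \<gamma>_def fun_eq_iff)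
      then show ?thesis
        using cexp_gen_prod_Suc[OF t fr, of 0] by (simp only: gen_prod.simps(1)[abs_def] b_def)
    qed
    ultimately show ?thesis by simp
  qed
  moreover have "1 \<le> C" by (simp add: C_def)
  moreover have "0 < \<beta> * \<kappa>0" using \<kappa>0 beta_gt_1 by simp
  ultimately show ?thesis using that by blast
qed

text \<open>Given the first k generations, both sides are determined by products over generation k; the
  ratio bound for a single vertex of that generation propagates back to the root.\<close>

lemma laplace_compare:
  obtains C \<kappa>1 where "1 \<le> C" "0 < \<kappa>1"
    "\<And>\<kappa> \<theta> k j t. \<kappa>1 * \<beta> ^ k \<le> \<kappa> \<Longrightarrow> 0 \<le> \<theta> \<Longrightarrow> 0 < snd t \<Longrightarrow>
       cexp Q (\<lambda>\<omega>. exp (- (\<theta> * W k \<omega>))) t - cexp Q (\<lambda>\<omega>. exp (- (\<theta> * W k \<omega>)) * extinct (Suc k) \<omega>) t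
       \<le> C * (cexp Q (\<lambda>\<omega>. exp (- (\<theta> * W k \<omega>))) t
            - cexp Q (\<lambda>\<omega>. exp (- (\<theta> * W k \<omega>)) * exp (- (\<kappa> * W (k + Suc j) \<omega>))) t)"
proof -
  obtain C \<kappa>1 where C: "1 \<le> C" "0 < \<kappa>1" and base:
    "\<And>\<kappa> j t. \<kappa>1 \<le> \<kappa> \<Longrightarrow> 0 < snd t \<Longrightarrow>
       1 - cexp Q (extinct 1) t \<le> C * (1 - cexp Q (\<lambda>\<omega>. exp (- (\<kappa> * W (Suc j) \<omega>))) t)"
    by (rule extinct_le_laplace) blast
  show ?thesis
  proof (rule that[OF C])
    fix \<kappa> \<theta> :: real and k j and t :: "nat \<times> real"
    assume \<kappa>: "\<kappa>1 * \<beta> ^ k \<le> \<kappa>" and \<theta>: "0 \<le> \<theta>" and t: "0 < snd t"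
    have bk: "0 < \<beta> ^ k" using beta_gt_1 by simp
    have \<kappa>': "\<kappa>1 \<le> \<kappa> / \<beta> ^ k" using \<kappa> bk by (simp add: pos_le_divide_eq)
    define \<gamma> \<delta> \<epsilon> where "\<gamma> = (\<lambda>\<omega>. exp (- (\<theta> / \<beta> ^ k * W 0 \<omega>)))"
      and "\<delta> = extinct 1" and "\<epsilon> = (\<lambda>\<omega>. exp (- (\<kappa> / \<beta> ^ k * W (Suc j) \<omega>)))"
    have fr: "fraction \<gamma>" "fraction \<delta>" "fraction \<epsilon>"
    proof -
      have nn: "0 \<le> \<theta> / \<beta> ^ k" "0 \<le> \<kappa> / \<beta> ^ k" using \<theta> \<kappa>' C bk by auto
      show "fraction \<gamma>" unfolding \<gamma>_def by (rule fraction_exp_W[OF nn(1)])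
      show "fraction \<epsilon>" unfolding \<epsilon>_def by (rule fraction_exp_W[OF nn(2)])
      show "fraction \<delta>" unfolding \<delta>_def by (rule fraction_gen_prod[OF fraction_zero])
    qed
    have prods: "fraction (\<lambda>\<omega>. \<gamma> \<omega> * \<delta> \<omega>)" "fraction (\<lambda>\<omega>. \<gamma> \<omega> * \<epsilon> \<omega>)"
      using fr by (auto intro: fraction_mult)
    have le: "\<gamma> \<omega> * \<delta> \<omega> \<le> \<gamma> \<omega>" "\<gamma> \<omega> * \<epsilon> \<omega> \<le> \<gamma> \<omega>" for \<omega>
      using fr by (auto intro!: mult_left_le simp: fraction_def)
    have "cexp Q \<gamma> s - cexp Q (\<lambda>\<omega>. \<gamma> \<omega> * \<delta> \<omega>) s \<le> C * (cexp Q \<gamma> s - cexp Q (\<lambda>\<omega>. \<gamma> \<omega> * \<epsilon> \<omega>) s)"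
      if s: "0 < snd s" for s
    proof -
      \<comment> \<open>Given the type the weight \<gamma> is deterministic, as W 0 is h at the
        root. It factors out of both sides, and the estimate of \<open>extinct_le_laplace\<close>
        remains.\<close>
      define g where "g = exp (- (\<theta> / \<beta> ^ k * h s))"
      have g: "\<gamma> (graft s b) = g" for b
        by (simp add: \<gamma>_def W_0 root_h_graft[OF s] g_def)
      have "cexp Q \<gamma> s = g" "cexp Q (\<lambda>\<omega>. \<gamma> \<omega> * \<delta> \<omega>) s = g * cexp Q \<delta> s"
        "cexp Q (\<lambda>\<omega>. \<gamma> \<omega> * \<epsilon> \<omega>) s = g * cexp Q \<epsilon> s"
        unfolding cexp_def g by (simp_all add: en.prob_space[simplified])
      moreover have "g * (1 - cexp Q \<delta> s) \<le> g * (C * (1 - cexp Q \<epsilon> s))"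
        unfolding \<delta>_def \<epsilon>_def by (intro mult_left_mono base \<kappa>' s) (simp add: g_def)
      ultimately show ?thesis by (simp add: algebra_simps)
    qed
    from gen_prod_compare[OF fr(1) prods C(1) le this t, of k]
    have "cexp Q (gen_prod k \<gamma>) t - cexp Q (gen_prod k (\<lambda>\<omega>. \<gamma> \<omega> * \<delta> \<omega>)) t
      \<le> C * (cexp Q (gen_prod k \<gamma>) t - cexp Q (gen_prod k (\<lambda>\<omega>. \<gamma> \<omega> * \<epsilon> \<omega>)) t)" .
    moreover have "gen_prod k \<gamma> = (\<lambda>\<omega>. exp (- (\<theta> * W k \<omega>)))"
      using exp_W_eq_gen_prod[of k \<theta> 0] by (auto simp: \<gamma>_def fun_eq_iff)
    moreover have "gen_prod k \<delta> = extinct (Suc k)"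
      unfolding \<delta>_def using gen_prod_add[of k 1 "\<lambda>_. 0"] by (auto simp: fun_eq_iff)
    moreover have "gen_prod k \<epsilon> = (\<lambda>\<omega>. exp (- (\<kappa> * W (k + Suc j) \<omega>)))"
      using exp_W_eq_gen_prod[of k \<kappa> "Suc j"] by (auto simp: \<epsilon>_def fun_eq_iff)
    ultimately show "cexp Q (\<lambda>\<omega>. exp (- (\<theta> * W k \<omega>))) t - cexp Q (\<lambda>\<omega>. exp (- (\<theta> * W k \<omega>)) * extinct (Suc k) \<omega>) t
       \<le> C * (cexp Q (\<lambda>\<omega>. exp (- (\<theta> * W k \<omega>))) t
            - cexp Q (\<lambda>\<omega>. exp (- (\<theta> * W k \<omega>)) * exp (- (\<kappa> * W (k + Suc j) \<omega>))) t)"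
      by (simp only: gen_prod_mult[abs_def])
  qed
qed

text \<open>Each vertex of generation k + 1 contributes its own martingale increment over j further
  generations, centred given the type and, once normalised, of second moment bounded uniformly in j.
  \<open>zero_mean_growth\<close> adds these up to order \<beta>^(k + 1), against a normalisation of
  \<beta>^(2 (k + 1)).\<close>

lemma W_increment:
  obtains K where "0 \<le> K"
    "\<And>k j t. 0 < snd t \<Longrightarrow> cexp Q (\<lambda>\<omega>. (W (Suc k + j) \<omega> - W (Suc k) \<omega>)\<^sup>2) t \<le> K / \<beta> ^ Suc k * h t"
proof -
  obtain B where B: "0 \<le> B"
    "\<And>l t. 0 < snd t \<Longrightarrow> cexp Q (\<lambda>\<omega>. (gen_sum l root_h \<omega>)\<^sup>2) t \<le> B * (\<beta>\<^sup>2) ^ l * (h t + (h t)\<^sup>2)"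
    by (rule gen_sum_root_h_second_moment) blast
  have "cexp Q (\<lambda>\<omega>. (W (Suc k + j) \<omega> - W (Suc k) \<omega>)\<^sup>2) t \<le> B * (1 + K1) / \<beta> ^ Suc k * h t"
    if t: "0 < snd t" for k j t
  proof -
    let ?\<xi> = "\<lambda>\<omega>. gen_sum j root_h \<omega> - \<beta> ^ j * root_h \<omega>"
    have sq: "sq_bounded ?\<xi>"
      by (rule sq_bounded_diff[OF sq_bounded_gen_sum[OF sq_bounded_root_h] sq_bounded_root_h])
    have zero: "cexp Q ?\<xi> s = 0" if s: "0 < snd s" for s
    proof -
      have "cexp Q ?\<xi> s = cexp Q (gen_sum j root_h) s - \<beta> ^ j * cexp Q root_h s"
        unfolding cexp_def
        using sq_bounded_integrable_graft(2)[OF sq_bounded_gen_sum[OF sq_bounded_root_h] s]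
          sq_bounded_integrable_graft(2)[OF sq_bounded_root_h s] by simp
      then show ?thesis by (simp add: cexp_gen_sum_root_h[OF s] cexp_root_h[OF s])
    qed
    have var: "cexp Q (\<lambda>\<omega>. (?\<xi> \<omega>)\<^sup>2) s \<le> (B * (\<beta>\<^sup>2) ^ j) * (h s + (h s)\<^sup>2)" if s: "0 < snd s" for s
    proof -
      note i = sq_bounded_integrable_graft[OF sq_bounded_gen_sum[OF sq_bounded_root_h] s, of j]
      have e: "(\<integral>b. gen_sum j root_h (graft s b) \<partial>\<E>) = \<beta> ^ j * h s"
        using cexp_gen_sum_root_h[OF s, of j] by (simp add: cexp_def)
      have "cexp Q (\<lambda>\<omega>. (?\<xi> \<omega>)\<^sup>2) s = (\<integral>b. (gen_sum j root_h (graft s b) - (\<integral>b. gen_sum j root_h (graft s b) \<partial>\<E>))\<^sup>2 \<partial>\<E>)"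
        unfolding cexp_def e by (simp add: root_h_graft[OF s])
      also have "\<dots> = cexp Q (\<lambda>\<omega>. (gen_sum j root_h \<omega>)\<^sup>2) s - (\<beta> ^ j * h s)\<^sup>2"
        using i unfolding e[symmetric] cexp_def by (intro en.variance_eq)
      also have "\<dots> \<le> (B * (\<beta>\<^sup>2) ^ j) * (h s + (h s)\<^sup>2)"
        using B(2)[OF s, of j] by (smt (verit) zero_le_power2)
      finally show ?thesis .
    qed
    have main: "cexp Q (\<lambda>\<omega>. (gen_sum (Suc k) ?\<xi> \<omega>)\<^sup>2) t \<le> B * (\<beta>\<^sup>2) ^ j * (1 + K1) * \<beta> ^ Suc k * h t"
      by (rule zero_mean_growth[OF sq zero var _ t]) (use B(1) in auto)
    define p where "p = (\<beta> ^ (Suc k + j))\<^sup>2"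
    have p: "0 < p" "p = (\<beta>\<^sup>2) ^ j * \<beta> ^ Suc k * \<beta> ^ Suc k"
      using beta_gt_1 by (auto simp: p_def power_add power_mult_distrib power2_eq_square)
    have "W (Suc k + j) \<omega> - W (Suc k) \<omega> = gen_sum (Suc k) ?\<xi> \<omega> / \<beta> ^ (Suc k + j)" for \<omega>
    proof -
      have "gen_sum (Suc k) ?\<xi> \<omega> = gen_sum (Suc k + j) root_h \<omega> - \<beta> ^ j * gen_sum (Suc k) root_h \<omega>"
        by (simp only: gen_sum_diff gen_sum_cmult gen_sum_add)
      then show ?thesis using beta_gt_1 by (simp only: W_def power_add) (simp add: diff_divide_distrib)
    qed
    then have "cexp Q (\<lambda>\<omega>. (W (Suc k + j) \<omega> - W (Suc k) \<omega>)\<^sup>2) t = cexp Q (\<lambda>\<omega>. (gen_sum (Suc k) ?\<xi> \<omega>)\<^sup>2) t / p"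
      by (simp add: cexp_def power_divide p_def)
    also have "\<dots> \<le> (B * (\<beta>\<^sup>2) ^ j * (1 + K1) * \<beta> ^ Suc k * h t) / p"
      using main p(1) by (intro divide_right_mono) auto
    also have "\<dots> = B * (1 + K1) / \<beta> ^ Suc k * h t"
      unfolding p(2) using beta_gt_1 by (simp add: field_simps)
    finally show ?thesis .
  qed
  moreover have "0 \<le> B * (1 + K1)" using B(1) K1_nonneg by simp
  ultimately show ?thesis using that by blast
qed

text \<open>\<open>mean_decay\<close> provides the hypothesis of \<open>second_moment_growth\<close>
  with \<theta> = rate * \<beta>; \<open>rate\<close> was chosen so that the square of this \<theta>
  exceeds \<beta>.\<close>

lemma orthogonal_second_moment:
  assumes \<xi>: "sq_bounded \<xi>" and orth: "(\<integral>t. f (snd t) * cexp Q \<xi> t \<partial>\<mu>) = 0"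
  obtains B where "0 \<le> B" "\<And>l t. 0 < snd t \<Longrightarrow>
     cexp Q (\<lambda>\<omega>. (gen_sum (Suc l) \<xi> \<omega> / \<beta> ^ Suc l)\<^sup>2) t \<le> B * (rate\<^sup>2) ^ Suc l * (h t + (h t)\<^sup>2)"
proof -
  obtain R where R: "0 \<le> R" "\<And>l t. 0 < snd t \<Longrightarrow> \<bar>cexp Q (gen_sum (Suc l) \<xi>) t\<bar> \<le> R * (rate * \<beta>) ^ Suc l * h t"
    by (rule mean_decay[OF \<xi> orth]) blast
  have rb: "0 < rate * \<beta>" using rate(1) beta_gt_1 by simp
  obtain B where B: "0 \<le> B" "\<And>l t. 0 < snd t \<Longrightarrow>
      cexp Q (\<lambda>\<omega>. (gen_sum (Suc l) \<xi> \<omega>)\<^sup>2) t \<le> B * ((rate * \<beta>)\<^sup>2) ^ Suc l * (h t + (h t)\<^sup>2)"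
    by (rule second_moment_growth[OF \<xi> rb rate(3) R]) blast+
  show ?thesis
  proof (rule that[OF B(1)])
    fix l and t :: "nat \<times> real" assume t: "0 < snd t"
    have pos: "0 < (\<beta>\<^sup>2) ^ Suc l" using beta_gt_1 by (intro zero_less_power) auto
    have "cexp Q (\<lambda>\<omega>. (gen_sum (Suc l) \<xi> \<omega> / \<beta> ^ Suc l)\<^sup>2) t = cexp Q (\<lambda>\<omega>. (gen_sum (Suc l) \<xi> \<omega>)\<^sup>2) t / (\<beta>\<^sup>2) ^ Suc l"
      unfolding cexp_def power_divide by (simp only: integral_divide_zero power_mult[symmetric] mult.commute)
    also have "\<dots> \<le> B * ((rate * \<beta>)\<^sup>2) ^ Suc l * (h t + (h t)\<^sup>2) / (\<beta>\<^sup>2) ^ Suc l"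
      using B(2)[OF t, of l] pos by (intro divide_right_mono) auto
    also have "\<dots> = B * (rate\<^sup>2) ^ Suc l * (h t + (h t)\<^sup>2)"
    proof -
      have "B * ((rate * \<beta>)\<^sup>2) ^ Suc l * (h t + (h t)\<^sup>2) = (B * (rate\<^sup>2) ^ Suc l * (h t + (h t)\<^sup>2)) * (\<beta>\<^sup>2) ^ Suc l"
        by (simp only: power_mult_distrib mult_ac)
      then show ?thesis using pos by (simp only: nonzero_mult_div_cancel_right[OF less_imp_neq[OF pos, symmetric]])
    qed
    finally show "cexp Q (\<lambda>\<omega>. (gen_sum (Suc l) \<xi> \<omega> / \<beta> ^ Suc l)\<^sup>2) t \<le> B * (rate\<^sup>2) ^ Suc l * (h t + (h t)\<^sup>2)" .
  qed
qed

end

section \<open>Survival and the limit of the normalised sums\<close>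

lemma gen_sum_one_ge_1: "extinct l \<omega> = 0 \<Longrightarrow> 1 \<le> gen_sum l (\<lambda>_. 1) \<omega>"
proof (induction l arbitrary: \<omega>)
  case (Suc l)
  then obtain j where j: "j \<in> kept \<omega>" "extinct l (subtree j \<omega>) = 0"
    by (auto simp: prod_zero_iff)
  have "1 \<le> gen_sum l (\<lambda>_. 1) (subtree j \<omega>)" by (rule Suc.IH[OF j(2)])
  also have "\<dots> \<le> (\<Sum>j\<in>kept \<omega>. gen_sum l (\<lambda>_. 1) (subtree j \<omega>))"
    using j(1) gen_sum_nonneg[of "\<lambda>_. 1"] by (intro member_le_sum) auto
  finally show ?case by simp
qed simp

lemma decseq_small_drop:
  fixes u :: "nat \<Rightarrow> real"
  assumes "decseq u" "\<And>n. 0 \<le> u n" "0 < \<epsilon>"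
  obtains N where "\<And>n. N \<le> n \<Longrightarrow> u N - u n \<le> \<epsilon>"
proof -
  have "convergent u"
    using assms(1,2) by (intro Bseq_monoseq_convergent decseq_bounded[of _ 0] decseq_imp_monoseq) auto
  then have "Cauchy u" by (rule convergent_Cauchy)
  then obtain N where "\<And>m n. N \<le> m \<Longrightarrow> N \<le> n \<Longrightarrow> norm (u m - u n) < \<epsilon>"
    using \<open>0 < \<epsilon>\<close> unfolding Cauchy_iff by blast
  then show ?thesis using that[of N] by (force dest: less_imp_le)
qed

text \<open>The root has its own degree law R, all other vertices have Q. Estimates conditional on
  the type of the root are common to both; only the final integration is over the type law of R
  instead of that of Q.\<close>

locale rooted_branching = spectral_branching +
  fixes R :: "nat pmf"
  assumes root_moment: "integrable (type_law R) (\<lambda>t. (1 + real (fst t))\<^sup>2)"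
    and root_pos: "0 < (\<integral>t. h t \<partial>type_law R)"
begin

abbreviation "\<Omega> \<equiv> tree_law R Q"
abbreviation "\<rho> \<equiv> type_law R"

sublocale om: prob_space \<Omega> by (rule prob_space_tree_law)
sublocale ro: prob_space \<rho> by (rule prob_space_type_law)

lemma quad_root:
  assumes q: "quad C \<phi>" shows "integrable \<rho> \<phi>"
proof (rule Bochner_Integration.integrable_bound)
  have [measurable]: "\<phi> \<in> borel_measurable (count_space UNIV \<Otimes>\<^sub>M borel)" using q by (simp add: quad_def)
  show "integrable \<rho> (\<lambda>t. C * (1 + real (fst t))\<^sup>2)" using root_moment by simp
  show "\<phi> \<in> borel_measurable \<rho>" by measurable
  show "AE t in \<rho>. norm (\<phi> t) \<le> norm (C * (1 + real (fst t))\<^sup>2)"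
    using AE_type_law_pos[of R]
  proof eventually_elim
    case (elim t)
    have "\<bar>\<phi> t\<bar> \<le> C * (1 + real (fst t))\<^sup>2" using q elim unfolding quad_def by blast
    then show ?case by simp
  qed
qed

text \<open>Passes from a bound on conditional expectations to an unconditional one; the detour
  through nonnegative integrals is what yields the integrability of F.\<close>

lemma dominated_root:
  assumes m[measurable]: "F \<in> borel_measurable marks_space" and nn: "\<And>\<omega>. 0 \<le> F \<omega>"
    and i: "\<And>t. 0 < snd t \<Longrightarrow> integrable \<E> (\<lambda>b. F (graft t b))"
    and le: "\<And>t. 0 < snd t \<Longrightarrow> cexp Q F t \<le> \<psi> t" and \<psi>: "quad C \<psi>"
  shows "integrable \<Omega> F" "(\<integral>\<omega>. F \<omega> \<partial>\<Omega>) \<le> (\<integral>t. \<psi> t \<partial>\<rho>)"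
proof -
  have "(\<integral>\<^sup>+\<omega>. ennreal (norm (F \<omega>)) \<partial>\<Omega>) = (\<integral>\<^sup>+t. \<integral>\<^sup>+b. ennreal (F (graft t b)) \<partial>\<E> \<partial>\<rho>)"
    using nn by (subst nn_integral_tree_law) auto
  also have "\<dots> \<le> (\<integral>\<^sup>+t. ennreal (norm (\<psi> t)) \<partial>\<rho>)"
  proof (rule nn_integral_mono_AE)
    show "AE t in \<rho>. (\<integral>\<^sup>+b. ennreal (F (graft t b)) \<partial>\<E>) \<le> ennreal (norm (\<psi> t))"
      using AE_type_law_pos[of R]
    proof eventually_elim
      case (elim t)
      have "(\<integral>\<^sup>+b. ennreal (F (graft t b)) \<partial>\<E>) = ennreal (cexp Q F t)"
        unfolding cexp_def using nn by (intro nn_integral_eq_integral i elim) auto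
      also have "\<dots> \<le> ennreal (norm (\<psi> t))" using le[OF elim] by (intro ennreal_leI) simp
      finally show ?case .
    qed
  qed
  also have "\<dots> < \<infinity>" using quad_root[OF \<psi>] by (simp add: integrable_iff_bounded)
  finally show F: "integrable \<Omega> F" by (intro integrableI_bounded) auto
  have "(\<integral>\<omega>. F \<omega> \<partial>\<Omega>) = (\<integral>t. cexp Q F t \<partial>\<rho>)" by (rule integral_tree_law[OF F])
  also have "\<dots> \<le> (\<integral>t. \<psi> t \<partial>\<rho>)"
  proof (rule integral_mono_AE)
    show "AE t in \<rho>. cexp Q F t \<le> \<psi> t" using AE_type_law_pos[of R] by eventually_elim (rule le)
  qed (use integrable_cexp[OF F] quad_root[OF \<psi>] in auto)
  finally show "(\<integral>\<omega>. F \<omega> \<partial>\<Omega>) \<le> (\<integral>t. \<psi> t \<partial>\<rho>)" .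
qed

lemma integrable_fraction_root: "fraction \<gamma> \<Longrightarrow> integrable \<Omega> \<gamma>"
  unfolding fraction_def by (intro integrable_tree_bounded[where c=1]) (auto simp: abs_of_nonneg)

lemma integral_fraction_root: "fraction \<gamma> \<Longrightarrow> (\<integral>\<omega>. \<gamma> \<omega> \<partial>\<Omega>) = (\<integral>t. cexp Q \<gamma> t \<partial>\<rho>)"
  by (rule integral_tree_law[OF integrable_fraction_root])

definition laplace :: "nat \<Rightarrow> real \<Rightarrow> real" where
  "laplace l \<theta> = (\<integral>\<omega>. exp (- (\<theta> * W l \<omega>)) \<partial>\<Omega>)"

definition death :: "nat \<Rightarrow> real" where
  "death l = (\<integral>\<omega>. extinct l \<omega> \<partial>\<Omega>)"

lemma fraction_extinct: "fraction (extinct l)"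
  by (rule fraction_gen_prod[OF fraction_zero])

lemma laplace_bounds: "0 \<le> \<theta> \<Longrightarrow> 0 \<le> laplace l \<theta>" "0 \<le> \<theta> \<Longrightarrow> laplace l \<theta> \<le> 1"
proof -
  show "0 \<le> laplace l \<theta>" unfolding laplace_def by (intro Bochner_Integration.integral_nonneg) auto
  assume \<theta>: "0 \<le> \<theta>"
  have "laplace l \<theta> \<le> (\<integral>\<omega>. 1 \<partial>\<Omega>)"
    unfolding laplace_def using \<theta> W_nonneg
    by (intro integral_mono integrable_fraction_root fraction_exp_W) (auto simp: fraction_def)
  then show "laplace l \<theta> \<le> 1" by (simp add: om.prob_space[simplified])
qed

lemma laplace_antimono: "0 \<le> \<theta> \<Longrightarrow> \<theta> \<le> \<theta>' \<Longrightarrow> laplace l \<theta>' \<le> laplace l \<theta>"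
  unfolding laplace_def
  by (intro integral_mono integrable_fraction_root fraction_exp_W) (auto intro: mult_right_mono W_nonneg)

lemma laplace_compare_root:
  obtains C \<kappa>1 where "1 \<le> C" "0 < \<kappa>1"
    "\<And>\<kappa> \<theta> k j. \<kappa>1 * \<beta> ^ k \<le> \<kappa> \<Longrightarrow> 0 \<le> \<theta> \<Longrightarrow>
       laplace k \<theta> - (\<integral>\<omega>. exp (- (\<theta> * W k \<omega>)) * extinct (Suc k) \<omega> \<partial>\<Omega>)
       \<le> C * (laplace k \<theta> - (\<integral>\<omega>. exp (- (\<theta> * W k \<omega>)) * exp (- (\<kappa> * W (k + Suc j) \<omega>)) \<partial>\<Omega>))"
proof -
  obtain C \<kappa>1 where C: "1 \<le> C" "0 < \<kappa>1" and cmp: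
    "\<And>\<kappa> \<theta> k j t. \<kappa>1 * \<beta> ^ k \<le> \<kappa> \<Longrightarrow> 0 \<le> \<theta> \<Longrightarrow> 0 < snd t \<Longrightarrow>
       cexp Q (\<lambda>\<omega>. exp (- (\<theta> * W k \<omega>))) t - cexp Q (\<lambda>\<omega>. exp (- (\<theta> * W k \<omega>)) * extinct (Suc k) \<omega>) t
       \<le> C * (cexp Q (\<lambda>\<omega>. exp (- (\<theta> * W k \<omega>))) t
            - cexp Q (\<lambda>\<omega>. exp (- (\<theta> * W k \<omega>)) * exp (- (\<kappa> * W (k + Suc j) \<omega>))) t)"
    by (rule laplace_compare) blast
  show ?thesis
  proof (rule that[OF C])
    fix \<kappa> \<theta> :: real and k j assume \<kappa>: "\<kappa>1 * \<beta> ^ k \<le> \<kappa>" and \<theta>: "0 \<le> \<theta>"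
    have \<kappa>0: "0 \<le> \<kappa>" using \<kappa> C beta_gt_1 by (smt (verit) mult_nonneg_nonneg zero_le_power)
    define g d e where "g = (\<lambda>\<omega>. exp (- (\<theta> * W k \<omega>)))"
      and "d = (\<lambda>\<omega>. exp (- (\<theta> * W k \<omega>)) * extinct (Suc k) \<omega>)"
      and "e = (\<lambda>\<omega>. exp (- (\<theta> * W k \<omega>)) * exp (- (\<kappa> * W (k + Suc j) \<omega>)))"
    have fr: "fraction g" "fraction d" "fraction e"
      unfolding g_def d_def e_def by (intro fraction_mult fraction_exp_W fraction_extinct \<theta> \<kappa>0)+
    note ci = fr[THEN integrable_fraction_root, THEN integrable_cexp]
    have "(\<integral>t. cexp Q g t - cexp Q d t \<partial>\<rho>) \<le> (\<integral>t. C * (cexp Q g t - cexp Q e t) \<partial>\<rho>)"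
    proof (rule integral_mono_AE)
      show "AE t in \<rho>. cexp Q g t - cexp Q d t \<le> C * (cexp Q g t - cexp Q e t)"
        using AE_type_law_pos[of R] unfolding g_def d_def e_def
        by eventually_elim (rule cmp[OF \<kappa> \<theta>])
    qed (intro Bochner_Integration.integrable_diff integrable_mult_right ci)+
    also have "\<dots> = C * ((\<integral>t. cexp Q g t \<partial>\<rho>) - (\<integral>t. cexp Q e t \<partial>\<rho>))"
      by (simp only: integral_mult_right_zero Bochner_Integration.integral_diff[OF ci(1) ci(3)])
    finally have "(\<integral>\<omega>. g \<omega> \<partial>\<Omega>) - (\<integral>\<omega>. d \<omega> \<partial>\<Omega>) \<le> C * ((\<integral>\<omega>. g \<omega> \<partial>\<Omega>) - (\<integral>\<omega>. e \<omega> \<partial>\<Omega>))"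
      by (simp only: Bochner_Integration.integral_diff[OF ci(1) ci(2)] integral_fraction_root[OF fr(1)]
          integral_fraction_root[OF fr(2)] integral_fraction_root[OF fr(3)])
    then show "laplace k \<theta> - (\<integral>\<omega>. exp (- (\<theta> * W k \<omega>)) * extinct (Suc k) \<omega> \<partial>\<Omega>)
       \<le> C * (laplace k \<theta> - (\<integral>\<omega>. exp (- (\<theta> * W k \<omega>)) * exp (- (\<kappa> * W (k + Suc j) \<omega>)) \<partial>\<Omega>))"
      unfolding laplace_def g_def d_def e_def .
  qed
qed

text \<open>\<open>W_increment\<close> controls second moments and Cauchy-Schwarz gives the L1 form,
  which is the one that matches the Lipschitz estimate for the exponential.\<close>

lemma W_increment_root:
  obtains K where "0 \<le> K"
    "\<And>k j. integrable \<Omega> (\<lambda>\<omega>. \<bar>W (Suc k + j) \<omega> - W (Suc k) \<omega>\<bar>)"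
    "\<And>k j. (\<integral>\<omega>. \<bar>W (Suc k + j) \<omega> - W (Suc k) \<omega>\<bar> \<partial>\<Omega>) \<le> sqrt (K / \<beta> ^ Suc k)"
proof -
  obtain K where K: "0 \<le> K" "\<And>k j t. 0 < snd t \<Longrightarrow>
     cexp Q (\<lambda>\<omega>. (W (Suc k + j) \<omega> - W (Suc k) \<omega>)\<^sup>2) t \<le> K / \<beta> ^ Suc k * h t"
    by (rule W_increment) blast
  have sq: "integrable \<Omega> (\<lambda>\<omega>. (W (Suc k + j) \<omega> - W (Suc k) \<omega>)\<^sup>2)"
    "(\<integral>\<omega>. (W (Suc k + j) \<omega> - W (Suc k) \<omega>)\<^sup>2 \<partial>\<Omega>) \<le> (K * (\<integral>t. h t \<partial>\<rho>)) / \<beta> ^ Suc k" for k j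
  proof -
    have s: "sq_bounded (\<lambda>\<omega>. W (Suc k + j) \<omega> - 1 * W (Suc k) \<omega>)"
      by (rule sq_bounded_diff[OF sq_bounded_W sq_bounded_W])
    have i: "integrable \<E> (\<lambda>b. (W (Suc k + j) (graft t b) - W (Suc k) (graft t b))\<^sup>2)" if "0 < snd t" for t
      using sq_bounded_integrable_graft(1)[OF s that] by simp
    note d = dominated_root[where F="\<lambda>\<omega>. (W (Suc k + j) \<omega> - W (Suc k) \<omega>)\<^sup>2", OF _ _ i K(2) quad_cmult[OF quad_h]]
    show "integrable \<Omega> (\<lambda>\<omega>. (W (Suc k + j) \<omega> - W (Suc k) \<omega>)\<^sup>2)" by (rule d(1)) auto
    have "(\<integral>\<omega>. (W (Suc k + j) \<omega> - W (Suc k) \<omega>)\<^sup>2 \<partial>\<Omega>) \<le> (\<integral>t. K / \<beta> ^ Suc k * h t \<partial>\<rho>)"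
      by (rule d(2)) auto
    then show "(\<integral>\<omega>. (W (Suc k + j) \<omega> - W (Suc k) \<omega>)\<^sup>2 \<partial>\<Omega>) \<le> (K * (\<integral>t. h t \<partial>\<rho>)) / \<beta> ^ Suc k"
      by simp
  qed
  show ?thesis
  proof (rule that[of "K * (\<integral>t. h t \<partial>\<rho>)"])
    show "0 \<le> K * (\<integral>t. h t \<partial>\<rho>)" using K(1) root_pos by simp
    fix k j
    show "integrable \<Omega> (\<lambda>\<omega>. \<bar>W (Suc k + j) \<omega> - W (Suc k) \<omega>\<bar>)"
      by (intro integrable_abs om.square_integrable_imp_integrable[OF _ sq(1)]) measurable
    have "(\<integral>\<omega>. \<bar>W (Suc k + j) \<omega> - W (Suc k) \<omega>\<bar> \<partial>\<Omega>) \<le> sqrt (\<integral>\<omega>. (W (Suc k + j) \<omega> - W (Suc k) \<omega>)\<^sup>2 \<partial>\<Omega>)"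
      by (rule om.L1_le_L2[OF _ sq(1)]) measurable
    also have "\<dots> \<le> sqrt (K * (\<integral>t. h t \<partial>\<rho>) / \<beta> ^ Suc k)"
      by (rule real_sqrt_le_mono[OF sq(2)])
    finally show "(\<integral>\<omega>. \<bar>W (Suc k + j) \<omega> - W (Suc k) \<omega>\<bar> \<partial>\<Omega>) \<le> sqrt (K * (\<integral>t. h t \<partial>\<rho>) / \<beta> ^ Suc k)" .
  qed
qed

text \<open>On the positive axis \<open>exp (- y)\<close> is Lipschitz with constant 1, and a factor
  \<gamma> with values in [0, 1] can only shrink the error.\<close>

lemma laplace_difference:
  assumes \<theta>: "0 \<le> \<theta>" and \<gamma>: "fraction \<gamma>"
    and i: "integrable \<Omega> (\<lambda>\<omega>. \<bar>W n \<omega> - W k \<omega>\<bar>)"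
    and e: "(\<integral>\<omega>. \<bar>W n \<omega> - W k \<omega>\<bar> \<partial>\<Omega>) \<le> \<epsilon>"
  shows "(\<integral>\<omega>. exp (- (\<theta> * W k \<omega>)) * \<gamma> \<omega> \<partial>\<Omega>) \<le> (\<integral>\<omega>. exp (- (\<theta> * W n \<omega>)) * \<gamma> \<omega> \<partial>\<Omega>) + \<theta> * \<epsilon>"
    and "(\<integral>\<omega>. exp (- (\<theta> * W n \<omega>)) * \<gamma> \<omega> \<partial>\<Omega>) \<le> (\<integral>\<omega>. exp (- (\<theta> * W k \<omega>)) * \<gamma> \<omega> \<partial>\<Omega>) + \<theta> * \<epsilon>"
proof -
  have main: "(\<integral>\<omega>. exp (- (\<theta> * W p \<omega>)) * \<gamma> \<omega> \<partial>\<Omega>) \<le> (\<integral>\<omega>. exp (- (\<theta> * W q \<omega>)) * \<gamma> \<omega> \<partial>\<Omega>) + \<theta> * \<epsilon>"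
    if i: "integrable \<Omega> (\<lambda>\<omega>. \<bar>W p \<omega> - W q \<omega>\<bar>)" and e: "(\<integral>\<omega>. \<bar>W p \<omega> - W q \<omega>\<bar> \<partial>\<Omega>) \<le> \<epsilon>" for p q
  proof -
    have fr: "integrable \<Omega> (\<lambda>\<omega>. exp (- (\<theta> * W l \<omega>)) * \<gamma> \<omega>)" for l
      by (intro integrable_fraction_root fraction_mult fraction_exp_W \<theta> \<gamma>)
    have "(\<integral>\<omega>. exp (- (\<theta> * W p \<omega>)) * \<gamma> \<omega> \<partial>\<Omega>)
      \<le> (\<integral>\<omega>. exp (- (\<theta> * W q \<omega>)) * \<gamma> \<omega> + \<theta> * \<bar>W p \<omega> - W q \<omega>\<bar> \<partial>\<Omega>)"
    proof (rule integral_mono)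
      fix \<omega>
      have "exp (- (\<theta> * W p \<omega>)) \<le> exp (- (\<theta> * W q \<omega>)) + \<bar>\<theta> * W p \<omega> - \<theta> * W q \<omega>\<bar>"
        using \<theta> W_nonneg by (intro exp_minus_lipschitz mult_nonneg_nonneg) auto
      also have "\<bar>\<theta> * W p \<omega> - \<theta> * W q \<omega>\<bar> = \<theta> * \<bar>W p \<omega> - W q \<omega>\<bar>"
        using \<theta> by (simp add: right_diff_distrib[symmetric] abs_mult)
      finally have "exp (- (\<theta> * W p \<omega>)) * \<gamma> \<omega> \<le> (exp (- (\<theta> * W q \<omega>)) + \<theta> * \<bar>W p \<omega> - W q \<omega>\<bar>) * \<gamma> \<omega>"
        using \<gamma> by (intro mult_right_mono) (auto simp: fraction_def)
      also have "\<dots> \<le> exp (- (\<theta> * W q \<omega>)) * \<gamma> \<omega> + \<theta> * \<bar>W p \<omega> - W q \<omega>\<bar> * 1"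
        unfolding distrib_right using \<gamma> \<theta> by (intro add_left_mono mult_left_mono) (auto simp: fraction_def)
      finally show "exp (- (\<theta> * W p \<omega>)) * \<gamma> \<omega> \<le> exp (- (\<theta> * W q \<omega>)) * \<gamma> \<omega> + \<theta> * \<bar>W p \<omega> - W q \<omega>\<bar>"
        by simp
    qed (use fr i in auto)
    also have "\<dots> = (\<integral>\<omega>. exp (- (\<theta> * W q \<omega>)) * \<gamma> \<omega> \<partial>\<Omega>) + \<theta> * (\<integral>\<omega>. \<bar>W p \<omega> - W q \<omega>\<bar> \<partial>\<Omega>)"
      using fr i by simp
    finally show ?thesis using mult_left_mono[OF e \<theta>] by linarith
  qed
  show "(\<integral>\<omega>. exp (- (\<theta> * W n \<omega>)) * \<gamma> \<omega> \<partial>\<Omega>) \<le> (\<integral>\<omega>. exp (- (\<theta> * W k \<omega>)) * \<gamma> \<omega> \<partial>\<Omega>) + \<theta> * \<epsilon>"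
    by (rule main[OF i e])
  show "(\<integral>\<omega>. exp (- (\<theta> * W k \<omega>)) * \<gamma> \<omega> \<partial>\<Omega>) \<le> (\<integral>\<omega>. exp (- (\<theta> * W n \<omega>)) * \<gamma> \<omega> \<partial>\<Omega>) + \<theta> * \<epsilon>"
    by (rule main) (use i e in \<open>simp_all add: abs_minus_commute\<close>)
qed

text \<open>In the limit of large \<open>\<theta>\<close> the Laplace transform of the limit of W is the probability that it
  vanishes; hence this lemma says that W only vanishes in the limit if the tree dies out.\<close>

lemma laplace_minus_death:
  assumes \<epsilon>: "0 < \<epsilon>"
  obtains \<theta> l0 where "0 < \<theta>" "\<And>l. l0 \<le> l \<Longrightarrow> laplace l \<theta> - death l \<le> \<epsilon>"
proof -
  obtain C \<kappa>1 where C: "1 \<le> C" "0 < \<kappa>1" and cmp: "\<And>\<kappa> \<theta> k j. \<kappa>1 * \<beta> ^ k \<le> \<kappa> \<Longrightarrow> 0 \<le> \<theta> \<Longrightarrow>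
       laplace k \<theta> - (\<integral>\<omega>. exp (- (\<theta> * W k \<omega>)) * extinct (Suc k) \<omega> \<partial>\<Omega>)
       \<le> C * (laplace k \<theta> - (\<integral>\<omega>. exp (- (\<theta> * W k \<omega>)) * exp (- (\<kappa> * W (k + Suc j) \<omega>)) \<partial>\<Omega>))"
    by (rule laplace_compare_root) blast
  obtain K where K: "0 \<le> K" "\<And>k j. integrable \<Omega> (\<lambda>\<omega>. \<bar>W (Suc k + j) \<omega> - W (Suc k) \<omega>\<bar>)"
    "\<And>k j. (\<integral>\<omega>. \<bar>W (Suc k + j) \<omega> - W (Suc k) \<omega>\<bar> \<partial>\<Omega>) \<le> sqrt (K / \<beta> ^ Suc k)"
    by (rule W_increment_root) blast
  have small: "\<exists>k. s * sqrt (K / \<beta> ^ Suc k) \<le> \<delta>" if "0 < \<delta>" for s \<delta>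
  proof -
    have "(\<lambda>k. s * sqrt (K / \<beta> ^ Suc k)) \<longlonglongrightarrow> s * sqrt 0"
      using beta_gt_1
      by (intro tendsto_mult tendsto_const tendsto_real_sqrt LIMSEQ_Suc[of "\<lambda>k. K / \<beta> ^ k"])
         (use LIMSEQ_divide_realpow_zero[of \<beta> K] in auto)
    then have "eventually (\<lambda>k. s * sqrt (K / \<beta> ^ Suc k) < \<delta>) sequentially"
      using that by (intro order_tendstoD) auto
    then show ?thesis by (auto simp: eventually_sequentially intro: less_imp_le)
  qed
  have f1: "fraction (\<lambda>_. 1)" by (simp add: fraction_def)
  have diff: "laplace (Suc k) \<theta> \<le> laplace (Suc k + j) \<theta> + \<theta> * sqrt (K / \<beta> ^ Suc k)"
    "laplace (Suc k + j) \<theta> \<le> laplace (Suc k) \<theta> + \<theta> * sqrt (K / \<beta> ^ Suc k)" if "0 \<le> \<theta>" for k j \<theta>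
    using laplace_difference[OF that f1 K(2) K(3), of k j] by (simp_all add: laplace_def)
  have "Cauchy (\<lambda>n. laplace n \<theta>)" if "0 \<le> \<theta>" for \<theta>
  proof (rule metric_CauchyI)
    fix e :: real assume e: "0 < e"
    obtain k where k: "\<theta> * sqrt (K / \<beta> ^ Suc k) \<le> e / 4" using small[of "e / 4" \<theta>] e by auto
    have "dist (laplace m \<theta>) (laplace n \<theta>) < e" if "Suc k \<le> m" "Suc k \<le> n" for m n
      using diff[OF \<open>0 \<le> \<theta>\<close>, of k "m - Suc k"] diff[OF \<open>0 \<le> \<theta>\<close>, of k "n - Suc k"] that k e
      by (simp add: dist_real_def)
    then show "\<exists>M. \<forall>m\<ge>M. \<forall>n\<ge>M. dist (laplace m \<theta>) (laplace n \<theta>) < e" by blast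
  qed
  then have conv: "convergent (\<lambda>n. laplace n \<theta>)" if "0 \<le> \<theta>" for \<theta>
    using that by (simp add: Cauchy_convergent_iff)
  define u where "u \<theta> = lim (\<lambda>n. laplace n \<theta>)" for \<theta>
  have u: "(\<lambda>n. laplace n \<theta>) \<longlonglongrightarrow> u \<theta>" if "0 \<le> \<theta>" for \<theta>
    using conv[OF that] by (simp add: u_def convergent_LIMSEQ_iff)
  \<comment> \<open>The limit u of the Laplace transforms is nonincreasing and bounded below, so
    from some integer on it drops by at most \<epsilon> / (4 C), no matter how far the argument
    moves along the integers.\<close>
  have "decseq (\<lambda>i. u (real (Suc i)))"
  proof (rule decseq_SucI)
    fix i
    show "u (real (Suc (Suc i))) \<le> u (real (Suc i))"
      by (rule LIMSEQ_le[OF u u]) (auto intro!: exI[of _ 0] laplace_antimono)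
  qed
  moreover have "0 \<le> u (real (Suc i))" for i
    by (rule LIMSEQ_le_const[OF u]) (auto intro!: exI[of _ 0] laplace_bounds)
  moreover have "0 < \<epsilon> / (4 * C)" using \<epsilon> C by simp
  ultimately obtain N where N: "\<And>n. N \<le> n \<Longrightarrow> u (real (Suc N)) - u (real (Suc n)) \<le> \<epsilon> / (4 * C)"
    by (rule decseq_small_drop) blast
  define \<theta> where "\<theta> = real (Suc N)"
  have \<theta>: "0 < \<theta>" by (simp add: \<theta>_def)
  \<comment> \<open>The weight 1 + 2 C counts the transfers between generations made below: one
    outside and two inside the factor C.\<close>
  obtain k where k: "(1 + 2 * C) * \<theta> * sqrt (K / \<beta> ^ Suc k) \<le> \<epsilon> / 4"
    using small[of "\<epsilon> / 4" "(1 + 2 * C) * \<theta>"] \<epsilon> by auto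
  let ?e = "\<theta> * sqrt (K / \<beta> ^ Suc k)"
  \<comment> \<open>An integer, so that \<theta> + \<kappa> stays on the grid on which the drop of u
    is controlled.\<close>
  obtain M where M: "\<kappa>1 * \<beta> ^ Suc k \<le> real M" using real_arch_simple by blast
  define \<kappa> where "\<kappa> = real M"
  have \<kappa>: "\<kappa>1 * \<beta> ^ Suc k \<le> \<kappa>" using M by (simp add: \<kappa>_def)
  have lim: "(\<lambda>n. laplace n \<theta> - laplace n (\<theta> + \<kappa>)) \<longlonglongrightarrow> u \<theta> - u (\<theta> + \<kappa>)"
    by (intro tendsto_diff u) (auto simp: \<theta>_def \<kappa>_def)
  have "u \<theta> - u (\<theta> + \<kappa>) \<le> \<epsilon> / (4 * C)" using N[of "N + M"] by (simp add: \<theta>_def \<kappa>_def algebra_simps)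
  also have "\<dots> < \<epsilon> / (2 * C)" using \<epsilon> C by (simp add: field_simps)
  finally have "eventually (\<lambda>n. laplace n \<theta> - laplace n (\<theta> + \<kappa>) < \<epsilon> / (2 * C)) sequentially"
    by (rule order_tendstoD(2)[OF lim])
  then obtain n0 where n0: "\<And>n. n0 \<le> n \<Longrightarrow> laplace n \<theta> - laplace n (\<theta> + \<kappa>) < \<epsilon> / (2 * C)"
    by (auto simp: eventually_sequentially)
  show ?thesis
  proof (rule that[OF \<theta>, of "max n0 (Suc (Suc k))"])
    fix n assume n: "max n0 (Suc (Suc k)) \<le> n"
    define j where "j = n - Suc (Suc k)"
    have nj: "n = Suc k + Suc j" using n unfolding j_def by arith
    have \<theta>0: "0 \<le> \<theta>" using \<theta> by simp
    have \<kappa>0: "0 \<le> \<kappa>" by (simp add: \<kappa>_def)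
    note ld = laplace_difference[OF \<theta>0 _ K(2) K(3), of _ k "Suc j", folded nj]
    have fx: "fraction (\<lambda>\<omega>. 1 - extinct n \<omega>)"
      using fraction_extinct[of n] by (auto simp: fraction_def simp del: gen_prod.simps)
    have ix: "integrable \<Omega> (\<lambda>\<omega>. exp (- (\<theta> * W l \<omega>)))" "integrable \<Omega> (\<lambda>\<omega>. exp (- (\<theta> * W l \<omega>)) * extinct i \<omega>)" for l i
      by (intro integrable_fraction_root fraction_mult fraction_exp_W fraction_extinct \<theta>0)+
    have s: "(\<integral>\<omega>. exp (- (\<theta> * W l \<omega>)) * (1 - extinct i \<omega>) \<partial>\<Omega>) = laplace l \<theta> - (\<integral>\<omega>. exp (- (\<theta> * W l \<omega>)) * extinct i \<omega> \<partial>\<Omega>)" for l i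
      using ix by (simp add: laplace_def right_diff_distrib del: gen_prod.simps)
    \<comment> \<open>On extinction W vanishes, so the exponential weight is 1 there.\<close>
    have dead: "(\<integral>\<omega>. exp (- (\<theta> * W n \<omega>)) * extinct n \<omega> \<partial>\<Omega>) = death n"
    proof -
      have "exp (- (\<theta> * W n \<omega>)) * extinct n \<omega> = extinct n \<omega>" for \<omega>
        using extinct_cases[of n \<omega>] gen_sum_extinct[of n \<omega> root_h] by (auto simp: W_def)
      then show ?thesis by (simp only: death_def)
    qed
    \<comment> \<open>The chain passes from W n to W (k + 1), enlarges survival up to generation n
      to survival up to generation k + 2, bounds this by the loss through the factor exp (- \<kappa>
      W n), and returns to W n.\<close>
    have "laplace n \<theta> - death n \<le> (\<integral>\<omega>. exp (- (\<theta> * W (Suc k) \<omega>)) * (1 - extinct n \<omega>) \<partial>\<Omega>) + ?e"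
      using ld(2)[OF fx] unfolding s[of n n] dead by simp
    also have "\<dots> \<le> (\<integral>\<omega>. exp (- (\<theta> * W (Suc k) \<omega>)) * (1 - extinct (Suc (Suc k)) \<omega>) \<partial>\<Omega>) + ?e"
    proof (intro add_right_mono integral_mono mult_left_mono diff_left_mono extinct_mono')
      show "Suc (Suc k) \<le> n" using n by simp
    qed (use ix in \<open>auto simp: right_diff_distrib simp del: gen_prod.simps\<close>)
    also have "(\<integral>\<omega>. exp (- (\<theta> * W (Suc k) \<omega>)) * (1 - extinct (Suc (Suc k)) \<omega>) \<partial>\<Omega>)
      \<le> C * (laplace (Suc k) \<theta> - (\<integral>\<omega>. exp (- (\<theta> * W (Suc k) \<omega>)) * exp (- (\<kappa> * W n \<omega>)) \<partial>\<Omega>))"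
      unfolding s nj by (rule cmp[OF \<kappa> \<theta>0])
    also have "\<dots> \<le> C * (laplace n \<theta> - laplace n (\<theta> + \<kappa>) + 2 * ?e)"
    proof (rule mult_left_mono)
      have "laplace (Suc k) \<theta> \<le> laplace n \<theta> + ?e" using diff(1)[OF \<theta>0, of k "Suc j"] by (simp add: nj)
      moreover have "laplace n (\<theta> + \<kappa>) = (\<integral>\<omega>. exp (- (\<theta> * W n \<omega>)) * exp (- (\<kappa> * W n \<omega>)) \<partial>\<Omega>)"
        by (simp add: laplace_def mult_exp_exp distrib_right)
      moreover have "(\<integral>\<omega>. exp (- (\<theta> * W n \<omega>)) * exp (- (\<kappa> * W n \<omega>)) \<partial>\<Omega>)
        \<le> (\<integral>\<omega>. exp (- (\<theta> * W (Suc k) \<omega>)) * exp (- (\<kappa> * W n \<omega>)) \<partial>\<Omega>) + ?e"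
        by (rule ld(2)[OF fraction_exp_W[OF \<kappa>0]])
      ultimately show "laplace (Suc k) \<theta> - (\<integral>\<omega>. exp (- (\<theta> * W (Suc k) \<omega>)) * exp (- (\<kappa> * W n \<omega>)) \<partial>\<Omega>)
        \<le> laplace n \<theta> - laplace n (\<theta> + \<kappa>) + 2 * ?e" by linarith
    qed (use C in simp)
    also have "\<dots> \<le> C * (\<epsilon> / (2 * C) + 2 * ?e)"
      using n0[of n] n C by (intro mult_left_mono add_right_mono) auto
    also have "\<dots> + ?e = \<epsilon> / 2 + (1 + 2 * C) * \<theta> * sqrt (K / \<beta> ^ Suc k)"
      using C by (simp add: algebra_simps)
    also have "\<dots> \<le> \<epsilon>" using k \<epsilon> by linarith
    finally show "laplace n \<theta> - death n \<le> \<epsilon>" by simp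
  qed
qed

text \<open>Keeps the conditioning from degenerating. As W l = 0 on extinction, survival to
  generation l is at least as likely as the mean of 1 - exp (- \<theta> W l), hence has probability
  at least \<theta> * I1 - \<theta>^2 * I2, uniformly in l; \<theta> is small enough for this to be
  positive.\<close>

lemma survival_bounded_below:
  obtains p where "0 < p" "\<And>l. p \<le> 1 - death l"
proof -
  obtain B where B: "0 \<le> B" "\<And>l t. 0 < snd t \<Longrightarrow> cexp Q (\<lambda>\<omega>. (W l \<omega>)\<^sup>2) t \<le> B * (h t + (h t)\<^sup>2)"
    by (rule cexp_W_sq_le) blast
  define I1 where "I1 = (\<integral>t. h t \<partial>\<rho>)"
  define I2 where "I2 = (\<integral>t. B * (h t + (h t)\<^sup>2) / 2 \<partial>\<rho>)"
  have qB: "quad (\<bar>B / 2\<bar> * (c2 + c2\<^sup>2)) (\<lambda>t. B * (h t + (h t)\<^sup>2) / 2)"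
    using quad_cmult[OF quad_W2, of "B / 2"] by simp
  have I2: "0 \<le> I2" unfolding I2_def
  proof (rule integral_nonneg_AE)
    show "AE t in \<rho>. 0 \<le> B * (h t + (h t)\<^sup>2) / 2"
      using AE_type_law_pos[of R] by eventually_elim (use B(1) h_nonneg in simp)
  qed
  define \<theta> where "\<theta> = I1 / (I2 + 1)"
  have \<theta>: "0 < \<theta>" using root_pos I2 by (simp add: \<theta>_def I1_def)
  define p where "p = \<theta> * (I1 - \<theta> * I2)"
  have p: "0 < p"
  proof -
    have "\<theta> * I2 < \<theta> * (I2 + 1)" using \<theta> by simp
    also have "\<dots> = I1" using I2 by (simp add: \<theta>_def)
    finally show ?thesis using \<theta> by (simp add: p_def)
  qed
  show ?thesis
  proof (rule that[OF p])
    fix l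
    have fr: "fraction (\<lambda>\<omega>. exp (- (\<theta> * W l \<omega>)))" using \<theta> by (intro fraction_exp_W) auto
    have "p = \<theta> * I1 - \<theta>\<^sup>2 * I2" by (simp add: p_def power2_eq_square right_diff_distrib)
    also have "\<dots> = (\<integral>t. \<theta> * h t - \<theta>\<^sup>2 * (B * (h t + (h t)\<^sup>2) / 2) \<partial>\<rho>)"
      unfolding I1_def I2_def using quad_root[OF quad_h] quad_root[OF qB]
      by (subst Bochner_Integration.integral_diff) (simp_all only: integrable_mult_right integral_mult_right_zero)
    also have "\<dots> \<le> (\<integral>t. 1 - cexp Q (\<lambda>\<omega>. exp (- (\<theta> * W l \<omega>))) t \<partial>\<rho>)"
    proof (rule integral_mono_AE)
      show "AE t in \<rho>. \<theta> * h t - \<theta>\<^sup>2 * (B * (h t + (h t)\<^sup>2) / 2) \<le> 1 - cexp Q (\<lambda>\<omega>. exp (- (\<theta> * W l \<omega>))) t"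
        using AE_type_law_pos[of R]
      proof eventually_elim
        case (elim t)
        show ?case using one_minus_laplace_ge[OF elim _ B(2), of \<theta> l] \<theta> by simp
      qed
    qed (intro Bochner_Integration.integrable_diff integrable_mult_right quad_root[OF quad_h] quad_root[OF qB]
        ro.integrable_const integrable_cexp[OF integrable_fraction_root[OF fr]])+
    also have "\<dots> = 1 - laplace l \<theta>"
      unfolding laplace_def integral_fraction_root[OF fr]
      using integrable_cexp[OF integrable_fraction_root[OF fr]] by (simp add: ro.prob_space[simplified])
    also have "\<dots> \<le> 1 - death l"
    proof -
      have "extinct l \<omega> \<le> exp (- (\<theta> * W l \<omega>))" for \<omega>
        using extinct_cases[of l \<omega>] gen_sum_extinct[of l \<omega> root_h] by (auto simp: W_def)
      then have "death l \<le> laplace l \<theta>" unfolding death_def laplace_def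
        by (intro integral_mono integrable_fraction_root fraction_extinct fr) auto
      then show ?thesis by simp
    qed
    finally show "p \<le> 1 - death l" .
  qed
qed

end

section \<open>Averages over a generation\<close>

context rooted_branching
begin

lemma root_second_moment_tendsto:
  assumes \<xi>: "sq_bounded \<xi>" and orth: "(\<integral>t. f (snd t) * cexp Q \<xi> t \<partial>\<mu>) = 0"
  shows "integrable \<Omega> (\<lambda>\<omega>. (gen_sum (Suc l) \<xi> \<omega> / \<beta> ^ Suc l)\<^sup>2)"
    and "(\<lambda>l. \<integral>\<omega>. (gen_sum (Suc l) \<xi> \<omega> / \<beta> ^ Suc l)\<^sup>2 \<partial>\<Omega>) \<longlonglongrightarrow> 0"
proof -
  obtain B where B: "0 \<le> B" "\<And>l t. 0 < snd t \<Longrightarrow>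
     cexp Q (\<lambda>\<omega>. (gen_sum (Suc l) \<xi> \<omega> / \<beta> ^ Suc l)\<^sup>2) t \<le> B * (rate\<^sup>2) ^ Suc l * (h t + (h t)\<^sup>2)"
    by (rule orthogonal_second_moment[OF \<xi> orth]) blast
  have [measurable]: "gen_sum (Suc l) \<xi> \<in> borel_measurable marks_space" for l
    by (rule measurable_gen_sum[OF sq_bounded_measurable[OF \<xi>]])
  have i: "integrable \<E> (\<lambda>b. (gen_sum (Suc l) \<xi> (graft t b) / \<beta> ^ Suc l)\<^sup>2)" if "0 < snd t" for l t
    using sq_bounded_integrable_graft(1)[OF sq_bounded_gen_sum[OF \<xi>] that, of "Suc l"]
    by (simp add: power_divide del: gen_sum.simps)
  have m: "(\<lambda>\<omega>. (gen_sum (Suc l) \<xi> \<omega> / \<beta> ^ Suc l)\<^sup>2) \<in> borel_measurable marks_space" for l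
    by measurable
  note d = dominated_root[where F="\<lambda>\<omega>. (gen_sum (Suc l) \<xi> \<omega> / \<beta> ^ Suc l)\<^sup>2" for l, OF _ _ i B(2) quad_cmult[OF quad_W2]]
  show "integrable \<Omega> (\<lambda>\<omega>. (gen_sum (Suc l) \<xi> \<omega> / \<beta> ^ Suc l)\<^sup>2)" for l
    by (rule d(1)[OF m zero_le_power2])
  have le: "(\<integral>\<omega>. (gen_sum (Suc l) \<xi> \<omega> / \<beta> ^ Suc l)\<^sup>2 \<partial>\<Omega>) \<le> B * (rate\<^sup>2) ^ Suc l * (\<integral>t. h t + (h t)\<^sup>2 \<partial>\<rho>)" for l
  proof -
    have "(\<integral>\<omega>. (gen_sum (Suc l) \<xi> \<omega> / \<beta> ^ Suc l)\<^sup>2 \<partial>\<Omega>) \<le> (\<integral>t. B * (rate\<^sup>2) ^ Suc l * (h t + (h t)\<^sup>2) \<partial>\<rho>)"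
      by (rule d(2)[OF m zero_le_power2])
    then show ?thesis by (simp only: integral_mult_right_zero)
  qed
  have r: "rate\<^sup>2 < 1" using rate(1,2) by (simp add: power2_eq_square mult_strict_mono[of rate 1 rate 1, simplified])
  have lim: "(\<lambda>l. B * (rate\<^sup>2) ^ Suc l * (\<integral>t. h t + (h t)\<^sup>2 \<partial>\<rho>)) \<longlonglongrightarrow> B * 0 * (\<integral>t. h t + (h t)\<^sup>2 \<partial>\<rho>)"
    by (intro tendsto_mult tendsto_const LIMSEQ_Suc[OF LIMSEQ_realpow_zero]) (use r in auto)
  show "(\<lambda>l. \<integral>\<omega>. (gen_sum (Suc l) \<xi> \<omega> / \<beta> ^ Suc l)\<^sup>2 \<partial>\<Omega>) \<longlonglongrightarrow> 0"
  proof (rule tendsto_sandwich[OF _ _ tendsto_const])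
    show "\<forall>\<^sub>F l in sequentially. 0 \<le> (\<integral>\<omega>. (gen_sum (Suc l) \<xi> \<omega> / \<beta> ^ Suc l)\<^sup>2 \<partial>\<Omega>)"
      by (intro always_eventually allI Bochner_Integration.integral_nonneg zero_le_power2)
    show "\<forall>\<^sub>F l in sequentially. (\<integral>\<omega>. (gen_sum (Suc l) \<xi> \<omega> / \<beta> ^ Suc l)\<^sup>2 \<partial>\<Omega>)
        \<le> B * (rate\<^sup>2) ^ Suc l * (\<integral>t. h t + (h t)\<^sup>2 \<partial>\<rho>)"
      by (intro always_eventually allI le)
  qed (use lim in simp)
qed

lemma f_integral_pos: "0 < (\<integral>t. f (snd t) \<partial>\<mu>)"
proof -
  have q: "quad (c2 * \<bar>1\<bar>) (\<lambda>t. f (snd t) * 1)" by (rule quad_f_mult[OF quad_const])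
  have i: "integrable \<mu> (\<lambda>t. f (snd t))" using quad_integrable(1)[OF q] by simp
  have nn: "AE t in \<mu>. 0 \<le> f (snd t)"
    using AE_type_law_pos[of Q] by eventually_elim (rule less_imp_le[OF f_pos])
  have "(\<integral>t. f (snd t) \<partial>\<mu>) \<noteq> 0"
  proof
    assume "(\<integral>t. f (snd t) \<partial>\<mu>) = 0"
    then have "AE t in \<mu>. f (snd t) = 0" using integral_nonneg_eq_0_iff_AE[OF i nn] by simp
    then have "AE t in \<mu>. False" using AE_type_law_pos[of Q]
    proof eventually_elim
      case (elim t)
      then show ?case using f_pos[of "snd t"] by simp
    qed
    then show False by simp
  qed
  moreover have "0 \<le> (\<integral>t. f (snd t) \<partial>\<mu>)" by (rule integral_nonneg_AE[OF nn])
  ultimately show ?thesis by simp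
qed

text \<open>Wherever W is not small, the size N of the generation is about c * W * \<beta>^l, and
  the deviation X - r N is of smaller order. So the mean of X / N is compared with r times the
  survival probability, and the error is charged to the event that W is small without
  extinction.\<close>

theorem generation_average_tendsto:
  assumes \<xi>: "fraction \<xi>"
  shows "(\<lambda>l. (\<integral>\<omega>. gen_sum l \<xi> \<omega> / gen_sum l (\<lambda>_. 1) \<omega> \<partial>\<Omega>) / (1 - death l))
    \<longlonglongrightarrow> (\<integral>t. f (snd t) * cexp Q \<xi> t \<partial>\<mu>) / (\<integral>t. f (snd t) \<partial>\<mu>)"
proof -
  have [measurable]: "\<xi> \<in> borel_measurable marks_space" and \<xi>b: "0 \<le> \<xi> \<omega>" "\<xi> \<omega> \<le> 1" for \<omega>
    using \<xi> by (auto simp: fraction_def)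
  define F where "F = (\<integral>t. f (snd t) \<partial>\<mu>)"
  have F: "0 < F" unfolding F_def by (rule f_integral_pos)
  have Fi: "integrable \<mu> (\<lambda>t. f (snd t))"
    using quad_integrable(1)[OF quad_f_mult[OF quad_const[of 1]]] by simp
  define H where "H = (\<integral>t. f (snd t) * h t \<partial>\<mu>)"
  have H: "0 < H" using gap_pos c2_pos by (simp add: gap_def H_def zero_less_divide_iff)
  have Hi: "integrable \<mu> (\<lambda>t. f (snd t) * h t)" by (rule quad_integrable(1)[OF quad_f_mult[OF quad_h]])
  define r where "r = (\<integral>t. f (snd t) * cexp Q \<xi> t \<partial>\<mu>) / F"
  \<comment> \<open>Makes 1 - c h orthogonal to f, so that N and c times the generation sum of h
    agree up to o(\<beta>^l).\<close>
  define c where "c = F / H"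
  have c: "0 < c" using F H by (simp add: c_def)
  have sqc: "sq_bounded (\<lambda>_. 1)" by (rule sq_bounded_bounded[where c=1]) auto
  have sq\<xi>: "sq_bounded \<xi>" by (rule sq_bounded_bounded[where c=1]) (use \<xi>b in \<open>auto simp: abs_of_nonneg\<close>)
  have q\<xi>: "quad 1 (cexp Q \<xi>)"
    by (rule quad_1) (use cexp_fraction[OF \<xi>] in auto)
  have \<xi>i: "integrable \<mu> (\<lambda>t. f (snd t) * cexp Q \<xi> t)" by (rule quad_integrable(1)[OF quad_f_mult[OF q\<xi>]])
  have r01: "0 \<le> r" "r \<le> 1"
  proof -
    have "AE t in \<mu>. 0 \<le> f (snd t) * cexp Q \<xi> t"
      using AE_type_law_pos[of Q]
      by eventually_elim (intro mult_nonneg_nonneg less_imp_le[OF f_pos] cexp_fraction[OF \<xi>])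
    then show "0 \<le> r" using F by (auto simp: r_def intro!: divide_nonneg_pos integral_nonneg_AE)
    have "(\<integral>t. f (snd t) * cexp Q \<xi> t \<partial>\<mu>) \<le> F" unfolding F_def
    proof (rule integral_mono_AE[OF \<xi>i Fi])
      show "AE t in \<mu>. f (snd t) * cexp Q \<xi> t \<le> f (snd t)"
        using AE_type_law_pos[of Q]
        by eventually_elim (intro mult_left_le less_imp_le[OF f_pos] cexp_fraction[OF \<xi>])
    qed
    then show "r \<le> 1" using F by (simp add: r_def)
  qed
  let ?\<xi>' = "\<lambda>\<omega>. \<xi> \<omega> - r * 1"
  have sq1: "sq_bounded ?\<xi>'" by (rule sq_bounded_diff[OF sq\<xi> sqc])
  have orth1: "(\<integral>t. f (snd t) * cexp Q ?\<xi>' t \<partial>\<mu>) = 0"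
  proof -
    have "cexp Q ?\<xi>' t = cexp Q \<xi> t - r" for t
      unfolding cexp_def using fraction_integrable[OF \<xi>] by (simp add: en.prob_space[simplified])
    then have "(\<integral>t. f (snd t) * cexp Q ?\<xi>' t \<partial>\<mu>) = (\<integral>t. f (snd t) * cexp Q \<xi> t - r * f (snd t) \<partial>\<mu>)"
      by (intro Bochner_Integration.integral_cong refl) (simp only: right_diff_distrib mult.commute[of _ r])
    also have "\<dots> = 0" using \<xi>i Fi F by (simp add: r_def F_def)
    finally show ?thesis .
  qed
  let ?\<psi> = "\<lambda>\<omega>. 1 - c * root_h \<omega>"
  have sq2: "sq_bounded ?\<psi>" by (rule sq_bounded_diff[OF sqc sq_bounded_root_h])
  have orth2: "(\<integral>t. f (snd t) * cexp Q ?\<psi> t \<partial>\<mu>) = 0"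
  proof -
    note [measurable] = sq_bounded_measurable[OF sq2]
    have "(\<integral>t. f (snd t) * cexp Q ?\<psi> t \<partial>\<mu>) = (\<integral>t. f (snd t) - c * (f (snd t) * h t) \<partial>\<mu>)"
    proof (rule integral_cong_AE)
      show "AE t in \<mu>. f (snd t) * cexp Q ?\<psi> t = f (snd t) - c * (f (snd t) * h t)"
        using AE_type_law_pos[of Q]
        by eventually_elim (simp add: cexp_def root_h_graft en.prob_space[simplified] algebra_simps)
    qed measurable
    also have "\<dots> = 0" using Fi Hi H by (simp add: c_def F_def H_def)
    finally show ?thesis .
  qed
  define X N where "X l \<omega> = gen_sum l \<xi> \<omega>" and "N l \<omega> = gen_sum l (\<lambda>_. 1) \<omega>" for l \<omega>
  define Y V where "Y l \<omega> = gen_sum (Suc l) ?\<xi>' \<omega> / \<beta> ^ Suc l" and "V l \<omega> = gen_sum (Suc l) ?\<psi> \<omega> / \<beta> ^ Suc l" for l \<omega>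
  have Y: "Y l \<omega> = (X (Suc l) \<omega> - r * N (Suc l) \<omega>) / \<beta> ^ Suc l" for l \<omega>
    unfolding Y_def X_def N_def by (simp only: gen_sum_diff gen_sum_cmult)
  have V: "V l \<omega> = N (Suc l) \<omega> / \<beta> ^ Suc l - c * W (Suc l) \<omega>" for l \<omega>
    unfolding V_def N_def W_def by (simp only: gen_sum_diff gen_sum_cmult) (simp add: diff_divide_distrib)
  have [measurable]: "X l \<in> borel_measurable marks_space" "N l \<in> borel_measurable marks_space" for l
    unfolding X_def[abs_def] N_def[abs_def] by measurable
  have [measurable]: "Y l \<in> borel_measurable marks_space" "V l \<in> borel_measurable marks_space" for l
    using Y V by (auto simp: fun_eq_iff[symmetric] cong: measurable_cong)
  have Y2: "integrable \<Omega> (\<lambda>\<omega>. (Y l \<omega>)\<^sup>2)" "(\<lambda>l. \<integral>\<omega>. (Y l \<omega>)\<^sup>2 \<partial>\<Omega>) \<longlonglongrightarrow> 0" for l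
    unfolding Y_def by (rule root_second_moment_tendsto[OF sq1 orth1])+
  have V2: "integrable \<Omega> (\<lambda>\<omega>. (V l \<omega>)\<^sup>2)" "(\<lambda>l. \<integral>\<omega>. (V l \<omega>)\<^sup>2 \<partial>\<Omega>) \<longlonglongrightarrow> 0" for l
    unfolding V_def by (rule root_second_moment_tendsto[OF sq2 orth2])+
  have Y1: "integrable \<Omega> (\<lambda>\<omega>. \<bar>Y l \<omega>\<bar>)" for l
    by (intro integrable_abs om.square_integrable_imp_integrable[OF _ Y2(1)]) measurable
  have XN: "0 \<le> X l \<omega>" "X l \<omega> \<le> N l \<omega>" for l \<omega>
    unfolding X_def N_def using \<xi>b by (auto intro: gen_sum_nonneg gen_sum_mono)
  \<comment> \<open>Includes extinction, where X / N is 0 / 0 = 0; this agrees with r * (1 -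
    extinct), which also vanishes there.\<close>
  have ratio: "0 \<le> X l \<omega> / N l \<omega>" "X l \<omega> / N l \<omega> \<le> 1" for l \<omega>
    using XN[of l \<omega>] by (auto simp: divide_le_eq_1 intro!: divide_nonneg_nonneg)
  have Xi: "integrable \<Omega> (\<lambda>\<omega>. X l \<omega> / N l \<omega>)" for l
    by (rule integrable_fraction_root) (use ratio in \<open>auto simp: fraction_def\<close>)
  have ei: "integrable \<Omega> (extinct l)" for l by (rule integrable_fraction_root[OF fraction_extinct])
  define D where "D l = (\<integral>\<omega>. X l \<omega> / N l \<omega> \<partial>\<Omega>) - r * (1 - death l)" for l
  have key: "\<bar>D (Suc l)\<bar> \<le> exp 1 * (laplace (Suc l) \<theta> - death (Suc l))
      + (\<integral>\<omega>. (V l \<omega>)\<^sup>2 \<partial>\<Omega>) / (c / (2 * \<theta>))\<^sup>2 + sqrt (\<integral>\<omega>. (Y l \<omega>)\<^sup>2 \<partial>\<Omega>) / (c / (2 * \<theta>))"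
    if \<theta>: "0 < \<theta>" for \<theta> l
  proof -
    let ?l = "Suc l"
    let ?a = "c / (2 * \<theta>)"
    have a: "0 < ?a" using c \<theta> by simp
    have frW: "integrable \<Omega> (\<lambda>\<omega>. exp (- (\<theta> * W ?l \<omega>)))"
      using \<theta> by (intro integrable_fraction_root fraction_exp_W) auto
    have D: "D ?l = (\<integral>\<omega>. X ?l \<omega> / N ?l \<omega> - r * (1 - extinct ?l \<omega>) \<partial>\<Omega>)"
      unfolding D_def death_def using Xi ei
      by (simp add: om.prob_space[simplified] del: gen_prod.simps)
    \<comment> \<open>A surviving tree is charged to the first term if W <= 1 / \<theta>, the factor
      exp 1 making that term at least 1, and to the second if V is large, as in Chebyshev's
      inequality. Otherwise N / \<beta>^l is at least ?a, and X / N deviates from r by at most |Y| /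
      ?a.\<close>
    have pt: "\<bar>X ?l \<omega> / N ?l \<omega> - r * (1 - extinct ?l \<omega>)\<bar>
        \<le> exp 1 * (exp (- (\<theta> * W ?l \<omega>)) - extinct ?l \<omega>) + (V l \<omega>)\<^sup>2 / ?a\<^sup>2 + \<bar>Y l \<omega>\<bar> / ?a" (is "?lhs \<le> ?A + ?B + ?C") for \<omega>
    proof (cases "extinct ?l \<omega> = 1")
      case True
      have N0: "N ?l \<omega> = 0" "W ?l \<omega> = 0"
        using gen_sum_extinct[OF True] by (simp_all add: N_def W_def del: gen_sum.simps)
      have "?lhs = 0" "?A = 0" "0 \<le> ?B" "0 \<le> ?C"
        using N0 True c \<theta> by (simp_all del: gen_prod.simps)
      then show ?thesis by linarith
    next
      case False
      then have ex: "extinct ?l \<omega> = 0" using extinct_cases by blast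
      have N1: "1 \<le> N ?l \<omega>" unfolding N_def by (rule gen_sum_one_ge_1[OF ex])
      have nn: "0 \<le> ?A" "0 \<le> ?B" "0 \<le> ?C" using c \<theta> unfolding ex by auto
      have lhs1: "?lhs \<le> 1" unfolding ex using ratio[of ?l \<omega>] r01 by (simp add: abs_le_iff)
      consider "\<theta> * W ?l \<omega> \<le> 1" | "?a < \<bar>V l \<omega>\<bar>" | "1 < \<theta> * W ?l \<omega>" "\<bar>V l \<omega>\<bar> \<le> ?a" by linarith
      then show ?thesis
      proof cases
        case 1
        then have "exp 1 * exp (- 1) \<le> exp 1 * exp (- (\<theta> * W ?l \<omega>))" by (intro mult_left_mono) auto
        then have "1 \<le> ?A" unfolding ex by (simp add: mult_exp_exp)
        then show ?thesis using lhs1 nn by linarith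
      next
        case 2
        then have "?a\<^sup>2 \<le> (V l \<omega>)\<^sup>2" using a by (metis abs_le_square_iff abs_of_pos less_imp_le)
        then have "1 \<le> ?B" using a by (simp only: le_divide_eq_1_pos[OF zero_less_power[OF a]])
        then show ?thesis using lhs1 nn by linarith
      next
        case 3
        have "1 / \<theta> < W ?l \<omega>" using 3(1) \<theta> by (simp add: field_simps)
        then have "c * (1 / \<theta>) < c * W ?l \<omega>" using c by (intro mult_strict_left_mono)
        then have "2 * ?a < c * W ?l \<omega>" by simp
        then have "?a \<le> N ?l \<omega> / \<beta> ^ ?l" using V[of l \<omega>] 3(2) by linarith
        moreover have "?lhs = \<bar>Y l \<omega>\<bar> / (N ?l \<omega> / \<beta> ^ ?l)"
        proof -
          have "X ?l \<omega> / N ?l \<omega> - r * (1 - extinct ?l \<omega>) = Y l \<omega> / (N ?l \<omega> / \<beta> ^ ?l)"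
            unfolding Y ex using N1 beta_gt_1 by (simp add: field_simps)
          moreover have "0 < N ?l \<omega> / \<beta> ^ ?l" using N1 beta_gt_1 by simp
          ultimately show ?thesis by (simp only: abs_div_pos)
        qed
        ultimately have "?lhs \<le> ?C" using a by (simp only: divide_left_mono[OF _ abs_ge_zero mult_pos_pos])
        then show ?thesis using nn by linarith
      qed
    qed
    have "\<bar>D ?l\<bar> \<le> (\<integral>\<omega>. \<bar>X ?l \<omega> / N ?l \<omega> - r * (1 - extinct ?l \<omega>)\<bar> \<partial>\<Omega>)"
      unfolding D by (rule integral_abs_bound)
    also have "\<dots> \<le> (\<integral>\<omega>. exp 1 * (exp (- (\<theta> * W ?l \<omega>)) - extinct ?l \<omega>) + (V l \<omega>)\<^sup>2 / ?a\<^sup>2 + \<bar>Y l \<omega>\<bar> / ?a \<partial>\<Omega>)"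
      by (rule integral_mono[OF _ _ pt]) (use Xi ei frW V2(1) Y1 in \<open>simp_all del: gen_prod.simps\<close>)
    also have "\<dots> = exp 1 * (laplace ?l \<theta> - death ?l) + (\<integral>\<omega>. (V l \<omega>)\<^sup>2 \<partial>\<Omega>) / ?a\<^sup>2 + (\<integral>\<omega>. \<bar>Y l \<omega>\<bar> \<partial>\<Omega>) / ?a"
      using ei frW V2(1) Y1 by (simp add: laplace_def death_def del: gen_prod.simps)
    also have "(\<integral>\<omega>. \<bar>Y l \<omega>\<bar> \<partial>\<Omega>) / ?a \<le> sqrt (\<integral>\<omega>. (Y l \<omega>)\<^sup>2 \<partial>\<Omega>) / ?a"
      using om.L1_le_L2[OF _ Y2(1), of l] a by (intro divide_right_mono) auto
    finally show ?thesis by simp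
  qed
  have D0: "(\<lambda>l. D (Suc l)) \<longlonglongrightarrow> 0"
  proof (rule LIMSEQ_I)
    fix e :: real assume e: "0 < e"
    obtain \<theta> l0 where \<theta>: "0 < \<theta>" and l0: "\<And>l. l0 \<le> l \<Longrightarrow> laplace l \<theta> - death l \<le> e / (2 * exp 1)"
      using laplace_minus_death[of "e / (2 * exp 1)"] e by auto
    have "(\<lambda>l. (\<integral>\<omega>. (V l \<omega>)\<^sup>2 \<partial>\<Omega>) / (c / (2 * \<theta>))\<^sup>2 + sqrt (\<integral>\<omega>. (Y l \<omega>)\<^sup>2 \<partial>\<Omega>) / (c / (2 * \<theta>)))
      \<longlonglongrightarrow> 0 / (c / (2 * \<theta>))\<^sup>2 + sqrt 0 / (c / (2 * \<theta>))"
      by (intro tendsto_intros V2(2) Y2(2)) (use c \<theta> in auto)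
    then have "eventually (\<lambda>l. (\<integral>\<omega>. (V l \<omega>)\<^sup>2 \<partial>\<Omega>) / (c / (2 * \<theta>))\<^sup>2 + sqrt (\<integral>\<omega>. (Y l \<omega>)\<^sup>2 \<partial>\<Omega>) / (c / (2 * \<theta>)) < e / 2) sequentially"
      using e by (intro order_tendstoD) auto
    then obtain l1 where l1: "\<And>l. l1 \<le> l \<Longrightarrow>
       (\<integral>\<omega>. (V l \<omega>)\<^sup>2 \<partial>\<Omega>) / (c / (2 * \<theta>))\<^sup>2 + sqrt (\<integral>\<omega>. (Y l \<omega>)\<^sup>2 \<partial>\<Omega>) / (c / (2 * \<theta>)) < e / 2"
      by (auto simp: eventually_sequentially)
    have "norm (D (Suc l) - 0) < e" if "max l0 l1 \<le> l" for l
    proof -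
      have "exp 1 * (laplace (Suc l) \<theta> - death (Suc l)) \<le> exp 1 * (e / (2 * exp 1))"
        using that by (intro mult_left_mono l0) auto
      also have "\<dots> = e / 2" by simp
      finally have A: "exp 1 * (laplace (Suc l) \<theta> - death (Suc l)) \<le> e / 2" .
      have "l1 \<le> l" using that by simp
      from l1[OF this] A key[OF \<theta>, of l] show ?thesis
        unfolding real_norm_def diff_0_right by linarith
    qed
    then show "\<exists>no. \<forall>l\<ge>no. norm (D (Suc l) - 0) < e" by blast
  qed
  obtain p where p: "0 < p" "\<And>l. p \<le> 1 - death l" by (rule survival_bounded_below) blast
  have "(\<lambda>l. D (Suc l) / (1 - death (Suc l))) \<longlonglongrightarrow> 0"
  proof (rule tendsto_rabs_zero_cancel, rule tendsto_sandwich[OF _ _ tendsto_const])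
    show "(\<lambda>l. \<bar>D (Suc l)\<bar> / p) \<longlonglongrightarrow> 0"
      using tendsto_divide[OF tendsto_rabs_zero[OF D0] tendsto_const[of p]] p by simp
    show "\<forall>\<^sub>F l in sequentially. \<bar>D (Suc l) / (1 - death (Suc l))\<bar> \<le> \<bar>D (Suc l)\<bar> / p"
    proof (rule always_eventually, rule allI)
      fix l
      have "\<bar>D (Suc l)\<bar> / (1 - death (Suc l)) \<le> \<bar>D (Suc l)\<bar> / p"
        using p(1) p(2)[of "Suc l"] by (intro divide_left_mono mult_pos_pos) auto
      then show "\<bar>D (Suc l) / (1 - death (Suc l))\<bar> \<le> \<bar>D (Suc l)\<bar> / p"
        using p(1) p(2)[of "Suc l"] by (simp add: abs_divide)
    qed
  qed simp
  then have "(\<lambda>l. D (Suc l) / (1 - death (Suc l)) + r) \<longlonglongrightarrow> 0 + r"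
    by (intro tendsto_add tendsto_const)
  moreover have "D l / (1 - death l) + r = (\<integral>\<omega>. X l \<omega> / N l \<omega> \<partial>\<Omega>) / (1 - death l)" for l
    using p(1) p(2)[of l] by (simp add: D_def field_simps)
  ultimately have "(\<lambda>l. (\<integral>\<omega>. X (Suc l) \<omega> / N (Suc l) \<omega> \<partial>\<Omega>) / (1 - death (Suc l))) \<longlonglongrightarrow> r"
    by simp
  from LIMSEQ_imp_Suc[OF this] show ?thesis by (simp add: X_def N_def r_def F_def)
qed

end

section \<open>Generations of the Erlang Weighted Tree\<close>

text \<open>A list encodes the path leading to it from the root, whose edges join consecutive
  prefixes; p i j is to be read as the presence of the edge from i to its child with index
  j.\<close>

definition is_path :: "('a list \<Rightarrow> 'a \<Rightarrow> bool) \<Rightarrow> 'a list \<Rightarrow> bool" where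
  "is_path p x \<longleftrightarrow> (\<forall>k<length x. p (take k x) (x ! k))"

lemma is_path_Nil [simp]: "is_path p []"
  by (simp add: is_path_def)

lemma is_path_snoc [simp]: "is_path p (x @ [j]) \<longleftrightarrow> is_path p x \<and> p x j"
  by (auto simp: is_path_def nth_append less_Suc_eq)

lemma is_path_Cons: "is_path p (j # x) \<longleftrightarrow> p [] j \<and> is_path (\<lambda>i. p (j # i)) x"
  by (auto simp: is_path_def All_less_Suc2)

abbreviation tree_edges :: "('a list \<Rightarrow> 'a \<Rightarrow> bool) \<Rightarrow> ('a list \<times> 'a list) set" where
  "tree_edges p \<equiv> {(i, i @ [j]) | i j. p i j}"

lemma is_path_relpow:
  "is_path p x \<Longrightarrow> ([], x) \<in> (tree_edges p \<union> (tree_edges p)\<inverse>) ^^ length x"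
proof (induction x rule: rev_induct)
  case (snoc j x)
  then have "([], x) \<in> (tree_edges p \<union> (tree_edges p)\<inverse>) ^^ length x"
    and "(x, x @ [j]) \<in> tree_edges p \<union> (tree_edges p)\<inverse>" by auto
  then show ?case by (auto intro: relpow_Suc_I)
qed simp

text \<open>Read as undirected, an edge appends or removes a last entry, and both preserve
  \<open>is_path\<close>; so walking back and forth reaches nothing new.\<close>

lemma component_tree_edges: "component (tree_edges p) [] = {x. is_path p x}"
proof (intro set_eqI iffI)
  fix x assume "x \<in> component (tree_edges p) []"
  then have "([], x) \<in> (tree_edges p \<union> (tree_edges p)\<inverse>)\<^sup>*" by (simp add: component_def)
  then have "is_path p x" by (induction rule: rtrancl_induct) auto
  then show "x \<in> {x. is_path p x}" by simp
next
  fix x assume "x \<in> {x. is_path p x}"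
  then show "x \<in> component (tree_edges p) []"
    using relpow_imp_rtrancl[OF is_path_relpow] by (auto simp: component_def)
qed

text \<open>Each step changes the length of the list by one, so n steps from the root cannot reach a
  vertex of length above n.\<close>

lemma graph_dist_tree_edges:
  assumes "is_path p x"
  shows "graph_dist (tree_edges p) [] x = length x"
  unfolding graph_dist_def
proof (rule Least_equality)
  show "([], x) \<in> (tree_edges p \<union> (tree_edges p)\<inverse>) ^^ length x" by (rule is_path_relpow[OF assms])
  have "length y \<le> n" if "([], y) \<in> (tree_edges p \<union> (tree_edges p)\<inverse>) ^^ n" for n y
    using that
  proof (induction n arbitrary: y)
    case (Suc n)
    then obtain z where z: "([], z) \<in> (tree_edges p \<union> (tree_edges p)\<inverse>) ^^ n"
      "(z, y) \<in> tree_edges p \<union> (tree_edges p)\<inverse>" by auto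
    from z(2) have "length y \<le> Suc (length z)" by auto
    with Suc.IH[OF z(1)] show ?case by simp
  qed simp
  then show "length x \<le> n" if "([], x) \<in> (tree_edges p \<union> (tree_edges p)\<inverse>) ^^ n" for n
    using that .
qed

definition joined :: "marks \<Rightarrow> vertex \<Rightarrow> nat \<Rightarrow> bool" where
  "joined \<omega> i j \<longleftrightarrow> 1 \<le> j \<and> j \<le> pot_deg \<omega> i \<and> cost \<omega> i j < threshold \<omega> (i @ [j])"

lemma backbone_eq: "backbone \<omega> = {x. is_path (\<lambda>i j. 1 \<le> j \<and> j \<le> pot_deg \<omega> i) x}"
  unfolding backbone_def potential_edges_def by (rule component_tree_edges)

lemma kept_edges_eq: "kept_edges \<omega> = tree_edges (\<lambda>i j. i \<in> backbone \<omega> \<and> joined \<omega> i j)"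
  unfolding kept_edges_def potential_edges_def joined_def by auto

text \<open>A path of joined edges runs along potential edges and so stays inside the
  backbone.\<close>

lemma is_path_joined: "is_path (\<lambda>i j. i \<in> backbone \<omega> \<and> joined \<omega> i j) x \<longleftrightarrow> is_path (joined \<omega>) x"
proof -
  have "is_path (joined \<omega>) x \<Longrightarrow> x \<in> backbone \<omega> \<and> is_path (\<lambda>i j. i \<in> backbone \<omega> \<and> joined \<omega> i j) x"
    by (induction x rule: rev_induct) (auto simp: backbone_eq joined_def)
  moreover have "is_path (\<lambda>i j. i \<in> backbone \<omega> \<and> joined \<omega> i j) x \<Longrightarrow> is_path (joined \<omega>) x"
    by (induction x rule: rev_induct) auto
  ultimately show ?thesis by blast
qed

lemma generation_eq: "generation l \<omega> = {x. is_path (joined \<omega>) x \<and> length x = l}"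
  unfolding generation_def kept_edges_eq component_tree_edges
  by (auto simp: graph_dist_tree_edges is_path_joined)

lemma is_path_joined_backbone: "is_path (joined \<omega>) x \<Longrightarrow> x \<in> backbone \<omega>"
  by (induction x rule: rev_induct) (auto simp: backbone_eq joined_def)

lemma children_eq: "children \<omega> x = (\<lambda>j. x @ [j]) ` {j \<in> {1..pot_deg \<omega> x}. x \<in> backbone \<omega> \<and> joined \<omega> x j}"
  unfolding children_def kept_edges_eq by (auto simp: joined_def)

lemma card_children: "card (children \<omega> x) = card {j \<in> {1..pot_deg \<omega> x}. x \<in> backbone \<omega> \<and> joined \<omega> x j}"
  unfolding children_eq by (rule card_image) (auto simp: inj_on_def)

lemma joined_Nil: "joined \<omega> [] j \<longleftrightarrow> j \<in> kept \<omega>"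
  by (auto simp: joined_def kept_def)

lemma joined_Cons: "joined \<omega> (j # i) = joined (subtree j \<omega>) i"
  by (auto simp: joined_def subtree_def pot_deg_def cost_def threshold_def fun_eq_iff)

lemma joined_append: "joined \<omega> x j \<longleftrightarrow> j \<in> kept (\<lambda>i. \<omega> (x @ i))"
  by (auto simp: joined_def kept_def pot_deg_def cost_def threshold_def)

lemma generation_0: "generation 0 \<omega> = {[]}"
  by (auto simp: generation_eq)

lemma generation_Suc: "generation (Suc l) \<omega> = (\<Union>j\<in>kept \<omega>. (#) j ` generation l (subtree j \<omega>))"
proof (intro set_eqI)
  fix x
  show "x \<in> generation (Suc l) \<omega> \<longleftrightarrow> x \<in> (\<Union>j\<in>kept \<omega>. (#) j ` generation l (subtree j \<omega>))"
    by (cases x) (auto simp: generation_eq is_path_Cons joined_Nil joined_Cons)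
qed

lemma finite_generation [simp]: "finite (generation l \<omega>)"
  by (induction l arbitrary: \<omega>) (auto simp: generation_0 generation_Suc)

lemma gen_sum_generation: "gen_sum l \<xi> \<omega> = (\<Sum>x\<in>generation l \<omega>. \<xi> (\<lambda>i. \<omega> (x @ i)))"
proof (induction l arbitrary: \<omega>)
  case 0
  then show ?case by (simp add: generation_0)
next
  case (Suc l)
  have "(\<Sum>x\<in>generation (Suc l) \<omega>. \<xi> (\<lambda>i. \<omega> (x @ i)))
    = (\<Sum>j\<in>kept \<omega>. \<Sum>x\<in>(#) j ` generation l (subtree j \<omega>). \<xi> (\<lambda>i. \<omega> (x @ i)))"
    unfolding generation_Suc by (intro sum.UNION_disjoint) auto
  also have "\<dots> = (\<Sum>j\<in>kept \<omega>. gen_sum l \<xi> (subtree j \<omega>))"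
  proof (rule sum.cong[OF refl])
    fix j
    show "(\<Sum>x\<in>(#) j ` generation l (subtree j \<omega>). \<xi> (\<lambda>i. \<omega> (x @ i))) = gen_sum l \<xi> (subtree j \<omega>)"
      unfolding Suc by (subst sum.reindex) (auto simp: subtree_def)
  qed
  finally show ?case by simp
qed

lemma card_generation: "real (card (generation l \<omega>)) = gen_sum l (\<lambda>_. 1) \<omega>"
  by (simp add: gen_sum_generation)

lemma extinct_eq: "extinct l \<omega> = of_bool (generation l \<omega> = {})"
proof (cases "generation l \<omega> = {}")
  case True
  then have "gen_sum l (\<lambda>_. 1) \<omega> = 0" by (simp add: gen_sum_generation)
  then have "extinct l \<omega> \<noteq> 0" using gen_sum_one_ge_1[of l \<omega>] by force
  then show ?thesis using extinct_cases[of l \<omega>] True by auto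
next
  case False
  then have "gen_sum l (\<lambda>_. 1) \<omega> \<noteq> 0" by (simp flip: card_generation)
  then have "extinct l \<omega> \<noteq> 1" using gen_sum_extinct by blast
  then show ?thesis using extinct_cases[of l \<omega>] False by auto
qed

lemma card_children_generation:
  assumes "x \<in> generation l \<omega>"
  shows "card (children \<omega> x) = card (kept (\<lambda>i. \<omega> (x @ i)))"
proof -
  have "x \<in> backbone \<omega>" using assms by (auto simp: generation_eq intro: is_path_joined_backbone)
  then have "{j \<in> {1..pot_deg \<omega> x}. x \<in> backbone \<omega> \<and> joined \<omega> x j} = kept (\<lambda>i. \<omega> (x @ i))"
    by (auto simp: joined_append kept_def pot_deg_def)
  then show ?thesis by (simp add: card_children)
qed

lemma measurable_joined [measurable]: "Measurable.pred marks_space (\<lambda>\<omega>. joined \<omega> i j)"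
  unfolding joined_def by measurable

lemma measurable_is_path:
  assumes "\<And>i j. Measurable.pred M (\<lambda>\<omega>. p \<omega> i j)"
  shows "Measurable.pred M (\<lambda>\<omega>. is_path (p \<omega>) x)"
  unfolding is_path_def using assms by measurable

lemma measurable_in_generation [measurable]: "Measurable.pred marks_space (\<lambda>\<omega>. x \<in> generation l \<omega>)"
  unfolding generation_eq mem_Collect_eq
  by (intro pred_intros_logic measurable_is_path) measurable

lemma measurable_in_backbone [measurable]: "Measurable.pred marks_space (\<lambda>\<omega>. x \<in> backbone \<omega>)"
  unfolding backbone_eq mem_Collect_eq by (intro measurable_is_path) measurable

text \<open>There are only countably many finite sets of vertices, so the random set is measurable
  once each event that it equals a given one is.\<close>

lemma measurable_generation [measurable]:
  "generation l \<in> measurable marks_space (count_space (Collect finite))"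
proof (subst measurable_count_space_eq_countable)
  show "countable (Collect finite :: vertex set set)" by (rule countable_Collect_finite)
  show "generation l \<in> space marks_space \<rightarrow> Collect finite \<and>
    (\<forall>S\<in>Collect finite. generation l -` {S} \<inter> space marks_space \<in> sets marks_space)"
  proof (intro conjI ballI)
    fix S :: "vertex set"
    have "generation l -` {S} \<inter> space marks_space = {\<omega> \<in> space marks_space. \<forall>x. x \<in> generation l \<omega> \<longleftrightarrow> x \<in> S}"
      by auto
    also have "\<dots> \<in> sets marks_space" by measurable
    finally show "generation l -` {S} \<inter> space marks_space \<in> sets marks_space" .
  qed auto
qed

lemma measurable_card_children [measurable]:
  "(\<lambda>\<omega>. card (children \<omega> x)) \<in> measurable marks_space (count_space UNIV)"
proof -
  have "(\<lambda>\<omega>. (\<lambda>n \<omega>. card {j \<in> {1..n}. x \<in> backbone \<omega> \<and> joined \<omega> x j}) (pot_deg \<omega> x) \<omega>)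
     \<in> measurable marks_space (count_space UNIV)"
    by (rule measurable_compose_countable) measurable
  then show ?thesis by (simp add: card_children)
qed

section \<open>The law of the uniformly selected vertex\<close>

definition selection :: "nat \<Rightarrow> marks \<Rightarrow> vertex pmf" where
  "selection l \<omega> = (if generation l \<omega> = {} then return_pmf [] else pmf_of_set (generation l \<omega>))"

text \<open>For \<open>bind\<close> the selection has to be a measurable kernel; it depends on the
  marks only through a finite set, one of countably many, which settles this.\<close>

lemma emeasure_ewt_selected:
  assumes A: "A \<in> sets (ewt P \<Otimes>\<^sub>M count_space UNIV)"
  shows "emeasure (ewt_selected P l) A = (\<integral>\<^sup>+\<omega>. emeasure (measure_pmf (selection l \<omega>)) {u. (\<omega>, u) \<in> A} \<partial>ewt P)"
    and "sets (ewt_selected P l) = sets (ewt P \<Otimes>\<^sub>M count_space UNIV)"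
proof -
  let ?M = "ewt P"
  have sM[measurable_cong]: "sets ?M = sets marks_space" by (simp add: ewt_eq_tree_law)
  have spM: "space ?M = UNIV" by (simp add: ewt_eq_tree_law)
  define K where "K \<omega> = distr (measure_pmf (selection l \<omega>)) (?M \<Otimes>\<^sub>M count_space UNIV) (\<lambda>u. (\<omega>, u))" for \<omega>
  have mP: "(\<lambda>u. (\<omega>, u)) \<in> measurable (measure_pmf (selection l \<omega>)) (?M \<Otimes>\<^sub>M count_space UNIV)" for \<omega>
    using measurable_Pair1'[of \<omega> ?M "count_space UNIV"] spM by simp
  have bind: "measure_pmf (selection l \<omega>) \<bind> (\<lambda>u. return (?M \<Otimes>\<^sub>M count_space UNIV) (\<omega>, u)) = K \<omega>" for \<omega>
    unfolding K_def by (rule bind_return_distr'[OF _ mP]) simp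
  have sel: "(\<lambda>\<omega>. measure_pmf (selection l \<omega>)) \<in> measurable ?M (subprob_algebra (count_space UNIV))"
  proof -
    have "generation l \<in> measurable ?M (count_space (Collect finite))" by measurable
    moreover have "(\<lambda>S. measure_pmf (if S = {} then return_pmf [] else pmf_of_set S))
       \<in> measurable (count_space (Collect finite)) (subprob_algebra (count_space (UNIV :: vertex set)))"
      by (simp add: measure_pmf_in_subprob_algebra)
    ultimately show ?thesis
      unfolding selection_def by (rule measurable_compose)
  qed
  have K: "K \<in> measurable ?M (subprob_algebra (?M \<Otimes>\<^sub>M count_space UNIV))"
    unfolding K_def by (rule measurable_distr2[OF _ sel]) (simp add: case_prod_beta')
  have law: "ewt_selected P l = ?M \<bind> K"
    unfolding ewt_selected_def selection_def[symmetric] bind ..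
  show "sets (ewt_selected P l) = sets (?M \<Otimes>\<^sub>M count_space UNIV)"
    unfolding law by (rule sets_bind) (auto simp: K_def spM)
  have "emeasure (ewt_selected P l) A = (\<integral>\<^sup>+\<omega>. emeasure (K \<omega>) A \<partial>?M)"
    unfolding law by (rule emeasure_bind[OF _ K A]) (simp add: spM)
  also have "\<dots> = (\<integral>\<^sup>+\<omega>. emeasure (measure_pmf (selection l \<omega>)) {u. (\<omega>, u) \<in> A} \<partial>?M)"
  proof (rule nn_integral_cong)
    fix \<omega>
    show "emeasure (K \<omega>) A = emeasure (measure_pmf (selection l \<omega>)) {u. (\<omega>, u) \<in> A}"
      unfolding K_def using emeasure_distr[OF mP A] by (simp add: vimage_def)
  qed
  finally show "emeasure (ewt_selected P l) A = (\<integral>\<^sup>+\<omega>. emeasure (measure_pmf (selection l \<omega>)) {u. (\<omega>, u) \<in> A} \<partial>?M)" .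
qed

lemma measurable_Z: "Z l \<in> measurable (marks_space \<Otimes>\<^sub>M count_space UNIV) (count_space UNIV)"
proof -
  have "card \<in> measurable (count_space (Collect finite)) (count_space UNIV)" by simp
  from measurable_compose[OF measurable_compose[OF measurable_fst measurable_generation] this]
  show ?thesis unfolding Z_def case_prod_beta' .
qed

lemma measurable_D: "D \<in> measurable (marks_space \<Otimes>\<^sub>M count_space UNIV) (count_space UNIV)"
proof -
  have "(\<lambda>x. (\<lambda>u x. card (children (fst x) u)) (snd x) x) \<in> measurable (marks_space \<Otimes>\<^sub>M count_space UNIV) (count_space UNIV)"
    by (rule measurable_compose_countable) (auto intro: measurable_compose[OF measurable_fst])
  then show ?thesis unfolding D_def case_prod_beta' .
qed

definition has_degree :: "nat \<Rightarrow> marks \<Rightarrow> real" where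
  "has_degree d \<omega> = of_bool (card (kept \<omega>) = d)"

lemma fraction_has_degree: "fraction (has_degree d)"
proof -
  have "(\<lambda>\<omega>. (\<lambda>n \<omega>. card {j \<in> {1..n}. j \<in> kept \<omega>}) (pot_deg \<omega> []) \<omega>) \<in> measurable marks_space (count_space UNIV)"
    by (rule measurable_compose_countable) measurable
  moreover have "{j \<in> {1..pot_deg \<omega> []}. j \<in> kept \<omega>} = kept \<omega>" for \<omega> by (auto simp: kept_def)
  ultimately have "(\<lambda>\<omega>. card (kept \<omega>)) \<in> measurable marks_space (count_space UNIV)" by simp
  then show ?thesis unfolding fraction_def has_degree_def[abs_def] by measurable
qed

text \<open>Given the marks, the selected vertex has d children with probability equal to the
  proportion of such vertices. Where the generation is empty, the proportion is 0 / 0 = 0, in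
  accordance with the failure of Z l > 0.\<close>

lemma cond_prob_ewt_selected:
  "\<P>(x in ewt_selected P l. D x = d \<bar> Z l x > 0)
    = (\<integral>\<omega>. gen_sum l (has_degree d) \<omega> / gen_sum l (\<lambda>_. 1) \<omega> \<partial>ewt P) / (1 - (\<integral>\<omega>. extinct l \<omega> \<partial>ewt P))"
proof -
  let ?M = "ewt P" and ?E = "ewt_selected P l"
  interpret M: prob_space ?M unfolding ewt_eq_tree_law by (rule prob_space_tree_law)
  have sM[measurable_cong]: "sets ?M = sets marks_space" by (simp add: ewt_eq_tree_law)
  have spM: "space ?M = UNIV" by (simp add: ewt_eq_tree_law)
  note [measurable] = measurable_Z measurable_D
  have sE: "sets ?E = sets (?M \<Otimes>\<^sub>M count_space UNIV)"
    by (rule emeasure_ewt_selected(2)[OF sets.empty_sets])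
  have spE: "space ?E = UNIV" using sets_eq_imp_space_eq[OF sE] by (simp add: space_pair_measure spM)
  note [measurable_cong] = sE
  let ?A = "{x \<in> space ?E. D x = d \<and> Z l x > 0}" and ?B = "{x \<in> space ?E. Z l x > 0}"
  have A: "?A \<in> sets (?M \<Otimes>\<^sub>M count_space UNIV)" and B: "?B \<in> sets (?M \<Otimes>\<^sub>M count_space UNIV)"
    unfolding sE[symmetric] by measurable
  have em: "emeasure (measure_pmf (selection l \<omega>)) {u. (\<omega>, u) \<in> {x \<in> space ?E. Q x \<and> Z l x > 0}}
     = ennreal (if generation l \<omega> = {} then 0 else real (card {u \<in> generation l \<omega>. Q (\<omega>, u)}) / real (card (generation l \<omega>)))" for Q \<omega>
  proof (cases "generation l \<omega> = {}")
    case True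
    then show ?thesis by (simp add: Z_def)
  next
    case False
    have "{u. (\<omega>, u) \<in> {x \<in> space ?E. Q x \<and> Z l x > 0}} = {u. Q (\<omega>, u)}"
      using False by (auto simp: Z_def spE card_gt_0_iff)
    moreover have "generation l \<omega> \<inter> {u. Q (\<omega>, u)} = {u \<in> generation l \<omega>. Q (\<omega>, u)}" by auto
    ultimately show ?thesis
      using False by (simp add: selection_def emeasure_pmf_of_set ennreal_of_nat_eq_real_of_nat
          divide_ennreal card_gt_0_iff)
  qed
  have numA: "(if generation l \<omega> = {} then 0 else real (card {u \<in> generation l \<omega>. D (\<omega>, u) = d}) / real (card (generation l \<omega>)))
     = gen_sum l (has_degree d) \<omega> / gen_sum l (\<lambda>_. 1) \<omega>" for \<omega>
  proof -
    have "gen_sum l (has_degree d) \<omega> = (\<Sum>u\<in>generation l \<omega>. of_bool (D (\<omega>, u) = d))"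
      unfolding gen_sum_generation has_degree_def
      by (intro sum.cong refl) (simp add: D_def card_children_generation)
    also have "\<dots> = real (card {u \<in> generation l \<omega>. D (\<omega>, u) = d})"
      by (simp add: of_bool_def sum.If_cases Int_def)
    finally show ?thesis by (simp add: card_generation[symmetric])
  qed
  have numB: "(if generation l \<omega> = {} then 0 else real (card {u \<in> generation l \<omega>. True}) / real (card (generation l \<omega>)))
     = 1 - extinct l \<omega>" for \<omega>
    by (auto simp: extinct_eq)
  have fr: "fraction (\<lambda>\<omega>. 1 - extinct l \<omega>)"
    using fraction_gen_prod[OF fraction_zero, of l] by (auto simp: fraction_def simp del: gen_prod.simps)
  have fd: "0 \<le> has_degree d \<omega>" "has_degree d \<omega> \<le> 1" for \<omega> by (auto simp: has_degree_def)
  have [measurable]: "has_degree d \<in> borel_measurable marks_space"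
    using fraction_has_degree[of d] by (simp add: fraction_def)
  have r: "0 \<le> gen_sum l (has_degree d) \<omega> / gen_sum l (\<lambda>_. 1) \<omega>" "gen_sum l (has_degree d) \<omega> / gen_sum l (\<lambda>_. 1) \<omega> \<le> 1" for \<omega>
    using gen_sum_nonneg[of "has_degree d" l \<omega>, OF fd(1)] gen_sum_mono[of "has_degree d" "\<lambda>_. 1" l \<omega>, OF fd(2)]
    by (auto simp: divide_le_eq_1 intro!: divide_nonneg_nonneg)
  have bounded_integrable: "integrable ?M \<gamma>" if "\<gamma> \<in> borel_measurable marks_space" "\<And>\<omega>. 0 \<le> \<gamma> \<omega>" "\<And>\<omega>. \<gamma> \<omega> \<le> 1" for \<gamma> :: "marks \<Rightarrow> real"
    using that by (intro M.integrable_const_bound[where B=1]) auto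
  have mA: "measure ?E ?A = (\<integral>\<omega>. gen_sum l (has_degree d) \<omega> / gen_sum l (\<lambda>_. 1) \<omega> \<partial>?M)"
  proof -
    have "emeasure ?E ?A = (\<integral>\<^sup>+\<omega>. ennreal (gen_sum l (has_degree d) \<omega> / gen_sum l (\<lambda>_. 1) \<omega>) \<partial>?M)"
      unfolding emeasure_ewt_selected(1)[OF A] em numA ..
    also have "\<dots> = ennreal (\<integral>\<omega>. gen_sum l (has_degree d) \<omega> / gen_sum l (\<lambda>_. 1) \<omega> \<partial>?M)"
      by (intro nn_integral_eq_integral bounded_integrable) (use r in auto)
    finally show ?thesis using r(1) by (simp add: measure_def)
  qed
  have mB: "measure ?E ?B = 1 - (\<integral>\<omega>. extinct l \<omega> \<partial>?M)"
  proof -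
    have "?B = {x \<in> space ?E. True \<and> Z l x > 0}" by simp
    then have "emeasure ?E ?B = (\<integral>\<^sup>+\<omega>. ennreal (1 - extinct l \<omega>) \<partial>?M)"
      unfolding emeasure_ewt_selected(1)[OF B] using em[of _ "\<lambda>_. True"] by (simp only: numB)
    also have "\<dots> = ennreal (\<integral>\<omega>. 1 - extinct l \<omega> \<partial>?M)"
      using fr by (intro nn_integral_eq_integral bounded_integrable) (auto simp: fraction_def)
    finally have "measure ?E ?B = (\<integral>\<omega>. 1 - extinct l \<omega> \<partial>?M)"
      using fr by (simp add: measure_def fraction_def)
    also have "\<dots> = 1 - (\<integral>\<omega>. extinct l \<omega> \<partial>?M)"
      using bounded_integrable[of "extinct l"] fraction_gen_prod[OF fraction_zero, of l]
      by (simp add: fraction_def M.prob_space del: gen_prod.simps)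
    finally show ?thesis .
  qed
  show ?thesis unfolding cond_prob_def mA mB ..
qed

section \<open>The kernel and its critical eigenfunction\<close>

text \<open>Truncated subtraction sends both 0 and 1 to 0, hence the hypothesis.\<close>

lemma pmf_shifted: "pmf P 0 = 0 \<Longrightarrow> pmf (shifted P) m = pmf P (m + 1)"
proof -
  assume 0: "pmf P 0 = 0"
  have "pmf (shifted P) m = measure (measure_pmf P) ((\<lambda>k. k - 1) -` {m})"
    by (simp add: shifted_def pmf_map)
  also have "\<dots> = measure (measure_pmf P) {m + 1}"
  proof (rule measure_pmf.finite_measure_eq_AE)
    show "AE x in measure_pmf P. x \<in> (\<lambda>k. k - 1) -` {m} \<longleftrightarrow> x \<in> {m + 1}"
      using 0 by (auto simp: AE_measure_pmf_iff set_pmf_eq) (metis Suc_pred neq0_conv)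
  qed auto
  finally show ?thesis by (simp add: measure_pmf_single)
qed

lemma summable_g2: "summable (\<lambda>k. pmf P (k + 2) * x ^ k / fact k)"
proof (rule summable_comparison_test)
  have "norm (pmf P (k + 2) * x ^ k / fact k) \<le> inverse (fact k) * \<bar>x\<bar> ^ k" for k
    using mult_right_mono[OF pmf_le_1[of P "k + 2"], of "\<bar>x\<bar> ^ k / fact k"]
    by (simp add: abs_mult power_abs divide_inverse mult_ac)
  then show "\<exists>N. \<forall>k\<ge>N. norm (pmf P (k + 2) * x ^ k / fact k) \<le> inverse (fact k) * \<bar>x\<bar> ^ k" by blast
  show "summable (\<lambda>k. inverse (fact k) * \<bar>x\<bar> ^ k)" by (rule summable_exp)
qed

lemma isCont_g2: "isCont (g2 P) x"
proof -
  have "(\<lambda>x. \<Sum>k. pmf P (k + 2) / fact k * x ^ k) = (\<lambda>x. \<Sum>k. pmf P (k + 2) * x ^ k / fact k)"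
    by (simp add: mult_ac)
  moreover have "isCont (\<lambda>x. \<Sum>k. pmf P (k + 2) / fact k * x ^ k) x"
    by (rule isCont_powser_converges_everywhere) (use summable_g2 in simp)
  ultimately show ?thesis unfolding g2_def[abs_def] by (intro continuous_intros) simp_all
qed

lemma measurable_g2 [measurable]: "g2 P \<in> borel_measurable borel"
  by (intro borel_measurable_continuous_onI continuous_at_imp_continuous_on ballI isCont_g2)

lemma g2_nonneg: "0 \<le> x \<Longrightarrow> 0 \<le> g2 P x"
  unfolding g2_def by (intro mult_nonneg_nonneg suminf_nonneg summable_g2) auto

text \<open>Absorbing exp (- z) into the power series shows g2 to be a mixture of Erlang(k + 1)
  densities.\<close>

lemma ennreal_g2:
  "ennreal (indicator {0..} z * g2 P z) = (\<Sum>k. ennreal (pmf P (k + 2) * erlang_density k 1 z))"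
proof (cases "z < 0")
  case True
  then show ?thesis by (simp add: erlang_density_def)
next
  case False
  have "(\<Sum>k. ennreal (pmf P (k + 2) * erlang_density k 1 z)) = ennreal (\<Sum>k. pmf P (k + 2) * erlang_density k 1 z)"
  proof (rule suminf_ennreal2)
    show "summable (\<lambda>k. pmf P (k + 2) * erlang_density k 1 z)"
      using summable_mult[OF summable_g2[of P z], of "exp (- z)"] False
      by (simp add: erlang_density_def mult_ac)
  qed simp
  also have "(\<Sum>k. pmf P (k + 2) * erlang_density k 1 z) = g2 P z"
    using suminf_mult[OF summable_g2[of P z], of "exp (- z)"] False
    by (simp add: erlang_density_def g2_def mult_ac)
  finally show ?thesis using False by simp
qed

locale degree_law =
  fixes P :: "nat pmf"
  assumes P0: "pmf P 0 = 0" and P1: "pmf P 1 < 1"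
    and P_mean: "integrable (measure_pmf P) real"
begin

abbreviation g :: "real \<Rightarrow> real" where "g \<equiv> g2 P"

text \<open>For m >= 1 the Erlang(m + 1) density times m / z is the Erlang(m) density. So the factor
  m / z of the mean operator turns the type law of a child into the measure with density g2; the
  term m = 0 drops out, which shifts the weights from P(m + 1) to P(m + 2).\<close>

lemma nn_integral_g2:
  assumes [measurable]: "\<phi> \<in> borel_measurable borel"
  shows "(\<integral>\<^sup>+z. ennreal (indicator {0..} z * g z) * \<phi> z \<partial>lborel)
    = (\<integral>\<^sup>+t. ennreal (real (fst t) / snd t) * \<phi> (snd t) \<partial>type_law (shifted P))"
proof -
  have "(\<integral>\<^sup>+t. ennreal (real (fst t) / snd t) * \<phi> (snd t) \<partial>type_law (shifted P))
    = (\<Sum>m. ennreal (pmf P (m + 1)) * (\<integral>\<^sup>+z. ennreal (erlang_density m 1 z) * (ennreal (real m / z) * \<phi> z) \<partial>lborel))"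
    by (subst nn_integral_type_law_lborel) (simp_all add: pmf_shifted[OF P0])
  also have "\<dots> = (\<Sum>m. ennreal (pmf P (Suc m + 1)) * (\<integral>\<^sup>+z. ennreal (erlang_density (Suc m) 1 z) * (ennreal (real (Suc m) / z) * \<phi> z) \<partial>lborel))"
    by (subst suminf_offset[of _ 1]) (auto intro: summableI)
  also have "\<dots> = (\<Sum>m. \<integral>\<^sup>+z. ennreal (pmf P (m + 2) * erlang_density m 1 z) * \<phi> z \<partial>lborel)"
  proof (rule suminf_cong)
    fix m
    have "(\<integral>\<^sup>+z. ennreal (erlang_density (Suc m) 1 z) * (ennreal (real (Suc m) / z) * \<phi> z) \<partial>lborel)
      = (\<integral>\<^sup>+z. ennreal (erlang_density m 1 z) * \<phi> z \<partial>lborel)"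
    proof (rule nn_integral_cong_AE)
      show "AE z in lborel. ennreal (erlang_density (Suc m) 1 z) * (ennreal (real (Suc m) / z) * \<phi> z)
         = ennreal (erlang_density m 1 z) * \<phi> z"
        using AE_lborel_singleton[of "0 :: real"]
      proof eventually_elim
        case (elim z)
        show ?case
        proof (cases "z < 0")
          case True
          then show ?thesis by (simp add: erlang_density_def)
        next
          case False
          have "erlang_density (Suc m) 1 z * (real (Suc m) / z) = erlang_density m 1 z"
            using elim False by (simp add: erlang_density_def fact_Suc field_simps del: of_nat_Suc)
          then show ?thesis using False elim
            by (subst mult.assoc[symmetric], subst ennreal_mult[symmetric]) auto
        qed
      qed
    qed
    then show "ennreal (pmf P (Suc m + 1)) * (\<integral>\<^sup>+z. ennreal (erlang_density (Suc m) 1 z) * (ennreal (real (Suc m) / z) * \<phi> z) \<partial>lborel)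
      = (\<integral>\<^sup>+z. ennreal (pmf P (m + 2) * erlang_density m 1 z) * \<phi> z \<partial>lborel)"
      by (simp add: ennreal_mult mult.assoc nn_integral_cmult)
  qed
  also have "\<dots> = (\<integral>\<^sup>+z. ennreal (indicator {0..} z * g z) * \<phi> z \<partial>lborel)"
    unfolding ennreal_g2 by (subst nn_integral_suminf[symmetric]) (auto simp: ennreal_suminf_multc)
  finally show ?thesis ..
qed

lemma nn_integral_g2_power:
  "(\<integral>\<^sup>+z. ennreal (indicator {0..} z * g z) * ennreal (z ^ i) \<partial>lborel)
     = (\<Sum>k. ennreal (pmf P (k + 2)) * ennreal (fact (k + i) / fact k))"
proof -
  have "(\<integral>\<^sup>+z. ennreal (indicator {0..} z * g z) * ennreal (z ^ i) \<partial>lborel)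
    = (\<Sum>k. \<integral>\<^sup>+z. ennreal (pmf P (k + 2) * erlang_density k 1 z) * ennreal (z ^ i) \<partial>lborel)"
    unfolding ennreal_g2 by (subst nn_integral_suminf[symmetric]) (auto simp: ennreal_suminf_multc)
  also have "\<dots> = (\<Sum>k. ennreal (pmf P (k + 2)) * ennreal (fact (k + i) / fact k))"
  proof (rule suminf_cong)
    fix k
    have "ennreal (erlang_density k 1 z) * ennreal (z ^ i) = ennreal (erlang_density k 1 z * z ^ i)" for z
      by (cases "z < 0") (auto simp: erlang_density_def ennreal_mult'[symmetric])
    then show "(\<integral>\<^sup>+z. ennreal (pmf P (k + 2) * erlang_density k 1 z) * ennreal (z ^ i) \<partial>lborel)
      = ennreal (pmf P (k + 2)) * ennreal (fact (k + i) / fact k)"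
      using nn_integral_erlang_ith_moment[of 1 k i]
      by (simp add: ennreal_mult mult.assoc nn_integral_cmult)
  qed
  finally show ?thesis .
qed

text \<open>The two integrals are the sums of P(k + 2) and of (k + 1) P(k + 2), and the latter is at
  most the mean of P.\<close>

lemma
  shows integrable_g: "integrable lborel (\<lambda>z. indicator {0..} z * g z)"
    and integrable_zg: "integrable lborel (\<lambda>z. indicator {0..} z * (z * g z))"
proof -
  have nn: "0 \<le> indicator {0..} z * g z" "0 \<le> indicator {0..} z * (z * g z)" for z
    using g2_nonneg[of z] by (auto simp: indicator_def)
  have e: "(\<integral>\<^sup>+k. ennreal (real k) \<partial>measure_pmf P) < \<infinity>"
    using P_mean by (simp add: integrable_iff_bounded)
  have "(\<Sum>k. ennreal (pmf P (k + 2)) * ennreal (real (k + 1))) \<le> (\<Sum>k. ennreal (pmf P (k + 2)) * ennreal (real (k + 2)))"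
    by (intro suminf_le mult_left_mono ennreal_leI) (auto intro: summableI)
  also have "\<dots> \<le> (\<Sum>k. ennreal (pmf P k) * ennreal (real k))"
    using suminf_offset[of "\<lambda>k. ennreal (pmf P k) * ennreal (real k)" 2] by (simp add: summableI)
  also have "\<dots> = (\<integral>\<^sup>+k. ennreal (real k) \<partial>measure_pmf P)"
    by (simp add: nn_integral_measure_pmf nn_integral_count_space_nat)
  finally have fin: "(\<Sum>k. ennreal (pmf P (k + 2)) * ennreal (real (k + 1))) < \<infinity>"
    using e by (rule order_le_less_trans)
  have "(\<integral>\<^sup>+z. ennreal (indicator {0..} z * g z) \<partial>lborel) = (\<Sum>k. ennreal (pmf P (k + 2)) * 1)"
    using nn_integral_g2_power[of 0] by simp
  also have "\<dots> \<le> (\<Sum>k. ennreal (pmf P (k + 2)) * ennreal (real (k + 1)))"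
    by (intro suminf_le mult_left_mono) (auto intro: summableI)
  finally have "(\<integral>\<^sup>+z. ennreal (norm (indicator {0..} z * g z)) \<partial>lborel) < \<infinity>"
    using fin nn by (simp add: abs_of_nonneg)
  then show "integrable lborel (\<lambda>z. indicator {0..} z * g z)"
    by (intro integrableI_bounded) auto
  have "(\<integral>\<^sup>+z. ennreal (norm (indicator {0..} z * (z * g z))) \<partial>lborel)
    = (\<integral>\<^sup>+z. ennreal (indicator {0..} z * g z) * ennreal (z ^ 1) \<partial>lborel)"
  proof (rule nn_integral_cong)
    fix z :: real
    show "ennreal (norm (indicator {0..} z * (z * g z))) = ennreal (indicator {0..} z * g z) * ennreal (z ^ 1)"
      using g2_nonneg[of z] by (cases "0 \<le> z") (auto simp: ennreal_mult'[symmetric] mult.commute)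
  qed
  also have "\<dots> = (\<Sum>k. ennreal (pmf P (k + 2)) * ennreal (real (k + 1)))"
    unfolding nn_integral_g2_power by (simp add: fact_Suc[symmetric] del: fact_Suc) (simp add: add.commute)
  finally show "integrable lborel (\<lambda>z. indicator {0..} z * (z * g z))"
    using fin by (intro integrableI_bounded) auto
qed

text \<open>If all P(k + 2) were 0, P would be concentrated at 1.\<close>

lemma g_pos: "0 < x \<Longrightarrow> 0 < g x"
proof -
  assume x: "0 < x"
  have "\<exists>k. 0 < pmf P (k + 2)"
  proof (rule ccontr)
    assume "\<not> ?thesis"
    then have z: "pmf P (k + 2) = 0" for k using pmf_nonneg[of P "k + 2"] by (meson not_less_iff_gr_or_eq order.antisym not_le)
    have "set_pmf P \<subseteq> {1}"
    proof
      fix k assume k: "k \<in> set_pmf P"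
      then have "pmf P k \<noteq> 0" by (simp add: set_pmf_iff)
      moreover have "k = 0 \<or> k = 1 \<or> k = (k - 2) + 2" by arith
      ultimately show "k \<in> {1}" using P0 z[of "k - 2"] by force
    qed
    then have "P = return_pmf 1" using set_pmf_subset_singleton by metis
    then show False using P1 by simp
  qed
  then obtain k where k: "0 < pmf P (k + 2)" by blast
  have "0 < pmf P (k + 2) * x ^ k / fact k" using k x by simp
  then have "0 < (\<Sum>k. pmf P (k + 2) * x ^ k / fact k)"
    by (intro suminf_pos2[OF summable_g2]) (use x in auto)
  then show ?thesis by (simp add: g2_def)
qed

end

text \<open>The point z is counted once for every y between x and z, that is, with weight z - x;
  integrability of H and of z H z on the half-line justifies Fubini's theorem.\<close>

lemma double_tail_integral:
  fixes H :: "real \<Rightarrow> real"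
  assumes [measurable]: "H \<in> borel_measurable borel" and x: "0 \<le> x"
    and i0: "integrable lborel (\<lambda>z. indicator {0..} z * H z)"
    and i1: "integrable lborel (\<lambda>z. indicator {0..} z * (z * H z))"
  shows "(LBINT y:{x..}. (LBINT z:{y..}. H z)) = (\<integral>z. indicator {x..} z * ((z - x) * H z) \<partial>lborel)"
    and "integrable lborel (\<lambda>z. indicator {x..} z * ((z - x) * H z))"
proof -
  let ?F = "\<lambda>z y. (if x \<le> y \<and> y \<le> z then H z else 0)"
  have ind: "?F z y = H z * indicator {x..z} y" for z y by (auto simp: indicator_def)
  have m: "(\<integral>y. c * indicator {x..z} y \<partial>lborel) = indicator {x..} z * ((z - x) * c)" for c z :: real
    by (cases "x \<le> z") auto
  have inner: "(\<integral>y. norm (?F z y) \<partial>lborel) = indicator {x..} z * ((z - x) * \<bar>H z\<bar>)" for z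
  proof -
    have "(\<integral>y. norm (?F z y) \<partial>lborel) = (\<integral>y. \<bar>H z\<bar> * indicator {x..z} y \<partial>lborel)"
      by (intro Bochner_Integration.integral_cong refl) (auto simp: indicator_def)
    then show ?thesis unfolding m .
  qed
  have inner': "(\<integral>y. ?F z y \<partial>lborel) = indicator {x..} z * ((z - x) * H z)" for z
    unfolding ind m ..
  have i: "integrable lborel (\<lambda>z. indicator {x..} z * ((z - x) * H z))"
  proof -
    have "integrable lborel (\<lambda>z. indicator {x..} z * (indicator {0..} z * (z * H z) - x * (indicator {0..} z * H z)))"
      by (rule integrable_real_mult_indicator[of "{x..}", unfolded mult.commute[of _ "indicator {x..} _"]])
         (use i0 i1 in auto)
    moreover have "indicator {x..} z * (indicator {0..} z * (z * H z) - x * (indicator {0..} z * H z)) = indicator {x..} z * ((z - x) * H z)" for z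
      using x by (auto simp: indicator_def algebra_simps)
    ultimately show ?thesis by simp
  qed
  then show "integrable lborel (\<lambda>z. indicator {x..} z * ((z - x) * H z))" .
  have F: "integrable (lborel \<Otimes>\<^sub>M lborel) (case_prod ?F)"
  proof (rule lborel_pair.Fubini_integrable)
    have "integrable lborel (\<lambda>z. norm (indicator {x..} z * ((z - x) * H z)))" by (rule integrable_norm[OF i])
    moreover have "norm (indicator {x..} z * ((z - x) * H z)) = indicator {x..} z * ((z - x) * \<bar>H z\<bar>)" for z
      by (auto simp: indicator_def abs_mult)
    ultimately show "integrable lborel (\<lambda>z. \<integral>y. norm (case (z, y) of (z, y) \<Rightarrow> ?F z y) \<partial>lborel)"
      unfolding prod.case inner by simp
    show "AE z in lborel. integrable lborel (\<lambda>y. case (z, y) of (z, y) \<Rightarrow> ?F z y)"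
      unfolding prod.case ind by (intro AE_I2 integrable_mult_right integrable_real_indicator) (auto simp: emeasure_lborel_Icc_eq)
  qed measurable
  have "(LBINT y:{x..}. (LBINT z:{y..}. H z)) = (\<integral>y. \<integral>z. ?F z y \<partial>lborel \<partial>lborel)"
    unfolding set_lebesgue_integral_def
  proof (intro Bochner_Integration.integral_cong refl)
    fix y
    show "indicator {x..} y *\<^sub>R (\<integral>z. indicator {y..} z *\<^sub>R H z \<partial>lborel) = (\<integral>z. ?F z y \<partial>lborel)"
      by (cases "x \<le> y") (auto simp: indicator_def intro!: Bochner_Integration.integral_cong)
  qed
  also have "\<dots> = (\<integral>z. \<integral>y. ?F z y \<partial>lborel \<partial>lborel)"
    by (rule lborel_pair.Fubini_integral[OF F])
  finally show "(LBINT y:{x..}. (LBINT z:{y..}. H z)) = (\<integral>z. indicator {x..} z * ((z - x) * H z) \<partial>lborel)"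
    unfolding inner' .
qed

lemma measurable_tail_integral:
  fixes H :: "real \<Rightarrow> real"
  assumes [measurable]: "H \<in> borel_measurable borel"
  shows "(\<lambda>y. LBINT z:{y..}. H z) \<in> borel_measurable borel"
proof -
  have "(\<lambda>y. \<integral>z. (if y \<le> z then H z else 0) \<partial>lborel) \<in> borel_measurable borel" by measurable
  moreover have "(\<integral>z. (if y \<le> z then H z else 0) \<partial>lborel) = (LBINT z:{y..}. H z)" for y
    unfolding set_lebesgue_integral_def by (intro Bochner_Integration.integral_cong) (auto simp: indicator_def)
  ultimately show ?thesis by simp
qed

lemma measurable_G [measurable]: "G P i \<in> borel_measurable borel"
  by (induction i) (auto intro!: measurable_tail_integral borel_measurable_times)

section \<open>Bounds for the iterated tail integrals\<close>

context degree_law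
begin

text \<open>For x >= 0 the tail integral of y g y. Written as the total minus an interval integral
  it is differentiable on the whole line, including at 0.\<close>

definition \<Psi> :: "real \<Rightarrow> real" where
  "\<Psi> x = (\<integral>z. indicator {0..} z * (z * g z) \<partial>lborel) - (LBINT y=0..x. y * g y)"

lemma DERIV_\<Psi>: "(\<Psi> has_real_derivative - (x * g x)) (at x)"
proof -
  let ?a = "min 0 x - 1" and ?b = "max 0 x + 1"
  have "continuous_on {?a..?b} (\<lambda>y. y * g y)"
    by (intro continuous_intros continuous_at_imp_continuous_on ballI isCont_g2)
  then have "((\<lambda>u. LBINT y=0..u. y * g y) has_vector_derivative x * g x) (at x within {?a..?b})"
    using interval_integral_FTC2[of ?a 0 ?b "\<lambda>y. y * g y" x] by (simp add: zero_ereal_def)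
  then have "((\<lambda>u. LBINT y=0..u. y * g y) has_real_derivative x * g x) (at x)"
    by (simp add: at_within_Icc_at has_real_derivative_iff_has_vector_derivative)
  then show ?thesis unfolding \<Psi>_def[abs_def] by (auto intro!: derivative_eq_intros)
qed

lemma measurable_\<Psi> [measurable]: "\<Psi> \<in> borel_measurable borel"
  by (intro borel_measurable_continuous_onI continuous_at_imp_continuous_on ballI DERIV_isCont[OF DERIV_\<Psi>])

lemma \<Psi>_eq: "0 \<le> x \<Longrightarrow> \<Psi> x = (\<integral>z. indicator {0..} z * (z * g z) \<partial>lborel) - (\<integral>z. indicator {..x} z *\<^sub>R (indicator {0..} z * (z * g z)) \<partial>lborel)"
proof -
  assume x: "0 \<le> x"
  have "(LBINT y=0..x. y * g y) = (LBINT y:{0..x}. y * g y)"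
    using x interval_integral_Icc[of 0 x "\<lambda>y. y * g y"] by (simp add: zero_ereal_def)
  also have "\<dots> = (\<integral>z. indicator {..x} z *\<^sub>R (indicator {0..} z * (z * g z)) \<partial>lborel)"
    unfolding set_lebesgue_integral_def by (intro Bochner_Integration.integral_cong) (auto simp: indicator_def)
  finally show ?thesis by (simp add: \<Psi>_def)
qed

lemma \<Psi>_tendsto: "(\<Psi> \<longlongrightarrow> 0) at_top"
proof -
  let ?k = "\<lambda>z. indicator {0..} z * (z * g z)"
  have lim: "((\<lambda>x. (\<integral>z. ?k z \<partial>lborel) - (\<integral>z. indicator {..x} z *\<^sub>R ?k z \<partial>lborel)) \<longlongrightarrow> (\<integral>z. ?k z \<partial>lborel) - (\<integral>z. ?k z \<partial>lborel)) at_top"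
    by (intro tendsto_diff tendsto_const tendsto_integral_at_top integrable_zg) simp
  have "eventually (\<lambda>x. (\<integral>z. ?k z \<partial>lborel) - (\<integral>z. indicator {..x} z *\<^sub>R ?k z \<partial>lborel) = \<Psi> x) at_top"
    using eventually_ge_at_top[of 0] by eventually_elim (simp add: \<Psi>_eq)
  from Lim_transform_eventually[OF lim this] show ?thesis by (simp only: diff_self)
qed

lemma \<Psi>_antimono:
  assumes "0 \<le> x" "x \<le> y" shows "\<Psi> y \<le> \<Psi> x"
proof (rule DERIV_nonpos_imp_nonincreasing[OF assms(2)])
  fix z assume "x \<le> z" "z \<le> y"
  then have "- (z * g z) \<le> 0" using assms g2_nonneg[of z P] by simp
  then show "\<exists>d. (\<Psi> has_real_derivative d) (at z) \<and> d \<le> 0" using DERIV_\<Psi> by blast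
qed

lemma \<Psi>_nonneg: assumes "0 \<le> x" shows "0 \<le> \<Psi> x"
proof (rule tendsto_upperbound[OF \<Psi>_tendsto])
  show "eventually (\<lambda>y. \<Psi> y \<le> \<Psi> x) at_top"
    using eventually_ge_at_top[of x] by eventually_elim (rule \<Psi>_antimono[OF assms])
qed simp

text \<open>The integrand is the derivative of - \<Psi>^(i + 1) / (i + 1)!, which tends to 0 at
  infinity.\<close>

lemma nn_integral_\<Psi>_power:
  assumes x: "0 \<le> x"
  shows "(\<integral>\<^sup>+z. ennreal (z * g z * (\<Psi> z ^ i / fact i)) * indicator {x..} z \<partial>lborel) = ennreal (\<Psi> x ^ Suc i / fact (Suc i))"
proof -
  have "(\<integral>\<^sup>+z. ennreal (z * g z * (\<Psi> z ^ i / fact i)) * indicator {x..} z \<partial>lborel) = ennreal (0 - (- (\<Psi> x ^ Suc i / fact (Suc i))))"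
  proof (rule nn_integral_FTC_atLeast)
    fix z assume z: "x \<le> z"
    have "((\<lambda>z. - (\<Psi> z ^ Suc i / fact (Suc i))) has_real_derivative - ((real (Suc i) * (- (z * g z) * \<Psi> z ^ i)) / fact (Suc i))) (at z)"
      using DERIV_power[where n="Suc i", OF DERIV_\<Psi>] by (intro DERIV_minus DERIV_cdivide) simp
    also have "- ((real (Suc i) * (- (z * g z) * \<Psi> z ^ i)) / fact (Suc i)) = z * g z * (\<Psi> z ^ i / fact i)"
      by (simp add: fact_Suc del: of_nat_Suc)
    finally show "((\<lambda>z. - (\<Psi> z ^ Suc i / fact (Suc i))) has_real_derivative z * g z * (\<Psi> z ^ i / fact i)) (at z)" .
    show "0 \<le> z * g z * (\<Psi> z ^ i / fact i)" using z x g2_nonneg[of z P] \<Psi>_nonneg[of z] by simp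
  next
    have "((\<lambda>z. - (\<Psi> z ^ Suc i / fact (Suc i))) \<longlongrightarrow> - (0 ^ Suc i / fact (Suc i))) at_top"
      by (intro tendsto_intros \<Psi>_tendsto) simp
    then show "((\<lambda>z. - (\<Psi> z ^ Suc i / fact (Suc i))) \<longlongrightarrow> 0) at_top" by simp
  qed measurable
  then show ?thesis by simp
qed

lemma g_bounded_integrable:
  fixes u :: "real \<Rightarrow> real"
  assumes [measurable]: "u \<in> borel_measurable borel" and b: "\<And>z. 0 \<le> z \<Longrightarrow> \<bar>u z\<bar> \<le> c"
  shows "integrable lborel (\<lambda>z. indicator {0..} z * (g z * u z))"
    and "integrable lborel (\<lambda>z. indicator {0..} z * (z * (g z * u z)))"
proof -
  show "integrable lborel (\<lambda>z. indicator {0..} z * (g z * u z))"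
  proof (rule Bochner_Integration.integrable_bound)
    show "integrable lborel (\<lambda>z. c * (indicator {0..} z * g z))" using integrable_g by simp
    show "AE z in lborel. norm (indicator {0..} z * (g z * u z)) \<le> norm (c * (indicator {0..} z * g z))"
    proof (rule AE_I2)
      fix z :: real
      have "\<bar>g z\<bar> * \<bar>u z\<bar> \<le> \<bar>g z\<bar> * \<bar>c\<bar>" if "0 \<le> z" using b[OF that] by (intro mult_left_mono) auto
      then show "norm (indicator {0..} z * (g z * u z)) \<le> norm (c * (indicator {0..} z * g z))"
        by (auto simp: indicator_def abs_mult mult.commute)
    qed
  qed measurable
  show "integrable lborel (\<lambda>z. indicator {0..} z * (z * (g z * u z)))"
  proof (rule Bochner_Integration.integrable_bound)
    show "integrable lborel (\<lambda>z. c * (indicator {0..} z * (z * g z)))" using integrable_zg by simp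
    show "AE z in lborel. norm (indicator {0..} z * (z * (g z * u z))) \<le> norm (c * (indicator {0..} z * (z * g z)))"
    proof (rule AE_I2)
      fix z :: real
      have "\<bar>z * g z\<bar> * \<bar>u z\<bar> \<le> \<bar>z * g z\<bar> * \<bar>c\<bar>" if "0 \<le> z" using b[OF that] by (intro mult_left_mono) auto
      then show "norm (indicator {0..} z * (z * (g z * u z))) \<le> norm (c * (indicator {0..} z * (z * g z)))"
        by (auto simp: indicator_def abs_mult mult_ac)
    qed
  qed measurable
qed

text \<open>Enlarging the weight z - x to z makes the iterated integrals exact powers, as in a
  Picard iteration. The factorial gained here makes the series for L converge at every positive
  \<beta>.\<close>

lemma G_bounds:
  "0 \<le> x \<Longrightarrow> 0 \<le> G P i x \<and> G P i x \<le> \<Psi> x ^ i / fact i"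
proof (induction i arbitrary: x)
  case 0
  then show ?case by simp
next
  case (Suc i)
  have b: "\<bar>G P i z\<bar> \<le> \<Psi> 0 ^ i / fact i" if "0 \<le> z" for z
  proof -
    have "\<Psi> z ^ i / fact i \<le> \<Psi> 0 ^ i / fact i"
      using that by (intro divide_right_mono power_mono \<Psi>_antimono \<Psi>_nonneg) auto
    then show ?thesis using Suc.IH[OF that] by linarith
  qed
  note gi = g_bounded_integrable[OF measurable_G b]
  note dt = double_tail_integral[OF _ Suc.prems gi]
  have eq: "G P (Suc i) x = (\<integral>z. indicator {x..} z * ((z - x) * (g z * G P i z)) \<partial>lborel)"
    unfolding G.simps by (rule dt(1)) measurable
  have i: "integrable lborel (\<lambda>z. indicator {x..} z * ((z - x) * (g z * G P i z)))"
    by (rule dt(2)) measurable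
  have nn: "0 \<le> indicator {x..} z * ((z - x) * (g z * G P i z))" for z
    using Suc.IH[of z] g2_nonneg[of z P] Suc.prems by (auto simp: indicator_def)
  have "ennreal (G P (Suc i) x) = (\<integral>\<^sup>+z. ennreal (indicator {x..} z * ((z - x) * (g z * G P i z))) \<partial>lborel)"
    unfolding eq using nn by (intro nn_integral_eq_integral[symmetric] i) auto
  also have "\<dots> \<le> (\<integral>\<^sup>+z. ennreal (z * g z * (\<Psi> z ^ i / fact i)) * indicator {x..} z \<partial>lborel)"
  proof (rule nn_integral_mono)
    fix z :: real
    show "ennreal (indicator {x..} z * ((z - x) * (g z * G P i z))) \<le> ennreal (z * g z * (\<Psi> z ^ i / fact i)) * indicator {x..} z"
    proof (cases "x \<le> z")
      case True
      then have z: "0 \<le> z" using Suc.prems by simp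
      have "(z - x) * (g z * G P i z) \<le> z * (g z * (\<Psi> z ^ i / fact i))"
        using True z Suc.prems Suc.IH[OF z] g2_nonneg[OF z, of P] by (intro mult_mono mult_nonneg_nonneg) auto
      then show ?thesis using True by (auto intro!: ennreal_leI simp: mult.assoc)
    qed simp
  qed
  also have "\<dots> = ennreal (\<Psi> x ^ Suc i / fact (Suc i))" by (rule nn_integral_\<Psi>_power[OF Suc.prems])
  finally have "G P (Suc i) x \<le> \<Psi> x ^ Suc i / fact (Suc i)"
    using \<Psi>_nonneg[OF Suc.prems] by (subst (asm) ennreal_le_iff) auto
  moreover have "0 \<le> G P (Suc i) x" unfolding eq using nn by (intro Bochner_Integration.integral_nonneg) auto
  ultimately show ?case by simp
qed

section \<open>The series as a function of s = 1 / \<beta>\<close>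

definition A :: real where "A = \<Psi> 0"

lemma G_abs_le: "0 \<le> x \<Longrightarrow> \<bar>G P i x\<bar> \<le> A ^ i / fact i"
proof -
  assume x: "0 \<le> x"
  have "\<Psi> x ^ i / fact i \<le> A ^ i / fact i"
    unfolding A_def using x by (intro divide_right_mono power_mono \<Psi>_antimono \<Psi>_nonneg) auto
  then show ?thesis using G_bounds[OF x, of i] by linarith
qed

lemma G_Suc:
  assumes "0 \<le> x"
  shows "G P (Suc i) x = (\<integral>z. indicator {x..} z * ((z - x) * (g z * G P i z)) \<partial>lborel)"
    and "integrable lborel (\<lambda>z. indicator {x..} z * ((z - x) * (g z * G P i z)))"
proof -
  note dt = double_tail_integral[OF _ assms g_bounded_integrable[OF measurable_G G_abs_le]]
  show "G P (Suc i) x = (\<integral>z. indicator {x..} z * ((z - x) * (g z * G P i z)) \<partial>lborel)"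
    unfolding G.simps by (rule dt(1)) measurable
  show "integrable lborel (\<lambda>z. indicator {x..} z * ((z - x) * (g z * G P i z)))"
    by (rule dt(2)) measurable
qed

text \<open>In the variable s = 1 / \<beta> the series is entire, and the largest zero in \<beta>
  becomes the smallest positive one in s, to be reached from s = 0, where u is 1.\<close>

definition u :: "real \<Rightarrow> real \<Rightarrow> real" where
  "u s x = (\<Sum>i. G P i x * (- s) ^ i)"

lemma L_eq_u: "L P \<beta> x = u (1 / \<beta>) x"
  by (simp add: L_def u_def)

lemma exp_series: "summable (\<lambda>i. A ^ i / fact i * s ^ i)" "(\<Sum>i. A ^ i / fact i * s ^ i) = exp (A * s)"
proof -
  have e: "A ^ i / fact i * s ^ i = (A * s) ^ i /\<^sub>R fact i" for i
    by (simp add: power_mult_distrib divide_inverse mult_ac)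
  show "summable (\<lambda>i. A ^ i / fact i * s ^ i)" unfolding e by (rule summable_exp_generic)
  show "(\<Sum>i. A ^ i / fact i * s ^ i) = exp (A * s)" unfolding e exp_def ..
qed

lemma u_summable:
  assumes "0 \<le> x" shows "summable (\<lambda>i. norm (G P i x * (- s) ^ i))"
proof (rule summable_comparison_test)
  have "norm (norm (G P i x * (- s) ^ i)) \<le> A ^ i / fact i * \<bar>s\<bar> ^ i" for i
    using mult_right_mono[OF G_abs_le[OF assms, of i], of "\<bar>s\<bar> ^ i"] by (simp add: abs_mult power_abs)
  then show "\<exists>N. \<forall>i\<ge>N. norm (norm (G P i x * (- s) ^ i)) \<le> A ^ i / fact i * \<bar>s\<bar> ^ i" by blast
qed (rule exp_series)

lemma measurable_u [measurable]: "u s \<in> borel_measurable borel"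
  unfolding u_def[abs_def] by measurable

lemma u_abs_le:
  assumes "0 \<le> x" shows "\<bar>u s x\<bar> \<le> exp (A * \<bar>s\<bar>)"
proof -
  have "norm (u s x) \<le> (\<Sum>i. norm (G P i x * (- s) ^ i))"
    unfolding u_def by (rule summable_norm[OF u_summable[OF assms]])
  also have "\<dots> \<le> (\<Sum>i. A ^ i / fact i * \<bar>s\<bar> ^ i)"
  proof (rule suminf_le[OF _ u_summable[OF assms] exp_series(1)])
    show "norm (G P i x * (- s) ^ i) \<le> A ^ i / fact i * \<bar>s\<bar> ^ i" for i
      using mult_right_mono[OF G_abs_le[OF assms, of i], of "\<bar>s\<bar> ^ i"] by (simp add: abs_mult power_abs)
  qed
  finally show ?thesis by (simp only: exp_series real_norm_def)
qed

text \<open>The coefficient bound A^i / i! is uniform in x, and its products with s'^i - s^i >= 0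
  sum to a difference of exponentials. This yields continuity in s, uniformly in x.\<close>

lemma u_diff_le:
  assumes x: "0 \<le> x" and s: "0 \<le> s" "s \<le> s'"
  shows "\<bar>u s' x - u s x\<bar> \<le> exp (A * s') - exp (A * s)"
proof -
  have sm: "summable (\<lambda>i. G P i x * (- r) ^ i)" for r by (rule summable_norm_cancel[OF u_summable[OF x]])
  have b: "norm (G P i x * (- s') ^ i - G P i x * (- s) ^ i) \<le> A ^ i / fact i * s' ^ i - A ^ i / fact i * s ^ i" for i
  proof -
    have "(- s') ^ i - (- s) ^ i = (- 1) ^ i * (s' ^ i - s ^ i)"
      by (simp add: power_minus[of s'] power_minus[of s] right_diff_distrib)
    then have "norm (G P i x * (- s') ^ i - G P i x * (- s) ^ i) = \<bar>G P i x\<bar> * (s' ^ i - s ^ i)"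
      using s power_mono[of s s' i] by (simp add: right_diff_distrib[symmetric] abs_mult power_abs)
    also have "\<dots> \<le> A ^ i / fact i * (s' ^ i - s ^ i)"
      using s power_mono[of s s' i] G_abs_le[OF x, of i] by (intro mult_right_mono) auto
    finally show ?thesis by (simp add: right_diff_distrib)
  qed
  have sb: "summable (\<lambda>i. A ^ i / fact i * s' ^ i - A ^ i / fact i * s ^ i)"
    by (intro summable_diff exp_series)
  have sn: "summable (\<lambda>i. norm (G P i x * (- s') ^ i - G P i x * (- s) ^ i))"
    by (rule summable_comparison_test[OF _ sb]) (use b in auto)
  have "u s' x - u s x = (\<Sum>i. G P i x * (- s') ^ i - G P i x * (- s) ^ i)"
    unfolding u_def by (rule suminf_diff[OF sm sm])
  also have "norm \<dots> \<le> (\<Sum>i. norm (G P i x * (- s') ^ i - G P i x * (- s) ^ i))" by (rule summable_norm[OF sn])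
  also have "\<dots> \<le> (\<Sum>i. A ^ i / fact i * s' ^ i - A ^ i / fact i * s ^ i)" by (rule suminf_le[OF b sn sb])
  also have "\<dots> = exp (A * s') - exp (A * s)"
    by (simp only: suminf_diff[OF exp_series(1) exp_series(1), symmetric] exp_series(2))
  finally show ?thesis by simp
qed

lemma u_integrable:
  shows "integrable lborel (\<lambda>z. indicator {0..} z * (g z * u s z))"
    and "integrable lborel (\<lambda>z. indicator {0..} z * (z * (g z * u s z)))"
  using g_bounded_integrable[OF measurable_u u_abs_le] by auto

text \<open>The recursion for G summed over i; absolute convergence allows sum and integral to be
  exchanged.\<close>

lemma u_eq:
  assumes x: "0 \<le> x"
  shows "u s x = 1 - s * (\<integral>z. indicator {x..} z * ((z - x) * (g z * u s z)) \<partial>lborel)"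
proof -
  have sm: "summable (\<lambda>i. G P i x * (- s) ^ i)" by (rule summable_norm_cancel[OF u_summable[OF x]])
  let ?F = "\<lambda>i z. (- s) ^ i * (indicator {x..} z * ((z - x) * (g z * G P i z)))"
  have Fi: "integrable lborel (?F i)" for i using G_Suc(2)[OF x] by simp
  have FI: "(\<integral>z. ?F i z \<partial>lborel) = (- s) ^ i * G P (Suc i) x" for i
    using G_Suc(1)[OF x] by simp
  have nn: "0 \<le> indicator {x..} z * ((z - x) * (g z * G P i z))" for i z
    using G_bounds[of z i] g2_nonneg[of z P] x by (auto simp: indicator_def)
  have Fn: "(\<integral>z. norm (?F i z) \<partial>lborel) = \<bar>s\<bar> ^ i * G P (Suc i) x" for i
  proof -
    have "norm (?F i z) = \<bar>s\<bar> ^ i * (indicator {x..} z * ((z - x) * (g z * G P i z)))" for z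
      by (simp only: real_norm_def abs_mult[of "(- s) ^ i"] abs_of_nonneg[OF nn] power_abs abs_minus_cancel)
    then show ?thesis by (simp only: integral_mult_right_zero G_Suc(1)[OF x])
  qed
  have "summable (\<lambda>i. \<bar>s\<bar> ^ i * G P (Suc i) x)"
  proof (cases "s = 0")
    case True
    then show ?thesis by (intro summable_finite[of "{0}"]) auto
  next
    case False
    have "summable (\<lambda>i. norm (G P (Suc i) x * (- s) ^ Suc i))"
      using summable_ignore_initial_segment[OF u_summable[OF x, of s], of 1] by simp
    then have "summable (\<lambda>i. norm (G P (Suc i) x * (- s) ^ Suc i) * inverse \<bar>s\<bar>)" by (rule summable_mult2)
    moreover have "norm (G P (Suc i) x * (- s) ^ Suc i) * inverse \<bar>s\<bar> = \<bar>s\<bar> ^ i * G P (Suc i) x" for i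
      using False G_bounds[OF x, of "Suc i"] by (simp add: abs_mult power_abs del: G.simps)
    ultimately show ?thesis by simp
  qed
  then have "(\<lambda>i. \<integral>z. ?F i z \<partial>lborel) sums (\<integral>z. (\<Sum>i. ?F i z) \<partial>lborel)"
  proof (intro sums_integral Fi AE_I2)
    fix z :: real
    show "summable (\<lambda>i. norm (?F i z))"
    proof (cases "x \<le> z")
      case True
      have "summable (\<lambda>i. norm (G P i z * (- s) ^ i) * \<bar>(z - x) * g z\<bar>)"
        by (rule summable_mult2[OF u_summable]) (use x True in simp)
      then show ?thesis using True by (simp add: abs_mult mult_ac)
    qed simp
  qed (simp only: Fn)
  moreover have "(\<Sum>i. ?F i z) = indicator {x..} z * ((z - x) * (g z * u s z))" for z
  proof (cases "x \<le> z")
    case True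
    have "summable (\<lambda>i. G P i z * (- s) ^ i)"
      by (rule summable_norm_cancel[OF u_summable]) (use x True in simp)
    from suminf_mult[OF this, of "(z - x) * g z"] show ?thesis
      using True by (simp add: u_def mult_ac)
  qed simp
  ultimately have sums: "(\<lambda>i. (- s) ^ i * G P (Suc i) x) sums (\<integral>z. indicator {x..} z * ((z - x) * (g z * u s z)) \<partial>lborel)"
    by (simp only: FI)
  have "u s x = (\<Sum>i. G P (i + 1) x * (- s) ^ (i + 1)) + (\<Sum>i<1. G P i x * (- s) ^ i)"
    unfolding u_def by (rule suminf_split_initial_segment[OF sm])
  also have "(\<Sum>i. G P (i + 1) x * (- s) ^ (i + 1)) = (\<Sum>i. (- s) * ((- s) ^ i * G P (Suc i) x))"
    by (simp add: mult_ac del: G.simps(2))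
  also have "\<dots> = (- s) * (\<integral>z. indicator {x..} z * ((z - x) * (g z * u s z)) \<partial>lborel)"
    using suminf_mult[OF sums_summable[OF sums], of "- s"] sums_unique[OF sums] by simp
  finally show ?thesis by simp
qed

lemma min_integrable:
  assumes [measurable]: "v \<in> borel_measurable borel" and b: "\<And>z. 0 \<le> z \<Longrightarrow> \<bar>v z\<bar> \<le> c" and x: "0 \<le> x"
  shows "integrable lborel (\<lambda>z. indicator {0..} z * (min x z * (g z * v z)))"
proof (rule Bochner_Integration.integrable_bound[OF g_bounded_integrable(2)[OF assms(1) b]])
  show "AE z in lborel. norm (indicator {0..} z * (min x z * (g z * v z))) \<le> norm (indicator {0..} z * (z * (g z * v z)))"
    using x by (intro AE_I2) (auto simp: indicator_def abs_mult intro!: mult_right_mono)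
qed measurable

text \<open>In the difference of the equations at 0 and at x, the weights z and max 0 (z - x)
  combine to \<open>min x z\<close>.\<close>

lemma u_minus_u0:
  assumes x: "0 \<le> x"
  shows "u s x = u s 0 + s * (\<integral>z. indicator {0..} z * (min x z * (g z * u s z)) \<partial>lborel)"
proof -
  have m: "(\<lambda>z. g z * u s z) \<in> borel_measurable borel" by measurable
  note dt = double_tail_integral(2)[OF m _ u_integrable[of s]]
  have i: "integrable lborel (\<lambda>z. indicator {0..} z * ((z - 0) * (g z * u s z)))"
    "integrable lborel (\<lambda>z. indicator {x..} z * ((z - x) * (g z * u s z)))"
    using dt[of 0] dt[OF x] by auto
  have "(\<integral>z. indicator {0..} z * (min x z * (g z * u s z)) \<partial>lborel)
     = (\<integral>z. indicator {0..} z * ((z - 0) * (g z * u s z)) - indicator {x..} z * ((z - x) * (g z * u s z)) \<partial>lborel)"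
    using x by (intro Bochner_Integration.integral_cong refl) (auto simp: indicator_def min_def algebra_simps)
  also have "\<dots> = (\<integral>z. indicator {0..} z * ((z - 0) * (g z * u s z)) \<partial>lborel) - (\<integral>z. indicator {x..} z * ((z - x) * (g z * u s z)) \<partial>lborel)"
    by (rule Bochner_Integration.integral_diff[OF i])
  finally have e: "(\<integral>z. indicator {0..} z * (min x z * (g z * u s z)) \<partial>lborel) = \<dots>" .
  show ?thesis
    unfolding u_eq[OF x, of s] u_eq[of 0 s, OF order_refl] e right_diff_distrib by linarith
qed

lemma u_mono_on_nonneg:
  assumes s: "0 \<le> s" and nn: "\<And>z. 0 \<le> z \<Longrightarrow> 0 \<le> u s z" and x: "0 \<le> x" "x \<le> y"
  shows "u s x \<le> u s y"
proof -
  have i: "integrable lborel (\<lambda>z. indicator {0..} z * (min x z * (g z * u s z)))" if "0 \<le> x" for x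
    by (rule min_integrable[OF measurable_u u_abs_le that])
  have "(\<integral>z. indicator {0..} z * (min x z * (g z * u s z)) \<partial>lborel) \<le> (\<integral>z. indicator {0..} z * (min y z * (g z * u s z)) \<partial>lborel)"
  proof (rule integral_mono[OF i i])
    fix z :: real
    show "indicator {0..} z * (min x z * (g z * u s z)) \<le> indicator {0..} z * (min y z * (g z * u s z))"
      using nn[of z] g2_nonneg[of z P] x by (auto simp: indicator_def intro!: mult_right_mono)
  qed (use x in auto)
  then show ?thesis
    using s x unfolding u_minus_u0[OF x(1), of s] u_minus_u0[of y s, OF order_trans[OF x]] by (simp add: mult_left_mono)
qed

section \<open>The critical parameter\<close>

definition bad :: "real set" where
  "bad = {s. 0 \<le> s \<and> (\<exists>x\<ge>0. u s x \<le> 0)}"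

text \<open>If u stayed positive for all s, it would be nondecreasing in x, and the integral
  equation at x = 1 would give u s 1 >= s * I * u s 1, where I is the mass of g on the half-line
  from 1; this fails for s = 2 / I.\<close>

lemma bad_nonempty: "bad \<noteq> {}"
proof
  assume "bad = {}"
  then have pos: "0 < u s x" if "0 \<le> s" "0 \<le> x" for s x
    using that by (force simp: bad_def)
  define I where "I = (\<integral>z. indicator {1..} z * g z \<partial>lborel)"
  have iI: "integrable lborel (\<lambda>z. indicator {1..} z * g z)"
  proof (rule Bochner_Integration.integrable_bound[OF integrable_g])
    show "AE z in lborel. norm (indicator {1..} z * g z) \<le> norm (indicator {0..} z * g z)"
      by (intro AE_I2) (auto simp: indicator_def)
  qed measurable
  have gn: "0 \<le> indicator {1..} z * g z" for z :: real using g2_nonneg[of z P] by (auto simp: indicator_def)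
  have I: "0 < I"
  proof -
    have "I \<noteq> 0"
    proof
      assume "I = 0"
      then have "AE z in lborel. indicator {1..} z * g z = 0"
        using integral_nonneg_eq_0_iff_AE[OF iI] gn by (simp add: I_def)
      then have "AE z in lborel. z \<notin> {1..(2::real)}"
      proof eventually_elim
        case (elim z)
        then show ?case using g_pos[of z] by (auto simp: indicator_def)
      qed
      then have "{1..(2::real)} \<in> null_sets lborel" by (subst (asm) AE_iff_null_sets[symmetric]) auto
      then show False by (simp add: null_sets_def)
    qed
    moreover have "0 \<le> I" unfolding I_def using gn by (intro Bochner_Integration.integral_nonneg) auto
    ultimately show ?thesis by simp
  qed
  define s where "s = 2 / I"
  have s: "0 < s" using I by (simp add: s_def)
  have s0: "0 \<le> s" using s by simp
  have nn: "0 \<le> u s z" if "0 \<le> z" for z using pos[OF s0 that] by simp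
  have "u s 1 * I = (\<integral>z. u s 1 * (indicator {1..} z * g z) \<partial>lborel)" by (simp add: I_def)
  also have "\<dots> \<le> (\<integral>z. indicator {0..} z * (min 1 z * (g z * u s z)) \<partial>lborel)"
  proof (rule integral_mono[OF _ min_integrable[OF measurable_u u_abs_le]])
    fix z :: real
    show "u s 1 * (indicator {1..} z * g z) \<le> indicator {0..} z * (min 1 z * (g z * u s z))"
    proof (cases "1 \<le> z")
      case True
      have "u s 1 * g z \<le> u s z * g z"
        using True g2_nonneg[of z P] by (intro mult_right_mono u_mono_on_nonneg s0 nn) auto
      then show ?thesis using True by (simp add: mult.commute)
    next
      case False
      then show ?thesis using nn[of z] g2_nonneg[of z P] by (auto simp: indicator_def)
    qed
  qed (use iI in auto)
  finally have "s * (u s 1 * I) \<le> s * (\<integral>z. indicator {0..} z * (min 1 z * (g z * u s z)) \<partial>lborel)"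
    using s0 by (rule mult_left_mono)
  also have "\<dots> \<le> u s 1" using u_minus_u0[of 1 s] nn[of 0] by simp
  finally have "2 * u s 1 \<le> u s 1" using I by (simp add: s_def)
  then show False using pos[OF s0, of 1] by simp
qed

text \<open>The threshold below which u s is positive on the whole half-line; it turns out to be the
  reciprocal of \<beta>0.\<close>

definition s_crit :: real where "s_crit = Inf bad"

lemma u_pos_below:
  assumes "0 \<le> s" "s < s_crit" "0 \<le> x" shows "0 < u s x"
proof (rule ccontr)
  assume "\<not> ?thesis"
  then have "s \<in> bad" using assms by (auto simp: bad_def)
  then have "s_crit \<le> s" unfolding s_crit_def by (intro cInf_lower bdd_belowI[of _ 0]) (auto simp: bad_def)
  then show False using assms by simp
qed

lemma exp_A_near:
  assumes "0 < e"
  obtains \<delta> where "0 < \<delta>" "\<And>r. \<bar>r - s\<bar> < \<delta> \<Longrightarrow> \<bar>exp (A * r) - exp (A * s)\<bar> < e"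
proof -
  have "isCont (\<lambda>r. exp (A * r)) s" by (intro continuous_intros)
  then obtain \<delta> where "0 < \<delta>" "\<And>r. dist r s < \<delta> \<Longrightarrow> dist (exp (A * r)) (exp (A * s)) < e"
    using assms unfolding continuous_at_eps_delta by blast
  then show ?thesis using that[of \<delta>] by (auto simp: dist_real_def)
qed

lemma u_diff_abs_le:
  assumes "0 \<le> x" "0 \<le> s" "0 \<le> s'"
  shows "\<bar>u s' x - u s x\<bar> \<le> \<bar>exp (A * s') - exp (A * s)\<bar>"
  using u_diff_le[OF assms(1,2), of s'] u_diff_le[OF assms(1,3), of s] by (cases "s \<le> s'") auto

text \<open>A lower bound uniform in x survives small changes of s, because the continuity in s is
  uniform in x.\<close>

lemma not_bad_near:
  assumes s: "0 \<le> s" and e: "0 < e" and lb: "\<And>x. 0 \<le> x \<Longrightarrow> e \<le> u s x"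
  obtains \<delta> where "0 < \<delta>" "\<And>r. r \<in> bad \<Longrightarrow> \<delta> \<le> \<bar>r - s\<bar>"
proof -
  obtain \<delta> where \<delta>: "0 < \<delta>" "\<And>r. \<bar>r - s\<bar> < \<delta> \<Longrightarrow> \<bar>exp (A * r) - exp (A * s)\<bar> < e"
    by (rule exp_A_near[OF e]) blast
  show ?thesis
  proof (rule that[OF \<delta>(1)], rule ccontr)
    fix r assume r: "r \<in> bad" "\<not> \<delta> \<le> \<bar>r - s\<bar>"
    then obtain x where x: "0 \<le> r" "0 \<le> x" "u r x \<le> 0" by (auto simp: bad_def)
    show False using u_diff_abs_le[OF x(2) s x(1)] \<delta>(2)[of r] r(2) lb[OF x(2)] x(3) by linarith
  qed
qed

lemma u_0: "u 0 x = 1"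
proof -
  have "u 0 x = (\<Sum>i. if i = 0 then 1 else 0)"
    unfolding u_def by (intro suminf_cong) (auto simp: power_0_left)
  then show ?thesis using suminf_finite[of "{0}" "\<lambda>i. if i = 0 then 1 else (0::real)"] by simp
qed

lemma s_crit_pos: "0 < s_crit"
proof -
  obtain \<delta> where \<delta>: "0 < \<delta>" "\<And>r. r \<in> bad \<Longrightarrow> \<delta> \<le> \<bar>r - 0\<bar>"
    by (rule not_bad_near[of 0 1]) (auto simp: u_0)
  have "\<delta> \<le> s_crit" unfolding s_crit_def
    using \<delta>(2) by (intro cInf_greatest bad_nonempty) (force simp: bad_def)
  then show ?thesis using \<delta>(1) by simp
qed

text \<open>A negative value would persist for parameters slightly below s_crit, where u is
  positive. The maximum with 0 keeps the chosen parameter admissible.\<close>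

lemma u_s_crit_nonneg:
  assumes x: "0 \<le> x" shows "0 \<le> u s_crit x"
proof (rule ccontr)
  assume neg: "\<not> ?thesis"
  then have "0 < - u s_crit x" by simp
  obtain \<delta> where \<delta>: "0 < \<delta>" "\<And>r. \<bar>r - s_crit\<bar> < \<delta> \<Longrightarrow> \<bar>exp (A * r) - exp (A * s_crit)\<bar> < - u s_crit x"
    by (rule exp_A_near[OF \<open>0 < - u s_crit x\<close>]) blast
  define r where "r = max 0 (s_crit - \<delta> / 2)"
  have r: "0 \<le> r" "r < s_crit" "\<bar>r - s_crit\<bar> < \<delta>" using \<delta>(1) s_crit_pos by (auto simp: r_def)
  show False using u_pos_below[OF r(1,2) x] u_diff_abs_le[OF x less_imp_le[OF s_crit_pos] r(1)] \<delta>(2)[OF r(3)]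
    by linarith
qed

text \<open>The critical parameter is reached at the boundary point 0: since u is nondecreasing, a positive
  value at 0 would keep nearby parameters good as well.\<close>

lemma u_s_crit_0: "u s_crit 0 = 0"
proof (rule ccontr)
  assume ne: "u s_crit 0 \<noteq> 0"
  then have a: "0 < u s_crit 0" using u_s_crit_nonneg[of 0] by simp
  have lb: "u s_crit 0 \<le> u s_crit x" if "0 \<le> x" for x
    using s_crit_pos that u_s_crit_nonneg by (intro u_mono_on_nonneg) auto
  obtain \<delta> where \<delta>: "0 < \<delta>" "\<And>r. r \<in> bad \<Longrightarrow> \<delta> \<le> \<bar>r - s_crit\<bar>"
    by (rule not_bad_near[OF less_imp_le[OF s_crit_pos] a lb]) auto
  have "s_crit + \<delta> \<le> s_crit"
    unfolding s_crit_def
  proof (rule cInf_greatest[OF bad_nonempty])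
    fix r assume r: "r \<in> bad"
    then have "Inf bad \<le> r" by (intro cInf_lower bdd_belowI[of _ 0]) (auto simp: bad_def)
    then show "Inf bad + \<delta> \<le> r" using \<delta>(2)[OF r] by (simp add: s_crit_def)
  qed
  then show False using \<delta>(1) by simp
qed

text \<open>\<open>u_s_crit_0\<close> makes 1 / s_crit a zero, and any zero b puts 1 / b into
  \<open>bad\<close> with witness x = 0. In particular the largest zero exists, so that
  \<open>GREATEST\<close> is meaningful.\<close>

lemma beta0_eq: "beta0 P = 1 / s_crit"
  unfolding beta0_def
proof (rule Greatest_equality)
  show "0 < 1 / s_crit \<and> L P (1 / s_crit) 0 = 0" using s_crit_pos u_s_crit_0 by (simp add: L_eq_u)
  fix b assume b: "0 < b \<and> L P b 0 = 0"
  then have "1 / b \<in> bad" by (auto simp: bad_def L_eq_u intro!: exI[of _ 0])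
  then have "s_crit \<le> 1 / b" unfolding s_crit_def by (intro cInf_lower bdd_belowI[of _ 0]) (auto simp: bad_def)
  then show "b \<le> 1 / s_crit" using b s_crit_pos by (simp add: field_simps)
qed

section \<open>The critical eigenfunction\<close>

definition U :: "real \<Rightarrow> real" where "U x = L P (beta0 P) x"

lemma U_eq_u: "U = u s_crit"
  using s_crit_pos by (simp add: U_def fun_eq_iff beta0_eq L_eq_u)

lemma measurable_U [measurable]: "U \<in> borel_measurable borel"
  by (simp add: U_eq_u)

lemma beta0_pos: "0 < beta0 P"
  using s_crit_pos by (simp add: beta0_eq)

lemma U_eigen:
  assumes x: "0 \<le> x"
  shows "beta0 P * U x = (\<integral>z. indicator {0..} z * (min x z * (g z * U z)) \<partial>lborel)"
  using u_minus_u0[OF x, of s_crit] s_crit_pos by (simp add: U_eq_u u_s_crit_0 beta0_eq)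

lemma U_nonneg: "0 \<le> x \<Longrightarrow> 0 \<le> U x"
  by (simp add: U_eq_u u_s_crit_nonneg)

lemma U_le_1: assumes x: "0 \<le> x" shows "U x \<le> 1"
proof -
  have "0 \<le> (\<integral>z. indicator {x..} z * ((z - x) * (g z * u s_crit z)) \<partial>lborel)"
    using x u_s_crit_nonneg g2_nonneg by (intro Bochner_Integration.integral_nonneg) (auto simp: indicator_def)
  then show ?thesis using u_eq[OF x, of s_crit] s_crit_pos by (simp add: U_eq_u)
qed

text \<open>Otherwise the integral in \<open>u_eq\<close> vanishes at x = 0, and u s_crit 0 would be
  1 instead of 0.\<close>

lemma gU_not_null: "\<not> (AE z in lborel. indicator {0..} z * (g z * U z) = 0)"
proof
  assume "AE z in lborel. indicator {0..} z * (g z * U z) = 0"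
  then have "AE z in lborel. indicator {0..} z * ((z - 0) * (g z * u s_crit z)) = 0"
    by eventually_elim (auto simp: U_eq_u indicator_def)
  then have "(\<integral>z. indicator {0..} z * ((z - 0) * (g z * u s_crit z)) \<partial>lborel) = (\<integral>z. 0 \<partial>(lborel :: real measure))"
    by (intro integral_cong_AE) auto
  then have "u s_crit 0 = 1" using u_eq[of 0 s_crit] by simp
  then show False by (simp add: u_s_crit_0)
qed

lemma U_abs_le: "0 \<le> z \<Longrightarrow> \<bar>U z\<bar> \<le> 1"
  using U_nonneg[of z] U_le_1[of z] by simp

lemma U_pos: assumes x: "0 < x" shows "0 < U x"
proof -
  have nn: "0 \<le> indicator {0..} z * (min x z * (g z * U z))" for z
    using x U_nonneg[of z] g2_nonneg[of z P] by (auto simp: indicator_def)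
  have i: "integrable lborel (\<lambda>z. indicator {0..} z * (min x z * (g z * U z)))"
    by (rule min_integrable[OF measurable_U U_abs_le]) (use x in auto)
  have "(\<integral>z. indicator {0..} z * (min x z * (g z * U z)) \<partial>lborel) \<noteq> 0"
  proof
    assume "(\<integral>z. indicator {0..} z * (min x z * (g z * U z)) \<partial>lborel) = 0"
    then have "AE z in lborel. indicator {0..} z * (min x z * (g z * U z)) = 0"
      using integral_nonneg_eq_0_iff_AE[OF i] nn by simp
    then have "AE z in lborel. indicator {0..} z * (g z * U z) = 0"
      using AE_lborel_singleton[of "0::real"]
      by eventually_elim (use x in \<open>auto simp: indicator_def min_def split: if_splits\<close>)
    then show False using gU_not_null by simp
  qed
  then have "0 < beta0 P * U x"
    unfolding U_eigen[OF less_imp_le[OF x]]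
    using nn by (simp add: less_le Bochner_Integration.integral_nonneg)
  then show ?thesis using beta0_pos by (simp add: zero_less_mult_iff)
qed

text \<open>\<open>min x 1 * min 1 z <= min x z\<close> compares the eigenvalue equation at x with
  that at 1.\<close>

lemma U_ge: assumes x: "0 < x" shows "U 1 * min x 1 \<le> U x"
proof -
  have "beta0 P * (U 1 * min x 1) = (\<integral>z. min x 1 * (indicator {0..} z * (min 1 z * (g z * U z))) \<partial>lborel)"
    using U_eigen[of 1] by simp
  also have "\<dots> \<le> (\<integral>z. indicator {0..} z * (min x z * (g z * U z)) \<partial>lborel)"
  proof (rule integral_mono)
    fix z :: real
    show "min x 1 * (indicator {0..} z * (min 1 z * (g z * U z))) \<le> indicator {0..} z * (min x z * (g z * U z))"
    proof (cases "0 \<le> z")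
      case True
      have "min x 1 * min 1 z \<le> min x z"
        using True x by (auto simp: min_def mult_le_one mult_left_le mult_left_le_one_le)
      then have "(min x 1 * min 1 z) * (g z * U z) \<le> min x z * (g z * U z)"
        using U_nonneg[OF True] g2_nonneg[OF True, of P] by (intro mult_right_mono) auto
      then show ?thesis using True by (simp add: mult.assoc)
    qed simp
  qed (use x in \<open>auto intro!: min_integrable[OF measurable_U U_abs_le]\<close>)
  also have "\<dots> = beta0 P * U x" using U_eigen[of x] x by simp
  finally show ?thesis using beta0_pos by simp
qed

text \<open>Results from inserting U <= 1 and \<open>min x z <= min x 1 * (1 + z)\<close> into the
  eigenvalue equation.\<close>

definition c_up :: real where
  "c_up = (\<integral>z. indicator {0..} z * g z + indicator {0..} z * (z * g z) \<partial>lborel) / beta0 P"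

lemma U_le: assumes x: "0 < x" shows "U x \<le> c_up * min x 1"
proof -
  have "beta0 P * U x = (\<integral>z. indicator {0..} z * (min x z * (g z * U z)) \<partial>lborel)"
    using U_eigen[of x] x by simp
  also have "\<dots> \<le> (\<integral>z. min x 1 * (indicator {0..} z * g z + indicator {0..} z * (z * g z)) \<partial>lborel)"
  proof (rule integral_mono)
    fix z :: real
    show "indicator {0..} z * (min x z * (g z * U z)) \<le> min x 1 * (indicator {0..} z * g z + indicator {0..} z * (z * g z))"
    proof (cases "0 \<le> z")
      case True
      have xz: "0 \<le> x * z" using x True by simp
      have "min x z \<le> min x 1 * (1 + z)"
      proof (cases "x \<le> 1")
        case True
        have "x \<le> x * (1 + z)" using xz by (simp only: ring_distribs)
        then show ?thesis using True by auto
      qed (use True in auto)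
      then have "min x z * (g z * U z) \<le> (min x 1 * (1 + z)) * (g z * 1)"
        using True x U_nonneg[OF True] U_le_1[OF True] g2_nonneg[OF True, of P]
        by (intro mult_mono mult_left_mono mult_nonneg_nonneg) auto
      then show ?thesis using True by (simp add: algebra_simps)
    qed simp
  qed (use x integrable_g integrable_zg in \<open>auto intro!: min_integrable[OF measurable_U U_abs_le]\<close>)
  also have "\<dots> = beta0 P * (c_up * min x 1)" using beta0_pos by (simp add: c_up_def)
  finally show ?thesis using beta0_pos by simp
qed

text \<open>The square root in \<open>f0\<close> can be cancelled from the asserted ratio because it
  is nonzero.\<close>

lemma normalisation_pos: "0 < (LBINT y:{0..}. g2 P y * (L P (beta0 P) y)\<^sup>2)"
proof -
  have eq: "(LBINT y:{0..}. g2 P y * (L P (beta0 P) y)\<^sup>2) = (\<integral>z. indicator {0..} z * (g z * (U z)\<^sup>2) \<partial>lborel)"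
    by (simp add: set_lebesgue_integral_def U_def)
  have b: "\<bar>(U z)\<^sup>2\<bar> \<le> 1" if "0 \<le> z" for z
    using U_nonneg[OF that] U_le_1[OF that] by (simp add: power_le_one)
  have i: "integrable lborel (\<lambda>z. indicator {0..} z * (g z * (U z)\<^sup>2))"
    by (rule g_bounded_integrable(1)[OF _ b]) auto
  have nn: "0 \<le> indicator {0..} z * (g z * (U z)\<^sup>2)" for z
    using g2_nonneg[of z P] by (auto simp: indicator_def)
  have "(\<integral>z. indicator {0..} z * (g z * (U z)\<^sup>2) \<partial>lborel) \<noteq> 0"
  proof
    assume "(\<integral>z. indicator {0..} z * (g z * (U z)\<^sup>2) \<partial>lborel) = 0"
    then have "AE z in lborel. indicator {0..} z * (g z * (U z)\<^sup>2) = 0"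
      using integral_nonneg_eq_0_iff_AE[OF i] nn by simp
    then have "AE z in lborel. indicator {0..} z * (g z * U z) = 0"
      by eventually_elim (auto simp: indicator_def split: if_splits)
    then show False using gU_not_null by simp
  qed
  then show ?thesis unfolding eq using nn by (simp add: less_le Bochner_Integration.integral_nonneg)
qed

end

section \<open>The degree of a vertex with given type\<close>

context branching
begin

text \<open>The indicator of having d kept children is the sum, over the d-element subsets J of the
  potential children, of the indicator that exactly J is kept; each of these is a product over
  i.i.d. children.\<close>

lemma cexp_has_degree:
  assumes x: "0 < x"
  shows "cexp Q (has_degree d) (m, x) = Bi d m (kappa Q x (\<lambda>_. 1))"
proof -
  let ?\<eta> = "kappa Q x (\<lambda>_. 1)"
  let ?S = "{J \<in> Pow {1..m}. card J = d}"
  have one: "integrable \<T> (\<lambda>_. 1 :: real)" by simp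
  have c1: "cexp Q (\<lambda>_. 1) = (\<lambda>_. 1)"
    by (simp add: cexp_def fun_eq_iff en.prob_space[simplified])
  have Y: "integrable child_law (\<lambda>c. of_bool (link x c) :: real)"
    "(\<integral>c. of_bool (link x c) \<partial>child_law) = ?\<eta>"
    using integrable_child[OF x one] integral_child[OF x one] by (simp_all add: c1)
  define F :: "nat set \<Rightarrow> nat \<Rightarrow> real \<times> marks \<Rightarrow> real"
    where "F J j c = (if j \<in> J then of_bool (link x c) else 1 - of_bool (link x c))" for J j c
  have Fi: "integrable child_law (F J j)" for J j
    using Y(1) by (cases "j \<in> J") (auto simp: F_def[abs_def])
  have FI: "integral\<^sup>L child_law (F J j) = (if j \<in> J then ?\<eta> else 1 - ?\<eta>)" for J j
    using Y by (cases "j \<in> J") (simp_all add: F_def[abs_def] ch.P.prob_space)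
  note prod = ch.P.integrable_PiM_prod[where J="{1..m}" and g="F J" for J, OF finite_atLeastAtMost Fi]
  have pt: "has_degree d (graft (m, x) b) = (\<Sum>J\<in>?S. \<Prod>j\<in>{1..m}. F J j (fst b j, snd b j))" for b
  proof -
    let ?K = "kept (graft (m, x) b)"
    have K: "?K = {j \<in> {1..m}. link x (fst b j, snd b j)}" by (rule kept_graft[OF x])
    have "(\<Prod>j\<in>{1..m}. F J j (fst b j, snd b j)) = of_bool (J = ?K)" if JS: "J \<in> ?S" for J
    proof (cases "J = ?K")
      case True
      then show ?thesis unfolding True K by (auto intro!: prod.neutral simp: F_def)
    next
      case False
      then obtain j where "j \<in> {1..m}" "(j \<in> J) \<noteq> link x (fst b j, snd b j)"
        using JS unfolding K set_eq_iff by blast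
      then have "F J j (fst b j, snd b j) = 0" "j \<in> {1..m}" by (auto simp: F_def)
      then have "(\<Prod>j\<in>{1..m}. F J j (fst b j, snd b j)) = 0" by (intro prod_zero) auto
      then show ?thesis using False by simp
    qed
    then have "(\<Sum>J\<in>?S. \<Prod>j\<in>{1..m}. F J j (fst b j, snd b j)) = (\<Sum>J\<in>?S. of_bool (J = ?K))"
      by (intro sum.cong) auto
    also have "\<dots> = of_bool (?K \<in> ?S)" by (simp add: of_bool_def sum.delta)
    also have "\<dots> = has_degree d (graft (m, x) b)" unfolding has_degree_def K by auto
    finally show ?thesis ..
  qed
  have "cexp Q (has_degree d) (m, x) = (\<Sum>J\<in>?S. \<integral>b. (\<Prod>j\<in>{1..m}. F J j (fst b j, snd b j)) \<partial>\<E>)"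
    unfolding cexp_def pt by (rule Bochner_Integration.integral_sum) (rule integrable_env_zip[OF prod(1)])
  also have "\<dots> = (\<Sum>J\<in>?S. ?\<eta> ^ d * (1 - ?\<eta>) ^ (m - d))"
  proof (rule sum.cong[OF refl])
    fix J assume J: "J \<in> ?S"
    have "(\<integral>b. (\<Prod>j\<in>{1..m}. F J j (fst b j, snd b j)) \<partial>\<E>) = (\<Prod>j\<in>{1..m}. integral\<^sup>L child_law (F J j))"
      unfolding integral_env_zip[OF prod(1)] by (rule prod(2))
    also have "\<dots> = (\<Prod>j\<in>J. ?\<eta>) * (\<Prod>j\<in>{1..m} - J. 1 - ?\<eta>)"
      unfolding FI using J by (subst prod.subset_diff[of J "{1..m}"]) (auto simp: mult.commute)
    also have "\<dots> = ?\<eta> ^ d * (1 - ?\<eta>) ^ (m - d)"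
      using J card_Diff_subset[of J "{1..m}"] finite_subset[of J "{1..m}"] by auto
    finally show "(\<integral>b. (\<Prod>j\<in>{1..m}. F J j (fst b j, snd b j)) \<partial>\<E>) = ?\<eta> ^ d * (1 - ?\<eta>) ^ (m - d)" .
  qed
  also have "\<dots> = Bi d m ?\<eta>"
    using n_subsets[of "{1..m}" d] by (simp add: Bi_def Pow_def)
  finally show ?thesis .
qed

text \<open>The tail formula: the mean of \<open>min x v\<close> is the integral over [0, x] of the
  probability that v exceeds y, a mixture of Erlang tails. At x = 0 both sides are 0 by the
  convention for division.\<close>

lemma kappa_one_eq:
  assumes x: "0 \<le> x"
  shows "kappa Q x (\<lambda>_. 1) = (LBINT y:{0..x}. (1 / x) * (\<Sum>k. pmf Q k * erlang_ccdf (k + 1) y))"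
proof (cases "x = 0")
  case True
  then show ?thesis by (simp add: kappa_def)
next
  case False
  then have x: "0 < x" using x by simp
  define T where "T y = measure \<mu> {t. y < snd t}" for y
  have sm[measurable]: "{t :: nat \<times> real. y < snd t} \<in> sets (count_space UNIV \<Otimes>\<^sub>M borel)" for y
    by (rule sets_Collect_UNIV) (auto simp: space_pair_measure)
  have tail: "(\<Sum>k. pmf Q k * erlang_ccdf (k + 1) y) = T y" for y
  proof -
    interpret E: prob_space "erlang_law k" for k by (rule prob_space_erlang_law)
    have "emeasure \<mu> {t. y < snd t} = (\<integral>\<^sup>+t. indicator {t. y < snd t} t \<partial>\<mu>)" by simp
    also have "\<dots> = (\<integral>\<^sup>+n. \<integral>\<^sup>+v. indicator {y<..} v \<partial>erlang_law (n + 1) \<partial>measure_pmf Q)"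
    proof (subst nn_integral_type_law)
      show "(\<integral>\<^sup>+n. \<integral>\<^sup>+v. indicator {t. y < snd t} (n, v) \<partial>erlang_law (n + 1) \<partial>measure_pmf Q) =
        (\<integral>\<^sup>+n. \<integral>\<^sup>+v. indicator {y<..} v \<partial>erlang_law (n + 1) \<partial>measure_pmf Q)"
        by (intro nn_integral_cong) (simp add: indicator_def)
    qed simp
    also have "\<dots> = (\<integral>\<^sup>+n. emeasure (erlang_law (n + 1)) {y<..} \<partial>measure_pmf Q)"
      by (intro nn_integral_cong nn_integral_indicator) (simp add: erlang_law_def)
    also have "\<dots> = (\<Sum>k. ennreal (pmf Q k * erlang_ccdf (k + 1) y))"
      by (simp add: nn_integral_measure_pmf nn_integral_count_space_nat erlang_ccdf_def ennreal_mult E.emeasure_eq_measure del: One_nat_def)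
    finally have e: "emeasure \<mu> {t. y < snd t} = (\<Sum>k. ennreal (pmf Q k * erlang_ccdf (k + 1) y))" .
    have nn: "0 \<le> pmf Q k * erlang_ccdf (k + 1) y" for k by (simp add: erlang_ccdf_def)
    have "(\<Sum>k. ennreal (pmf Q k * erlang_ccdf (k + 1) y)) \<noteq> top"
      unfolding e[symmetric] by simp
    from summable_suminf_not_top[OF nn this]
    have "(\<Sum>k. ennreal (pmf Q k * erlang_ccdf (k + 1) y)) = ennreal (\<Sum>k. pmf Q k * erlang_ccdf (k + 1) y)"
      by (intro suminf_ennreal2 nn)
    moreover have "0 \<le> (\<Sum>k. pmf Q k * erlang_ccdf (k + 1) y)"
      by (rule suminf_nonneg[OF summable_suminf_not_top[OF nn]]) (use e nn in \<open>auto simp: e[symmetric]\<close>)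
    ultimately show ?thesis unfolding T_def measure_def e by simp
  qed
  interpret pair_sigma_finite lborel \<mu> ..
  have "(\<integral>\<^sup>+y. ennreal (indicator {0..x} y * T y) \<partial>lborel) = (\<integral>\<^sup>+y. \<integral>\<^sup>+t. (if 0 \<le> y \<and> y \<le> x \<and> y < snd t then 1 else 0) \<partial>\<mu> \<partial>lborel)"
  proof (rule nn_integral_cong)
    fix y
    have smm: "{t. y < snd t} \<in> sets \<mu>" by simp
    have "ennreal (indicator {0..x} y * T y) = indicator {0..x} y * (\<integral>\<^sup>+t. indicator {t. y < snd t} t \<partial>\<mu>)"
      unfolding nn_integral_indicator[OF smm] by (cases "y \<in> {0..x}") (simp_all add: T_def mu.emeasure_eq_measure)
    also have "\<dots> = (\<integral>\<^sup>+t. indicator {0..x} y * indicator {t. y < snd t} t \<partial>\<mu>)"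
      by (rule nn_integral_cmult[symmetric]) simp
    finally show "ennreal (indicator {0..x} y * T y) = (\<integral>\<^sup>+t. (if 0 \<le> y \<and> y \<le> x \<and> y < snd t then 1 else 0) \<partial>\<mu>)"
      by (auto simp: indicator_def intro!: nn_integral_cong elim!: trans)
  qed
  also have "\<dots> = (\<integral>\<^sup>+t. \<integral>\<^sup>+y. (if 0 \<le> y \<and> y \<le> x \<and> y < snd t then 1 else 0) \<partial>lborel \<partial>\<mu>)"
    by (rule Fubini'[symmetric]) measurable
  also have "\<dots> = (\<integral>\<^sup>+t. ennreal (min x (snd t)) \<partial>\<mu>)"
  proof (rule nn_integral_cong_AE)
    show "AE t in \<mu>. (\<integral>\<^sup>+y. (if 0 \<le> y \<and> y \<le> x \<and> y < snd t then 1 else 0) \<partial>lborel) = ennreal (min x (snd t))"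
      using AE_type_law_pos[of Q]
    proof eventually_elim
      case (elim t)
      have "(\<integral>\<^sup>+y. (if 0 \<le> y \<and> y \<le> x \<and> y < snd t then 1 else 0) \<partial>lborel) = (\<integral>\<^sup>+y. indicator (if snd t \<le> x then {0..<snd t} else {0..x}) y \<partial>lborel)"
        by (intro nn_integral_cong) (auto simp: indicator_def)
      also have "\<dots> = ennreal (min x (snd t))" using elim x by (simp add: min_def)
      finally show ?case .
    qed
  qed
  finally have nn: "(\<integral>\<^sup>+y. ennreal (indicator {0..x} y * T y) \<partial>lborel) = (\<integral>\<^sup>+t. ennreal (min x (snd t)) \<partial>\<mu>)" .
  have Tm[measurable]: "T \<in> borel_measurable borel"
  proof -
    have "antimono T" unfolding T_def by (intro antimonoI mu.finite_measure_mono) auto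
    then have "mono (\<lambda>y. - T y)" by (auto simp: monotone_def)
    then have "(\<lambda>y. - T y) \<in> borel_measurable borel" by (rule borel_measurable_mono)
    then show ?thesis by simp
  qed
  have "(\<integral>y. indicator {0..x} y * T y \<partial>lborel) = enn2real (\<integral>\<^sup>+y. ennreal (indicator {0..x} y * T y) \<partial>lborel)"
    by (intro integral_eq_nn_integral) (auto simp: T_def)
  also have "\<dots> = (\<integral>t. min x (snd t) \<partial>\<mu>)"
    unfolding nn
  proof (rule integral_eq_nn_integral[symmetric])
    show "AE t in \<mu>. 0 \<le> min x (snd t)" using AE_type_law_pos[of Q] by eventually_elim (use x in simp)
  qed measurable
  finally have main: "(\<integral>y. indicator {0..x} y * T y \<partial>lborel) = (\<integral>t. min x (snd t) \<partial>\<mu>)" .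
  have "(LBINT y:{0..x}. (1 / x) * (\<Sum>k. pmf Q k * erlang_ccdf (k + 1) y)) = (\<integral>y. (1 / x) * (indicator {0..x} y * T y) \<partial>lborel)"
    unfolding tail set_lebesgue_integral_def by (intro Bochner_Integration.integral_cong) auto
  also have "\<dots> = kappa Q x (\<lambda>_. 1)"
    unfolding integral_mult_right_zero main kappa_def by simp
  finally show ?thesis ..
qed

end

lemma nn_integral_type_law_fst:
  "(\<integral>\<^sup>+t. F (fst t) \<partial>type_law R) = (\<integral>\<^sup>+n. F n \<partial>measure_pmf R)"
proof -
  interpret E: prob_space "erlang_law k" for k by (rule prob_space_erlang_law)
  show ?thesis
    by (subst nn_integral_type_law) (auto simp: E.emeasure_space_1[simplified])
qed

text \<open>Cubes \<open>y / 3 <= exp (y / 3)\<close>.\<close>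

lemma power3_le_exp:
  fixes y :: real
  assumes "0 \<le> y" shows "y ^ 3 \<le> 27 * exp y"
proof -
  have "(y / 3) ^ 3 \<le> exp (y / 3) ^ 3"
  proof (rule power_mono)
    show "y / 3 \<le> exp (y / 3)" using exp_ge_add_one_self[of "y / 3"] by linarith
  qed (use assms in simp)
  also have "\<dots> = exp y" by (simp add: exp_of_nat_mult[symmetric])
  finally show ?thesis by (simp add: power_divide)
qed

lemma integrable_cube_pmf:
  assumes "0 < \<theta>" "integrable (measure_pmf P) (\<lambda>k. exp (\<theta> * real k))"
  shows "integrable (measure_pmf P) (\<lambda>k. real k ^ 3)"
proof (rule Bochner_Integration.integrable_bound)
  show "integrable (measure_pmf P) (\<lambda>k. 27 / \<theta> ^ 3 * exp (\<theta> * real k))" using assms by simp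
  have "real k ^ 3 \<le> 27 / \<theta> ^ 3 * exp (\<theta> * real k)" for k
    using power3_le_exp[of "\<theta> * real k"] assms(1) by (simp add: power_mult_distrib field_simps)
  then show "AE k in measure_pmf P. norm (real k ^ 3) \<le> norm (27 / \<theta> ^ 3 * exp (\<theta> * real k))"
    using assms(1) by (intro AE_I2) (simp add: abs_of_nonneg)
qed simp

lemma nn_integral_erlang_law_one_plus:
  "(\<integral>\<^sup>+v. ennreal (1 + \<bar>v\<bar>) \<partial>erlang_law (n + 1)) = ennreal (real n + 2)"
proof -
  interpret E: prob_space "erlang_law (n + 1)" by (rule prob_space_erlang_law)
  have "(\<integral>\<^sup>+v. ennreal (1 + \<bar>v\<bar>) \<partial>erlang_law (n + 1)) = (\<integral>\<^sup>+v. 1 + ennreal \<bar>v\<bar> \<partial>erlang_law (n + 1))"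
    by (intro nn_integral_cong) (simp only: ennreal_plus[OF zero_le_one abs_ge_zero] ennreal_1)
  also have "\<dots> = 1 + (\<integral>\<^sup>+v. ennreal \<bar>v\<bar> \<partial>erlang_law (n + 1))"
    by (subst nn_integral_add) (auto simp: E.emeasure_space_1[simplified])
  also have "(\<integral>\<^sup>+v. ennreal \<bar>v\<bar> \<partial>erlang_law (n + 1)) = (\<integral>\<^sup>+v. ennreal (erlang_density n 1 v * v ^ 1) \<partial>lborel)"
    unfolding erlang_law_def
    by (subst nn_integral_density) (auto intro!: nn_integral_cong simp: erlang_density_def ennreal_mult'[symmetric])
  also have "\<dots> = ennreal (real n + 1)"
    using nn_integral_erlang_ith_moment[of 1 n 1] by (simp add: add.commute)
  finally show ?thesis using ennreal_plus[of 1 "real n + 1"] by (simp add: add.commute add.left_commute del: ennreal_plus)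
qed

section \<open>The limiting degree distribution\<close>

context degree_law
begin

text \<open>The weight in \<open>nu\<close> is the type law of a child, P(m + 1) times the Erlang(m
  + 1) density, times U over its normalisation; so the series of integrals is one integral.
  Nonnegativity, and finiteness from U <= 1, allow the passage through
  \<open>ennreal\<close>.\<close>

lemma sum_nu:
  assumes [measurable]: "\<Phi> \<in> borel_measurable (count_space UNIV \<Otimes>\<^sub>M borel)"
    and \<Phi>: "\<And>t. 0 \<le> \<Phi> t" "\<And>t. \<Phi> t \<le> 1"
  shows "(\<Sum>m. LBINT z:{0..}. nu P m z * \<Phi> (m, z))
    = (\<integral>t. U (snd t) * \<Phi> t \<partial>type_law (shifted P)) / sqrt (LBINT y:{0..}. g2 P y * (L P (beta0 P) y)\<^sup>2)"
proof -
  interpret T: prob_space "type_law (shifted P)" by (rule prob_space_type_law)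
  define c where "c = sqrt (LBINT y:{0..}. g2 P y * (L P (beta0 P) y)\<^sup>2)"
  have c: "0 < c" using normalisation_pos by (simp add: c_def)
  define w where "w m z = pmf P (m + 1) * (erlang_density m 1 z * (U z * \<Phi> (m, z) / c))" for m z
  have w: "indicator {0..} z * (nu P m z * \<Phi> (m, z)) = w m z" for m z
    by (auto simp: w_def nu_def f0_def c_def U_def erlang_density_def indicator_def)
  have w_nn: "0 \<le> w m z" for m z
    using U_nonneg[of z] \<Phi>(1) c by (cases "z < 0") (auto simp: w_def erlang_density_def)
  have wm[measurable]: "w m \<in> borel_measurable borel" for m
    unfolding w_def by measurable
  define a where "a m = (LBINT z:{0..}. nu P m z * \<Phi> (m, z))" for m
  have a: "a m = enn2real (\<integral>\<^sup>+z. ennreal (w m z) \<partial>lborel)" for m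
    unfolding a_def set_lebesgue_integral_def real_scaleR_def w
    by (rule integral_eq_nn_integral) (auto simp: w_nn)
  have nn: "AE t in type_law (shifted P). 0 \<le> U (snd t) * \<Phi> t / c"
    using AE_type_law_pos[of "shifted P"]
    by eventually_elim (use U_nonneg \<Phi>(1) c in \<open>auto intro!: divide_nonneg_pos mult_nonneg_nonneg\<close>)
  define I where "I = (\<integral>\<^sup>+t. ennreal (U (snd t) * \<Phi> t / c) \<partial>type_law (shifted P))"
  have "I \<le> (\<integral>\<^sup>+t. ennreal (1 / c) \<partial>type_law (shifted P))"
    unfolding I_def
  proof (rule nn_integral_mono_AE)
    show "AE t in type_law (shifted P). ennreal (U (snd t) * \<Phi> t / c) \<le> ennreal (1 / c)"
      using AE_type_law_pos[of "shifted P"]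
    proof eventually_elim
      case (elim t)
      have "U (snd t) * \<Phi> t \<le> 1 * 1"
        using elim U_nonneg U_le_1 \<Phi> by (intro mult_mono) auto
      then show ?case using c by (intro ennreal_leI divide_right_mono) auto
    qed
  qed
  also have "\<dots> < top" by (simp add: T.emeasure_space_1[simplified])
  finally have fin: "I < top" .
  have I: "I = (\<Sum>m. \<integral>\<^sup>+z. ennreal (w m z) \<partial>lborel)"
    unfolding I_def
  proof (subst nn_integral_type_law_lborel)
    have "ennreal (pmf (shifted P) m) * (\<integral>\<^sup>+z. ennreal (erlang_density m 1 z) * ennreal (U (snd (m, z)) * \<Phi> (m, z) / c) \<partial>lborel)
      = (\<integral>\<^sup>+z. ennreal (w m z) \<partial>lborel)" for m
    proof (subst nn_integral_cmult[symmetric])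
      have "ennreal (pmf (shifted P) m) * (ennreal (erlang_density m 1 z) * ennreal (U (snd (m, z)) * \<Phi> (m, z) / c)) = ennreal (w m z)" for z
        by (simp only: w_def pmf_shifted[OF P0] snd_conv ennreal_mult'[OF pmf_nonneg] ennreal_mult'[OF erlang_density_nonneg[OF zero_le_one]])
      then show "(\<integral>\<^sup>+z. ennreal (pmf (shifted P) m) * (ennreal (erlang_density m 1 z) * ennreal (U (snd (m, z)) * \<Phi> (m, z) / c)) \<partial>lborel)
        = (\<integral>\<^sup>+z. ennreal (w m z) \<partial>lborel)" by simp
      show "(\<lambda>z. ennreal (erlang_density m 1 z) * ennreal (U (snd (m, z)) * \<Phi> (m, z) / c)) \<in> borel_measurable lborel"
        unfolding snd_conv measurable_lborel1 by measurable
    qed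
    then show "(\<Sum>m. ennreal (pmf (shifted P) m) * (\<integral>\<^sup>+z. ennreal (erlang_density m 1 z) * ennreal (U (snd (m, z)) * \<Phi> (m, z) / c) \<partial>lborel))
      = (\<Sum>m. \<integral>\<^sup>+z. ennreal (w m z) \<partial>lborel)" by simp
  qed measurable
  have "(\<integral>\<^sup>+z. ennreal (w m z) \<partial>lborel) < top" for m
    using ennreal_suminf_lessD[of _ _ m] fin unfolding I by blast
  then have ea: "ennreal (a m) = (\<integral>\<^sup>+z. ennreal (w m z) \<partial>lborel)" for m
    unfolding a by simp
  have a_nn: "0 \<le> a m" for m unfolding a by simp
  have "I = (\<Sum>m. ennreal (a m))" unfolding I ea ..
  also have "\<dots> = ennreal (\<Sum>m. a m)"
    using fin by (intro suminf_ennreal2 a_nn summable_suminf_not_top) (auto simp: I ea)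
  finally have "ennreal (\<Sum>m. a m) = I" ..
  moreover have "0 \<le> (\<Sum>m. a m)"
    using fin by (intro suminf_nonneg a_nn summable_suminf_not_top) (auto simp: I ea)
  ultimately have "(\<Sum>m. a m) = enn2real I" by (metis enn2real_ennreal)
  also have "\<dots> = (\<integral>t. U (snd t) * \<Phi> t / c \<partial>type_law (shifted P))"
    unfolding I_def by (rule integral_eq_nn_integral[symmetric, OF _ nn]) measurable
  finally show ?thesis by (simp add: a_def c_def)
qed

text \<open>Transports the eigenvalue equation from Lebesgue measure to the type law of a child by
  means of \<open>nn_integral_g2\<close>.\<close>

lemma integral_eigen:
  assumes x: "0 < x"
  shows "(\<integral>t. min x (snd t) * (real (fst t) * U (snd t) / snd t) \<partial>type_law (shifted P)) = beta0 P * U x"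
proof -
  have "AE t in type_law (shifted P). 0 \<le> min x (snd t) * (real (fst t) * U (snd t) / snd t)"
    using AE_type_law_pos[of "shifted P"]
    by eventually_elim (use x U_nonneg in \<open>auto intro!: divide_nonneg_pos mult_nonneg_nonneg\<close>)
  then have "(\<integral>t. min x (snd t) * (real (fst t) * U (snd t) / snd t) \<partial>type_law (shifted P))
    = enn2real (\<integral>\<^sup>+t. ennreal (min x (snd t) * (real (fst t) * U (snd t) / snd t)) \<partial>type_law (shifted P))"
    by (intro integral_eq_nn_integral) auto
  also have "(\<integral>\<^sup>+t. ennreal (min x (snd t) * (real (fst t) * U (snd t) / snd t)) \<partial>type_law (shifted P))
    = (\<integral>\<^sup>+t. ennreal (real (fst t) / snd t) * ennreal (min x (snd t) * U (snd t)) \<partial>type_law (shifted P))"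
  proof (rule nn_integral_cong_AE)
    show "AE t in type_law (shifted P). ennreal (min x (snd t) * (real (fst t) * U (snd t) / snd t))
      = ennreal (real (fst t) / snd t) * ennreal (min x (snd t) * U (snd t))"
      using AE_type_law_pos[of "shifted P"]
      by eventually_elim (simp add: ennreal_mult'[symmetric] mult_ac)
  qed
  also have "\<dots> = (\<integral>\<^sup>+z. ennreal (indicator {0..} z * g z) * ennreal (min x z * U z) \<partial>lborel)"
    by (rule nn_integral_g2[symmetric]) measurable
  also have "\<dots> = (\<integral>\<^sup>+z. ennreal (indicator {0..} z * (min x z * (g z * U z))) \<partial>lborel)"
    by (intro nn_integral_cong) (auto simp: indicator_def ennreal_mult'[symmetric] g2_nonneg mult_ac)
  also have "enn2real \<dots> = (\<integral>z. indicator {0..} z * (min x z * (g z * U z)) \<partial>lborel)"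
    using x U_nonneg g2_nonneg[of _ P]
    by (intro integral_eq_nn_integral[symmetric]) (auto simp: indicator_def)
  also have "\<dots> = beta0 P * U x" using U_eigen[of x] x by simp
  finally show ?thesis .
qed

text \<open>Disposes of z = 0 in the final integrals, where \<open>cexp_has_degree\<close> gives no
  value.\<close>

lemma U_0: "U 0 = 0"
proof -
  have "beta0 P * U 0 = (\<integral>z. 0 \<partial>(lborel :: real measure))"
    unfolding U_eigen[OF order_refl]
    by (intro Bochner_Integration.integral_cong) (auto simp: indicator_def)
  then show ?thesis using beta0_pos by simp
qed

lemma AE_pos: "AE k in measure_pmf P. 1 \<le> k"
  using P0 by (auto simp: AE_measure_pmf_iff set_pmf_iff Suc_le_eq intro: gr0I)

text \<open>The mean n + 1 of the Erlang variable adds one power of n to the square, so third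
  moments of P suffice.\<close>

lemma integrable_type_law_moments:
  assumes cube: "integrable (measure_pmf P) (\<lambda>k. real k ^ 3)"
  shows "integrable (type_law (shifted P)) (\<lambda>t. (1 + real (fst t))\<^sup>2 * (1 + \<bar>snd t\<bar>))"
    and "integrable (type_law P) (\<lambda>t. (1 + real (fst t))\<^sup>2)"
proof -
  have fin: "(\<integral>\<^sup>+k. ennreal (4 * real k ^ 3) \<partial>measure_pmf P) < \<infinity>"
    using nn_integral_eq_integral[of "measure_pmf P" "\<lambda>k. 4 * real k ^ 3"] cube by simp
  have "(\<integral>\<^sup>+t. ennreal ((1 + real (fst t))\<^sup>2 * (1 + \<bar>snd t\<bar>)) \<partial>type_law (shifted P))
    = (\<integral>\<^sup>+n. ennreal ((1 + real n)\<^sup>2) * (\<integral>\<^sup>+v. ennreal (1 + \<bar>v\<bar>) \<partial>erlang_law (n + 1)) \<partial>measure_pmf (shifted P))"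
    by (subst nn_integral_type_law)
      (auto intro!: nn_integral_cong simp: ennreal_mult nn_integral_cmult erlang_law_def)
  also have "\<dots> = (\<integral>\<^sup>+k. ennreal ((1 + real (k - 1))\<^sup>2 * (real (k - 1) + 2)) \<partial>measure_pmf P)"
    by (simp only: nn_integral_erlang_law_one_plus shifted_def nn_integral_map_pmf ennreal_mult'[OF zero_le_power2])
  also have "\<dots> \<le> (\<integral>\<^sup>+k. ennreal (4 * real k ^ 3) \<partial>measure_pmf P)"
  proof (rule nn_integral_mono_AE)
    show "AE k in measure_pmf P. ennreal ((1 + real (k - 1))\<^sup>2 * (real (k - 1) + 2)) \<le> ennreal (4 * real k ^ 3)"
      using AE_pos
    proof eventually_elim
      case (elim k)
      have "(real k)\<^sup>2 * (real k + 1) \<le> (real k)\<^sup>2 * (4 * real k)" using elim by (intro mult_left_mono) auto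
      then show ?case using elim by (intro ennreal_leI) (simp add: of_nat_diff power3_eq_cube power2_eq_square)
    qed
  qed
  finally have "(\<integral>\<^sup>+t. ennreal ((1 + real (fst t))\<^sup>2 * (1 + \<bar>snd t\<bar>)) \<partial>type_law (shifted P)) < \<infinity>"
    using fin by (rule le_less_trans)
  then show "integrable (type_law (shifted P)) (\<lambda>t. (1 + real (fst t))\<^sup>2 * (1 + \<bar>snd t\<bar>))"
    by (intro integrableI_nonneg) auto
  have "(\<integral>\<^sup>+t. ennreal ((1 + real (fst t))\<^sup>2) \<partial>type_law P) = (\<integral>\<^sup>+k. ennreal ((1 + real k)\<^sup>2) \<partial>measure_pmf P)"
    by (rule nn_integral_type_law_fst)
  also have "\<dots> \<le> (\<integral>\<^sup>+k. ennreal (4 * real k ^ 3) \<partial>measure_pmf P)"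
  proof (rule nn_integral_mono_AE)
    show "AE k in measure_pmf P. ennreal ((1 + real k)\<^sup>2) \<le> ennreal (4 * real k ^ 3)"
      using AE_pos
    proof eventually_elim
      case (elim k)
      have "(1 + real k)\<^sup>2 \<le> (2 * real k)\<^sup>2" using elim by (intro power_mono) auto
      also have "\<dots> = 4 * real k ^ 2" by simp
      also have "\<dots> \<le> 4 * real k ^ 3" using elim by (intro mult_left_mono power_increasing) auto
      finally show ?case by (rule ennreal_leI)
    qed
  qed
  finally have "(\<integral>\<^sup>+t. ennreal ((1 + real (fst t))\<^sup>2) \<partial>type_law P) < \<infinity>" using fin by (rule le_less_trans)
  then show "integrable (type_law P) (\<lambda>t. (1 + real (fst t))\<^sup>2)"
    by (intro integrableI_nonneg) auto
qed

lemma spectral_branching_U: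
  assumes cube: "integrable (measure_pmf P) (\<lambda>k. real k ^ 3)" and sup: "1 < beta0 P"
  shows "spectral_branching (shifted P) U (beta0 P) (U 1) c_up"
  using sup U_pos[of 1] U_ge U_le integral_eigen integrable_type_law_moments(1)[OF cube]
  by unfold_locales auto

text \<open>Under P the root has at least one potential child, so h is almost surely positive at the
  root and has a positive mean there.\<close>

lemma rooted_branching_U:
  assumes cube: "integrable (measure_pmf P) (\<lambda>k. real k ^ 3)" and sup: "1 < beta0 P"
  shows "rooted_branching (shifted P) U (beta0 P) (U 1) c_up P"
proof -
  interpret spectral_branching "shifted P" U "beta0 P" "U 1" c_up
    by (rule spectral_branching_U[OF assms])
  interpret prob_space "type_law P" by (rule prob_space_type_law)
  have [measurable]: "h \<in> borel_measurable (count_space UNIV \<Otimes>\<^sub>M borel)"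
    using quad_h by (simp add: quad_def)
  have "AE t in type_law P. \<bar>h t\<bar> \<le> c_up * (1 + real (fst t))\<^sup>2"
    using AE_type_law_pos[of P]
  proof eventually_elim
    case (elim t)
    then show ?case using quad_h by (cases t) (auto simp: quad_def)
  qed
  then have i: "integrable (type_law P) h"
    by (intro Bochner_Integration.integrable_bound[OF integrable_mult_right[OF integrable_type_law_moments(2)[OF cube], of c_up]])
      auto
  have [measurable]: "(\<lambda>t :: nat \<times> real. indicator {0} (fst t) :: ennreal) \<in> borel_measurable (count_space UNIV \<Otimes>\<^sub>M borel)"
    by (rule measurable_compose[OF measurable_fst]) simp
  have "(\<integral>\<^sup>+t. indicator {0} (fst t) \<partial>type_law P) = (\<integral>\<^sup>+n. indicator {0} n \<partial>measure_pmf P)"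
    by (rule nn_integral_type_law_fst)
  also have "\<dots> = 0" using P0 by (simp add: emeasure_pmf_single)
  finally have "AE t in type_law P. indicator {0} (fst t) = (0 :: ennreal)"
    by (subst (asm) nn_integral_0_iff_AE) auto
  with AE_type_law_pos[of P] have pos: "AE t in type_law P. 0 < h t"
    by eventually_elim (auto simp: h_def U_pos split: split_indicator_asm intro!: divide_pos_pos mult_pos_pos)
  have nn: "AE t in type_law P. 0 \<le> h t" using pos by eventually_elim simp
  have "(\<integral>t. h t \<partial>type_law P) \<noteq> 0"
  proof
    assume "(\<integral>t. h t \<partial>type_law P) = 0"
    then have "AE t in type_law P. h t = 0" using integral_nonneg_eq_0_iff_AE[OF i nn] by simp
    with pos have "AE t in type_law P. False" by eventually_elim simp
    then show False by simp
  qed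
  moreover have "0 \<le> (\<integral>t. h t \<partial>type_law P)" by (rule integral_nonneg_AE[OF nn])
  ultimately show ?thesis
    by unfold_locales (simp_all add: integrable_type_law_moments(2)[OF cube])
qed

end

theorem theorem5p27:
  fixes P :: "nat pmf" and d :: nat
  assumes "pmf P 0 = 0"
    and "pmf P 1 < 1"
    and "\<exists>\<theta>>0. integrable (measure_pmf P) (\<lambda>k. exp (\<theta> * real k))"
    and "beta0 P > 1"
  shows "(\<lambda>l. \<P>(x in ewt_selected P l. D x = d \<bar> Z l x > 0)) \<longlonglongrightarrow>
    (\<Sum>m. LBINT z:{0..}. nu P m z *
        Bi d m (LBINT y:{0..z}. (1 / z) * (\<Sum>k. pmf P (k + 1) * erlang_ccdf (k + 1) y)))
    / (\<Sum>m. LBINT z:{0..}. nu P m z)"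
proof -
  obtain \<theta> where "0 < \<theta>" "integrable (measure_pmf P) (\<lambda>k. exp (\<theta> * real k))"
    using assms(3) by blast
  then have cube: "integrable (measure_pmf P) (\<lambda>k. real k ^ 3)" by (rule integrable_cube_pmf)
  have mean: "integrable (measure_pmf P) real"
  proof (rule Bochner_Integration.integrable_bound[OF cube])
    show "AE k in measure_pmf P. norm (real k) \<le> norm (real k ^ 3)"
    proof (rule AE_I2)
      fix k show "norm (real k) \<le> norm (real k ^ 3)"
        using power_increasing[of 1 3 "real k"] by (cases k) auto
    qed
  qed simp
  interpret degree_law P by (rule degree_law.intro[OF assms(1,2) mean])
  interpret rooted_branching "shifted P" U "beta0 P" "U 1" c_up P
    by (rule rooted_branching_U[OF cube assms(4)])
  let ?Q = "shifted P" and ?\<xi> = "has_degree d"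
  let ?N = "LBINT y:{0..}. g2 P y * (L P (beta0 P) y)\<^sup>2"
  have \<xi>: "fraction ?\<xi>" by (rule fraction_has_degree)
  have [measurable]: "?\<xi> \<in> borel_measurable marks_space" using \<xi> by (simp add: fraction_def)
  have "nu P m z * Bi d m (LBINT y:{0..z}. (1 / z) * (\<Sum>k. pmf P (k + 1) * erlang_ccdf (k + 1) y))
      = nu P m z * cexp ?Q ?\<xi> (m, z)" if "z \<in> {0..}" for m z
  proof (cases "z = 0")
    case True
    then show ?thesis using U_0 by (simp add: nu_def f0_def U_def)
  next
    case False
    then have "0 < z" using that by simp
    then show ?thesis
      using kappa_one_eq[of z] cexp_has_degree[of z d m] by (simp add: pmf_shifted[OF assms(1)])
  qed
  then have "(\<Sum>m. LBINT z:{0..}. nu P m z *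
        Bi d m (LBINT y:{0..z}. (1 / z) * (\<Sum>k. pmf P (k + 1) * erlang_ccdf (k + 1) y)))
      = (\<Sum>m. LBINT z:{0..}. nu P m z * cexp ?Q ?\<xi> (m, z))"
    by (intro suminf_cong set_lebesgue_integral_cong) auto
  also have "\<dots> = (\<integral>t. U (snd t) * cexp ?Q ?\<xi> t \<partial>type_law ?Q) / sqrt ?N"
    by (rule sum_nu) (use cexp_fraction[OF \<xi>] in auto)
  finally have num: "(\<Sum>m. LBINT z:{0..}. nu P m z *
        Bi d m (LBINT y:{0..z}. (1 / z) * (\<Sum>k. pmf P (k + 1) * erlang_ccdf (k + 1) y)))
      = (\<integral>t. U (snd t) * cexp ?Q ?\<xi> t \<partial>type_law ?Q) / sqrt ?N" .
  have den: "(\<Sum>m. LBINT z:{0..}. nu P m z) = (\<integral>t. U (snd t) \<partial>type_law ?Q) / sqrt ?N"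
    using sum_nu[of "\<lambda>_. 1"] by simp
  have "(\<lambda>l. \<P>(x in ewt_selected P l. D x = d \<bar> Z l x > 0))
    \<longlonglongrightarrow> (\<integral>t. U (snd t) * cexp ?Q ?\<xi> t \<partial>type_law ?Q) / (\<integral>t. U (snd t) \<partial>type_law ?Q)"
    using generation_average_tendsto[OF \<xi>]
    by (simp only: cond_prob_ewt_selected ewt_eq_tree_law death_def)
  then show ?thesis unfolding num den using normalisation_pos by simp
qed

end
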